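(* Let $q$ be a nonzero real number and let $G_q$ be one of the compact forms $U_q(N)$, $SU_q(N)$, $O_q(N;\mathbb{R})$, $USp_q(N)$ of the quantum groups $GL_q(N)$, $SL_q(N)$, $O_q(N)$, $Sp_q(N)$, respectively. Let $\mathbf{r}$ be the universal $r$-form of the Hopf $\ast$-algebra $\mathcal{O}(G_q)$ determined by $\mathbf{r}(u^i_j\otimes u^n_m)=zR^{in}_{jm}$ for $i,j,n,m=1,\dots,N$, where $z$ is a fixed complex number with $z\ne0$ for $GL_q(N)$, $z^N=q^{-1}$ for $SL_q(N)$ and $z^2=1$ for $O_q(N)$, $Sp_q(N)$. Then $F_{\mathbf{r}}=f_{-2}$, where $F_{\mathbf{r}}:=f_{\mathbf{r}}\ast f_{\bar{\mathbf{r}}_{21}}$ and $f_{-2}$ is Woronowicz's modular character with index $-2$ on the CQG-algebra $\mathcal{O}(G_q)$.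
   Context: Everything is over $\mathbb{C}$. Sweedler notation $\Delta(a)=a_{(1)}\otimes a_{(2)}$; $\ast$ between functionals is the convolution product, $\bar{\mathbf{r}}$ is the convolution inverse of $\mathbf{r}$, and $\bar{\mathbf{r}}_{21}(a\otimes b):=\bar{\mathbf{r}}(b\otimes a)$ (again a universal $r$-form). **Universal $r$-forms.** A universal $r$-form on a Hopf algebra $\mathcal{A}$ is a convolution invertible linear functional $\mathbf{r}$ on $\mathcal{A}\otimes\mathcal{A}$ such that for all $a,b,c\in\mathcal{A}$: $\mathbf{r}(c\otimes ab)=\mathbf{r}(c_{(1)}\otimes b)\mathbf{r}(c_{(2)}\otimes a)$; $\mathbf{r}(ab\otimes c)=\mathbf{r}(a\otimes c_{(1)})\mathbf{r}(b\otimes c_{(2)})$; $\mathbf{r}(a_{(1)}\otimes b_{(1)})a_{(2)}b_{(2)}=\mathbf{r}(a_{(2)}\otimes b_{(2)})b_{(1)}a_{(1)}$. For a universal $r$-form $\mathbf{t}$ on $\mathcal{A}$ with antipode $S$, define $f_{\mathbf{t}}(a)=\mathbf{t}(a_{(1)}\otimes S(a_{(2)}))$. **The Hopf algebras $\mathcal{O}(G_q)$** (Faddeev-Reshetikhin-Takhtajan). Here $N\ge2$ for $GL_q(N)$, $SL_q(N)$; $N\ge3$ for $O_q(N)$; $N\geq 2$ even for $Sp_q(N)$. Let $\theta(k)=1$ for $k>0$ and $\theta(k)=0$ for $k\le0$. For $GL_q(N)$ and $SL_q(N)$: $R^{ij}_{mn}=q^{\delta_{ij}}\delta_{im}\delta_{jn}+(q-q^{-1})\theta(i-j)\delta_{in}\delta_{jm}$.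 For $O_q(N)$ and $Sp_q(N)$: put $i'=N+1-i$; $\epsilon_i=1$ for all $i$ in the case $O_q(N)$; $\epsilon_i=1$ for $i\le N/2$, $\epsilon_i=-1$ for $i>N/2$ in the case $Sp_q(N)$; and $(\rho_1,\dots,\rho_N)=(n-\tfrac12,\dots,\tfrac12,0,-\tfrac12,\dots,-n+\tfrac12)$ for $O_q(2n+1)$, $(n-1,\dots,1,0,0,-1,\dots,-n+1)$ for $O_q(2n)$, $(n,\dots,1,-1,\dots,-n)$ for $Sp_q(2n)$. For $O_q(2n+1)$ half-integer powers of $q$ occur; there $q>0$ and $q^{1/2}>0$. Then $$R^{ij}_{mn}=q^{\delta_{ij}-\delta_{ij'}}\delta_{im}\delta_{jn}+(q-q^{-1})\theta(i-m)\bigl(\delta_{jm}\delta_{in}-\epsilon_i\epsilon_m q^{\rho_i-\rho_m}\delta_{ji'}\delta_{nm'}\bigr),$$ and $C=(C^i_j)$ is the matrix $C^i_j=\epsilon_i\delta_{ij'}q^{-\rho_i}$. Let $\mathcal{A}(R)$ be the unital algebra generated by $u^i_j$, $i,j=1,\dots,N$, with relations $\sum_{k,l}R^{ij}_{kl}u^k_mu^l_n=\sum_{k,l}u^j_lu^i_kR^{kl}_{mn}$; it is a bialgebra with $\Delta(u^i_j)=\sum_ku^i_k\otimes u^k_j$, $\varepsilon(u^i_j)=\delta_{ij}$. For the first type of $R$, let $D=\sum_{\pi\in S_N}(-q)^{\ell(\pi)}u^1_{\pi(1)}\cdots u^N_{\pi(N)}$ be the (central, group-like) quantum determinant. Then $\mathcal{O}(GL_q(N))=\mathcal{A}(R)[D^{-1}]$,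 $\mathcal{O}(SL_q(N))=\mathcal{A}(R)/(D-1)$. For the second type, $\mathcal{O}(O_q(N))$ resp. $\mathcal{O}(Sp_q(N))$ is the quotient of $\mathcal{A}(R)$ by the relations $u\,C\,u^{t}C^{-1}=I=C\,u^{t}C^{-1}u$, where $u=(u^i_j)$ and $t$ denotes transposition. These are Hopf algebras with $S(u)=u^{-1}$. For each $z$ as in the claim there is a unique universal $r$-form with $\mathbf{r}(u^i_j\otimes u^n_m)=zR^{in}_{jm}$. **Compact forms.** For real $q$, $\mathcal{O}(U_q(N))$, $\mathcal{O}(SU_q(N))$, $\mathcal{O}(O_q(N;\mathbb{R}))$, $\mathcal{O}(USp_q(N))$ are the Hopf algebras $\mathcal{O}(GL_q(N))$, $\mathcal{O}(SL_q(N))$, $\mathcal{O}(O_q(N))$, $\mathcal{O}(Sp_q(N))$ with the $\ast$-structure $(u^i_j)^\ast=S(u^j_i)$. They are CQG-algebras, i.e. Hopf $\ast$-algebras spanned by matrix coefficients of finite-dimensional unitary corepresentations. **Modular characters.** On a CQG-algebra $\mathcal{A}$, Woronowicz's modular characters $f_z$, $z\in\mathbb{C}$, are the linear functionals determined by $f_z(v_{ij})=(F_v^{\,z})_{ij}$ for every irreducible unitary matrix corepresentation $v=(v_{ij})$ (with $\Delta(v_{ij})=\sum_kv_{ik}\otimes v_{kj}$), where $F_v$ is the unique positive definite complex matrix with $S^2(v)=F_v\,v\,F_v^{-1}$ (with $S^2$ applied entrywise) and $\mathrm{Tr}\,F_v=\mathrm{Tr}\,F_v^{-1}$. They are characters of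 $\mathcal{A}$ (multiplicative functionals) with $f_z\ast f_{z'}=f_{z+z'}$, $f_0=\varepsilon$, and $S^2(a)=f_1(a_{(1)})a_{(2)}f_{-1}(a_{(3)})$. *)

theory Defs
  imports
    Complex_Main
    "HOL-Library.Poly_Mapping"
    "HOL-Combinatorics.Permutations"
    "Jordan_Normal_Form.Schur_Decomposition"
begin

section \<open>Hopf *-algebras over the complex numbers\<close>

text \<open>
  The comultiplication is given by Sweedler representatives: \<open>comult H a\<close> is a list of
  pairs with \<open>\<Delta>(a) = \<Sum>(x,y)\<leftarrow>comult H a. x \<otimes> y\<close>. Only the tensor represented by the list
  matters. Two lists represent the same element of the tensor product iff every bilinear form
  takes the same value on them, because the dual of a tensor product of vector spaces is the space
  of bilinear forms, and elements of a vector space are separated by its dual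
  (likewise trilinear forms for threefold tensor products).
\<close>

record 'a hopf_star =
  scl :: "complex \<Rightarrow> 'a \<Rightarrow> 'a"
  comult :: "'a \<Rightarrow> ('a \<times> 'a) list"
  counit :: "'a \<Rightarrow> complex"
  antipode :: "'a \<Rightarrow> 'a"
  star :: "'a \<Rightarrow> 'a"

definition linear_form :: "('a::ring_1) hopf_star \<Rightarrow> ('a \<Rightarrow> complex) \<Rightarrow> bool" where
  "linear_form H f \<longleftrightarrow> Vector_Spaces.linear (scl H) (*) f"

definition bilinear_form :: "('a::ring_1) hopf_star \<Rightarrow> ('a \<Rightarrow> 'a \<Rightarrow> complex) \<Rightarrow> bool" where
  "bilinear_form H B \<longleftrightarrow>
     (\<forall>x. linear_form H (\<lambda>y. B x y)) \<and> (\<forall>y. linear_form H (\<lambda>x. B x y))"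

definition trilinear_form :: "('a::ring_1) hopf_star \<Rightarrow> ('a \<Rightarrow> 'a \<Rightarrow> 'a \<Rightarrow> complex) \<Rightarrow> bool" where
  "trilinear_form H T \<longleftrightarrow>
     (\<forall>y z. linear_form H (\<lambda>x. T x y z)) \<and> (\<forall>x z. linear_form H (\<lambda>y. T x y z)) \<and>
     (\<forall>x y. linear_form H (\<lambda>z. T x y z))"

definition tensor_eq :: "('a::ring_1) hopf_star \<Rightarrow> ('a \<times> 'a) list \<Rightarrow> ('a \<times> 'a) list \<Rightarrow> bool" where
  "tensor_eq H s t \<longleftrightarrow>
     (\<forall>B. bilinear_form H B \<longrightarrow> (\<Sum>(x, y)\<leftarrow>s. B x y) = (\<Sum>(x, y)\<leftarrow>t. B x y))"

text \<open>\<open>sweedler H F a\<close> is \<open>F(a\<^sub>(\<^sub>1\<^sub>), a\<^sub>(\<^sub>2\<^sub>))\<close> in Sweedler notation.\<close>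

definition sweedler ::
  "('a::ring_1) hopf_star \<Rightarrow> ('a \<Rightarrow> 'a \<Rightarrow> 'b::monoid_add) \<Rightarrow> 'a \<Rightarrow> 'b" where
  "sweedler H F a = (\<Sum>(x, y)\<leftarrow>comult H a. F x y)"

locale hopf_star_algebra = vector_space "scl H" for H :: "('a::ring_1) hopf_star" +
  assumes scl_mult_left: "scl H c x * y = scl H c (x * y)"
    and scl_mult_right: "x * scl H c y = scl H c (x * y)"
    and comult_linear: "bilinear_form H B \<Longrightarrow> linear_form H (sweedler H B)"
    and coassoc: "trilinear_form H T \<Longrightarrow>
      sweedler H (\<lambda>x y. sweedler H (\<lambda>x1 x2. T x1 x2 y) x) a =
      sweedler H (\<lambda>x y. sweedler H (\<lambda>y1 y2. T x y1 y2) y) a"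
    and counit_linear: "linear_form H (counit H)"
    and counit_left: "sweedler H (\<lambda>x y. scl H (counit H x) y) a = a"
    and counit_right: "sweedler H (\<lambda>x y. scl H (counit H y) x) a = a"
    and comult_mult: "tensor_eq H (comult H (a * b))
      [(x * x', y * y'). (x, y) \<leftarrow> comult H a, (x', y') \<leftarrow> comult H b]"
    and comult_one: "tensor_eq H (comult H 1) [(1, 1)]"
    and counit_mult: "counit H (a * b) = counit H a * counit H b"
    and counit_one: "counit H 1 = 1"
    and antipode_linear: "Vector_Spaces.linear (scl H) (scl H) (antipode H)"
    and antipode_left: "sweedler H (\<lambda>x y. antipode H x * y) a = scl H (counit H a) 1"
    and antipode_right: "sweedler H (\<lambda>x y. x * antipode H y) a = scl H (counit H a) 1"
    and star_add: "star H (a + b) = star H a + star H b"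
    and star_scl: "star H (scl H c a) = scl H (cnj c) (star H a)"
    and star_mult: "star H (a * b) = star H b * star H a"
    and star_star: "star H (star H a) = a"
    and comult_star: "tensor_eq H (comult H (star H a))
      [(star H x, star H y). (x, y) \<leftarrow> comult H a]"


section \<open>Convolution and universal r-forms\<close>

definition conv ::
  "('a::ring_1) hopf_star \<Rightarrow> ('a \<Rightarrow> complex) \<Rightarrow> ('a \<Rightarrow> complex) \<Rightarrow> 'a \<Rightarrow> complex" where
  "conv H f g a = sweedler H (\<lambda>x y. f x * g y) a"

text \<open>Linear functionals on \<open>A \<otimes> A\<close> are bilinear forms on \<open>A\<close>; \<open>conv2\<close> is the convolution
  for the tensor product coalgebra \<open>A \<otimes> A\<close>.\<close>

definition conv2 ::
  "('a::ring_1) hopf_star \<Rightarrow> ('a \<Rightarrow> 'a \<Rightarrow> complex) \<Rightarrow> ('a \<Rightarrow> 'a \<Rightarrow> complex) \<Rightarrow>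
   'a \<Rightarrow> 'a \<Rightarrow> complex" where
  "conv2 H r s a b = sweedler H (\<lambda>a1 a2. sweedler H (\<lambda>b1 b2. r a1 b1 * s a2 b2) b) a"

definition is_conv_inverse ::
  "('a::ring_1) hopf_star \<Rightarrow> ('a \<Rightarrow> 'a \<Rightarrow> complex) \<Rightarrow> ('a \<Rightarrow> 'a \<Rightarrow> complex) \<Rightarrow> bool" where
  "is_conv_inverse H r s \<longleftrightarrow> bilinear_form H s \<and>
     conv2 H r s = (\<lambda>a b. counit H a * counit H b) \<and>
     conv2 H s r = (\<lambda>a b. counit H a * counit H b)"

definition conv_inverse ::
  "('a::ring_1) hopf_star \<Rightarrow> ('a \<Rightarrow> 'a \<Rightarrow> complex) \<Rightarrow> 'a \<Rightarrow> 'a \<Rightarrow> complex" where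
  "conv_inverse H r = (THE s. is_conv_inverse H r s)"

definition universal_r_form ::
  "('a::ring_1) hopf_star \<Rightarrow> ('a \<Rightarrow> 'a \<Rightarrow> complex) \<Rightarrow> bool" where
  "universal_r_form H r \<longleftrightarrow>
     bilinear_form H r \<and> (\<exists>s. is_conv_inverse H r s) \<and>
     (\<forall>a b c. r c (a * b) = sweedler H (\<lambda>c1 c2. r c1 b * r c2 a) c) \<and>
     (\<forall>a b c. r (a * b) c = sweedler H (\<lambda>c1 c2. r a c1 * r b c2) c) \<and>
     (\<forall>a b.
        sweedler H (\<lambda>a1 a2. sweedler H (\<lambda>b1 b2. scl H (r a1 b1) (a2 * b2)) b) a =
        sweedler H (\<lambda>a1 a2. sweedler H (\<lambda>b1 b2. scl H (r a2 b2) (b1 * a1)) b) a)"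

definition rbar21 ::
  "('a::ring_1) hopf_star \<Rightarrow> ('a \<Rightarrow> 'a \<Rightarrow> complex) \<Rightarrow> 'a \<Rightarrow> 'a \<Rightarrow> complex" where
  "rbar21 H r a b = conv_inverse H r b a"

definition f_form ::
  "('a::ring_1) hopf_star \<Rightarrow> ('a \<Rightarrow> 'a \<Rightarrow> complex) \<Rightarrow> 'a \<Rightarrow> complex" where
  "f_form H t a = sweedler H (\<lambda>x y. t x (antipode H y)) a"

definition F_form ::
  "('a::ring_1) hopf_star \<Rightarrow> ('a \<Rightarrow> 'a \<Rightarrow> complex) \<Rightarrow> 'a \<Rightarrow> complex" where
  "F_form H r = conv H (f_form H r) (f_form H (rbar21 H r))"


section \<open>Unitary corepresentations and Woronowicz's modular characters\<close>

definition matrix_corep :: "('a::ring_1) hopf_star \<Rightarrow> nat \<Rightarrow> 'a mat \<Rightarrow> bool" where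
  "matrix_corep H n v \<longleftrightarrow> v \<in> carrier_mat n n \<and>
     (\<forall>i<n. \<forall>j<n.
        tensor_eq H (comult H (v $$ (i, j))) [(v $$ (i, k), v $$ (k, j)). k \<leftarrow> [0..<n]] \<and>
        counit H (v $$ (i, j)) = (if i = j then 1 else 0))"

definition unitary_corep :: "('a::ring_1) hopf_star \<Rightarrow> nat \<Rightarrow> 'a mat \<Rightarrow> bool" where
  "unitary_corep H n v \<longleftrightarrow> matrix_corep H n v \<and>
     (let v' = mat n n (\<lambda>(i, j). star H (v $$ (j, i))) in v * v' = 1\<^sub>m n \<and> v' * v = 1\<^sub>m n)"

definition vec_subspace :: "nat \<Rightarrow> complex vec set \<Rightarrow> bool" where
  "vec_subspace n W \<longleftrightarrow> W \<subseteq> carrier_vec n \<and> 0\<^sub>v n \<in> W \<and>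
     (\<forall>x\<in>W. \<forall>y\<in>W. x + y \<in> W) \<and> (\<forall>c. \<forall>x\<in>W. c \<cdot>\<^sub>v x \<in> W)"

text \<open>The coaction of \<open>v\<close> on \<open>\<complex>\<^sup>n\<close> is \<open>e\<^sub>j \<mapsto> \<Sum>\<^sub>i e\<^sub>i \<otimes> v\<^sub>i\<^sub>j\<close>. With \<open>\<complex>\<^sup>n \<otimes> A\<close> identified with \<open>A\<^sup>n\<close>,
  the list \<open>ts\<close> below stands for the element \<open>\<Sum>(w,a)\<leftarrow>ts. w \<otimes> a\<close> of \<open>W \<otimes> A\<close>.\<close>

definition invariant_subspace ::
  "('a::ring_1) hopf_star \<Rightarrow> nat \<Rightarrow> 'a mat \<Rightarrow> complex vec set \<Rightarrow> bool" where
  "invariant_subspace H n v W \<longleftrightarrow> vec_subspace n W \<and>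
     (\<forall>x\<in>W. \<exists>ts. (\<forall>(w, a)\<in>set ts. w \<in> W) \<and>
        (\<forall>i<n. (\<Sum>j<n. scl H (x $ j) (v $$ (i, j))) = (\<Sum>(w, a)\<leftarrow>ts. scl H (w $ i) a)))"

definition irreducible_corep :: "('a::ring_1) hopf_star \<Rightarrow> nat \<Rightarrow> 'a mat \<Rightarrow> bool" where
  "irreducible_corep H n v \<longleftrightarrow> matrix_corep H n v \<and> 0 < n \<and>
     (\<forall>W. invariant_subspace H n v W \<longrightarrow> W = {0\<^sub>v n} \<or> W = carrier_vec n)"

definition positive_definite :: "nat \<Rightarrow> complex mat \<Rightarrow> bool" where
  "positive_definite n F \<longleftrightarrow> F \<in> carrier_mat n n \<and> mat_adjoint F = F \<and>
     (\<forall>x\<in>carrier_vec n. x \<noteq> 0\<^sub>v n \<longrightarrow> 0 < Re ((F *\<^sub>v x) \<bullet>c x))"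

definition mat_trace :: "complex mat \<Rightarrow> complex" where
  "mat_trace F = (\<Sum>i<dim_row F. F $$ (i, i))"

text \<open>Complex powers of a positive definite matrix by functional calculus:
  if \<open>F = U diag(d) U\<^sup>*\<close> with \<open>U\<close> unitary and \<open>d > 0\<close>, then \<open>F\<^sup>z = U diag(d\<^sup>z) U\<^sup>*\<close>,
  where \<open>d\<^sup>z = exp(z ln d)\<close>.\<close>

definition posdef_power :: "nat \<Rightarrow> complex mat \<Rightarrow> complex \<Rightarrow> complex mat" where
  "posdef_power n F z = (THE M. \<exists>U (d :: nat \<Rightarrow> real).
     U \<in> carrier_mat n n \<and> U * mat_adjoint U = 1\<^sub>m n \<and> mat_adjoint U * U = 1\<^sub>m n \<and>
     (\<forall>i<n. 0 < d i) \<and>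
     F = U * mat n n (\<lambda>(i, j). if i = j then complex_of_real (d i) else 0) * mat_adjoint U \<and>
     M = U * mat n n (\<lambda>(i, j). if i = j then exp (z * complex_of_real (ln (d i))) else 0)
           * mat_adjoint U)"

definition scalar_mat :: "('a::ring_1) hopf_star \<Rightarrow> complex mat \<Rightarrow> 'a mat" where
  "scalar_mat H F = map_mat (\<lambda>c. scl H c 1) F"

definition modular_matrix :: "('a::ring_1) hopf_star \<Rightarrow> nat \<Rightarrow> 'a mat \<Rightarrow> complex mat" where
  "modular_matrix H n v = (THE F. positive_definite n F \<and>
     (\<exists>G\<in>carrier_mat n n. F * G = 1\<^sub>m n \<and> G * F = 1\<^sub>m n \<and>
        map_mat (\<lambda>a. antipode H (antipode H a)) v = scalar_mat H F * v * scalar_mat H G \<and>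
        mat_trace F = mat_trace G))"

definition modular_character :: "('a::ring_1) hopf_star \<Rightarrow> complex \<Rightarrow> 'a \<Rightarrow> complex" where
  "modular_character H z = (THE f. linear_form H f \<and>
     (\<forall>n v. unitary_corep H n v \<and> irreducible_corep H n v \<longrightarrow>
        (\<forall>i<n. \<forall>j<n. f (v $$ (i, j)) = posdef_power n (modular_matrix H n v) z $$ (i, j))))"


section \<open>Algebras given by generators and relations\<close>

text \<open>The free complex algebra on \<open>'g\<close> is the monoid algebra of the free monoid of words.\<close>

datatype 'g fword = FWord (letters: "'g list")

instantiation fword :: (type) monoid_add
begin

definition zero_fword :: "'a fword" where "zero_fword = FWord []"

definition plus_fword :: "'a fword \<Rightarrow> 'a fword \<Rightarrow> 'a fword" where
  "plus_fword v w = FWord (letters v @ letters w)"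

instance
  by standard (simp_all add: zero_fword_def plus_fword_def)

end

type_synonym 'g free_algebra = "'g fword \<Rightarrow>\<^sub>0 complex"

definition fgen :: "'g \<Rightarrow> 'g free_algebra" where
  "fgen g = Poly_Mapping.single (FWord [g]) 1"

definition fconst :: "complex \<Rightarrow> 'g free_algebra" where
  "fconst c = Poly_Mapping.single 0 c"

definition free_on :: "'g set \<Rightarrow> 'g free_algebra set" where
  "free_on X = {p. \<forall>w\<in>Poly_Mapping.keys p. set (letters w) \<subseteq> X}"

inductive_set two_sided_ideal :: "'g set \<Rightarrow> 'g free_algebra set \<Rightarrow> 'g free_algebra set"
  for X R where
  zero: "0 \<in> two_sided_ideal X R"
| add: "p \<in> two_sided_ideal X R \<Longrightarrow> p' \<in> two_sided_ideal X R \<Longrightarrow> p + p' \<in> two_sided_ideal X R"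
| rel: "a \<in> free_on X \<Longrightarrow> \<rho> \<in> R \<Longrightarrow> b \<in> free_on X \<Longrightarrow> a * \<rho> * b \<in> two_sided_ideal X R"

definition free_eval :: "('a::ring_1) hopf_star \<Rightarrow> ('g \<Rightarrow> 'a) \<Rightarrow> 'g free_algebra \<Rightarrow> 'a" where
  "free_eval H g p =
     (\<Sum>w\<in>Poly_Mapping.keys p. scl H (Poly_Mapping.lookup p w) (prod_list (map g (letters w))))"

text \<open>The algebra is the quotient of the free algebra on \<open>X\<close> by the ideal generated by \<open>R\<close>, each
  generator \<open>x\<close> being sent to \<open>g x\<close>.\<close>

definition presented_by ::
  "('a::ring_1) hopf_star \<Rightarrow> ('g \<Rightarrow> 'a) \<Rightarrow> 'g set \<Rightarrow> 'g free_algebra set \<Rightarrow> bool" where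
  "presented_by H g X R \<longleftrightarrow> free_eval H g ` free_on X = UNIV \<and>
     (\<forall>p\<in>free_on X. free_eval H g p = 0 \<longleftrightarrow> p \<in> two_sided_ideal X R)"


section \<open>The Hopf algebras of Faddeev, Reshetikhin and Takhtajan\<close>

datatype family = GLq | SLq | Oq | Spq

text \<open>Indices run through \<open>{1..N}\<close>. \<open>qpow q x\<close> is \<open>q\<^sup>x\<close>, an integer power of a possibly negative
  \<open>q\<close>, or else a power of \<open>q > 0\<close>.\<close>

definition qpow :: "real \<Rightarrow> real \<Rightarrow> real" where
  "qpow q x = (if x \<in> \<int> then q powi \<lfloor>x\<rfloor> else q powr x)"

definition kron :: "nat \<Rightarrow> nat \<Rightarrow> real" where
  "kron i j = (if i = j then 1 else 0)"

definition theta :: "int \<Rightarrow> real" where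
  "theta k = (if k > 0 then 1 else 0)"

definition opp :: "nat \<Rightarrow> nat \<Rightarrow> nat" where
  "opp N i = N + 1 - i"

fun eps :: "family \<Rightarrow> nat \<Rightarrow> nat \<Rightarrow> real" where
  "eps Spq N i = (if 2 * i \<le> N then 1 else -1)"
| "eps _ N i = 1"

text \<open>Only the values for \<open>Oq\<close> and \<open>Spq\<close> are meaningful. For \<open>Oq\<close> they are
  \<open>N/2 - 1, N/2 - 2, \<dots>\<close> in the first half of the index range, for \<open>Spq\<close> they are
  \<open>N/2, N/2 - 1, \<dots>\<close>; the second half is determined by \<open>\<rho>\<^sub>i\<^sub>' = - \<rho>\<^sub>i\<close>.\<close>

fun rho :: "family \<Rightarrow> nat \<Rightarrow> nat \<Rightarrow> real" where
  "rho Spq N i = (if 2 * i \<le> N then real N / 2 + 1 - real i else real N / 2 - real i)"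
| "rho _ N i = (if 2 * i \<le> N then real N / 2 - real i
     else if 2 * i = N + 1 then 0
     else real N / 2 + 1 - real i)"

definition R_A :: "real \<Rightarrow> nat \<Rightarrow> nat \<Rightarrow> nat \<Rightarrow> nat \<Rightarrow> real" where
  "R_A q i j m n = qpow q (kron i j) * kron i m * kron j n
     + (q - inverse q) * theta (int i - int j) * kron i n * kron j m"

definition R_BCD :: "family \<Rightarrow> nat \<Rightarrow> real \<Rightarrow> nat \<Rightarrow> nat \<Rightarrow> nat \<Rightarrow> nat \<Rightarrow> real" where
  "R_BCD G N q i j m n = qpow q (kron i j - kron i (opp N j)) * kron i m * kron j n
     + (q - inverse q) * theta (int i - int m) *
       (kron j m * kron i n
        - eps G N i * eps G N m * qpow q (rho G N i - rho G N m)
          * kron j (opp N i) * kron n (opp N m))"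

text \<open>\<open>Rmat G N q i j m n\<close> is \<open>R\<^sup>i\<^sup>j\<^sub>m\<^sub>n\<close>.\<close>

definition Rmat :: "family \<Rightarrow> nat \<Rightarrow> real \<Rightarrow> nat \<Rightarrow> nat \<Rightarrow> nat \<Rightarrow> nat \<Rightarrow> complex" where
  "Rmat G N q i j m n = complex_of_real
     (if G = GLq \<or> G = SLq then R_A q i j m n else R_BCD G N q i j m n)"

definition Cmat :: "family \<Rightarrow> nat \<Rightarrow> real \<Rightarrow> nat \<Rightarrow> nat \<Rightarrow> complex" where
  "Cmat G N q i j = complex_of_real (eps G N i * kron i (opp N j) * qpow q (- rho G N i))"

definition Cinv :: "family \<Rightarrow> nat \<Rightarrow> real \<Rightarrow> nat \<Rightarrow> nat \<Rightarrow> complex" where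
  "Cinv G N q i j = complex_of_real (eps G N j * kron i (opp N j) * qpow q (rho G N j))"

text \<open>\<open>Gen i j\<close> stands for \<open>u\<^sup>i\<^sub>j\<close>, and \<open>GenDinv\<close> for the inverse of the quantum determinant.\<close>

datatype qgen = Gen nat nat | GenDinv

abbreviation U :: "nat \<Rightarrow> nat \<Rightarrow> qgen free_algebra" where
  "U i j \<equiv> fgen (Gen i j)"

definition FRT_rels :: "family \<Rightarrow> nat \<Rightarrow> real \<Rightarrow> qgen free_algebra set" where
  "FRT_rels G N q =
     {(\<Sum>k=1..N. \<Sum>l=1..N. fconst (Rmat G N q i j k l) * U k m * U l n)
      - (\<Sum>k=1..N. \<Sum>l=1..N. U j l * U i k * fconst (Rmat G N q k l m n))
      | i j m n. i \<in> {1..N} \<and> j \<in> {1..N} \<and> m \<in> {1..N} \<and> n \<in> {1..N}}"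

definition inversions :: "nat \<Rightarrow> (nat \<Rightarrow> nat) \<Rightarrow> nat" where
  "inversions N \<pi> = card {(i, j). i \<in> {1..N} \<and> j \<in> {1..N} \<and> i < j \<and> \<pi> j < \<pi> i}"

definition qdet :: "nat \<Rightarrow> real \<Rightarrow> qgen free_algebra" where
  "qdet N q = (\<Sum>\<pi> | \<pi> permutes {1..N}.
     fconst (complex_of_real ((- q) ^ inversions N \<pi>)) *
     prod_list (map (\<lambda>i. U i (\<pi> i)) [1..<Suc N]))"

text \<open>The entries of \<open>u C u\<^sup>t C\<^sup>-\<^sup>1 - I\<close> and \<open>C u\<^sup>t C\<^sup>-\<^sup>1 u - I\<close>.\<close>

definition C_rels :: "family \<Rightarrow> nat \<Rightarrow> real \<Rightarrow> qgen free_algebra set" where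
  "C_rels G N q =
     {(\<Sum>k=1..N. \<Sum>l=1..N. \<Sum>p=1..N.
         U i k * fconst (Cmat G N q k l) * U p l * fconst (Cinv G N q p j))
      - fconst (complex_of_real (kron i j)) | i j. i \<in> {1..N} \<and> j \<in> {1..N}}
   \<union> {(\<Sum>k=1..N. \<Sum>l=1..N. \<Sum>p=1..N.
         fconst (Cmat G N q i k) * U l k * fconst (Cinv G N q l p) * U p j)
      - fconst (complex_of_real (kron i j)) | i j. i \<in> {1..N} \<and> j \<in> {1..N}}"

fun qgens :: "family \<Rightarrow> nat \<Rightarrow> qgen set" where
  "qgens GLq N = {Gen i j | i j. i \<in> {1..N} \<and> j \<in> {1..N}} \<union> {GenDinv}"
| "qgens _ N = {Gen i j | i j. i \<in> {1..N} \<and> j \<in> {1..N}}"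

text \<open>In the case \<open>GLq\<close>, inverting the central element \<open>D\<close> means adjoining a central
  \<open>D\<^sup>-\<^sup>1\<close> with \<open>D D\<^sup>-\<^sup>1 = 1\<close>.\<close>

fun qrels :: "family \<Rightarrow> nat \<Rightarrow> real \<Rightarrow> qgen free_algebra set" where
  "qrels GLq N q = FRT_rels GLq N q \<union> {qdet N q * fgen GenDinv - 1}
     \<union> {U i j * fgen GenDinv - fgen GenDinv * U i j | i j. i \<in> {1..N} \<and> j \<in> {1..N}}"
| "qrels SLq N q = FRT_rels SLq N q \<union> {qdet N q - 1}"
| "qrels Oq N q = FRT_rels Oq N q \<union> C_rels Oq N q"
| "qrels Spq N q = FRT_rels Spq N q \<union> C_rels Spq N q"

text \<open>\<open>compact_form G N q H u\<close>: up to isomorphism, \<open>H\<close> with the matrix \<open>u = (u\<^sup>i\<^sub>j)\<close> of generators is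
  the Hopf *-algebra of \<open>U\<^sub>q(N)\<close>, \<open>SU\<^sub>q(N)\<close>, \<open>O\<^sub>q(N;\<real>)\<close> or \<open>USp\<^sub>q(N)\<close>, respectively.\<close>

definition compact_form ::
  "family \<Rightarrow> nat \<Rightarrow> real \<Rightarrow> ('a::ring_1) hopf_star \<Rightarrow> (nat \<Rightarrow> nat \<Rightarrow> 'a) \<Rightarrow> bool" where
  "compact_form G N q H u \<longleftrightarrow> hopf_star_algebra H \<and>
     (\<exists>dinv. presented_by H (case_qgen u dinv) (qgens G N) (qrels G N q)) \<and>
     (\<forall>i\<in>{1..N}. \<forall>j\<in>{1..N}.
        tensor_eq H (comult H (u i j)) [(u i k, u k j). k \<leftarrow> [1..<Suc N]] \<and>
        counit H (u i j) = (if i = j then 1 else 0) \<and>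
        star H (u i j) = antipode H (u j i))"

fun admissible_params :: "family \<Rightarrow> nat \<Rightarrow> real \<Rightarrow> bool" where
  "admissible_params Oq N q \<longleftrightarrow> q \<noteq> 0 \<and> N \<ge> 3 \<and> (odd N \<longrightarrow> q > 0)"
| "admissible_params Spq N q \<longleftrightarrow> q \<noteq> 0 \<and> N \<ge> 2 \<and> even N"
| "admissible_params _ N q \<longleftrightarrow> q \<noteq> 0 \<and> N \<ge> 2"

fun admissible_z :: "family \<Rightarrow> nat \<Rightarrow> real \<Rightarrow> complex \<Rightarrow> bool" where
  "admissible_z GLq N q z \<longleftrightarrow> z \<noteq> 0"
| "admissible_z SLq N q z \<longleftrightarrow> z ^ N = complex_of_real (inverse q)"
| "admissible_z _ N q z \<longleftrightarrow> z\<^sup>2 = 1"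

lemma qpow_minus:
  assumes "q \<noteq> 0" and "x \<in> \<int> \<or> q > 0"
  shows "qpow q (- x) * qpow q x = 1"
proof (cases "x \<in> \<int>")
  case True
  then obtain k where "x = of_int k" by (auto elim: Ints_cases)
  moreover have "- x \<in> \<int>" using True by simp
  ultimately show ?thesis using assms(1) by (simp add: qpow_def power_int_minus)
next
  case False
  then show ?thesis using assms by (simp add: qpow_def powr_minus)
qed

lemma rho_Ints:
  assumes "admissible_params G N q" and "G = Oq \<or> G = Spq"
  shows "rho G N i \<in> \<int> \<or> q > 0"
proof (cases "even N")
  case True
  then obtain k where "real N / 2 = of_int (int k)" by (auto elim: evenE)
  then show ?thesis using assms(2) by (auto intro!: Ints_diff Ints_add)
next
  case False
  then show ?thesis using assms by auto
qed

lemma Cmat_Cinv: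
  assumes "admissible_params G N q" and "G = Oq \<or> G = Spq" and "i \<in> {1..N}" and "j \<in> {1..N}"
  shows "(\<Sum>k=1..N. Cmat G N q i k * Cinv G N q k j) = (if i = j then 1 else 0)"
    and "(\<Sum>k=1..N. Cinv G N q i k * Cmat G N q k j) = (if i = j then 1 else 0)"
proof -
  have q: "q \<noteq> 0" using assms(1,2) by auto
  have pw: "qpow q (- rho G N m) * qpow q (rho G N m) = 1" for m
    using qpow_minus[OF q rho_Ints[OF assms(1,2)]] .
  have ee: "eps G N m * eps G N m = 1" for m using assms(2) by auto
  have oo: "opp N (opp N m) = m" "opp N m \<in> {1..N}" if "m \<in> {1..N}" for m
    using that by (auto simp: opp_def)
  have one: "eps G N m * qpow q (- rho G N m) * (eps G N m * qpow q (rho G N m)) = 1" for m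
    using pw[of m] ee[of m] by (metis (no_types, opaque_lifting) mult.assoc mult.commute mult_1)
  have "(\<Sum>k=1..N. Cmat G N q i k * Cinv G N q k j)
      = (\<Sum>k\<in>{1..N}. if k = opp N i then (if i = j then 1 else 0) else 0)"
  proof (rule sum.cong[OF refl])
    fix k assume k: "k \<in> {1..N}"
    have "Cmat G N q i k * Cinv G N q k j = complex_of_real (kron i (opp N k) * kron k (opp N j) *
        (eps G N i * qpow q (- rho G N i) * (eps G N j * qpow q (rho G N j))))"
      by (simp add: Cmat_def Cinv_def)
    moreover have "i = opp N k \<longleftrightarrow> k = opp N i" "k = opp N j \<longleftrightarrow> j = opp N k"
      using oo(1)[of k] oo(1)[OF assms(3)] oo(1)[OF assms(4)] k by auto
    ultimately show "Cmat G N q i k * Cinv G N q k j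
        = (if k = opp N i then (if i = j then 1 else 0) else 0)"
      using one[of i] by (auto simp: kron_def simp del: of_real_mult)
  qed
  then show "(\<Sum>k=1..N. Cmat G N q i k * Cinv G N q k j) = (if i = j then 1 else 0)"
    using oo(2)[OF assms(3)] by simp
  have "(\<Sum>k=1..N. Cinv G N q i k * Cmat G N q k j)
      = (\<Sum>k\<in>{1..N}. if k = opp N i then (if i = j then 1 else 0) else 0)"
  proof (rule sum.cong[OF refl])
    fix k assume k: "k \<in> {1..N}"
    have "Cinv G N q i k * Cmat G N q k j = complex_of_real (kron i (opp N k) * kron k (opp N j) *
        (eps G N k * qpow q (- rho G N k) * (eps G N k * qpow q (rho G N k))))"
      by (simp add: Cmat_def Cinv_def)
    moreover have "i = opp N k \<longleftrightarrow> k = opp N i" "k = opp N j \<longleftrightarrow> j = opp N k"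
      using oo(1)[of k] oo(1)[OF assms(3)] oo(1)[OF assms(4)] k by auto
    ultimately show "Cinv G N q i k * Cmat G N q k j
        = (if k = opp N i then (if i = j then 1 else 0) else 0)"
      using one[of k] by (auto simp: kron_def simp del: of_real_mult)
  qed
  then show "(\<Sum>k=1..N. Cinv G N q i k * Cmat G N q k j) = (if i = j then 1 else 0)"
    using oo(2)[OF assms(3)] by simp
qed

end

theory Submission
  imports Defs "Jordan_Normal_Form.Spectral_Radius"
begin

text \<open>
  Both sides of the identity are shown to be characters, that is, multiplicative functionals, so that
  they can be compared on the matrix \<open>u\<close> of generators.

  The functional \<open>f\<^sub>r\<close> implements the square of the antipode, \<open>f\<^sub>r(a\<^sub>1) S\<^sup>2(a\<^sub>2) = a\<^sub>1 f\<^sub>r(a\<^sub>2)\<close>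
  (\<open>f_antipode_square\<close>, Drinfeld's argument), and it fails to be multiplicative by the inverse of the
  double braiding (\<open>f_mult\<close>). For the flipped inverse form the double braiding itself appears, so that
  the product \<open>F\<^sub>r\<close> is a character (\<open>F_mult\<close>).

  On the other side, \<open>\<phi>\<^sub>t(u\<^sub>i\<^sub>j) = \<delta>\<^sub>i\<^sub>j exp(t \<mu>\<^sub>i)\<close> defines a one-parameter group of characters, because \<open>R\<close>
  preserves the weights \<open>\<mu>\<close> (\<open>Rmat_weight\<close>). It is Hermitian (\<open>\<phi>_hermitian\<close>), and
  \<open>S\<^sup>2(a) = \<phi>\<^sub>1(a\<^sub>1) a\<^sub>2 \<phi>\<^sub>-\<^sub>1(a\<^sub>3)\<close> (\<open>antipode_square_\<phi>\<close>): both sides are algebra maps, and they agree on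
  \<open>u\<close>. There \<open>S\<^sup>2\<close> is read off from \<open>S(u) = C u\<^sup>t C\<^sup>-\<^sup>1\<close> for the orthogonal and symplectic groups. For the
  linear groups it is read off from \<open>f\<^sub>r(u)\<close>, which the axioms of an r-form determine (\<open>f_u_type_A\<close>); this
  avoids a formula for the cofactor matrix of \<open>u\<close>. Consequently, for an irreducible unitary
  corepresentation \<open>V\<close>, the matrix \<open>K = \<phi>\<^sub>1(V)\<close> implements \<open>S\<^sup>2\<close>, and it is positive definite, being the
  square of the Hermitian matrix \<open>\<phi>\<^sub>1\<^sub>/\<^sub>2(V)\<close>.

  The values of \<open>F\<^sub>r\<close> on \<open>u\<close> come from one property of \<open>R\<close>: with \<open>K\<^sub>i = exp \<mu>\<^sub>i\<close>, the quantum trace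
  \<open>\<Sum>\<^sub>k K\<^sub>k R\<^sup>k\<^sup>i\<^sub>j\<^sub>k\<close> is a multiple \<open>\<kappa>\<close> of the identity (\<open>Rmat_quantum_trace\<close>). This evaluates \<open>f\<close> of the
  flipped inverse form on \<open>u\<close> as \<open>z \<kappa> K\<^sup>-\<^sup>1\<close>. The inverse of that matrix is another partial trace of
  \<open>R\<^sup>-\<^sup>1\<close>, and the symmetry \<open>R\<^sup>i\<^sup>j\<^sub>m\<^sub>n = R\<^sup>m\<^sup>'\<^sup>n\<^sup>'\<^sub>i\<^sub>'\<^sub>j\<^sub>'\<close> turns it into \<open>f\<^sub>r(u) = (z \<kappa>)\<^sup>-\<^sup>1 K\<^sup>-\<^sup>1\<close>. The constants
  cancel in \<open>F\<^sub>r(u) = K\<^sup>-\<^sup>2\<close>, hence \<open>F\<^sub>r = \<phi>\<^sub>-\<^sub>2\<close>.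

  It remains to see that \<open>K\<close> has the normalization \<open>Tr K = Tr K\<^sup>-\<^sup>1\<close> on every irreducible \<open>V\<close>, not only on
  \<open>u\<close>. This follows from \<open>F\<^sub>r(V) = K\<^sup>-\<^sup>2\<close> by closing the inverse braiding of \<open>V\<close> with itself in two
  ways (\<open>balanced_trace\<close>); it is the statement that ribbon categories are spherical. So \<open>K\<close> is
  Woronowicz's matrix of \<open>V\<close>, and \<open>F\<^sub>r\<close> and the modular character agree on the coefficients of \<open>V\<close>.

  These coefficients span the algebra, because every unitary corepresentation is completely reducible
  (\<open>coefficients_in_span\<close>) and all generators are coefficients of unitary corepresentations. For the
  inverse of the quantum determinant \<open>D\<close> this holds since \<open>D\<close> is group-like and unitary
  (\<open>ucorep_qdeterminant\<close>), so that \<open>D\<^sup>-\<^sup>1 = D\<^sup>*\<close>.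
\<close>


section \<open>Linear algebra over a Hopf algebra\<close>

lemma delta_sum [simp]:
  fixes f :: "'i \<Rightarrow> 'b::comm_semiring_1"
  assumes "finite I"
  shows "(\<Sum>k\<in>I. (if i = k then 1 else 0) * f k) = (if i \<in> I then f i else 0)"
    and "(\<Sum>k\<in>I. f k * (if k = i then 1 else 0)) = (if i \<in> I then f i else 0)"
  using assms by (simp_all add: if_distrib[of "\<lambda>x. x * _"] if_distrib[of "\<lambda>x. _ * x"] cong: if_cong)

lemma matrix_inverse_unique:
  fixes v :: "'i \<Rightarrow> 'i \<Rightarrow> 'b::ring_1"
  assumes I: "finite I" and ij: "i \<in> I" "j \<in> I"
    and l: "\<And>i j. i \<in> I \<Longrightarrow> j \<in> I \<Longrightarrow> (\<Sum>k\<in>I. x i k * v k j) = (if i = j then 1 else 0)"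
    and r: "\<And>i j. i \<in> I \<Longrightarrow> j \<in> I \<Longrightarrow> (\<Sum>k\<in>I. v i k * y k j) = (if i = j then 1 else 0)"
  shows "x i j = y i j"
proof -
  have "x i j = (\<Sum>k\<in>I. x i k * (if k = j then 1 else 0))"
    using I ij by (simp add: if_distrib cong: if_cong)
  also have "\<dots> = (\<Sum>k\<in>I. x i k * (\<Sum>l\<in>I. v k l * y l j))"
    using r ij by (intro sum.cong) auto
  also have "\<dots> = (\<Sum>l\<in>I. (\<Sum>k\<in>I. x i k * v k l) * y l j)"
    by (simp add: sum_distrib_left sum_distrib_right mult.assoc) (rule sum.swap)
  also have "\<dots> = (\<Sum>l\<in>I. (if i = l then 1 else 0) * y l j)"
    using l ij by (intro sum.cong) auto
  also have "\<dots> = y i j"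
    using I ij by (simp add: if_distrib[of "\<lambda>x. x * _"] cong: if_cong)
  finally show ?thesis .
qed

context hopf_star_algebra
begin

lemma vector_space_scl: "vector_space (scl H)" by unfold_locales

lemma vector_space_complex: "vector_space ((*) :: complex \<Rightarrow> complex \<Rightarrow> complex)"
  by unfold_locales (auto simp: algebra_simps)

lemma linear_form_iff:
  "linear_form H f \<longleftrightarrow> (\<forall>x y. f (x + y) = f x + f y) \<and> (\<forall>c x. f (scl H c x) = c * f x)"
  by (auto simp: linear_form_def Vector_Spaces.linear_iff vector_space_scl vector_space_complex)

abbreviation linear_map :: "('a \<Rightarrow> 'a) \<Rightarrow> bool" where
  "linear_map \<equiv> Vector_Spaces.linear (scl H) (scl H)"

lemma linear_map_iff:
  "linear_map f \<longleftrightarrow> (\<forall>x y. f (x + y) = f x + f y) \<and> (\<forall>c x. f (scl H c x) = scl H c (f x))"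
  by (auto simp: Vector_Spaces.linear_iff vector_space_scl)

lemma bilinear_form_iff:
  "bilinear_form H B \<longleftrightarrow>
     (\<forall>x y z. B (x + y) z = B x z + B y z) \<and> (\<forall>x y z. B x (y + z) = B x y + B x z) \<and>
     (\<forall>c x y. B (scl H c x) y = c * B x y) \<and> (\<forall>c x y. B x (scl H c y) = c * B x y)"
  unfolding bilinear_form_def linear_form_iff by blast

definition bilinear_map :: "('a \<Rightarrow> 'a \<Rightarrow> 'a) \<Rightarrow> bool" where
  "bilinear_map B \<longleftrightarrow>
     (\<forall>x y z. B (x + y) z = B x z + B y z) \<and> (\<forall>x y z. B x (y + z) = B x y + B x z) \<and>
     (\<forall>c x y. B (scl H c x) y = scl H c (B x y)) \<and> (\<forall>c x y. B x (scl H c y) = scl H c (B x y))"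

lemma linear_form_add: "linear_form H f \<Longrightarrow> f (x + y) = f x + f y"
  and linear_form_scl: "linear_form H f \<Longrightarrow> f (scl H c x) = c * f x"
  by (auto simp: linear_form_iff)

lemma linear_form_zero: "linear_form H f \<Longrightarrow> f 0 = 0"
  using linear_form_scl[of f 0 0] by simp

lemma linear_form_sum: "linear_form H f \<Longrightarrow> f (\<Sum>x\<in>A. g x) = (\<Sum>x\<in>A. f (g x))"
  by (induction A rule: infinite_finite_induct) (auto simp: linear_form_zero linear_form_add)

lemma linear_form_sum_list: "linear_form H f \<Longrightarrow> f (\<Sum>x\<leftarrow>xs. g x) = (\<Sum>x\<leftarrow>xs. f (g x))"
  by (induction xs) (auto simp: linear_form_zero linear_form_add)

lemma linear_map_add: "linear_map f \<Longrightarrow> f (x + y) = f x + f y"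
  and linear_map_scl: "linear_map f \<Longrightarrow> f (scl H c x) = scl H c (f x)"
  by (auto simp: linear_map_iff)

lemma linear_map_zero: "linear_map f \<Longrightarrow> f 0 = 0"
  using linear_map_scl[of f 0 0] by simp

lemma linear_map_sum: "linear_map f \<Longrightarrow> f (\<Sum>x\<in>A. g x) = (\<Sum>x\<in>A. f (g x))"
  by (induction A rule: infinite_finite_induct) (auto simp: linear_map_zero linear_map_add)

text \<open>Tensors are described by bilinear forms. With this lemma, identities between elements written in Sweedler
  notation reduce to identities between complex numbers.\<close>

lemma linear_forms_separate:
  assumes "\<And>f. linear_form H f \<Longrightarrow> f x = f y"
  shows "x = y"
proof (rule ccontr)
  assume "x \<noteq> y"
  interpret vp: vector_space_pair "scl H" "(*) :: complex \<Rightarrow> complex \<Rightarrow> complex"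
    using vector_space_scl vector_space_complex by (simp add: vector_space_pair_def)
  have "independent {x - y}"
    using \<open>x \<noteq> y\<close> by (simp add: dependent_single)
  from vp.linear_independent_extend[OF this, of "\<lambda>_. 1"] obtain g
    where g: "Vector_Spaces.linear (scl H) (*) g" "g (x - y) = 1" by auto
  have lg: "linear_form H g" using g by (simp add: linear_form_def)
  have "g (x - y) + g y = g x" using linear_form_add[OF lg, of "x - y" y] by simp
  with assms[OF lg] g show False by simp
qed

lemma linear_form_bilinear_map:
  "linear_form H f \<Longrightarrow> bilinear_map B \<Longrightarrow> bilinear_form H (\<lambda>x y. f (B x y))"
  by (auto simp: linear_form_iff bilinear_map_def bilinear_form_iff)

lemma linear_form_sweedler: "linear_form H f \<Longrightarrow> f (sweedler H B a) = sweedler H (\<lambda>x y. f (B x y)) a"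
  unfolding sweedler_def by (subst linear_form_sum_list) (auto intro!: arg_cong[of _ _ sum_list])

lemma sweedler_linear:
  assumes "bilinear_map B"
  shows "linear_map (sweedler H B)"
  unfolding linear_map_iff
proof (intro conjI allI)
  fix x y c
  show "sweedler H B (x + y) = sweedler H B x + sweedler H B y"
    using comult_linear[OF linear_form_bilinear_map[OF _ assms]]
    by (intro linear_forms_separate) (simp add: linear_form_add linear_form_sweedler)
  show "sweedler H B (scl H c x) = scl H c (sweedler H B x)"
    using comult_linear[OF linear_form_bilinear_map[OF _ assms]]
    by (intro linear_forms_separate) (simp add: linear_form_scl linear_form_sweedler)
qed

lemma linear_form_eq_on_span:
  assumes f: "linear_form H f" and g: "linear_form H g" and eq: "\<And>x. x \<in> S \<Longrightarrow> f x = g x"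
    and a: "a \<in> span S"
  shows "f a = g a"
  using a
proof (induction rule: span_induct_alt)
  case base
  show ?case using f g by (simp add: linear_form_zero)
next
  case (step c x y)
  then show ?case using f g eq by (simp add: linear_form_add linear_form_scl)
qed

lemma bilinear_form_sum_list:
  assumes "\<And>x y. (x, y) \<in> set xs \<Longrightarrow> bilinear_form H (\<lambda>a b. T a b x y)"
  shows "bilinear_form H (\<lambda>a b. \<Sum>(x, y)\<leftarrow>xs. T a b x y)"
  using assms by (induction xs) (auto simp: bilinear_form_iff algebra_simps split: prod.splits)

lemma bilinear_form_sweedler:
  assumes "\<And>x y. bilinear_form H (\<lambda>a b. T a b x y)"
  shows "bilinear_form H (\<lambda>a b. sweedler H (T a b) c)"
  unfolding sweedler_def using assms by (rule bilinear_form_sum_list)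

lemma sweedler_mult:
  assumes B: "bilinear_form H B"
  shows "sweedler H B (a * b) =
    sweedler H (\<lambda>x y. sweedler H (\<lambda>x' y'. B (x * x') (y * y')) b) a"
proof -
  have "(\<Sum>(x, y)\<leftarrow>[(x * x', y * y'). (x, y) \<leftarrow> s, (x', y') \<leftarrow> t]. B x y)
      = (\<Sum>(x, y)\<leftarrow>s. \<Sum>(x', y')\<leftarrow>t. B (x * x') (y * y'))" for s t
    by (induction s) (auto simp: split_def comp_def)
  then show ?thesis
    using comult_mult B unfolding tensor_eq_def sweedler_def by auto
qed

lemma sweedler_one: "bilinear_form H B \<Longrightarrow> sweedler H B 1 = B 1 1"
  using comult_one unfolding tensor_eq_def sweedler_def by auto

lemma sweedler_star:
  assumes B: "bilinear_form H B"
  shows "sweedler H B (star H a) = sweedler H (\<lambda>x y. B (star H x) (star H y)) a"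
proof -
  have "(\<Sum>(x, y)\<leftarrow>[(star H x, star H y). (x, y) \<leftarrow> s]. B x y)
      = (\<Sum>(x, y)\<leftarrow>s. B (star H x) (star H y))" for s
    by (induction s) auto
  then show ?thesis
    using comult_star B unfolding tensor_eq_def sweedler_def by auto
qed

lemma bilinear_form_star:
  "bilinear_form H B \<Longrightarrow> bilinear_form H (\<lambda>x y. cnj (B (star H x) (star H y)))"
  by (auto simp: bilinear_form_iff star_add star_scl)

lemma star_zero: "star H 0 = 0"
  using star_scl[of 0 0] by simp

lemma star_sum: "star H (\<Sum>x\<in>A. f x) = (\<Sum>x\<in>A. star H (f x))"
  by (induction A rule: infinite_finite_induct) (auto simp: star_zero star_add)

lemma star_one: "star H 1 = 1"
  using star_mult[of "star H 1" 1] by (simp add: star_star)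

lemma scl_mult: "scl H c x * scl H d y = scl H (c * d) (x * y)"
  by (simp add: scl_mult_left scl_mult_right)

lemma scl_if: "scl H (if P then c else 0) a = (if P then scl H c a else 0)"
  by simp

lemma antipode_add: "antipode H (a + b) = antipode H a + antipode H b"
  and antipode_scl: "antipode H (scl H c a) = scl H c (antipode H a)"
  and antipode_sum: "antipode H (\<Sum>x\<in>A. f x) = (\<Sum>x\<in>A. antipode H (f x))"
  using antipode_linear by (auto simp: linear_map_iff linear_map_sum)


section \<open>Matrix corepresentations\<close>

text \<open>Index sets are arbitrary finite sets, so that a tensor product of corepresentations is
  indexed by pairs and needs no renumbering. The comultiplication is tested on bilinear forms because
  elements of the tensor square are given by representatives.\<close>

definition corep :: "'i set \<Rightarrow> ('i \<Rightarrow> 'i \<Rightarrow> 'a) \<Rightarrow> bool" where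
  "corep I v \<longleftrightarrow> finite I \<and> (\<forall>i\<in>I. \<forall>j\<in>I.
     (\<forall>B. bilinear_form H B \<longrightarrow> sweedler H B (v i j) = (\<Sum>k\<in>I. B (v i k) (v k j))) \<and>
     counit H (v i j) = (if i = j then 1 else 0))"

lemma corep_finite: "corep I v \<Longrightarrow> finite I"
  by (simp add: corep_def)

lemma corep_counit: "corep I v \<Longrightarrow> i \<in> I \<Longrightarrow> j \<in> I \<Longrightarrow> counit H (v i j) = (if i = j then 1 else 0)"
  by (simp add: corep_def)

lemma corep_form:
  "corep I v \<Longrightarrow> i \<in> I \<Longrightarrow> j \<in> I \<Longrightarrow> bilinear_form H B \<Longrightarrow>
     sweedler H B (v i j) = (\<Sum>k\<in>I. B (v i k) (v k j))"
  by (simp add: corep_def)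

lemma corep_map:
  assumes "corep I v" "i \<in> I" "j \<in> I" "bilinear_map B"
  shows "sweedler H B (v i j) = (\<Sum>k\<in>I. B (v i k) (v k j))"
  using corep_form[OF assms(1-3) linear_form_bilinear_map[OF _ assms(4)]]
  by (intro linear_forms_separate) (simp add: linear_form_sweedler linear_form_sum)

lemma corep_antipode_left:
  assumes "corep I v" "i \<in> I" "j \<in> I"
  shows "(\<Sum>k\<in>I. antipode H (v i k) * v k j) = (if i = j then 1 else 0)"
proof -
  have "bilinear_map (\<lambda>x y. antipode H x * y)"
    by (simp add: bilinear_map_def antipode_add antipode_scl scl_mult_left scl_mult_right algebra_simps)
  from corep_map[OF assms this] show ?thesis
    using antipode_left[of "v i j"] corep_counit[OF assms] by (simp split: if_splits)
qed

lemma corep_antipode_right: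
  assumes "corep I v" "i \<in> I" "j \<in> I"
  shows "(\<Sum>k\<in>I. v i k * antipode H (v k j)) = (if i = j then 1 else 0)"
proof -
  have "bilinear_map (\<lambda>x y. x * antipode H y)"
    by (simp add: bilinear_map_def antipode_add antipode_scl scl_mult_left scl_mult_right algebra_simps)
  from corep_map[OF assms this] show ?thesis
    using antipode_right[of "v i j"] corep_counit[OF assms] by (simp split: if_splits)
qed

text \<open>The matrix \<open>S(v)\<close> is a two-sided inverse of \<open>v\<close>, hence equals every one-sided inverse.\<close>

lemma corep_antipode_eqI_left:
  assumes v: "corep I v" and ij: "i \<in> I" "j \<in> I"
    and "\<And>i j. i \<in> I \<Longrightarrow> j \<in> I \<Longrightarrow> (\<Sum>k\<in>I. x i k * v k j) = (if i = j then 1 else 0)"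
  shows "antipode H (v i j) = x i j"
  using matrix_inverse_unique[OF corep_finite[OF v] ij assms(4), of "\<lambda>i j. antipode H (v i j)"]
    corep_antipode_right[OF v] by simp

lemma corep_antipode_eqI_right:
  assumes v: "corep I v" and ij: "i \<in> I" "j \<in> I"
    and "\<And>i j. i \<in> I \<Longrightarrow> j \<in> I \<Longrightarrow> (\<Sum>k\<in>I. v i k * x k j) = (if i = j then 1 else 0)"
  shows "antipode H (v i j) = x i j"
  using matrix_inverse_unique[OF corep_finite[OF v] ij _ assms(4), of "\<lambda>i j. antipode H (v i j)"]
    corep_antipode_left[OF v] by simp

definition tensor_corep :: "('i \<Rightarrow> 'i \<Rightarrow> 'a) \<Rightarrow> ('j \<Rightarrow> 'j \<Rightarrow> 'a) \<Rightarrow> 'i \<times> 'j \<Rightarrow> 'i \<times> 'j \<Rightarrow> 'a" where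
  "tensor_corep v w = (\<lambda>p q. v (fst p) (fst q) * w (snd p) (snd q))"

lemma sweedler_mult_corep:
  assumes v: "corep I v" "i \<in> I" "j \<in> I" and w: "corep J w" "k \<in> J" "l \<in> J"
    and B: "bilinear_form H B"
  shows "sweedler H B (v i j * w k l) = (\<Sum>p\<in>I. \<Sum>q\<in>J. B (v i p * w k q) (v p j * w q l))"
proof -
  have *: "bilinear_form H (\<lambda>x y. B (x * x') (y * y'))"
    "bilinear_form H (\<lambda>x' y'. B (x * x') (y * y'))" for x y x' y'
    using B by (auto simp: bilinear_form_iff scl_mult_left scl_mult_right algebra_simps)
  have "sweedler H B (v i j * w k l) =
      (\<Sum>p\<in>I. sweedler H (\<lambda>x' y'. B (v i p * x') (v p j * y')) (w k l))"
    unfolding sweedler_mult[OF B] using corep_form[OF v] * by (intro corep_form[OF v] bilinear_form_sweedler)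
  also have "\<dots> = (\<Sum>p\<in>I. \<Sum>q\<in>J. B (v i p * w k q) (v p j * w q l))"
    by (intro sum.cong refl corep_form[OF w] *)
  finally show ?thesis .
qed

lemma corep_tensor:
  assumes v: "corep I v" and w: "corep J w"
  shows "corep (I \<times> J) (tensor_corep v w)"
  using corep_finite[OF v] corep_finite[OF w]
  by (auto simp: corep_def tensor_corep_def sweedler_mult_corep[OF v _ _ w] counit_mult
      corep_counit[OF v] corep_counit[OF w] sum.cartesian_product case_prod_unfold)

lemma corep_reindex:
  assumes v: "corep I v" and f: "bij_betw f J I"
  shows "corep J (\<lambda>i j. v (f i) (f j))"
proof -
  have fin: "finite J" using corep_finite[OF v] f by (simp add: bij_betw_finite)
  have inj: "f i = f j \<longleftrightarrow> i = j" if "i \<in> J" "j \<in> J" for i j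
    using f that by (auto simp: bij_betw_def inj_on_def)
  have mem: "f i \<in> I" if "i \<in> J" for i using f that by (auto simp: bij_betw_def)
  show ?thesis
    using fin by (auto simp: corep_def corep_form[OF v mem mem] corep_counit[OF v mem mem] inj
        sum.reindex_bij_betw[OF f, symmetric])
qed

text \<open>Unitarity is the condition \<open>S(v) = v\<^sup>*\<close>, as \<open>S(v)\<close> is the inverse of \<open>v\<close>.\<close>

definition ucorep :: "'i set \<Rightarrow> ('i \<Rightarrow> 'i \<Rightarrow> 'a) \<Rightarrow> bool" where
  "ucorep I v \<longleftrightarrow> corep I v \<and> (\<forall>i\<in>I. \<forall>j\<in>I. antipode H (v i j) = star H (v j i))"

lemma ucorep_corep: "ucorep I v \<Longrightarrow> corep I v"
  and ucorep_antipode: "ucorep I v \<Longrightarrow> i \<in> I \<Longrightarrow> j \<in> I \<Longrightarrow> antipode H (v i j) = star H (v j i)"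
  by (auto simp: ucorep_def)

lemma ucorep_reindex: "ucorep I v \<Longrightarrow> bij_betw f J I \<Longrightarrow> ucorep J (\<lambda>i j. v (f i) (f j))"
  by (auto simp: ucorep_def corep_reindex bij_betwE)

lemma ucorepI:
  assumes v: "corep I v"
    and "\<And>i j. i \<in> I \<Longrightarrow> j \<in> I \<Longrightarrow> (\<Sum>k\<in>I. star H (v k i) * v k j) = (if i = j then 1 else 0)"
  shows "ucorep I v"
  unfolding ucorep_def
  using v corep_antipode_eqI_left[OF v, where x = "\<lambda>i j. star H (v j i)"] assms(2) by auto

lemma ucorep_tensor:
  assumes v: "ucorep I v" and w: "ucorep J w"
  shows "ucorep (I \<times> J) (tensor_corep v w)"
proof (rule ucorepI)
  show "corep (I \<times> J) (tensor_corep v w)"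
    using assms by (intro corep_tensor ucorep_corep)
  fix i j assume i: "i \<in> I \<times> J" and j: "j \<in> I \<times> J"
  have sv: "(\<Sum>k\<in>I. star H (v k i) * v k j) = (if i = j then 1 else 0)" if "i \<in> I" "j \<in> I" for i j
    using corep_antipode_left[OF ucorep_corep[OF v] that] ucorep_antipode[OF v that(1)]
    by (simp cong: sum.cong)
  have sw: "(\<Sum>k\<in>J. star H (w k i) * w k j) = (if i = j then 1 else 0)" if "i \<in> J" "j \<in> J" for i j
    using corep_antipode_left[OF ucorep_corep[OF w] that] ucorep_antipode[OF w that(1)]
    by (simp cong: sum.cong)
  have "(\<Sum>k\<in>I \<times> J. star H (tensor_corep v w k i) * tensor_corep v w k j)
      = (\<Sum>q\<in>J. star H (w q (snd i)) * (\<Sum>p\<in>I. star H (v p (fst i)) * v p (fst j)) * w q (snd j))"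
    by (simp add: tensor_corep_def star_mult sum.cartesian_product' sum_distrib_left sum_distrib_right
        mult.assoc) (rule sum.swap)
  also have "\<dots> = (if i = j then 1 else 0)"
    using i j sv sw by (auto simp: prod_eq_iff)
  finally show "(\<Sum>k\<in>I \<times> J. star H (tensor_corep v w k i) * tensor_corep v w k j) =
      (if i = j then 1 else 0)" .
qed

text \<open>The comultiplication and the counit are compatible with the involution. For unitary \<open>v\<close> this says that
  the antipode reverses the comultiplication on the coefficients of \<open>v\<close>.\<close>

lemma corep_conj:
  assumes v: "corep I v"
  shows "corep I (\<lambda>i j. star H (v i j))"
proof -
  have cnj_sum: "cnj (\<Sum>(x, y)\<leftarrow>s. F x y) = (\<Sum>(x, y)\<leftarrow>s. cnj (F x y))"
    for F :: "'a \<Rightarrow> 'a \<Rightarrow> complex" and s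
    by (induction s) auto
  have form: "sweedler H B (star H (v i j)) = (\<Sum>k\<in>I. B (star H (v i k)) (star H (v k j)))"
    if "i \<in> I" "j \<in> I" and B: "bilinear_form H B" for i j B
  proof -
    have "cnj (sweedler H B (star H (v i j)))
        = sweedler H (\<lambda>x y. cnj (B (star H x) (star H y))) (v i j)"
      unfolding sweedler_star[OF B] by (simp add: sweedler_def cnj_sum)
    also have "\<dots> = (\<Sum>k\<in>I. cnj (B (star H (v i k)) (star H (v k j))))"
      by (rule corep_form[OF v that(1,2) bilinear_form_star[OF B]])
    finally have "cnj (sweedler H B (star H (v i j)))
        = cnj (\<Sum>k\<in>I. B (star H (v i k)) (star H (v k j)))" by simp
    then show ?thesis by (simp only: complex_cnj_cancel_iff)
  qed
  \<comment> \<open>The counit is a *-homomorphism, because it is determined by the comultiplication.\<close>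
  have counit: "counit H (star H a) = cnj (counit H a)" for a
  proof -
    have B: "bilinear_form H (\<lambda>x y. counit H x * cnj (counit H (star H y)))"
      using counit_linear by (auto simp: bilinear_form_iff linear_form_iff star_add star_scl algebra_simps)
    have l: "linear_form H (\<lambda>y. cnj (counit H (star H y)))"
      using counit_linear by (auto simp: linear_form_iff star_add star_scl)
    have "cnj (counit H a) = sweedler H (\<lambda>x y. counit H x * cnj (counit H (star H y))) (star H a)"
      using arg_cong[OF counit_left[of "star H a"], of "\<lambda>y. cnj (counit H (star H y))"]
      by (simp add: linear_form_sweedler[OF l] linear_form_scl[OF l] star_star)
    also have "\<dots> = sweedler H (\<lambda>x y. counit H (star H x) * cnj (counit H y)) a"
      by (simp add: sweedler_star[OF B] star_star)
    also have "\<dots> = cnj (sweedler H (\<lambda>x y. counit H y * cnj (counit H (star H x))) a)"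
      by (simp add: sweedler_def cnj_sum mult.commute)
    also have "\<dots> = counit H (star H a)"
      using arg_cong[OF counit_right[of a], of "\<lambda>y. cnj (counit H (star H y))"]
      by (simp add: linear_form_sweedler[OF l] linear_form_scl[OF l])
    finally show ?thesis ..
  qed
  show ?thesis
    unfolding corep_def using corep_finite[OF v] form counit corep_counit[OF v] by auto
qed

end

section \<open>Orthonormal bases and positive definite matrices\<close>

lemma adjoint_carrier [simp, intro]:
  "A \<in> carrier_mat n m \<Longrightarrow> mat_adjoint A \<in> carrier_mat m n"
  by (auto simp: mat_adjoint_def)

lemma adjoint_index [simp]:
  "i < dim_col A \<Longrightarrow> j < dim_row A \<Longrightarrow> mat_adjoint A $$ (i, j) = conjugate (A $$ (j, i))"
  by (simp add: mat_adjoint_def mat_of_rows_index cols_nth)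

lemma adjoint_dim [simp]: "dim_row (mat_adjoint A) = dim_col A" "dim_col (mat_adjoint A) = dim_row A"
  by (auto simp: mat_adjoint_def)

lemma adjoint_mult:
  assumes "(A :: complex mat) \<in> carrier_mat n m" "B \<in> carrier_mat m l"
  shows "mat_adjoint (A * B) = mat_adjoint B * mat_adjoint A"
  using assms by (intro eq_matI) (auto simp: scalar_prod_def mult.commute)

lemma cscalar_sum: "x \<in> carrier_vec n \<Longrightarrow> y \<in> carrier_vec n \<Longrightarrow> (x :: complex vec) \<bullet>c y = (\<Sum>i<n. x $ i * cnj (y $ i))"
  by (auto simp: scalar_prod_def atLeast0LessThan)

lemma cscalar_mult_mat_vec:
  assumes A: "(A :: complex mat) \<in> carrier_mat n m" and x: "x \<in> carrier_vec m" and y: "y \<in> carrier_vec n"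
  shows "(A *\<^sub>v x) \<bullet>c y = x \<bullet>c (mat_adjoint A *\<^sub>v y)"
proof -
  have "(A *\<^sub>v x) \<bullet>c y = (\<Sum>i<n. (\<Sum>j<m. A $$ (i, j) * x $ j) * cnj (y $ i))"
    using A x y by (auto simp: cscalar_sum[of _ n] scalar_prod_def atLeast0LessThan intro!: sum.cong)
  also have "\<dots> = (\<Sum>j<m. x $ j * cnj (\<Sum>i<n. cnj (A $$ (i, j)) * y $ i))"
    by (simp add: sum_distrib_left sum_distrib_right algebra_simps) (rule sum.swap)
  also have "\<dots> = x \<bullet>c (mat_adjoint A *\<^sub>v y)"
    using A x y mult_mat_vec_carrier[OF adjoint_carrier[OF A] y]
    by (subst cscalar_sum[of _ m]) (auto simp: scalar_prod_def atLeast0LessThan intro!: sum.cong)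
  finally show ?thesis .
qed

lemma cscalar_swap:
  "x \<in> carrier_vec n \<Longrightarrow> y \<in> carrier_vec n \<Longrightarrow> (x :: complex vec) \<bullet>c y = cnj (y \<bullet>c x)"
  by (simp add: cscalar_sum[of _ n] mult.commute)

lemma cscalar_minus:
  "x \<in> carrier_vec n \<Longrightarrow> y \<in> carrier_vec n \<Longrightarrow> z \<in> carrier_vec n \<Longrightarrow>
    (x - y :: complex vec) \<bullet>c z = x \<bullet>c z - y \<bullet>c z"
  by (simp add: cscalar_sum[of _ n] algebra_simps sum_subtractf)

lemma cscalar_add:
  "x \<in> carrier_vec n \<Longrightarrow> y \<in> carrier_vec n \<Longrightarrow> z \<in> carrier_vec n \<Longrightarrow>
    (x + y :: complex vec) \<bullet>c z = x \<bullet>c z + y \<bullet>c z"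
  by (simp add: cscalar_sum[of _ n] algebra_simps sum.distrib)

lemma cscalar_smult:
  "x \<in> carrier_vec n \<Longrightarrow> z \<in> carrier_vec n \<Longrightarrow> (c \<cdot>\<^sub>v x :: complex vec) \<bullet>c z = c * (x \<bullet>c z)"
  by (simp add: cscalar_sum[of _ n] algebra_simps sum_distrib_left)

lemma cscalar_self:
  assumes "(x :: complex vec) \<in> carrier_vec n"
  shows "x \<bullet>c x = complex_of_real (\<Sum>i<n. (cmod (x $ i))\<^sup>2)"
  using assms by (simp add: cscalar_sum[of _ n] complex_norm_square[symmetric])

lemma cscalar_self_pos:
  assumes "(x :: complex vec) \<in> carrier_vec n" "x \<noteq> 0\<^sub>v n"
  shows "0 < Re (x \<bullet>c x)"
proof -
  from assms obtain i where "i < n" "x $ i \<noteq> 0"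
    by (metis carrier_vecD eq_vecI index_zero_vec(1) index_zero_vec(2))
  then have "0 < (\<Sum>i<n. (cmod (x $ i))\<^sup>2)"
    by (intro sum_pos2[of _ i]) auto
  then show ?thesis using cscalar_self[OF assms(1)] by simp
qed

lemma mult_mat_zero_vec: "A \<in> carrier_mat n m \<Longrightarrow> A *\<^sub>v 0\<^sub>v m = 0\<^sub>v n"
  by (intro eq_vecI) (auto simp: scalar_prod_def)

definition orthonormal :: "nat \<Rightarrow> nat \<Rightarrow> (nat \<Rightarrow> complex vec) \<Rightarrow> bool" where
  "orthonormal n k e \<longleftrightarrow>
     (\<forall>i<k. e i \<in> carrier_vec n) \<and> (\<forall>i<k. \<forall>j<k. e i \<bullet>c e j = (if i = j then 1 else 0))"

definition unitary :: "nat \<Rightarrow> complex mat \<Rightarrow> bool" where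
  "unitary n Q \<longleftrightarrow> Q \<in> carrier_mat n n \<and> Q * mat_adjoint Q = 1\<^sub>m n \<and> mat_adjoint Q * Q = 1\<^sub>m n"

lemma adjoint_mult_vec_index:
  assumes "(Q :: complex mat) \<in> carrier_mat n n" "x \<in> carrier_vec n" "i < n"
  shows "(mat_adjoint Q *\<^sub>v x) $ i = x \<bullet>c col Q i"
  using assms by (simp add: cscalar_sum[of _ n] scalar_prod_def atLeast0LessThan mult.commute)

lemma orthonormal_unitary:
  assumes "orthonormal n n e"
  shows "unitary n (mat n n (\<lambda>(i, j). e j $ i))"
proof -
  let ?Q = "mat n n (\<lambda>(i, j). e j $ i)"
  have Q: "?Q \<in> carrier_mat n n" by simp
  have "mat_adjoint ?Q * ?Q = 1\<^sub>m n"
  proof (rule eq_matI)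
    fix i j assume ij: "i < dim_row (1\<^sub>m n :: complex mat)" "j < dim_col (1\<^sub>m n :: complex mat)"
    moreover have "e i \<in> carrier_vec n" "e j \<in> carrier_vec n"
      using assms ij by (auto simp: orthonormal_def)
    ultimately have "(mat_adjoint ?Q * ?Q) $$ (i, j) = e j \<bullet>c e i"
      by (simp add: cscalar_sum[of _ n] scalar_prod_def atLeast0LessThan mult.commute)
    then show "(mat_adjoint ?Q * ?Q) $$ (i, j) = 1\<^sub>m n $$ (i, j)"
      using assms ij by (auto simp: orthonormal_def)
  qed auto
  with mat_mult_left_right_inverse[OF adjoint_carrier[OF Q] Q] show ?thesis
    by (simp add: unitary_def)
qed

lemma unitary_col:
  assumes Q: "unitary n Q" and ij: "i < n" "j < n"
  shows "col Q i \<bullet>c col Q j = (if i = j then 1 else 0)"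
proof -
  have c: "Q \<in> carrier_mat n n" using Q by (simp add: unitary_def)
  have "col Q i \<bullet>c col Q j = (mat_adjoint Q * Q) $$ (j, i)"
    using adjoint_mult_vec_index[OF c, of "col Q i" j] c ij by auto
  then show ?thesis using Q ij by (simp add: unitary_def)
qed

lemma unitary_orthogonal_zero:
  assumes Q: "unitary n Q" and x: "x \<in> carrier_vec n" and "\<And>i. i < n \<Longrightarrow> x \<bullet>c col Q i = 0"
  shows "x = 0\<^sub>v n"
proof -
  have c: "Q \<in> carrier_mat n n" using Q by (simp add: unitary_def)
  have "mat_adjoint Q *\<^sub>v x = 0\<^sub>v n"
    using c assms(3) adjoint_mult_vec_index[OF c x] by (intro eq_vecI) auto
  moreover have "Q *\<^sub>v (mat_adjoint Q *\<^sub>v x) = x"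
    using Q c x by (simp add: unitary_def assoc_mult_mat_vec[symmetric, of _ n n _ n])
  ultimately show ?thesis using c by auto
qed

lemma orthonormal_bound:
  assumes e: "orthonormal n k e"
  shows "k \<le> n"
proof (rule ccontr)
  assume "\<not> k \<le> n"
  then have "orthonormal n n e" using e by (auto simp: orthonormal_def)
  note Q = orthonormal_unitary[OF this]
  have en: "e n \<in> carrier_vec n" using e \<open>\<not> k \<le> n\<close> by (auto simp: orthonormal_def)
  have "e n \<bullet>c col (mat n n (\<lambda>(i, j). e j $ i)) i = 0" if "i < n" for i
  proof -
    have "e i \<in> carrier_vec n" using e \<open>\<not> k \<le> n\<close> that by (auto simp: orthonormal_def)
    then have "col (mat n n (\<lambda>(i, j). e j $ i)) i = e i" using that by (intro eq_vecI) auto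
    then show ?thesis using e \<open>\<not> k \<le> n\<close> that by (auto simp: orthonormal_def)
  qed
  from unitary_orthogonal_zero[OF Q en this] have "e n = 0\<^sub>v n" by simp
  moreover have "e n \<bullet>c e n = 1" using e \<open>\<not> k \<le> n\<close> by (auto simp: orthonormal_def)
  ultimately show False by simp
qed

lemma orthonormal_add:
  assumes e: "orthonormal n k e" and x: "x \<in> carrier_vec n" "x \<noteq> 0\<^sub>v n"
    and o: "\<And>i. i < k \<Longrightarrow> x \<bullet>c e i = 0"
  obtains c where "orthonormal n (Suc k) (e(k := c \<cdot>\<^sub>v x))"
proof -
  define c where "c = complex_of_real (1 / sqrt (Re (x \<bullet>c x)))"
  have p: "0 < Re (x \<bullet>c x)" by (rule cscalar_self_pos[OF x])
  have xx: "x \<bullet>c x = complex_of_real (Re (x \<bullet>c x))" using cscalar_self[OF x(1)] by simp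
  have "(c \<cdot>\<^sub>v x) \<bullet>c (c \<cdot>\<^sub>v x) = c * (cnj c * (x \<bullet>c x))"
    using x by (simp add: cscalar_smult[of _ n] cscalar_swap[of x n "c \<cdot>\<^sub>v x"] cscalar_swap[of x n x, symmetric])
  also have "\<dots> = 1"
    using p by (subst xx) (simp add: c_def flip: of_real_mult)
  finally have cc: "(c \<cdot>\<^sub>v x) \<bullet>c (c \<cdot>\<^sub>v x) = 1" .
  have ec: "e i \<in> carrier_vec n" if "i < k" for i using e that by (simp add: orthonormal_def)
  have o1: "(c \<cdot>\<^sub>v x) \<bullet>c e i = 0" if "i < k" for i
    using x o[OF that] ec[OF that] by (simp add: cscalar_smult[of _ n])
  have o2: "e i \<bullet>c (c \<cdot>\<^sub>v x) = 0" if "i < k" for i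
    using x ec[OF that] o1[OF that] by (subst cscalar_swap[of _ n]) auto
  show thesis
    by (rule that[of c]) (use e x cc o1 o2 in \<open>auto simp: orthonormal_def less_Suc_eq\<close>)
qed

text \<open>The matrix whose rows are the conjugates of the \<open>e\<^sub>i\<close>, completed by zero rows, is singular, and the
  vectors in its kernel are those orthogonal to all \<open>e\<^sub>i\<close>.\<close>

lemma exists_orthogonal:
  assumes e: "orthonormal n k e" and k: "k < n"
  obtains x where "x \<in> carrier_vec n" "x \<noteq> 0\<^sub>v n" "\<And>i. i < k \<Longrightarrow> x \<bullet>c e i = 0"
proof -
  define A where "A = mat\<^sub>r n n (\<lambda>i. if i = k then 0\<^sub>v n else if i < k then conjugate (e i) else 0\<^sub>v n)"
  have A: "A \<in> carrier_mat n n" by (simp add: A_def)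
  have "det A = 0"
    unfolding A_def using k e by (intro det_row_0) (auto simp: orthonormal_def)
  then obtain x where x: "x \<in> carrier_vec n" "x \<noteq> 0\<^sub>v n" "A *\<^sub>v x = 0\<^sub>v n"
    using det_0_iff_vec_prod_zero[OF A] by auto
  have "x \<bullet>c e i = 0" if i: "i < k" for i
  proof -
    have "e i \<in> carrier_vec n" using e i by (simp add: orthonormal_def)
    then have "row A i = conjugate (e i)"
      using i k unfolding A_def by (subst row_mat_of_row_fun) auto
    then have "x \<bullet>c e i = (A *\<^sub>v x) $ i"
      using i k x(1) A \<open>e i \<in> carrier_vec n\<close> by (simp add: comm_scalar_prod[of _ n])
    then show ?thesis using x i k by simp
  qed
  with x that show thesis by blast
qed

lemma orthonormal_extend:
  assumes e: "orthonormal n k e"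
  obtains Q where "unitary n Q" "\<And>i. i < k \<Longrightarrow> col Q i = e i"
proof -
  have "\<exists>e'. orthonormal n n e' \<and> (\<forall>i<k. e' i = e i)"
    using orthonormal_bound[OF e] e
  proof (induction k arbitrary: e rule: inc_induct)
    case base
    then show ?case by blast
  next
    case (step m)
    obtain x where x: "x \<in> carrier_vec n" "x \<noteq> 0\<^sub>v n" "\<And>i. i < m \<Longrightarrow> x \<bullet>c e i = 0"
      using exists_orthogonal[OF step.prems step.hyps(2)] by blast
    from orthonormal_add[OF step.prems this] obtain c where
      "orthonormal n (Suc m) (e(m := c \<cdot>\<^sub>v x))" by blast
    from step.IH[OF this] obtain e' where
      "orthonormal n n e'" "\<forall>i<Suc m. e' i = (e(m := c \<cdot>\<^sub>v x)) i" by blast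
    then show ?case by (intro exI[of _ e']) auto
  qed
  then obtain e' where e': "orthonormal n n e'" "\<forall>i<k. e' i = e i" by blast
  show thesis
  proof (rule that[OF orthonormal_unitary[OF e'(1)]])
    fix i assume "i < k"
    with orthonormal_bound[OF e] have "i < n" by simp
    with e' \<open>i < k\<close> have "e' i \<in> carrier_vec n" "e' i = e i"
      unfolding orthonormal_def by blast+
    then show "col (mat n n (\<lambda>(i, j). e' j $ i)) i = e i"
      using \<open>i < n\<close> by (intro eq_vecI) auto
  qed
qed

text \<open>Orthonormal families have at most \<open>n\<close> members. So among the families with members in the cone \<open>P\<close> there
  is a longest one, and a nonzero vector of \<open>P\<close> orthogonal to it would prolong it.\<close>

lemma maximal_orthonormal:
  assumes "\<And>x c. P x \<Longrightarrow> P (c \<cdot>\<^sub>v x)"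
  obtains k e where "orthonormal n k e" "\<And>i. i < k \<Longrightarrow> P (e i)"
    "\<And>x. x \<in> carrier_vec n \<Longrightarrow> P x \<Longrightarrow> (\<And>i. i < k \<Longrightarrow> x \<bullet>c e i = 0) \<Longrightarrow> x = 0\<^sub>v n"
proof -
  let ?S = "\<lambda>k. \<exists>e. orthonormal n k e \<and> (\<forall>i<k. P (e i))"
  define k where "k = Greatest ?S"
  have S0: "?S 0" by (auto simp: orthonormal_def)
  have bd: "\<And>k. ?S k \<Longrightarrow> k \<le> n" using orthonormal_bound by blast
  have "?S k" unfolding k_def by (rule GreatestI_nat[of ?S, OF S0 bd])
  then obtain e where e: "orthonormal n k e" "\<forall>i<k. P (e i)" by blast
  have "x = 0\<^sub>v n" if x: "x \<in> carrier_vec n" "P x" "\<And>i. i < k \<Longrightarrow> x \<bullet>c e i = 0" for x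
  proof (rule ccontr)
    assume "x \<noteq> 0\<^sub>v n"
    from orthonormal_add[OF e(1) x(1) this x(3)] obtain c where
      "orthonormal n (Suc k) (e(k := c \<cdot>\<^sub>v x))" by blast
    moreover have "\<forall>i<Suc k. P ((e(k := c \<cdot>\<^sub>v x)) i)"
      using e x assms by (auto simp: less_Suc_eq)
    ultimately have "?S (Suc k)" by blast
    from Greatest_le_nat[of ?S, OF this bd] show False unfolding k_def by simp
  qed
  with e that show thesis by blast
qed

text \<open>The vector \<open>s\<close> is the orthogonal projection of \<open>x\<close> to the span of the \<open>e\<^sub>i\<close>. Built up one coefficient at
  a time, it stays in \<open>W\<close> and orthogonal to everything that is orthogonal to the \<open>e\<^sub>i\<close>.\<close>

lemma gram_schmidt_projection:
  assumes W: "vec_subspace n W" and e: "orthonormal n k e" "\<And>i. i < k \<Longrightarrow> e i \<in> W"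
    and x: "x \<in> carrier_vec n"
  obtains s where "s \<in> W" "\<And>i. i < k \<Longrightarrow> (x - s) \<bullet>c e i = 0"
    "\<And>y. y \<in> carrier_vec n \<Longrightarrow> (\<And>i. i < k \<Longrightarrow> e i \<bullet>c y = 0) \<Longrightarrow> s \<bullet>c y = 0"
proof -
  have Wc: "w \<in> carrier_vec n" if "w \<in> W" for w using W that by (auto simp: vec_subspace_def)
  have "\<exists>s\<in>W. (\<forall>i<k. s \<bullet>c e i = (if i < m then x \<bullet>c e i else 0)) \<and>
      (\<forall>y\<in>carrier_vec n. (\<forall>i<k. e i \<bullet>c y = 0) \<longrightarrow> s \<bullet>c y = 0)" if "m \<le> k" for m
    using that
  proof (induction m)
    case 0
    have "0\<^sub>v n \<in> W" using W by (simp add: vec_subspace_def)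
    moreover have "0\<^sub>v n \<bullet>c y = 0" if "y \<in> carrier_vec n" for y :: "complex vec"
      using that by (simp add: cscalar_sum[of _ n])
    ultimately show ?case using e by (intro bexI[of _ "0\<^sub>v n"]) (auto simp: orthonormal_def)
  next
    case (Suc m)
    then obtain s where s: "s \<in> W" "\<forall>i<k. s \<bullet>c e i = (if i < m then x \<bullet>c e i else 0)"
      "\<forall>y\<in>carrier_vec n. (\<forall>i<k. e i \<bullet>c y = 0) \<longrightarrow> s \<bullet>c y = 0" by auto
    let ?s = "s + (x \<bullet>c e m) \<cdot>\<^sub>v e m"
    have m: "m < k" "e m \<in> carrier_vec n" using Suc e by (auto simp: orthonormal_def)
    have dot: "?s \<bullet>c y = s \<bullet>c y + (x \<bullet>c e m) * (e m \<bullet>c y)" if "y \<in> carrier_vec n" for y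
      using that Wc[OF s(1)] m by (simp add: cscalar_add[of _ n] cscalar_smult[of _ n])
    have "?s \<in> W" using W s e m by (auto simp: vec_subspace_def)
    moreover have "?s \<bullet>c e i = (if i < Suc m then x \<bullet>c e i else 0)" if "i < k" for i
    proof -
      have "e i \<in> carrier_vec n" "e m \<bullet>c e i = (if m = i then 1 else 0)"
        using e m that by (auto simp: orthonormal_def)
      then show ?thesis using dot s that by (auto simp: less_Suc_eq)
    qed
    ultimately show ?case using dot s m by (intro bexI[of _ ?s]) auto
  qed
  from this[OF le_refl] obtain s where s: "s \<in> W" "\<forall>i<k. s \<bullet>c e i = x \<bullet>c e i"
    "\<forall>y\<in>carrier_vec n. (\<forall>i<k. e i \<bullet>c y = 0) \<longrightarrow> s \<bullet>c y = 0" by auto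
  show thesis
  proof (rule that[OF s(1)])
    fix i assume "i < k"
    then show "(x - s) \<bullet>c e i = 0"
      using s x e Wc[OF s(1)] by (simp add: cscalar_minus[of _ n] orthonormal_def)
  qed (use s in auto)
qed

text \<open>A longest orthonormal family in \<open>W\<close> spans \<open>W\<close>; the first columns of \<open>Q\<close> are this family, the others
  complete it to an orthonormal basis.\<close>

lemma adapted_unitary:
  assumes W: "vec_subspace n W" and ne: "W \<noteq> {0\<^sub>v n}" "W \<noteq> carrier_vec n"
  obtains Q k where "unitary n Q" "0 < k" "k < n" "\<And>j. j < k \<Longrightarrow> col Q j \<in> W"
    "\<And>x j. x \<in> W \<Longrightarrow> k \<le> j \<Longrightarrow> j < n \<Longrightarrow> x \<bullet>c col Q j = 0"
proof -
  have Wc: "w \<in> carrier_vec n" if "w \<in> W" for w using W that by (auto simp: vec_subspace_def)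
  obtain k e where e: "orthonormal n k e" "\<And>i. i < k \<Longrightarrow> e i \<in> W"
    and max: "\<And>x. x \<in> carrier_vec n \<Longrightarrow> x \<in> W \<Longrightarrow> (\<And>i. i < k \<Longrightarrow> x \<bullet>c e i = 0) \<Longrightarrow> x = 0\<^sub>v n"
    using maximal_orthonormal[of "\<lambda>x. x \<in> W" n] W by (auto simp: vec_subspace_def)
  obtain Q where Q: "unitary n Q" "\<And>i. i < k \<Longrightarrow> col Q i = e i"
    using orthonormal_extend[OF e(1)] by blast
  have kn: "k \<le> n" by (rule orthonormal_bound[OF e(1)])
  have colc: "col Q j \<in> carrier_vec n" for j using Q by (auto simp: unitary_def)
  have orth: "x \<bullet>c col Q j = 0" if x: "x \<in> W" and j: "k \<le> j" "j < n" for x j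
  proof -
    obtain s where s: "s \<in> W" "\<And>i. i < k \<Longrightarrow> (x - s) \<bullet>c e i = 0"
      "\<And>y. y \<in> carrier_vec n \<Longrightarrow> (\<And>i. i < k \<Longrightarrow> e i \<bullet>c y = 0) \<Longrightarrow> s \<bullet>c y = 0"
      using gram_schmidt_projection[OF W e Wc[OF x]] by blast
    have "x - s = x + (-1) \<cdot>\<^sub>v s" using Wc[OF x] Wc[OF s(1)] by auto
    then have "x - s \<in> W" using W x s by (auto simp: vec_subspace_def)
    from max[OF Wc[OF this] this s(2)] have "x - s = 0\<^sub>v n" by blast
    moreover have "s \<bullet>c col Q j = 0"
    proof (rule s(3)[OF colc])
      fix i assume "i < k"
      then show "e i \<bullet>c col Q j = 0"
        using unitary_col[OF Q(1), of i j] Q(2)[of i] j by auto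
    qed
    moreover have "(x - s) \<bullet>c col Q j = x \<bullet>c col Q j - s \<bullet>c col Q j"
      using Wc[OF x] Wc[OF s(1)] colc by (simp add: cscalar_minus[of _ n])
    moreover have "0\<^sub>v n \<bullet>c col Q j = 0" using colc by (simp add: cscalar_sum[of _ n])
    ultimately show ?thesis by simp
  qed
  have "0 < k"
  proof (rule ccontr)
    assume "\<not> 0 < k"
    then have "W \<subseteq> {0\<^sub>v n}" using max Wc by auto
    then show False using ne W by (auto simp: vec_subspace_def)
  qed
  moreover have "k < n"
  proof (rule ccontr)
    assume "\<not> k < n"
    then have k: "k = n" using kn by simp
    have "x \<in> W" if x: "x \<in> carrier_vec n" for x
    proof -
      obtain s where s: "s \<in> W" "\<And>i. i < k \<Longrightarrow> (x - s) \<bullet>c e i = 0"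
        using gram_schmidt_projection[OF W e x] by blast
      have "x - s = 0\<^sub>v n"
      proof (rule unitary_orthogonal_zero[OF Q(1)])
        show "x - s \<in> carrier_vec n" using x Wc[OF s(1)] by simp
        show "(x - s) \<bullet>c col Q i = 0" if "i < n" for i
          using s(2)[of i] Q(2)[of i] that k by simp
      qed
      then have "(x - s) $ i = 0" if "i < n" for i using that by simp
      then have "x $ i = s $ i" if "i < n" for i using that x Wc[OF s(1)] by force
      then have "x = s" using x Wc[OF s(1)] by (intro eq_vecI) auto
      then show "x \<in> W" using s by simp
    qed
    then show False using ne Wc by auto
  qed
  moreover have "col Q j \<in> W" if "j < k" for j using that Q e by simp
  ultimately show thesis using that[of Q k] Q orth by blast
qed

definition diag :: "nat \<Rightarrow> (nat \<Rightarrow> complex) \<Rightarrow> complex mat" where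
  "diag n d = mat n n (\<lambda>(i, j). if i = j then d i else 0)"

lemma diag_carrier [simp]: "diag n d \<in> carrier_mat n n"
  by (simp add: diag_def)

lemma diag_mult_left:
  "A \<in> carrier_mat n m \<Longrightarrow> i < n \<Longrightarrow> j < m \<Longrightarrow> (diag n d * A) $$ (i, j) = d i * A $$ (i, j)"
  by (simp add: diag_def scalar_prod_def if_distrib[of "\<lambda>x. x * _"] cong: if_cong)

lemma diag_mult_right:
  "A \<in> carrier_mat m n \<Longrightarrow> i < m \<Longrightarrow> j < n \<Longrightarrow> (A * diag n d) $$ (i, j) = A $$ (i, j) * d j"
  by (simp add: diag_def scalar_prod_def if_distrib[of "\<lambda>x. _ * x"] cong: if_cong)

lemma diag_mult: "diag n c * diag n d = diag n (\<lambda>i. c i * d i)"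
proof (rule eq_matI)
  fix i j assume "i < dim_row (diag n (\<lambda>i. c i * d i))" "j < dim_col (diag n (\<lambda>i. c i * d i))"
  then have "i < n" "j < n" by (simp_all add: diag_def)
  then show "(diag n c * diag n d) $$ (i, j) = diag n (\<lambda>i. c i * d i) $$ (i, j)"
    using diag_mult_left[OF diag_carrier, of i n j c d] by (simp add: diag_def)
qed (simp_all add: diag_def)

text \<open>A longest orthonormal family of eigenvectors is a basis. In an orthonormal basis that begins with the
  family, a Hermitian matrix is block diagonal; so if the second block were nonempty, an eigenvector of that block
  would be an eigenvector of \<open>F\<close> orthogonal to the family.\<close>

theorem hermitian_diagonalization:
  assumes F: "F \<in> carrier_mat n n" and herm: "mat_adjoint F = F"
  obtains Q d where "unitary n Q" "F = Q * diag n d * mat_adjoint Q"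
proof -
  let ?E = "\<lambda>x. x \<in> carrier_vec n \<and> (\<exists>c. F *\<^sub>v x = c \<cdot>\<^sub>v x)"
  have "?E (a \<cdot>\<^sub>v x)" if "?E x" for a x
    using that F by (auto simp: mult_mat_vec smult_smult_assoc mult.commute)
  from maximal_orthonormal[of ?E n, OF this] obtain k e where e: "orthonormal n k e"
    "\<And>i. i < k \<Longrightarrow> ?E (e i)" and
    max: "\<And>x. x \<in> carrier_vec n \<Longrightarrow> ?E x \<Longrightarrow> (\<And>i. i < k \<Longrightarrow> x \<bullet>c e i = 0) \<Longrightarrow> x = 0\<^sub>v n"
    by blast
  from e(2) obtain d where d: "\<And>i. i < k \<Longrightarrow> F *\<^sub>v e i = d i \<cdot>\<^sub>v e i" by metis
  obtain Q where Q: "unitary n Q" "\<And>i. i < k \<Longrightarrow> col Q i = e i"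
    using orthonormal_extend[OF e(1)] by blast
  have kn: "k \<le> n" by (rule orthonormal_bound[OF e(1)])
  have Qc: "Q \<in> carrier_mat n n" and QQ: "Q * mat_adjoint Q = 1\<^sub>m n" "mat_adjoint Q * Q = 1\<^sub>m n"
    using Q by (auto simp: unitary_def)
  have aQ: "mat_adjoint Q \<in> carrier_mat n n" using Qc by simp
  define G where "G = mat_adjoint Q * F * Q"
  have Gc: "G \<in> carrier_mat n n" unfolding G_def by (rule mult_carrier_mat[OF mult_carrier_mat[OF aQ F] Qc])
  have FQ: "F * Q = Q * G"
  proof -
    have "Q * G = (Q * mat_adjoint Q) * (F * Q)"
      unfolding G_def using F Qc aQ by (simp add: assoc_mult_mat[of _ n n _ n _ n])
    then show ?thesis using QQ F Qc by simp
  qed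
  have colc: "col Q j \<in> carrier_vec n" for j using Qc by auto
  have Gij: "G $$ (i, j) = (F *\<^sub>v col Q j) \<bullet>c col Q i" if "i < n" "j < n" for i j
  proof -
    have "G = mat_adjoint Q * (F * Q)"
      unfolding G_def using F Qc aQ by (simp add: assoc_mult_mat[of _ n n _ n _ n])
    moreover have "col (F * Q) j = F *\<^sub>v col Q j" using F Qc that by auto
    ultimately have "G $$ (i, j) = (mat_adjoint Q *\<^sub>v (F *\<^sub>v col Q j)) $ i"
      using F Qc that by simp
    also have "\<dots> = (F *\<^sub>v col Q j) \<bullet>c col Q i"
      using adjoint_mult_vec_index[OF Qc _ that(1), of "F *\<^sub>v col Q j"] F colc by auto
    finally show ?thesis .
  qed
  have Gk: "G $$ (i, j) = (if i = j then d j else 0)" if "i < n" "j < k" for i j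
    using that kn Q d unitary_col[OF Q(1), of j i] colc
    by (simp add: Gij cscalar_smult[of _ n] flip: Q(2))
  have Gsym: "G $$ (i, j) = cnj (G $$ (j, i))" if "i < n" "j < n" for i j
    using that cscalar_mult_mat_vec[OF F colc colc, of j i] herm F
      cscalar_swap[of "col Q j" n "F *\<^sub>v col Q i"] colc by (auto simp: Gij)
  have "k = n"
  proof (rule ccontr)
    assume "k \<noteq> n"
    with kn have kn: "k < n" by simp
    \<comment> \<open>The block of \<open>F\<close> on the orthogonal complement of the eigenvectors found so far.\<close>
    define G' where "G' = mat (n - k) (n - k) (\<lambda>(i, j). G $$ (i + k, j + k))"
    have "G' \<in> carrier_mat (n - k) (n - k)" by (simp add: G'_def)
    from spectrum_non_empty[OF this] kn obtain c where "eigenvalue G' c"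
      by (auto simp: spectrum_def)
    then obtain y where y: "y \<in> carrier_vec (n - k)" "y \<noteq> 0\<^sub>v (n - k)" "G' *\<^sub>v y = c \<cdot>\<^sub>v y"
      by (auto simp: eigenvalue_def eigenvector_def G'_def)
    define x where "x = vec n (\<lambda>i. if i < k then 0 else y $ (i - k))"
    have xc: "x \<in> carrier_vec n" by (simp add: x_def)
    have split: "{..<n} = {..<k} \<union> (\<lambda>i. i + k) ` {..<n - k}"
    proof -
      have "i \<in> (\<lambda>i. i + k) ` {..<n - k}" if "i < n" "\<not> i < k" for i
        using that by (intro image_eqI[of _ _ "i - k"]) auto
      then show ?thesis using kn by auto
    qed
    have Gx: "G *\<^sub>v x = c \<cdot>\<^sub>v x"
    proof (rule eq_vecI)
      fix i assume "i < dim_vec (c \<cdot>\<^sub>v x)"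
      then have i: "i < n" by (simp add: x_def)
      have "(G *\<^sub>v x) $ i = (\<Sum>j<n. G $$ (i, j) * x $ j)"
        using i Gc xc by (simp add: scalar_prod_def atLeast0LessThan)
      also have "\<dots> = (\<Sum>j<k. G $$ (i, j) * x $ j) + (\<Sum>j\<in>(\<lambda>i. i + k) ` {..<n - k}. G $$ (i, j) * x $ j)"
        unfolding split by (rule sum.union_disjoint) auto
      also have "\<dots> = (\<Sum>j<n - k. G $$ (i, j + k) * y $ j)"
        using kn by (subst sum.reindex) (auto simp: x_def inj_on_def intro!: sum.cong)
      also have "\<dots> = c * x $ i"
      proof (cases "i < k")
        case True
        then have "G $$ (i, j + k) = 0" if "j < n - k" for j
          using Gsym[of i "j + k"] Gk[of "j + k" i] that i by auto
        then show ?thesis using True i by (simp add: x_def)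
      next
        case False
        then have "(\<Sum>j<n - k. G $$ (i, j + k) * y $ j) = (G' *\<^sub>v y) $ (i - k)"
          using i y(1) by (simp add: G'_def scalar_prod_def atLeast0LessThan)
        then show ?thesis using y False i by (simp add: x_def)
      qed
      finally show "(G *\<^sub>v x) $ i = (c \<cdot>\<^sub>v x) $ i" using i xc by simp
    qed (use Gc in \<open>simp add: x_def\<close>)
    have "?E (Q *\<^sub>v x)"
    proof (intro conjI exI)
      have "F *\<^sub>v (Q *\<^sub>v x) = Q *\<^sub>v (G *\<^sub>v x)"
        using F Qc Gc xc FQ by (metis assoc_mult_mat_vec)
      then show "F *\<^sub>v (Q *\<^sub>v x) = c \<cdot>\<^sub>v (Q *\<^sub>v x)"
        using Qc xc by (simp add: Gx mult_mat_vec)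
    qed (use Qc xc in auto)
    moreover have "(Q *\<^sub>v x) \<bullet>c e i = 0" if "i < k" for i
    proof -
      have "mat_adjoint Q *\<^sub>v (Q *\<^sub>v x) = x"
        using Qc aQ xc QQ by (simp flip: assoc_mult_mat_vec[of _ n n _ n])
      then show ?thesis
        using adjoint_mult_vec_index[OF Qc, of "Q *\<^sub>v x" i] Qc xc that kn Q by (simp add: x_def)
    qed
    ultimately have "Q *\<^sub>v x = 0\<^sub>v n" using max[of "Q *\<^sub>v x"] by blast
    moreover have "mat_adjoint Q *\<^sub>v 0\<^sub>v n = 0\<^sub>v n" by (rule mult_mat_zero_vec[OF aQ])
    moreover have "mat_adjoint Q *\<^sub>v (Q *\<^sub>v x) = x"
      using Qc aQ xc QQ by (simp flip: assoc_mult_mat_vec[of _ n n _ n])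
    ultimately have "x = 0\<^sub>v n" by metis
    then have "x $ (i + k) = 0" if "i < n - k" for i using that kn by simp
    then have "y = 0\<^sub>v (n - k)" using y by (intro eq_vecI) (auto simp: x_def less_diff_conv)
    with y show False by simp
  qed
  then have "G = diag n d"
    using Gk Gc by (intro eq_matI) (auto simp: diag_def)
  moreover have "F = Q * G * mat_adjoint Q"
  proof -
    have "Q * G * mat_adjoint Q = F * (Q * mat_adjoint Q)"
      unfolding FQ[symmetric] using F Qc aQ by (rule assoc_mult_mat)
    then show ?thesis using QQ F by simp
  qed
  ultimately show thesis using that[of Q d] Q by simp
qed

text \<open>The functional calculus does not depend on the diagonalization: if \<open>T\<close> is the unitary matrix between two
  eigenbases, then \<open>T\<^sub>i\<^sub>j = 0\<close> unless the \<open>i\<close>-th and the \<open>j\<close>-th eigenvalue agree, so \<open>T\<close> also intertwines the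
  diagonal matrices of powers.\<close>

lemma posdef_power_eq:
  assumes Q: "unitary n Q" and d: "\<And>i. i < n \<Longrightarrow> 0 < d i"
    and F: "F = Q * diag n (\<lambda>i. complex_of_real (d i)) * mat_adjoint Q"
  shows "posdef_power n F z = Q * diag n (\<lambda>i. exp (z * complex_of_real (ln (d i)))) * mat_adjoint Q"
proof -
  let ?E = "\<lambda>d :: nat \<Rightarrow> real. diag n (\<lambda>i. exp (z * complex_of_real (ln (d i))))"
  let ?D = "\<lambda>d :: nat \<Rightarrow> real. diag n (\<lambda>i. complex_of_real (d i))"
  have Qc: "Q \<in> carrier_mat n n" and QQ: "Q * mat_adjoint Q = 1\<^sub>m n" "mat_adjoint Q * Q = 1\<^sub>m n"
    using Q by (auto simp: unitary_def)
  have eq: "V * ?E e * mat_adjoint V = Q * ?E d * mat_adjoint Q"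
    if V: "unitary n V" and FV: "F = V * ?D e * mat_adjoint V" for V e
  proof -
    have Vc: "V \<in> carrier_mat n n" and VV: "V * mat_adjoint V = 1\<^sub>m n" "mat_adjoint V * V = 1\<^sub>m n"
      using V by (auto simp: unitary_def)
    note c = Qc Vc adjoint_carrier[OF Qc] adjoint_carrier[OF Vc] diag_carrier mult_carrier_mat[of _ n n _ n]
    note [simp] = c(1-5) and assoc = assoc_mult_mat[of _ n n _ n _ n]
    define T where "T = mat_adjoint V * Q"
    have T: "T \<in> carrier_mat n n" unfolding T_def by (rule c(6)) simp_all
    note [simp] = T
    have QVT: "Q = V * T" and aT: "mat_adjoint V = T * mat_adjoint Q"
      unfolding T_def using VV QQ
      by (simp_all add: assoc c(6) left_mult_one_mat[of _ n n] right_mult_one_mat[of _ n n]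
          flip: assoc[of V "mat_adjoint V" Q])
    have "?D e * T = mat_adjoint V * F * Q"
      unfolding FV T_def using VV
      by (simp add: assoc c(6) left_mult_one_mat[of _ n n] flip: assoc[of "mat_adjoint V" V])
    also have "\<dots> = T * ?D d"
      unfolding F T_def using QQ by (simp add: assoc c(6) right_mult_one_mat[of _ n n])
    finally have comm: "?D e * T = T * ?D d" .
    have "?E e * T = T * ?E d"
    proof (rule eq_matI)
      fix i j assume "i < dim_row (T * ?E d)" "j < dim_col (T * ?E d)"
      then have ij: "i < n" "j < n" using T by (simp_all add: diag_def)
      have "complex_of_real (e i) * T $$ (i, j) = T $$ (i, j) * complex_of_real (d j)"
        using arg_cong[OF comm, of "\<lambda>A. A $$ (i, j)"] ij T by (simp add: diag_mult_left diag_mult_right del: of_real_eq_iff)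
      then have "T $$ (i, j) = 0 \<or> e i = d j" by auto
      then show "(?E e * T) $$ (i, j) = (T * ?E d) $$ (i, j)"
        using ij by (auto simp: diag_mult_left[OF T] diag_mult_right[OF T])
    qed (simp_all add: carrier_matD[OF T] diag_def)
    then have "V * (?E e * T) * mat_adjoint Q = V * (T * ?E d) * mat_adjoint Q" by simp
    then show ?thesis
      by (simp add: assoc c(6) aT QVT)
  qed
  show ?thesis
    unfolding posdef_power_def
  proof (rule the_equality)
    show "\<exists>U (e :: nat \<Rightarrow> real). U \<in> carrier_mat n n \<and> U * mat_adjoint U = 1\<^sub>m n \<and>
       mat_adjoint U * U = 1\<^sub>m n \<and> (\<forall>i<n. 0 < e i) \<and>
       F = U * mat n n (\<lambda>(i, j). if i = j then complex_of_real (e i) else 0) * mat_adjoint U \<and>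
       Q * ?E d * mat_adjoint Q =
         U * mat n n (\<lambda>(i, j). if i = j then exp (z * complex_of_real (ln (e i))) else 0) * mat_adjoint U"
      by (intro exI[of _ Q] exI[of _ d]) (use Qc QQ F d in \<open>simp add: diag_def\<close>)
  qed (use eq in \<open>auto simp: unitary_def diag_def\<close>)
qed

lemma positive_definite_eigenvalues:
  assumes F: "positive_definite n F"
  obtains Q d where "unitary n Q" "\<And>i. i < n \<Longrightarrow> 0 < d i"
    "F = Q * diag n (\<lambda>i. complex_of_real (d i)) * mat_adjoint Q"
proof -
  have Fc: "F \<in> carrier_mat n n" and herm: "mat_adjoint F = F" using F by (auto simp: positive_definite_def)
  obtain Q c where Q: "unitary n Q" and FQ: "F = Q * diag n c * mat_adjoint Q"
    using hermitian_diagonalization[OF Fc herm] by blast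
  have Qc: "Q \<in> carrier_mat n n" and QQ: "Q * mat_adjoint Q = 1\<^sub>m n" "mat_adjoint Q * Q = 1\<^sub>m n"
    using Q by (auto simp: unitary_def)
  have "F * Q = Q * diag n c * (mat_adjoint Q * Q)"
    unfolding FQ using Qc adjoint_carrier[OF Qc] diag_carrier[of n c]
    by (intro assoc_mult_mat[of _ n n _ n _ n]) (auto intro: mult_carrier_mat)
  then have FQ': "F * Q = Q * diag n c"
    using QQ right_mult_one_mat[OF mult_carrier_mat[OF Qc diag_carrier[of n c]]] by simp
  have ev: "F *\<^sub>v col Q i = c i \<cdot>\<^sub>v col Q i" if i: "i < n" for i
  proof -
    have "F *\<^sub>v col Q i = col (F * Q) i" using Fc Qc i by auto
    also have "\<dots> = c i \<cdot>\<^sub>v col Q i"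
      unfolding FQ' using Qc i diag_mult_right[OF Qc, of _ i c]
      by (intro eq_vecI) (auto simp: diag_def mult.commute)
    finally show ?thesis .
  qed
  have cc: "(F *\<^sub>v col Q i) \<bullet>c col Q i = c i" if i: "i < n" for i
    using ev[OF i] unitary_col[OF Q i i] Qc i by (simp add: cscalar_smult[of _ n])
  have real: "c i = complex_of_real (Re (c i))" if i: "i < n" for i
  proof -
    have cl: "col Q i \<in> carrier_vec n" using Qc by auto
    have "c i = col Q i \<bullet>c (F *\<^sub>v col Q i)"
      using cscalar_mult_mat_vec[OF Fc cl cl] unfolding herm cc[OF i] .
    also have "\<dots> = cnj ((F *\<^sub>v col Q i) \<bullet>c col Q i)"
      by (rule cscalar_swap[OF cl mult_mat_vec_carrier[OF Fc cl]])
    also have "\<dots> = cnj (c i)" unfolding cc[OF i] ..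
    finally have "c i = cnj (c i)" .
    then show ?thesis by (simp add: complex_eq_iff)
  qed
  have pos: "0 < Re (c i)" if i: "i < n" for i
  proof -
    have "col Q i \<in> carrier_vec n" using Qc by auto
    moreover have "col Q i \<noteq> 0\<^sub>v n"
      using unitary_col[OF Q i i] by (auto simp: cscalar_sum[of "0\<^sub>v n" n "0\<^sub>v n"])
    ultimately show ?thesis using F cc[OF i] by (auto simp: positive_definite_def)
  qed
  have "diag n c = diag n (\<lambda>i. complex_of_real (Re (c i)))"
    using real by (intro eq_matI) (auto simp: diag_def)
  with FQ Q pos that show thesis by metis
qed

lemma posdef_power_minus2:
  assumes F: "positive_definite n F" and G: "G \<in> carrier_mat n n" and FG: "F * G = 1\<^sub>m n"
  shows "posdef_power n F (- 2) = G * G"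
proof -
  obtain Q d where Q: "unitary n Q" and d: "\<And>i. i < n \<Longrightarrow> 0 < d i"
    and FQ: "F = Q * diag n (\<lambda>i. complex_of_real (d i)) * mat_adjoint Q"
    using positive_definite_eigenvalues[OF F] by metis
  have Qc: "Q \<in> carrier_mat n n" and QQ: "Q * mat_adjoint Q = 1\<^sub>m n" "mat_adjoint Q * Q = 1\<^sub>m n"
    using Q by (auto simp: unitary_def)
  define G' where "G' = Q * diag n (\<lambda>i. inverse (complex_of_real (d i))) * mat_adjoint Q"
  note c = Qc adjoint_carrier[OF Qc] diag_carrier mult_carrier_mat[of _ n n _ n]
  note [simp] = c(1-3) and assoc = assoc_mult_mat[of _ n n _ n _ n]
  have conj: "(Q * diag n a * mat_adjoint Q) * (Q * diag n b * mat_adjoint Q)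
      = Q * diag n (\<lambda>i. a i * b i) * mat_adjoint Q" for a b
  proof -
    have "(Q * diag n a * mat_adjoint Q) * (Q * diag n b * mat_adjoint Q)
        = Q * (diag n a * ((mat_adjoint Q * Q) * (diag n b * mat_adjoint Q)))"
      by (simp add: assoc c(4))
    also have "\<dots> = Q * ((diag n a * diag n b) * mat_adjoint Q)"
      unfolding QQ by (simp add: assoc c(4) left_mult_one_mat[of _ n n])
    finally show ?thesis by (simp add: diag_mult assoc c(4))
  qed
  have G'c: "G' \<in> carrier_mat n n" unfolding G'_def by (intro c(4)) simp_all
  have one: "diag n (\<lambda>i. inverse (complex_of_real (d i)) * complex_of_real (d i)) = 1\<^sub>m n"
    using d by (intro eq_matI) (fastforce simp: diag_def)+
  have "G' * F = 1\<^sub>m n"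
    unfolding G'_def FQ conj one right_mult_one_mat[OF Qc] by (rule QQ)
  then have "G' * (F * G) = G"
    using G'c G F by (simp add: assoc_mult_mat[of _ n n _ n _ n, symmetric] positive_definite_def)
  then have "G = G'" using FG G'c by simp
  moreover have "exp (- 2 * complex_of_real (ln (d i))) =
      inverse (complex_of_real (d i)) * inverse (complex_of_real (d i))" if "i < n" for i
  proof -
    have "exp (- 2 * complex_of_real (ln (d i))) = exp (- complex_of_real (ln (d i))) * exp (- complex_of_real (ln (d i)))"
      by (simp flip: exp_add)
    then show ?thesis using d[OF that] by (simp add: exp_minus exp_of_real)
  qed
  then have "diag n (\<lambda>i. exp (- 2 * complex_of_real (ln (d i)))) =
      diag n (\<lambda>i. inverse (complex_of_real (d i)) * inverse (complex_of_real (d i)))"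
    by (intro eq_matI) (auto simp: diag_def)
  ultimately show ?thesis
    by (simp add: posdef_power_eq[OF Q d FQ] G'_def conj)
qed

text \<open>Indeed \<open>\<langle>L L x, x\<rangle> = \<langle>L x, L x\<rangle>\<close>, and \<open>L\<close> is injective.\<close>

lemma positive_definite_square:
  assumes L: "L \<in> carrier_mat n n" and herm: "mat_adjoint L = L"
    and inv: "M \<in> carrier_mat n n" "M * L = 1\<^sub>m n"
  shows "positive_definite n (L * L)"
  unfolding positive_definite_def
proof (intro conjI ballI impI)
  show "L * L \<in> carrier_mat n n" using L by simp
  show "mat_adjoint (L * L) = L * L" using adjoint_mult[OF L L] herm by simp
  fix x :: "complex vec" assume x: "x \<in> carrier_vec n" "x \<noteq> 0\<^sub>v n"
  have "M *\<^sub>v (L *\<^sub>v x) = x"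
    using inv L x by (simp flip: assoc_mult_mat_vec[of _ n n _ n])
  moreover have "M *\<^sub>v 0\<^sub>v n = 0\<^sub>v n" by (rule mult_mat_zero_vec[OF inv(1)])
  ultimately have "L *\<^sub>v x \<noteq> 0\<^sub>v n" using x by metis
  have "(L * L *\<^sub>v x) \<bullet>c x = (L *\<^sub>v x) \<bullet>c (L *\<^sub>v x)"
    using cscalar_mult_mat_vec[OF L _ x(1), of "L *\<^sub>v x"] L x herm
    by (simp add: assoc_mult_mat_vec[of _ n n _ n])
  with \<open>L *\<^sub>v x \<noteq> 0\<^sub>v n\<close> show "0 < Re ((L * L *\<^sub>v x) \<bullet>c x)"
    using cscalar_self_pos[of "L *\<^sub>v x" n] L x by simp
qed

lemma positive_definite_diagonal:
  assumes F: "positive_definite n F" and i: "i < n"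
  shows "0 < Re (F $$ (i, i))"
proof -
  have Fc: "F \<in> carrier_mat n n" using F by (simp add: positive_definite_def)
  have "(F *\<^sub>v unit_vec n i) \<bullet>c unit_vec n i = F $$ (i, i)"
    using Fc i by (simp add: cscalar_sum[of _ n] unit_vec_def scalar_prod_def
        if_distrib[of cnj] if_distrib[of "\<lambda>x. _ * x"] cong: if_cong)
  moreover have "unit_vec n i \<noteq> (0\<^sub>v n :: complex vec)"
    using i by (metis index_unit_vec(1) index_zero_vec(1) zero_neq_one)
  ultimately show ?thesis using F by (auto simp: positive_definite_def)
qed

lemma positive_definite_trace:
  assumes F: "positive_definite n F" and n: "0 < n"
  shows "0 < Re (mat_trace F)"
proof -
  have "dim_row F = n" using F by (auto simp: positive_definite_def)
  then show ?thesis
    using n positive_definite_diagonal[OF F] by (auto simp: mat_trace_def intro!: sum_pos)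
qed

section \<open>Complete reducibility and Schur's lemma\<close>

context hopf_star_algebra
begin

lemma ucorep_star_left:
  assumes v: "ucorep I v" and "i \<in> I" "j \<in> I"
  shows "(\<Sum>k\<in>I. star H (v k i) * v k j) = (if i = j then 1 else 0)"
proof -
  have "(\<Sum>k\<in>I. star H (v k i) * v k j) = (\<Sum>k\<in>I. antipode H (v i k) * v k j)"
    using assms by (intro sum.cong) (auto simp: ucorep_antipode[OF v])
  then show ?thesis using corep_antipode_left[OF ucorep_corep[OF v] assms(2,3)] by simp
qed

lemma ucorep_star_right:
  assumes v: "ucorep I v" and "i \<in> I" "j \<in> I"
  shows "(\<Sum>k\<in>I. v i k * star H (v j k)) = (if i = j then 1 else 0)"
proof -
  have "(\<Sum>k\<in>I. v i k * star H (v j k)) = (\<Sum>k\<in>I. v i k * antipode H (v k j))"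
    using assms by (intro sum.cong) (auto simp: ucorep_antipode[OF v])
  then show ?thesis using corep_antipode_right[OF ucorep_corep[OF v] assms(2,3)] by simp
qed

lemma matrix_corep_iff:
  "matrix_corep H n v \<longleftrightarrow> v \<in> carrier_mat n n \<and> corep {..<n} (\<lambda>i j. v $$ (i, j))"
proof -
  have "(\<Sum>(x, y)\<leftarrow>[(v $$ (i, k), v $$ (k, j)). k \<leftarrow> [0..<n]]. B x y)
      = (\<Sum>k<n. B (v $$ (i, k)) (v $$ (k, j)))" for B :: "'a \<Rightarrow> 'a \<Rightarrow> complex" and i j
    by (simp add: comp_def interv_sum_list_conv_sum_set_nat atLeast0LessThan)
  then show ?thesis
    unfolding matrix_corep_def corep_def tensor_eq_def sweedler_def by auto
qed

lemma unitary_corep_ucorep: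
  assumes "unitary_corep H n v"
  shows "ucorep {..<n} (\<lambda>i j. v $$ (i, j))"
proof (rule ucorepI)
  have v: "v \<in> carrier_mat n n" and c: "corep {..<n} (\<lambda>i j. v $$ (i, j))"
    and u: "mat n n (\<lambda>(i, j). star H (v $$ (j, i))) * v = 1\<^sub>m n"
    using assms by (auto simp: unitary_corep_def matrix_corep_iff Let_def)
  show "corep {..<n} (\<lambda>i j. v $$ (i, j))" by (rule c)
  fix i j assume "i \<in> {..<n}" "j \<in> {..<n}"
  then have "(\<Sum>k<n. star H (v $$ (k, i)) * v $$ (k, j))
      = (mat n n (\<lambda>(i, j). star H (v $$ (j, i))) * v) $$ (i, j)"
    using v by (simp add: scalar_prod_def atLeast0LessThan)
  then show "(\<Sum>k<n. star H (v $$ (k, i)) * v $$ (k, j)) = (if i = j then 1 else 0)"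
    using u \<open>i \<in> {..<n}\<close> \<open>j \<in> {..<n}\<close> by simp
qed

lemma ucorep_unitary_corep:
  assumes v: "ucorep {..<n} v"
  shows "unitary_corep H n (mat n n (\<lambda>(i, j). v i j))"
proof -
  have c: "corep {..<n} v" by (rule ucorep_corep[OF v])
  have "corep {..<n} (\<lambda>i j. mat n n (\<lambda>(i, j). v i j) $$ (i, j))"
    using c by (auto simp: corep_def)
  moreover have "(\<Sum>k<n. v i k * star H (v j k)) = (if i = j then 1 else 0)" if "i < n" "j < n" for i j
    using ucorep_star_right[OF v, of i j] that by simp
  moreover have "(\<Sum>k<n. star H (v k i) * v k j) = (if i = j then 1 else 0)" if "i < n" "j < n" for i j
    using ucorep_star_left[OF v, of i j] that by simp
  ultimately show ?thesis
    unfolding unitary_corep_def matrix_corep_iff Let_def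
    by (auto intro!: eq_matI simp: scalar_prod_def atLeast0LessThan)
qed

text \<open>In the comultiplication of \<open>v\<^sub>i\<^sub>j\<close> with \<open>i, j \<in> J\<close>, the terms with \<open>k\<close> outside \<open>J\<close> vanish.\<close>

lemma corep_subset:
  assumes v: "corep I v" and J: "J \<subseteq> I"
    and z: "(\<forall>i\<in>I - J. \<forall>j\<in>J. v i j = 0) \<or> (\<forall>i\<in>J. \<forall>j\<in>I - J. v i j = 0)"
  shows "corep J v"
proof -
  have fin: "finite I" by (rule corep_finite[OF v])
  have "sweedler H B (v i j) = (\<Sum>k\<in>J. B (v i k) (v k j))"
    if ij: "i \<in> J" "j \<in> J" and B: "bilinear_form H B" for i j B
  proof -
    have B0: "B 0 y = 0" "B x 0 = 0" for x y
      using B linear_form_zero[of "B x"] linear_form_zero[of "\<lambda>x. B x y"] by (auto simp: bilinear_form_def)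
    have "sweedler H B (v i j) = (\<Sum>k\<in>I. B (v i k) (v k j))"
      using ij J by (intro corep_form[OF v _ _ B]) auto
    also have "\<dots> = (\<Sum>k\<in>J. B (v i k) (v k j))"
    proof (rule sum.mono_neutral_right[OF fin J], intro ballI)
      fix k assume "k \<in> I - J"
      then show "B (v i k) (v k j) = 0" using z ij B0 by metis
    qed
    finally show ?thesis .
  qed
  moreover have "counit H (v i j) = (if i = j then 1 else 0)" if "i \<in> J" "j \<in> J" for i j
    using that J by (intro corep_counit[OF v]) auto
  ultimately show ?thesis
    using finite_subset[OF J fin] by (simp add: corep_def)
qed

text \<open>A block triangular unitary corepresentation is block diagonal, because the diagonal block is
  itself unitary.\<close>

lemma ucorep_block_diagonal:
  assumes v: "ucorep I v" and J: "J \<subseteq> I" and z: "\<And>i j. i \<in> I - J \<Longrightarrow> j \<in> J \<Longrightarrow> v i j = 0"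
    and m: "m \<in> J" and j: "j \<in> I - J"
  shows "v m j = 0"
proof -
  have c: "corep I v" by (rule ucorep_corep[OF v])
  have fin: "finite I" by (rule corep_finite[OF c])
  have cJ: "corep J v" using corep_subset[OF c J] z by blast
  have 0: "(\<Sum>l\<in>J. star H (v l i) * v l j) = 0" if i: "i \<in> J" for i
  proof -
    have "(\<Sum>l\<in>J. star H (v l i) * v l j) = (\<Sum>l\<in>I. star H (v l i) * v l j)"
      using z i by (intro sum.mono_neutral_left[OF fin J]) (auto simp: star_zero)
    also have "\<dots> = 0" using ucorep_star_left[OF v, of i j] i j J by auto
    finally show ?thesis .
  qed
  have "ucorep J v" using v cJ J by (auto simp: ucorep_def)
  note r = ucorep_star_right[OF this m]
  have "v m j = (\<Sum>l\<in>J. (\<Sum>i\<in>J. v m i * star H (v l i)) * v l j)"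
    using r m finite_subset[OF J fin] by (simp add: if_distrib[of "\<lambda>x. x * _"] cong: if_cong)
  also have "\<dots> = (\<Sum>i\<in>J. v m i * (\<Sum>l\<in>J. star H (v l i) * v l j))"
    by (simp add: sum_distrib_left sum_distrib_right mult.assoc) (rule sum.swap)
  also have "\<dots> = 0" using 0 by simp
  finally show ?thesis .
qed

text \<open>The entries of \<open>Q\<^sup>* v Q\<close>.\<close>

definition conjugate_corep :: "nat \<Rightarrow> complex mat \<Rightarrow> (nat \<Rightarrow> nat \<Rightarrow> 'a) \<Rightarrow> nat \<Rightarrow> nat \<Rightarrow> 'a" where
  "conjugate_corep n Q v p q = (\<Sum>i<n. \<Sum>j<n. scl H (cnj (Q $$ (i, p)) * Q $$ (j, q)) (v i j))"

lemma unitary_sums: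
  assumes "unitary n Q" "i < n" "j < n"
  shows "(\<Sum>k<n. Q $$ (i, k) * cnj (Q $$ (j, k))) = (if i = j then 1 else 0)"
    and "(\<Sum>k<n. cnj (Q $$ (k, i)) * Q $$ (k, j)) = (if i = j then 1 else 0)"
proof -
  have Q: "Q \<in> carrier_mat n n" "Q * mat_adjoint Q = 1\<^sub>m n" "mat_adjoint Q * Q = 1\<^sub>m n"
    using assms by (auto simp: unitary_def)
  have "(\<Sum>k<n. Q $$ (i, k) * cnj (Q $$ (j, k))) = (Q * mat_adjoint Q) $$ (i, j)"
    using Q(1) assms by (simp add: scalar_prod_def atLeast0LessThan)
  then show "(\<Sum>k<n. Q $$ (i, k) * cnj (Q $$ (j, k))) = (if i = j then 1 else 0)" using Q assms by simp
  have "(\<Sum>k<n. cnj (Q $$ (k, i)) * Q $$ (k, j)) = (mat_adjoint Q * Q) $$ (i, j)"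
    using Q(1) assms by (simp add: scalar_prod_def atLeast0LessThan)
  then show "(\<Sum>k<n. cnj (Q $$ (k, i)) * Q $$ (k, j)) = (if i = j then 1 else 0)" using Q assms by simp
qed

text \<open>A change of orthonormal basis respects the comultiplication: the sum over \<open>k\<close> collapses by unitarity of
  \<open>Q\<close>. The function \<open>s\<close> is the scalar multiplication of the space in which \<open>F\<close> takes its values.\<close>

lemma conjugate_corep_product:
  fixes F :: "'a \<Rightarrow> 'a \<Rightarrow> 'b::ab_group_add"
  assumes Q: "unitary n Q"
    and add: "\<And>x y z. F (x + y) z = F x z + F y z" "\<And>x y z. F x (y + z) = F x y + F x z"
    and scl: "\<And>c x y. F (scl H c x) y = s c (F x y)" "\<And>c x y. F x (scl H c y) = s c (F x y)"
    and s: "\<And>c d x. s c (s d x) = s (c * d) x" "\<And>c d x. s (c + d) x = s c x + s d x" "\<And>x. s 1 x = x"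
      "\<And>c x y. s c (x + y) = s c x + s c y"
  shows "(\<Sum>k<n. F (conjugate_corep n Q v p k) (conjugate_corep n Q w k q))
    = (\<Sum>i<n. \<Sum>j<n. s (cnj (Q $$ (i, p)) * Q $$ (j, q)) (\<Sum>k<n. F (v i k) (w k j)))"
proof -
  have s0: "s 0 x = 0" "s c 0 = 0" for x c
    using s(2)[of 0 0 x] s(4)[of c 0 0] by simp_all
  have F0: "F 0 y = 0" "F x 0 = 0" for x y
    using add(1)[of 0 0 y] add(2)[of x 0 0] by simp_all
  have Fs1: "F (\<Sum>a\<in>A. f a) y = (\<Sum>a\<in>A. F (f a) y)" for A :: "nat set" and f y
    by (induction A rule: infinite_finite_induct) (simp_all add: F0 add)
  have Fs2: "F x (\<Sum>a\<in>A. f a) = (\<Sum>a\<in>A. F x (f a))" for A :: "nat set" and f x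
    by (induction A rule: infinite_finite_induct) (simp_all add: F0 add)
  have ss1: "s (\<Sum>a\<in>A. f a) y = (\<Sum>a\<in>A. s (f a) y)" for A :: "nat set" and f y
    by (induction A rule: infinite_finite_induct) (simp_all add: s0 s)
  have ss2: "s x (\<Sum>a\<in>A. f a) = (\<Sum>a\<in>A. s x (f a))" for A :: "nat set" and f x
    by (induction A rule: infinite_finite_induct) (simp_all add: s0 s)
  let ?c = "\<lambda>i j. cnj (Q $$ (i, p)) * Q $$ (j, q)"
  have "(\<Sum>k<n. F (conjugate_corep n Q v p k) (conjugate_corep n Q w k q))
    = (\<Sum>k<n. \<Sum>b<n. \<Sum>j<n. \<Sum>i<n. \<Sum>a<n. s (?c i j * (Q $$ (a, k) * cnj (Q $$ (b, k)))) (F (v i a) (w b j)))"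
    by (simp add: conjugate_corep_def Fs1 Fs2 scl s(1) ss2 mult_ac)
  also have "\<dots> = (\<Sum>i<n. \<Sum>j<n. \<Sum>a<n. \<Sum>b<n. \<Sum>k<n. s (?c i j * (Q $$ (a, k) * cnj (Q $$ (b, k)))) (F (v i a) (w b j)))"
    (is "?l = ?r")
  proof -
    have "?l = (\<Sum>(k, b, j, i, a)\<in>{..<n} \<times> {..<n} \<times> {..<n} \<times> {..<n} \<times> {..<n}.
        s (?c i j * (Q $$ (a, k) * cnj (Q $$ (b, k)))) (F (v i a) (w b j)))"
      by (simp add: sum.cartesian_product case_prod_unfold)
    also have "\<dots> = (\<Sum>(i, j, a, b, k)\<in>{..<n} \<times> {..<n} \<times> {..<n} \<times> {..<n} \<times> {..<n}.
        s (?c i j * (Q $$ (a, k) * cnj (Q $$ (b, k)))) (F (v i a) (w b j)))"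
      by (rule sum.reindex_bij_witness[of _ "\<lambda>(i, j, a, b, k). (k, b, j, i, a)" "\<lambda>(k, b, j, i, a). (i, j, a, b, k)"])
        auto
    also have "\<dots> = ?r" by (simp add: sum.cartesian_product case_prod_unfold)
    finally show ?thesis .
  qed
  also have "\<dots> = (\<Sum>i<n. \<Sum>j<n. \<Sum>a<n. \<Sum>b<n. s (?c i j * (if a = b then 1 else 0)) (F (v i a) (w b j)))"
    by (intro sum.cong refl) (simp add: unitary_sums[OF Q] flip: ss1 sum_distrib_left)
  also have "\<dots> = (\<Sum>i<n. \<Sum>j<n. s (?c i j) (\<Sum>k<n. F (v i k) (w k j)))"
    by (intro sum.cong refl)
      (simp add: ss2 if_distrib[of "\<lambda>x. _ * x"] if_distrib[of "\<lambda>x. s x _"] s0 cong: if_cong)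
  finally show ?thesis .
qed

lemma ucorep_conjugate:
  assumes Q: "unitary n Q" and v: "ucorep {..<n} v"
  shows "ucorep {..<n} (conjugate_corep n Q v)"
proof -
  have c: "corep {..<n} v" by (rule ucorep_corep[OF v])
  have ap: "antipode H (conjugate_corep n Q v p q) = star H (conjugate_corep n Q v q p)" for p q
  proof -
    have "antipode H (conjugate_corep n Q v p q)
        = (\<Sum>i<n. \<Sum>j<n. scl H (cnj (Q $$ (i, p)) * Q $$ (j, q)) (star H (v j i)))"
      unfolding conjugate_corep_def antipode_sum antipode_scl
      by (intro sum.cong refl) (simp add: ucorep_antipode[OF v])
    also have "\<dots> = (\<Sum>j<n. \<Sum>i<n. star H (scl H (cnj (Q $$ (j, q)) * Q $$ (i, p)) (v j i)))"
      by (subst sum.swap) (simp add: star_scl mult.commute)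
    finally show ?thesis by (simp add: conjugate_corep_def star_sum)
  qed
  have "sweedler H B (conjugate_corep n Q v p q)
      = (\<Sum>k<n. B (conjugate_corep n Q v p k) (conjugate_corep n Q v k q))"
    if "p < n" "q < n" and B: "bilinear_form H B" for p q B
  proof -
    have lin: "linear_form H (sweedler H B)" by (rule comult_linear[OF B])
    have "(\<Sum>k<n. B (conjugate_corep n Q v p k) (conjugate_corep n Q v k q))
      = (\<Sum>i<n. \<Sum>j<n. (cnj (Q $$ (i, p)) * Q $$ (j, q)) * (\<Sum>k<n. B (v i k) (v k j)))"
      using B by (intro conjugate_corep_product[OF Q, where s = "(*)"])
        (auto simp: bilinear_form_iff algebra_simps)
    also have "\<dots> = sweedler H B (conjugate_corep n Q v p q)"
      unfolding conjugate_corep_def linear_form_sum[OF lin] linear_form_scl[OF lin]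
      by (intro sum.cong refl) (simp add: corep_form[OF c _ _ B])
    finally show ?thesis ..
  qed
  moreover have "counit H (conjugate_corep n Q v p q) = (if p = q then 1 else 0)"
    if "p < n" "q < n" for p q
  proof -
    have "counit H (conjugate_corep n Q v p q) = (\<Sum>i<n. \<Sum>j<n. (cnj (Q $$ (i, p)) * Q $$ (j, q)) * (if i = j then 1 else 0))"
      unfolding conjugate_corep_def linear_form_sum[OF counit_linear] linear_form_scl[OF counit_linear]
      by (intro sum.cong refl) (simp add: corep_counit[OF c])
    also have "\<dots> = (if p = q then 1 else 0)"
      using unitary_sums(2)[OF Q that] by (simp add: if_distrib[of "\<lambda>x. _ * x"] cong: if_cong)
    finally show ?thesis .
  qed
  ultimately show ?thesis using ap by (simp add: ucorep_def corep_def)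
qed

lemma conjugate_corep_inverse:
  assumes Q: "unitary n Q" and ij: "i < n" "j < n"
  shows "v i j = (\<Sum>p<n. \<Sum>q<n. scl H (Q $$ (i, p) * cnj (Q $$ (j, q))) (conjugate_corep n Q v p q))"
proof -
  have "(\<Sum>p<n. \<Sum>q<n. scl H (Q $$ (i, p) * cnj (Q $$ (j, q))) (conjugate_corep n Q v p q))
    = (\<Sum>p<n. \<Sum>q<n. \<Sum>a<n. \<Sum>b<n. scl H ((Q $$ (i, p) * cnj (Q $$ (a, p))) * (Q $$ (b, q) * cnj (Q $$ (j, q)))) (v a b))"
    by (simp add: conjugate_corep_def scale_sum_right mult_ac)
  also have "\<dots> = (\<Sum>a<n. \<Sum>b<n. \<Sum>p<n. \<Sum>q<n. scl H ((Q $$ (i, p) * cnj (Q $$ (a, p))) * (Q $$ (b, q) * cnj (Q $$ (j, q)))) (v a b))"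
    (is "?l = ?r")
  proof -
    have "?l = (\<Sum>(p, q, a, b)\<in>{..<n} \<times> {..<n} \<times> {..<n} \<times> {..<n}.
        scl H ((Q $$ (i, p) * cnj (Q $$ (a, p))) * (Q $$ (b, q) * cnj (Q $$ (j, q)))) (v a b))"
      by (simp add: sum.cartesian_product case_prod_unfold)
    also have "\<dots> = (\<Sum>(a, b, p, q)\<in>{..<n} \<times> {..<n} \<times> {..<n} \<times> {..<n}.
        scl H ((Q $$ (i, p) * cnj (Q $$ (a, p))) * (Q $$ (b, q) * cnj (Q $$ (j, q)))) (v a b))"
      by (rule sum.reindex_bij_witness[of _ "\<lambda>(a, b, p, q). (p, q, a, b)" "\<lambda>(p, q, a, b). (a, b, p, q)"])
        auto
    also have "\<dots> = ?r" by (simp add: sum.cartesian_product case_prod_unfold)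
    finally show ?thesis .
  qed
  also have "\<dots> = (\<Sum>a<n. \<Sum>b<n. scl H ((\<Sum>p<n. Q $$ (i, p) * cnj (Q $$ (a, p))) * (\<Sum>q<n. Q $$ (b, q) * cnj (Q $$ (j, q)))) (v a b))"
    unfolding sum_product by (simp only: scale_sum_left)
  also have "\<dots> = (\<Sum>a<n. \<Sum>b<n. scl H ((if i = a then 1 else 0) * (if b = j then 1 else 0)) (v a b))"
    using ij by (intro sum.cong refl) (simp add: unitary_sums[OF Q])
  also have "\<dots> = (\<Sum>a<n. \<Sum>b<n. if b = j then (if i = a then v a b else 0) else 0)"
    by (intro sum.cong refl) auto
  also have "\<dots> = v i j" using ij by simp
  finally show ?thesis ..
qed

definition irreducible_coefficients :: "'a set" where
  "irreducible_coefficients = {w $$ (i, j) | n w i j.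
     unitary_corep H n w \<and> irreducible_corep H n w \<and> i < n \<and> j < n}"

text \<open>In an orthonormal basis that begins with a basis of a proper invariant subspace, a unitary corepresentation
  is block triangular, hence block diagonal. So its coefficients are linear combinations of the coefficients
  of two smaller unitary corepresentations.\<close>

lemma coefficients_in_span_nat:
  fixes n :: nat
  assumes "ucorep {..<n} v" "i < n" "j < n"
  shows "v i j \<in> span irreducible_coefficients"
  using assms
proof (induction n arbitrary: v i j rule: less_induct)
  case (less n)
  note v = less.prems(1)
  let ?V = "mat n n (\<lambda>(i, j). v i j)"
  have uV: "unitary_corep H n ?V" by (rule ucorep_unitary_corep[OF v])
  show ?case
  proof (cases "irreducible_corep H n ?V")
    case True
    have "v i j = ?V $$ (i, j)" using less.prems by simp
    then have "v i j \<in> irreducible_coefficients"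
      unfolding irreducible_coefficients_def using True uV less.prems by blast
    then show ?thesis by (rule span_base)
  next
    case False
    then obtain W where W: "invariant_subspace H n ?V W" "W \<noteq> {0\<^sub>v n}" "W \<noteq> carrier_vec n"
      using uV less.prems by (auto simp: irreducible_corep_def unitary_corep_def)
    from W(1) have "vec_subspace n W" by (simp add: invariant_subspace_def)
    from adapted_unitary[OF this W(2,3)] obtain Q k where Q: "unitary n Q" and k: "0 < k" "k < n"
      and QW: "\<And>j. j < k \<Longrightarrow> col Q j \<in> W"
      and orth: "\<And>x j. x \<in> W \<Longrightarrow> k \<le> j \<Longrightarrow> j < n \<Longrightarrow> x \<bullet>c col Q j = 0" by metis
    have Qc: "Q \<in> carrier_mat n n" using Q by (simp add: unitary_def)
    have Wc: "w \<in> carrier_vec n" if "w \<in> W" for w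
      using that W(1) by (auto simp: invariant_subspace_def vec_subspace_def)
    let ?v = "conjugate_corep n Q v"
    have lower: "?v p q = 0" if p: "k \<le> p" "p < n" and q: "q < k" for p q
    proof -
      obtain ts where ts: "\<forall>(w, a)\<in>set ts. w \<in> W"
        "\<forall>i<n. (\<Sum>j<n. scl H (col Q q $ j) (?V $$ (i, j))) = (\<Sum>(w, a)\<leftarrow>ts. scl H (w $ i) a)"
        using W(1) QW[OF q] by (auto simp: invariant_subspace_def)
      have "?v p q = (\<Sum>i<n. scl H (cnj (Q $$ (i, p))) (\<Sum>j<n. scl H (col Q q $ j) (?V $$ (i, j))))"
        unfolding conjugate_corep_def using Qc q k
        by (intro sum.cong refl) (simp add: scale_sum_right)
      also have "\<dots> = (\<Sum>i<n. scl H (cnj (Q $$ (i, p))) (\<Sum>(w, a)\<leftarrow>ts. scl H (w $ i) a))"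
        using ts(2) by (intro sum.cong) auto
      also have "\<dots> = (\<Sum>(w, a)\<leftarrow>ts. scl H (w \<bullet>c col Q p) a)"
        using ts(1)
      proof (induction ts)
        case Nil
        then show ?case by simp
      next
        case (Cons t ts)
        obtain w a where t: "t = (w, a)" by force
        then have "w \<in> carrier_vec n" using Cons.prems Wc by auto
        then have "w \<bullet>c col Q p = (\<Sum>i<n. w $ i * cnj (Q $$ (i, p)))"
          using Qc p by (simp add: cscalar_sum[of _ n])
        then have "(\<Sum>i<n. scl H (cnj (Q $$ (i, p))) (scl H (w $ i) a)) = scl H (w \<bullet>c col Q p) a"
          by (simp add: scale_sum_left mult.commute)
        then show ?case
          using Cons t by (simp add: scale_right_distrib sum.distrib)
      qed
      also have "\<dots> = (\<Sum>t\<leftarrow>ts. 0)"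
        using ts(1) orth p by (intro arg_cong[of _ _ sum_list] map_cong) auto
      finally show ?thesis by simp
    qed
    have uv: "ucorep {..<n} ?v" by (rule ucorep_conjugate[OF Q v])
    have upper: "?v p q = 0" if "p < k" "k \<le> q" "q < n" for p q
      using ucorep_block_diagonal[OF uv, of "{..<k}"] lower k that by auto
    have u1: "ucorep {..<k} ?v"
      using uv corep_subset[OF ucorep_corep[OF uv], of "{..<k}"] lower k by (auto simp: ucorep_def)
    have u2: "ucorep {k..<n} ?v"
    proof -
      have "corep {k..<n} ?v"
        by (rule corep_subset[OF ucorep_corep[OF uv]]) (use lower in auto)
      then show ?thesis using uv by (auto simp: ucorep_def)
    qed
    have "bij_betw (\<lambda>i. i + k) {..<n - k} {k..<n}"
      by (rule bij_betw_byWitness[of _ "\<lambda>i. i - k"]) auto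
    note u3 = ucorep_reindex[OF u2 this]
    have "?v p q \<in> span irreducible_coefficients" if "p < n" "q < n" for p q
    proof -
      consider "p < k" "q < k" | "k \<le> p" "k \<le> q" | "?v p q = 0"
        using lower upper \<open>p < n\<close> \<open>q < n\<close> by (meson not_less)
      then show ?thesis
      proof cases
        case 1
        then show ?thesis using less.IH[OF k(2) u1] by simp
      next
        case 2
        then show ?thesis using less.IH[OF _ u3, of "p - k" "q - k"] k that by simp
      next
        case 3
        then show ?thesis by (simp add: span_zero)
      qed
    qed
    then show ?thesis
      unfolding conjugate_corep_inverse[OF Q less.prems(2,3), of v]
      by (intro span_sum span_scale) simp
  qed
qed

lemma coefficients_in_span:
  assumes v: "ucorep I v" and ij: "i \<in> I" "j \<in> I"
  shows "v i j \<in> span irreducible_coefficients"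
proof -
  have "finite I" using corep_finite[OF ucorep_corep[OF v]] .
  from ex_bij_betw_nat_finite[OF this] obtain h where h: "bij_betw h {..<card I} I"
    by (auto simp: atLeast0LessThan)
  then have "i \<in> h ` {..<card I}" "j \<in> h ` {..<card I}"
    using ij by (simp_all add: bij_betw_def)
  then obtain a b where ab: "a < card I" "b < card I" "i = h a" "j = h b"
    by blast
  show ?thesis
    unfolding ab(3,4) by (rule coefficients_in_span_nat[OF ucorep_reindex[OF v h] ab(1,2)])
qed

text \<open>An eigenspace of an intertwiner is invariant, hence everything. The definition of invariance asks for
  coefficient vectors in the subspace; they arise by expanding the coaction in a basis of the algebra, because the
  coordinates with respect to that basis are linear forms.\<close>

lemma schur:
  assumes irr: "irreducible_corep H n v"
    and comm: "\<And>i j. i < n \<Longrightarrow> j < n \<Longrightarrow>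
      (\<Sum>k<n. scl H (M i k) (v $$ (k, j))) = (\<Sum>k<n. scl H (M k j) (v $$ (i, k)))"
  obtains c where "\<And>i j. i < n \<Longrightarrow> j < n \<Longrightarrow> M i j = (if i = j then c else 0)"
proof -
  have n: "0 < n" using irr by (simp add: irreducible_corep_def)
  let ?M = "mat n n (\<lambda>(i, j). M i j)"
  have Mc: "?M \<in> carrier_mat n n" by simp
  from spectrum_non_empty[OF Mc n] obtain c where "eigenvalue ?M c" by (auto simp: spectrum_def)
  then obtain x0 where x0: "x0 \<in> carrier_vec n" "x0 \<noteq> 0\<^sub>v n" "?M *\<^sub>v x0 = c \<cdot>\<^sub>v x0"
    by (auto simp: eigenvalue_def eigenvector_def)
  define W where "W = {x \<in> carrier_vec n. \<forall>i<n. (\<Sum>k<n. M i k * x $ k) = c * x $ i}"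
  have "x0 \<in> W"
  proof -
    have "(\<Sum>k<n. M i k * x0 $ k) = c * x0 $ i" if "i < n" for i
      using arg_cong[OF x0(3), of "\<lambda>v. v $ i"] x0(1) that by (simp add: scalar_prod_def atLeast0LessThan)
    then show ?thesis using x0 by (simp add: W_def)
  qed
  have sub: "vec_subspace n W"
    unfolding vec_subspace_def
  proof (intro conjI ballI allI)
    fix x y a assume x: "x \<in> W" and y: "y \<in> W"
    show "x + y \<in> W" using x y by (auto simp: W_def distrib_left sum.distrib)
    have "(\<Sum>k<n. M i k * (a * x $ k)) = a * (\<Sum>k<n. M i k * x $ k)" for i
      by (simp add: sum_distrib_left mult_ac)
    then show "a \<cdot>\<^sub>v x \<in> W" using x by (auto simp: W_def)
  next
    show "W \<subseteq> carrier_vec n" by (auto simp: W_def)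
    show "0\<^sub>v n \<in> W" by (simp add: W_def)
  qed
  obtain B where "B \<subseteq> UNIV" "independent B" "UNIV \<subseteq> span B"
    by (rule maximal_independent_subset)
  then have B: "independent B" "span B = UNIV" by auto
  have lin: "linear_form H (\<lambda>a. representation B a b)" for b
    using linear_representation[OF B] by (simp add: linear_form_def)
  have "\<exists>ts. (\<forall>(w, a)\<in>set ts. w \<in> W) \<and>
      (\<forall>i<n. (\<Sum>j<n. scl H (x $ j) (v $$ (i, j))) = (\<Sum>(w, a)\<leftarrow>ts. scl H (w $ i) a))" if x: "x \<in> W" for x
  proof -
    define y where "y = (\<lambda>i. \<Sum>j<n. scl H (x $ j) (v $$ (i, j)))"
    have My: "(\<Sum>k<n. scl H (M i k) (y k)) = scl H c (y i)" if i: "i < n" for i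
    proof -
      have "(\<Sum>k<n. scl H (M i k) (y k)) = (\<Sum>j<n. scl H (x $ j) (\<Sum>k<n. scl H (M i k) (v $$ (k, j))))"
        by (simp add: y_def scale_sum_right mult.commute) (rule sum.swap)
      also have "\<dots> = (\<Sum>j<n. scl H (x $ j) (\<Sum>k<n. scl H (M k j) (v $$ (i, k))))"
        using comm i by simp
      also have "\<dots> = (\<Sum>k<n. scl H (\<Sum>j<n. M k j * x $ j) (v $$ (i, k)))"
        by (simp add: scale_sum_right scale_sum_left mult.commute) (rule sum.swap)
      also have "\<dots> = (\<Sum>k<n. scl H (c * x $ k) (v $$ (i, k)))"
        using x by (simp add: W_def)
      finally show ?thesis by (simp add: y_def scale_sum_right)
    qed
    define T where "T = (\<Union>i<n. {b. representation B (y i) b \<noteq> 0})"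
    have T: "finite T" by (simp add: T_def finite_representation)
    then obtain bs where bs: "set bs = T" "distinct bs" using finite_distinct_list by blast
    let ?w = "\<lambda>b. vec n (\<lambda>i. representation B (y i) b)"
    have "?w b \<in> W" for b
      using arg_cong[OF My, of _ "\<lambda>a. representation B a b"]
      by (simp add: W_def linear_form_sum[OF lin] linear_form_scl[OF lin])
    moreover have "y i = (\<Sum>(w, a)\<leftarrow>map (\<lambda>b. (?w b, b)) bs. scl H (w $ i) a)" if i: "i < n" for i
    proof -
      have "y i = (\<Sum>b | representation B (y i) b \<noteq> 0. scl H (representation B (y i) b) b)"
        using B by (simp add: sum_nonzero_representation_eq)
      also have "\<dots> = (\<Sum>b\<in>T. scl H (representation B (y i) b) b)"
        using i T by (intro sum.mono_neutral_left) (auto simp: T_def)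
      also have "\<dots> = (\<Sum>b\<leftarrow>bs. scl H (representation B (y i) b) b)"
        by (simp add: sum_list_distinct_conv_sum_set bs)
      also have "\<dots> = (\<Sum>(w, a)\<leftarrow>map (\<lambda>b. (?w b, b)) bs. scl H (w $ i) a)"
        using i by (simp add: comp_def)
      finally show ?thesis .
    qed
    moreover have "\<forall>(w, a)\<in>set (map (\<lambda>b. (?w b, b)) bs). w \<in> W" using \<open>\<And>b. ?w b \<in> W\<close> by simp
    ultimately show ?thesis unfolding y_def by blast
  qed
  with sub have "invariant_subspace H n v W" by (simp add: invariant_subspace_def)
  with irr \<open>x0 \<in> W\<close> x0 have W: "W = carrier_vec n" by (auto simp: irreducible_corep_def)
  have "M i j = (if i = j then c else 0)" if "i < n" "j < n" for i j
  proof -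
    have "unit_vec n j \<in> W" using W by simp
    then have "(\<Sum>k<n. M i k * unit_vec n j $ k) = c * unit_vec n j $ i" using that by (simp add: W_def)
    then show ?thesis using that by (simp add: unit_vec_def if_distrib[of "\<lambda>x. _ * x"] cong: if_cong)
  qed
  with that show thesis by blast
qed


section \<open>Modular matrices and the modular character\<close>

lemma scalar_mat_carrier [simp]: "F \<in> carrier_mat n m \<Longrightarrow> scalar_mat H F \<in> carrier_mat n m"
  by (simp add: scalar_mat_def)

lemma scalar_mat_mult:
  assumes "A \<in> carrier_mat n n" "B \<in> carrier_mat n n"
  shows "scalar_mat H (A * B) = scalar_mat H A * scalar_mat H B"
  using assms
  by (intro eq_matI) (auto simp: scalar_mat_def scalar_prod_def scl_mult scale_sum_left)

lemma scalar_mat_one: "scalar_mat H (1\<^sub>m n) = 1\<^sub>m n"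
  by (intro eq_matI) (auto simp: scalar_mat_def)

lemma scalar_mat_left_index:
  "A \<in> carrier_mat n n \<Longrightarrow> v \<in> carrier_mat n n \<Longrightarrow> i < n \<Longrightarrow> j < n \<Longrightarrow>
    (scalar_mat H A * v) $$ (i, j) = (\<Sum>k<n. scl H (A $$ (i, k)) (v $$ (k, j)))"
  by (simp add: scalar_mat_def scalar_prod_def atLeast0LessThan scl_mult_left)

lemma scalar_mat_right_index:
  "A \<in> carrier_mat n n \<Longrightarrow> v \<in> carrier_mat n n \<Longrightarrow> i < n \<Longrightarrow> j < n \<Longrightarrow>
    (v * scalar_mat H A) $$ (i, j) = (\<Sum>k<n. scl H (A $$ (k, j)) (v $$ (i, k)))"
  by (simp add: scalar_mat_def scalar_prod_def atLeast0LessThan scl_mult_right)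

lemma scalar_mat_conj_index:
  assumes "F \<in> carrier_mat n n" "G \<in> carrier_mat n n" "v \<in> carrier_mat n n" "i < n" "j < n"
  shows "(scalar_mat H F * v * scalar_mat H G) $$ (i, j)
    = (\<Sum>k<n. \<Sum>l<n. scl H (F $$ (i, k) * G $$ (l, j)) (v $$ (k, l)))"
proof -
  have "(scalar_mat H F * v * scalar_mat H G) $$ (i, j)
      = (\<Sum>l<n. scl H (G $$ (l, j)) (\<Sum>k<n. scl H (F $$ (i, k)) (v $$ (k, l))))"
    using assms mult_carrier_mat[OF scalar_mat_carrier[OF assms(1)] assms(3)]
    by (simp add: scalar_mat_right_index scalar_mat_left_index)
  also have "\<dots> = (\<Sum>k<n. \<Sum>l<n. scl H (F $$ (i, k) * G $$ (l, j)) (v $$ (k, l)))"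
    by (simp add: scale_sum_right mult.commute) (rule sum.swap)
  finally show ?thesis .
qed

text \<open>By Schur's lemma the matrix implementing \<open>S\<^sup>2\<close> is unique up to a factor, which positivity and
  the trace condition fix.\<close>

lemma modular_matrix_eqI:
  assumes irr: "irreducible_corep H n v"
    and F: "positive_definite n F" and G: "G \<in> carrier_mat n n" and FG: "F * G = 1\<^sub>m n"
    and S2: "\<And>i j. i < n \<Longrightarrow> j < n \<Longrightarrow> antipode H (antipode H (v $$ (i, j)))
      = (\<Sum>k<n. \<Sum>l<n. scl H (F $$ (i, k) * G $$ (l, j)) (v $$ (k, l)))"
    and tr: "mat_trace F = mat_trace G"
  shows "modular_matrix H n v = F"
  unfolding modular_matrix_def
proof (rule the_equality)
  have n: "0 < n" and v: "v \<in> carrier_mat n n"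
    using irr by (auto simp: irreducible_corep_def matrix_corep_def)
  have Fc: "F \<in> carrier_mat n n" using F by (simp add: positive_definite_def)
  have GF: "G * F = 1\<^sub>m n" by (rule mat_mult_left_right_inverse[OF Fc G FG])
  have S2': "map_mat (\<lambda>a. antipode H (antipode H a)) v = scalar_mat H F * v * scalar_mat H G"
    using v Fc G scalar_mat_conj_index[OF Fc G v] S2 by (intro eq_matI) (auto simp: scalar_mat_def)
  show "positive_definite n F \<and> (\<exists>G\<in>carrier_mat n n. F * G = 1\<^sub>m n \<and> G * F = 1\<^sub>m n \<and>
      map_mat (\<lambda>a. antipode H (antipode H a)) v = scalar_mat H F * v * scalar_mat H G \<and>
      mat_trace F = mat_trace G)"
    using F G FG GF S2' tr by blast
  fix F' assume "positive_definite n F' \<and> (\<exists>G\<in>carrier_mat n n. F' * G = 1\<^sub>m n \<and> G * F' = 1\<^sub>m n \<and>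
      map_mat (\<lambda>a. antipode H (antipode H a)) v = scalar_mat H F' * v * scalar_mat H G \<and>
      mat_trace F' = mat_trace G)"
  then obtain G' where F': "positive_definite n F'" and G': "G' \<in> carrier_mat n n"
    and inv': "F' * G' = 1\<^sub>m n" "G' * F' = 1\<^sub>m n"
    and eq: "scalar_mat H F' * v * scalar_mat H G' = scalar_mat H F * v * scalar_mat H G"
    and tr': "mat_trace F' = mat_trace G'" using S2' by auto
  have F'c: "F' \<in> carrier_mat n n" using F' by (simp add: positive_definite_def)
  let ?s = "scalar_mat H"
  have sc: "?s F \<in> carrier_mat n n" "?s G \<in> carrier_mat n n" "?s F' \<in> carrier_mat n n"
    "?s G' \<in> carrier_mat n n" using Fc G F'c G' by simp_all
  note assoc = assoc_mult_mat[of _ n n _ n _ n] and c = mult_carrier_mat[of _ n n _ n]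
  have M: "G' * F \<in> carrier_mat n n" using G' Fc by (rule mult_carrier_mat)
  have ss: "?s G' * ?s F' = 1\<^sub>m n" "?s G * ?s F = 1\<^sub>m n" "?s G' * ?s F = ?s (G' * F)"
    using scalar_mat_mult[OF G' F'c] scalar_mat_mult[OF G Fc] scalar_mat_mult[OF G' Fc] inv' GF
    by (simp_all add: scalar_mat_one)
  have "?s G' * (?s F' * v * ?s G') * ?s F = ?s G' * (?s F * v * ?s G) * ?s F"
    by (simp add: eq)
  moreover have "?s G' * (?s F' * v * ?s G') * ?s F = (?s G' * ?s F') * (v * (?s G' * ?s F))"
    using sc v by (simp add: assoc c)
  moreover have "?s G' * (?s F * v * ?s G) * ?s F = (?s G' * ?s F) * (v * (?s G * ?s F))"
    using sc v by (simp add: assoc c)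
  ultimately have comm: "v * ?s (G' * F) = ?s (G' * F) * v"
    using v M mult_carrier_mat[OF v scalar_mat_carrier[OF M]] by (simp add: ss)
  have "(\<Sum>k<n. scl H ((G' * F) $$ (i, k)) (v $$ (k, j))) = (\<Sum>k<n. scl H ((G' * F) $$ (k, j)) (v $$ (i, k)))"
    if ij: "i < n" "j < n" for i j
    using arg_cong[OF comm, of "\<lambda>A. A $$ (i, j)"]
    unfolding scalar_mat_left_index[OF M v ij] scalar_mat_right_index[OF M v ij] by simp
  from schur[OF irr, of "\<lambda>i j. (G' * F) $$ (i, j)", OF this] obtain a where
    a: "\<And>i j. i < n \<Longrightarrow> j < n \<Longrightarrow> (G' * F) $$ (i, j) = (if i = j then a else 0)" by blast
  then have GFa: "G' * F = a \<cdot>\<^sub>m 1\<^sub>m n" using G' Fc by (intro eq_matI) auto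
  have "F = F' * (G' * F)"
    using inv' F'c G' Fc by (simp flip: assoc)
  then have FF': "F = a \<cdot>\<^sub>m F'" unfolding GFa using F'c by (simp add: mult_smult_distrib[of _ n n _ n])
  have "G' = (G' * F) * G"
    using FG F'c G' Fc G by (simp add: assoc)
  then have GG': "G' = a \<cdot>\<^sub>m G" unfolding GFa using G by (simp add: mult_smult_assoc_mat[of _ n n _ n])
  have trF: "mat_trace F = a * mat_trace F'"
    using F'c by (simp add: FF' mat_trace_def sum_distrib_left)
  have trG: "mat_trace G' = a * mat_trace G"
    using G by (simp add: GG' mat_trace_def sum_distrib_left)
  have "0 < Re (mat_trace F)" "0 < Re (mat_trace F')"
    using positive_definite_trace[OF F n] positive_definite_trace[OF F' n] .
  moreover have "mat_trace F = a * (a * mat_trace F)" using trF tr' trG tr by simp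
  ultimately have "a * a = 1" by (metis mult.assoc mult_cancel_right1 zero_complex.simps(1) less_irrefl)
  then have "a = 1 \<or> a = -1" by (simp add: square_eq_1_iff)
  moreover have "a \<noteq> -1"
    using trF \<open>0 < Re (mat_trace F)\<close> \<open>0 < Re (mat_trace F')\<close> by auto
  ultimately show "F' = F" using FF' F'c by auto
qed

text \<open>The matrix \<open>F\<close> is the modular matrix of \<open>v\<close> and \<open>G\<close> is its inverse, so \<open>G G\<close> is the power with exponent
  \<open>-2\<close>.\<close>

theorem modular_character_eqI:
  assumes span: "span irreducible_coefficients = UNIV" and f: "linear_form H f"
    and irr: "\<And>n v. unitary_corep H n v \<Longrightarrow> irreducible_corep H n v \<Longrightarrow>
      \<exists>F G. positive_definite n F \<and> G \<in> carrier_mat n n \<and> F * G = 1\<^sub>m n \<and> mat_trace F = mat_trace G \<and>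
        (\<forall>i<n. \<forall>j<n. antipode H (antipode H (v $$ (i, j)))
          = (\<Sum>k<n. \<Sum>l<n. scl H (F $$ (i, k) * G $$ (l, j)) (v $$ (k, l)))) \<and>
        (\<forall>i<n. \<forall>j<n. f (v $$ (i, j)) = (G * G) $$ (i, j))"
  shows "modular_character H (- 2) = f"
  unfolding modular_character_def
proof (rule the_equality)
  have val: "f (v $$ (i, j)) = posdef_power n (modular_matrix H n v) (- 2) $$ (i, j)"
    if v: "unitary_corep H n v" "irreducible_corep H n v" and ij: "i < n" "j < n" for n v i j
  proof -
    from irr[OF v] obtain F G where FG: "positive_definite n F" "G \<in> carrier_mat n n" "F * G = 1\<^sub>m n"
      "mat_trace F = mat_trace G"
      "\<forall>i<n. \<forall>j<n. antipode H (antipode H (v $$ (i, j)))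
          = (\<Sum>k<n. \<Sum>l<n. scl H (F $$ (i, k) * G $$ (l, j)) (v $$ (k, l)))"
      "\<forall>i<n. \<forall>j<n. f (v $$ (i, j)) = (G * G) $$ (i, j)" by blast
    have "modular_matrix H n v = F"
      by (rule modular_matrix_eqI[OF v(2) FG(1-3) _ FG(4)]) (use FG(5) in blast)
    then show ?thesis using posdef_power_minus2[OF FG(1-3)] FG(6) ij by simp
  qed
  then show "linear_form H f \<and> (\<forall>n v. unitary_corep H n v \<and> irreducible_corep H n v \<longrightarrow>
      (\<forall>i<n. \<forall>j<n. f (v $$ (i, j)) = posdef_power n (modular_matrix H n v) (- 2) $$ (i, j)))"
    using f by blast
  fix g assume g: "linear_form H g \<and> (\<forall>n v. unitary_corep H n v \<and> irreducible_corep H n v \<longrightarrow>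
      (\<forall>i<n. \<forall>j<n. g (v $$ (i, j)) = posdef_power n (modular_matrix H n v) (- 2) $$ (i, j)))"
  show "g = f"
  proof
    fix a
    have "g x = f x" if "x \<in> irreducible_coefficients" for x
      using that g val unfolding irreducible_coefficients_def by auto
    then show "g a = f a"
      using linear_form_eq_on_span[of g f irreducible_coefficients a] g f span by auto
  qed
qed

end

section \<open>Universal r-forms in terms of matrix coefficients\<close>

definition mmul :: "'i set \<Rightarrow> ('i \<Rightarrow> 'i \<Rightarrow> 'b::semiring_0) \<Rightarrow> ('i \<Rightarrow> 'i \<Rightarrow> 'b) \<Rightarrow> 'i \<Rightarrow> 'i \<Rightarrow> 'b" where
  "mmul K X Y = (\<lambda>x y. \<Sum>z\<in>K. X x z * Y z y)"

text \<open>Cutting off outside the index set makes equality of matrices equality of functions.\<close>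

definition cut :: "'i set \<Rightarrow> ('i \<Rightarrow> 'i \<Rightarrow> 'b::zero) \<Rightarrow> 'i \<Rightarrow> 'i \<Rightarrow> 'b" where
  "cut K X = (\<lambda>x y. if x \<in> K \<and> y \<in> K then X x y else 0)"

definition unit_matrix :: "'i \<Rightarrow> 'i \<Rightarrow> 'b::zero_neq_one" where
  "unit_matrix x y = (if x = y then 1 else 0)"

lemma mmul_assoc: "mmul K (mmul K X Y) Z = mmul K X (mmul K Y Z)"
  by (intro ext) (simp add: mmul_def sum_distrib_left sum_distrib_right mult.assoc, rule sum.swap)

lemma mmul_cut_one [simp]:
  fixes X :: "'i \<Rightarrow> 'i \<Rightarrow> 'b::ring_1"
  assumes "finite K"
  shows "mmul K (cut K unit_matrix) (cut K X) = cut K X"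
    and "mmul K (cut K X) (cut K unit_matrix) = cut K X"
  using assms
  by (auto simp: mmul_def cut_def unit_matrix_def fun_eq_iff if_distrib[of "\<lambda>x. x * _"]
      if_distrib[of "\<lambda>x. _ * x"] cong: if_cong)

lemma mmul_cut_eqI:
  "(\<And>x y. x \<in> K \<Longrightarrow> y \<in> K \<Longrightarrow> (\<Sum>z\<in>K. X x z * Y z y) = Z x y) \<Longrightarrow> mmul K (cut K X) (cut K Y) = cut K Z"
  by (auto simp: mmul_def cut_def fun_eq_iff)

lemma mmul_cut_eq_mmulI:
  assumes "\<And>x y. x \<in> K \<Longrightarrow> y \<in> K \<Longrightarrow> (\<Sum>z\<in>K. X x z * Y z y) = (\<Sum>z\<in>K. X' x z * Y' z y)"
  shows "mmul K (cut K X) (cut K Y) = mmul K (cut K X') (cut K Y')"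
proof -
  have "mmul K (cut K X) (cut K Y) x y = mmul K (cut K X') (cut K Y') x y" for x y
    using assms[of x y] by (cases "x \<in> K \<and> y \<in> K") (auto simp: mmul_def cut_def)
  then show ?thesis by blast
qed

lemma mmul_cut_app: "x \<in> K \<Longrightarrow> y \<in> K \<Longrightarrow> mmul K (cut K X) (cut K Y) x y = (\<Sum>z\<in>K. X x z * Y z y)"
  by (simp add: mmul_def cut_def)

context hopf_star_algebra
begin

lemma sweedler_swap:
  "sweedler H (\<lambda>x y. sweedler H (\<lambda>x' y'. F x y x' y') b) a
    = sweedler H (\<lambda>x' y'. sweedler H (\<lambda>x y. F x y x' y') a) (b :: 'a)"
  for F :: "'a \<Rightarrow> 'a \<Rightarrow> 'a \<Rightarrow> 'a \<Rightarrow> 'c::comm_monoid_add"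
proof -
  have z: "(\<Sum>(x, y)\<leftarrow>s. 0 :: 'c) = 0" for s :: "('a \<times> 'a) list" by (induction s) auto
  have a: "(\<Sum>(x, y)\<leftarrow>s. G x y + G' x y) = (\<Sum>(x, y)\<leftarrow>s. G x y) + (\<Sum>(x, y)\<leftarrow>s. G' x y)"
    for s :: "('a \<times> 'a) list" and G G' :: "'a \<Rightarrow> 'a \<Rightarrow> 'c"
    by (induction s) (auto simp: ac_simps)
  have "(\<Sum>(x, y)\<leftarrow>s. \<Sum>(x', y')\<leftarrow>t. F x y x' y') = (\<Sum>(x', y')\<leftarrow>t. \<Sum>(x, y)\<leftarrow>s. F x y x' y')"
    for s t
    by (induction s) (auto simp: z a)
  then show ?thesis by (simp add: sweedler_def)
qed

text \<open>Multiply the relation by the inverse of \<open>R\<close> from both sides.\<close>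

lemma intertwiner_inverse:
  fixes R Rb :: "'i \<Rightarrow> 'i \<Rightarrow> complex" and M M' :: "'i \<Rightarrow> 'i \<Rightarrow> 'a"
  assumes K: "finite K" and x: "x \<in> K" and z: "z \<in> K"
    and l: "\<And>x y. x \<in> K \<Longrightarrow> y \<in> K \<Longrightarrow> (\<Sum>k\<in>K. Rb x k * R k y) = (if x = y then 1 else 0)"
    and r: "\<And>x y. x \<in> K \<Longrightarrow> y \<in> K \<Longrightarrow> (\<Sum>k\<in>K. R x k * Rb k y) = (if x = y then 1 else 0)"
    and eq: "\<And>x z. x \<in> K \<Longrightarrow> z \<in> K \<Longrightarrow> (\<Sum>y\<in>K. scl H (R x y) (M y z)) = (\<Sum>y\<in>K. scl H (R y z) (M' x y))"
  shows "(\<Sum>y\<in>K. scl H (Rb x y) (M' y z)) = (\<Sum>y\<in>K. scl H (Rb y z) (M x y))"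
proof -
  have "(\<Sum>y\<in>K. scl H (Rb x y) (M' y z))
      = (\<Sum>y\<in>K. scl H (Rb x y) (\<Sum>u\<in>K. scl H (\<Sum>k\<in>K. R u k * Rb k z) (M' y u)))"
    using r z K by (intro sum.cong refl) (simp add: if_distrib[of "\<lambda>c. scl H c _"] cong: if_cong)
  also have "\<dots> = (\<Sum>y\<in>K. \<Sum>u\<in>K. \<Sum>k\<in>K. scl H (Rb x y * (R u k * Rb k z)) (M' y u))"
    by (simp add: scale_sum_left scale_sum_right)
  also have "\<dots> = (\<Sum>y\<in>K. \<Sum>k\<in>K. \<Sum>u\<in>K. scl H (Rb x y * (R u k * Rb k z)) (M' y u))"
    by (intro sum.cong refl sum.swap)
  also have "\<dots> = (\<Sum>y\<in>K. \<Sum>k\<in>K. scl H (Rb x y * Rb k z) (\<Sum>u\<in>K. scl H (R u k) (M' y u)))"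
    by (simp add: scale_sum_right mult_ac)
  also have "\<dots> = (\<Sum>y\<in>K. \<Sum>k\<in>K. scl H (Rb x y * Rb k z) (\<Sum>u\<in>K. scl H (R y u) (M u k)))"
    using eq by simp
  also have "\<dots> = (\<Sum>y\<in>K. \<Sum>k\<in>K. \<Sum>u\<in>K. scl H (Rb k z * (Rb x y * R y u)) (M u k))"
    by (simp add: scale_sum_right mult_ac)
  also have "\<dots> = (\<Sum>k\<in>K. \<Sum>y\<in>K. \<Sum>u\<in>K. scl H (Rb k z * (Rb x y * R y u)) (M u k))"
    by (rule sum.swap)
  also have "\<dots> = (\<Sum>k\<in>K. \<Sum>u\<in>K. \<Sum>y\<in>K. scl H (Rb k z * (Rb x y * R y u)) (M u k))"
    by (intro sum.cong refl sum.swap)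
  also have "\<dots> = (\<Sum>k\<in>K. scl H (Rb k z) (\<Sum>u\<in>K. scl H (\<Sum>y\<in>K. Rb x y * R y u) (M u k)))"
    by (simp add: scale_sum_left scale_sum_right)
  also have "\<dots> = (\<Sum>k\<in>K. scl H (Rb k z) (M x k))"
    using l x K by (intro sum.cong refl) (simp add: scl_if if_distrib[of "\<lambda>c. scl H c _"] cong: if_cong)
  finally show ?thesis .
qed

lemma bilinear_form_sum:
  "(\<And>q. q \<in> Q \<Longrightarrow> bilinear_form H (B q)) \<Longrightarrow> bilinear_form H (\<lambda>x y. \<Sum>q\<in>Q. B q x y)"
  by (auto simp: bilinear_form_iff sum.distrib sum_distrib_left)

lemma bilinear_map_sum:
  "(\<And>q. q \<in> Q \<Longrightarrow> bilinear_map (B q)) \<Longrightarrow> bilinear_map (\<lambda>x y. \<Sum>q\<in>Q. B q x y)"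
  by (auto simp: bilinear_map_def sum.distrib scale_sum_right)

lemma conv2_corep:
  assumes v: "corep I v" "i \<in> I" "j \<in> I" and w: "corep J w" "k \<in> J" "l \<in> J"
    and R: "bilinear_form H R" and T: "bilinear_form H T"
  shows "conv2 H R T (v i j) (w k l) = (\<Sum>p\<in>I. \<Sum>q\<in>J. R (v i p) (w k q) * T (v p j) (w q l))"
proof -
  have "sweedler H (\<lambda>b1 b2. R a1 b1 * T a2 b2) (w k l) = (\<Sum>q\<in>J. R a1 (w k q) * T a2 (w q l))" for a1 a2
    using R T by (intro corep_form[OF w]) (auto simp: bilinear_form_iff algebra_simps)
  moreover have "bilinear_form H (\<lambda>a1 a2. \<Sum>q\<in>J. R a1 (w k q) * T a2 (w q l))"
    using R T by (intro bilinear_form_sum) (auto simp: bilinear_form_iff algebra_simps)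
  ultimately show ?thesis
    unfolding conv2_def using corep_form[OF v] by simp
qed

lemma conv2_bilinear:
  assumes R: "bilinear_form H R" and T: "bilinear_form H T"
  shows "bilinear_form H (conv2 H R T)"
  unfolding bilinear_form_def
proof (intro conjI allI)
  fix a
  show "linear_form H (\<lambda>b. conv2 H R T b a)"
    unfolding conv2_def using R T
    by (intro comult_linear bilinear_form_sweedler) (auto simp: bilinear_form_iff algebra_simps)
  show "linear_form H (conv2 H R T a)"
    unfolding conv2_def using R T
    by (subst sweedler_swap, intro comult_linear bilinear_form_sweedler)
      (auto simp: bilinear_form_iff algebra_simps)
qed

lemma conv_corep:
  assumes v: "corep I v" "i \<in> I" "j \<in> I" and f: "linear_form H f" and g: "linear_form H g"
  shows "conv H f g (v i j) = (\<Sum>k\<in>I. f (v i k) * g (v k j))"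
  unfolding conv_def using f g
  by (intro corep_form[OF v]) (auto simp: bilinear_form_iff linear_form_iff algebra_simps)

lemma conv_linear: "linear_form H f \<Longrightarrow> linear_form H g \<Longrightarrow> linear_form H (conv H f g)"
  unfolding conv_def by (intro comult_linear) (auto simp: bilinear_form_iff linear_form_iff algebra_simps)

lemma corep_cong:
  assumes v: "corep I v" and eq: "\<And>i j. i \<in> I \<Longrightarrow> j \<in> I \<Longrightarrow> v i j = w i j"
  shows "corep I w"
  unfolding corep_def
proof (intro conjI ballI allI impI)
  show "finite I" by (rule corep_finite[OF v])
  fix i j assume ij: "i \<in> I" "j \<in> I"
  show "counit H (w i j) = (if i = j then 1 else 0)"
    using corep_counit[OF v ij] eq[OF ij] by simp
  fix B assume "bilinear_form H B"
  from corep_form[OF v ij this] show "sweedler H B (w i j) = (\<Sum>k\<in>I. B (w i k) (w k j))"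
    using eq ij by simp
qed

lemma ucorep_one: "ucorep {0 :: nat} (\<lambda>_ _. 1)"
proof (rule ucorepI)
  show "corep {0 :: nat} (\<lambda>_ _. 1)"
    by (simp add: corep_def sweedler_one counit_one)
qed (simp add: star_one)

lemma antipode_one: "antipode H 1 = 1"
  using ucorep_antipode[OF ucorep_one, of 0 0] by (simp add: star_one)

end

text \<open>The defining property of a CQG algebra. Natural numbers suffice as indices, by renumbering.\<close>

locale cqg_algebra = hopf_star_algebra H for H :: "('a::ring_1) hopf_star" +
  assumes coefficients_span:
    "span {v i j | (I :: nat set) v i j. ucorep I v \<and> i \<in> I \<and> j \<in> I} = UNIV"
begin

lemma form_eqI:
  assumes f: "linear_form H f" and g: "linear_form H g"
    and eq: "\<And>(I :: nat set) v i j. ucorep I v \<Longrightarrow> i \<in> I \<Longrightarrow> j \<in> I \<Longrightarrow> f (v i j) = g (v i j)"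
  shows "f a = g a"
  by (rule linear_form_eq_on_span[OF f g, of "{v i j | (I :: nat set) v i j. ucorep I v \<and> i \<in> I \<and> j \<in> I}"])
    (use eq in \<open>auto simp: coefficients_span\<close>)

lemma bilinear_form_eqI:
  assumes f: "bilinear_form H f" and g: "bilinear_form H g"
    and eq: "\<And>(I :: nat set) v i j (J :: nat set) w k l. ucorep I v \<Longrightarrow> i \<in> I \<Longrightarrow> j \<in> I \<Longrightarrow>
      ucorep J w \<Longrightarrow> k \<in> J \<Longrightarrow> l \<in> J \<Longrightarrow> f (v i j) (w k l) = g (v i j) (w k l)"
  shows "f a b = g a b"
proof (rule form_eqI[of "f a" "g a"])
  fix J :: "nat set" and w k l assume w: "ucorep J w" "k \<in> J" "l \<in> J"
  show "f a (w k l) = g a (w k l)"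
    by (rule form_eqI[of "\<lambda>a. f a (w k l)" "\<lambda>a. g a (w k l)"])
      (use f g eq w in \<open>auto simp: bilinear_form_def\<close>)
qed (use f g in \<open>auto simp: bilinear_form_def\<close>)

lemma bilinear_map_eqI:
  assumes f: "bilinear_map f" and g: "bilinear_map g"
    and eq: "\<And>(I :: nat set) v i j (J :: nat set) w k l. ucorep I v \<Longrightarrow> i \<in> I \<Longrightarrow> j \<in> I \<Longrightarrow>
      ucorep J w \<Longrightarrow> k \<in> J \<Longrightarrow> l \<in> J \<Longrightarrow> f (v i j) (w k l) = g (v i j) (w k l)"
  shows "f a b = g a b"
proof (rule linear_forms_separate)
  fix h assume "linear_form H h"
  then show "h (f a b) = h (g a b)"
    using bilinear_form_eqI[OF linear_form_bilinear_map[OF _ f] linear_form_bilinear_map[OF _ g], of h h a b] eq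
    by auto
qed

lemma antipode_mult: "antipode H (a * b) = antipode H b * antipode H a"
proof (rule bilinear_map_eqI[of "\<lambda>a b. antipode H (a * b)" "\<lambda>a b. antipode H b * antipode H a"])
  fix I J :: "nat set" and v w i j k l
  assume v: "ucorep I v" "i \<in> I" "j \<in> I" and w: "ucorep J w" "k \<in> J" "l \<in> J"
  have cv: "corep I v" and cw: "corep J w" using v w by (auto simp: ucorep_corep)
  let ?x = "\<lambda>p q. antipode H (w (snd p) (snd q)) * antipode H (v (fst p) (fst q))"
  have "antipode H (tensor_corep v w (i, k) (j, l)) = ?x (i, k) (j, l)"
  proof (rule corep_antipode_eqI_left[OF corep_tensor[OF cv cw]])
    fix p q assume p: "p \<in> I \<times> J" and q: "q \<in> I \<times> J"
    have "(\<Sum>m\<in>I \<times> J. ?x p m * tensor_corep v w m q)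
      = (\<Sum>b\<in>J. antipode H (w (snd p) b) * (\<Sum>a\<in>I. antipode H (v (fst p) a) * v a (fst q)) * w b (snd q))"
      by (simp add: tensor_corep_def sum.cartesian_product' sum_distrib_left sum_distrib_right mult.assoc)
        (rule sum.swap)
    also have "\<dots> = (if p = q then 1 else 0)"
      using p q corep_antipode_left[OF cv] corep_antipode_left[OF cw] by (auto simp: prod_eq_iff)
    finally show "(\<Sum>m\<in>I \<times> J. ?x p m * tensor_corep v w m q) = (if p = q then 1 else 0)" .
  qed (use v w in auto)
  then show "antipode H (v i j * w k l) = antipode H (w k l) * antipode H (v i j)"
    by (simp add: tensor_corep_def)
qed (auto simp: bilinear_map_def antipode_add antipode_scl scl_mult_left scl_mult_right algebra_simps)

text \<open>By unitarity this is the complex conjugate of \<open>v\<close>.\<close>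

lemma corep_antipode_transpose:
  assumes v: "ucorep I v"
  shows "corep I (\<lambda>i j. antipode H (v j i))"
proof (rule corep_cong[OF corep_conj[OF ucorep_corep[OF v]]])
  show "star H (v i j) = antipode H (v j i)" if "i \<in> I" "j \<in> I" for i j
    using ucorep_antipode[OF v] that by simp
qed

end

locale r_form_algebra = cqg_algebra H for H :: "('a::ring_1) hopf_star" +
  fixes r :: "'a \<Rightarrow> 'a \<Rightarrow> complex"
  assumes universal: "universal_r_form H r"
begin

lemma bilinear: "bilinear_form H r"
  and invertible: "\<exists>s. is_conv_inverse H r s"
  using universal unfolding universal_r_form_def by blast+

lemma axiom_right: "r c (a * b) = sweedler H (\<lambda>c1 c2. r c1 b * r c2 a) c"
  and axiom_left: "r (a * b) c = sweedler H (\<lambda>c1 c2. r a c1 * r b c2) c"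
  and axiom_commute:
    "sweedler H (\<lambda>a1 a2. sweedler H (\<lambda>b1 b2. scl H (r a1 b1) (a2 * b2)) b) a =
     sweedler H (\<lambda>a1 a2. sweedler H (\<lambda>b1 b2. scl H (r a2 b2) (b1 * a1)) b) a"
  using universal unfolding universal_r_form_def by blast+

lemma linear_left: "linear_form H (\<lambda>a. r a b)"
  and linear_right: "linear_form H (r a)"
  using bilinear by (auto simp: bilinear_form_def)

lemma mult_right:
  assumes v: "corep I v" "i \<in> I" "j \<in> I"
  shows "r (v i j) (a * b) = (\<Sum>k\<in>I. r (v i k) b * r (v k j) a)"
proof -
  have "r (v i j) (a * b) = sweedler H (\<lambda>c1 c2. r c1 b * r c2 a) (v i j)"
    by (rule axiom_right)
  also have "\<dots> = (\<Sum>k\<in>I. r (v i k) b * r (v k j) a)"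
    using bilinear by (intro corep_form[OF v]) (auto simp: bilinear_form_iff algebra_simps)
  finally show ?thesis .
qed

lemma mult_left:
  assumes v: "corep I v" "i \<in> I" "j \<in> I"
  shows "r (a * b) (v i j) = (\<Sum>k\<in>I. r a (v i k) * r b (v k j))"
proof -
  have "r (a * b) (v i j) = sweedler H (\<lambda>c1 c2. r a c1 * r b c2) (v i j)"
    by (rule axiom_left)
  also have "\<dots> = (\<Sum>k\<in>I. r a (v i k) * r b (v k j))"
    using bilinear by (intro corep_form[OF v]) (auto simp: bilinear_form_iff algebra_simps)
  finally show ?thesis .
qed

text \<open>Stated for arbitrary \<open>B\<close> and \<open>m\<close> in order to apply both to \<open>r\<close> and to its flipped inverse.\<close>

lemma quasi_commutative_side:
  assumes v: "corep I v" "i \<in> I" "j \<in> I" and w: "corep J w" "k \<in> J" "l \<in> J"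
    and B: "bilinear_form H B" and m: "bilinear_map m"
  shows "sweedler H (\<lambda>a1 a2. sweedler H (\<lambda>b1 b2. scl H (B a1 b1) (m a2 b2)) (w k l)) (v i j)
      = (\<Sum>p\<in>I. \<Sum>q\<in>J. scl H (B (v i p) (w k q)) (m (v p j) (w q l)))"
    and "sweedler H (\<lambda>a1 a2. sweedler H (\<lambda>b1 b2. scl H (B a2 b2) (m a1 b1)) (w k l)) (v i j)
      = (\<Sum>p\<in>I. \<Sum>q\<in>J. scl H (B (v p j) (w q l)) (m (v i p) (w k q)))"
proof -
  have 1: "sweedler H (\<lambda>b1 b2. scl H (B a1 b1) (m a2 b2)) (w k l)
      = (\<Sum>q\<in>J. scl H (B a1 (w k q)) (m a2 (w q l)))" for a1 a2
    using B m by (intro corep_map[OF w]) (auto simp: bilinear_form_iff bilinear_map_def algebra_simps)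
  have 2: "bilinear_map (\<lambda>a1 a2. \<Sum>q\<in>J. scl H (B a1 (w k q)) (m a2 (w q l)))"
    using B m by (intro bilinear_map_sum) (auto simp: bilinear_form_iff bilinear_map_def algebra_simps)
  show "sweedler H (\<lambda>a1 a2. sweedler H (\<lambda>b1 b2. scl H (B a1 b1) (m a2 b2)) (w k l)) (v i j)
      = (\<Sum>p\<in>I. \<Sum>q\<in>J. scl H (B (v i p) (w k q)) (m (v p j) (w q l)))"
    unfolding 1 by (rule corep_map[OF v 2])
  have 1: "sweedler H (\<lambda>b1 b2. scl H (B a2 b2) (m a1 b1)) (w k l)
      = (\<Sum>q\<in>J. scl H (B a2 (w q l)) (m a1 (w k q)))" for a1 a2
    using B m by (intro corep_map[OF w]) (auto simp: bilinear_form_iff bilinear_map_def algebra_simps)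
  have 2: "bilinear_map (\<lambda>a1 a2. \<Sum>q\<in>J. scl H (B a2 (w q l)) (m a1 (w k q)))"
    using B m by (intro bilinear_map_sum) (auto simp: bilinear_form_iff bilinear_map_def algebra_simps)
  show "sweedler H (\<lambda>a1 a2. sweedler H (\<lambda>b1 b2. scl H (B a2 b2) (m a1 b1)) (w k l)) (v i j)
      = (\<Sum>p\<in>I. \<Sum>q\<in>J. scl H (B (v p j) (w q l)) (m (v i p) (w k q)))"
    unfolding 1 by (rule corep_map[OF v 2])
qed

lemma bilinear_mult: "bilinear_map (\<lambda>x y. x * y)" "bilinear_map (\<lambda>x y. y * x)"
  by (auto simp: bilinear_map_def scl_mult_left scl_mult_right algebra_simps)

lemma quasi_commutative:
  assumes v: "corep I v" "i \<in> I" "j \<in> I" and w: "corep J w" "k \<in> J" "l \<in> J"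
  shows "(\<Sum>p\<in>I. \<Sum>q\<in>J. scl H (r (v i p) (w k q)) (v p j * w q l))
    = (\<Sum>p\<in>I. \<Sum>q\<in>J. scl H (r (v p j) (w q l)) (w k q * v i p))"
  by (rule trans[OF quasi_commutative_side(1)[OF v w bilinear bilinear_mult(1), symmetric]
        trans[OF axiom_commute quasi_commutative_side(2)[OF v w bilinear bilinear_mult(2)]]])

text \<open>This gives the values of \<open>r\<close> at the unit: the matrix with entries \<open>r(1 \<otimes> v\<^sub>i\<^sub>j)\<close> is idempotent by the
  multiplication rule for \<open>1 = 1 1\<close>, and invertible because \<open>r\<close> is.\<close>

lemma idempotent_invertible:
  fixes X Y :: "'i \<Rightarrow> 'i \<Rightarrow> complex"
  assumes J: "finite J" "k \<in> J" "l \<in> J"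
    and idem: "\<And>k l. k \<in> J \<Longrightarrow> l \<in> J \<Longrightarrow> (\<Sum>q\<in>J. X k q * X q l) = X k l"
    and inv: "\<And>k l. k \<in> J \<Longrightarrow> l \<in> J \<Longrightarrow> (\<Sum>q\<in>J. X k q * Y q l) = (if k = l then 1 else 0)"
  shows "X k l = (if k = l then 1 else 0)"
proof -
  have i: "mmul J (cut J X) (cut J X) = cut J X" by (rule mmul_cut_eqI) (rule idem)
  have v: "mmul J (cut J X) (cut J Y) = cut J unit_matrix"
    by (rule mmul_cut_eqI) (simp add: inv unit_matrix_def)
  have "cut J X = mmul J (mmul J (cut J X) (cut J X)) (cut J Y)"
    unfolding mmul_assoc v using J(1) by simp
  then have "cut J X = cut J unit_matrix" unfolding i v .
  then show ?thesis using J by (auto simp: cut_def unit_matrix_def fun_eq_iff split: if_splits)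
qed

lemma one_left: "r 1 a = counit H a"
proof (rule form_eqI[of "r 1" "counit H"])
  fix I :: "nat set" and v i j assume v: "ucorep I v" and ij: "i \<in> I" "j \<in> I"
  have c: "corep I v" by (rule ucorep_corep[OF v])
  obtain s where s: "bilinear_form H s" "conv2 H r s = (\<lambda>a b. counit H a * counit H b)"
    using invertible by (auto simp: is_conv_inverse_def)
  have "r 1 (v i j) = (if i = j then 1 else 0)"
  proof (rule idempotent_invertible[OF corep_finite[OF c] ij, of "\<lambda>i j. r 1 (v i j)" "\<lambda>i j. s 1 (v i j)"])
    fix k l assume "k \<in> I" "l \<in> I"
    then show "(\<Sum>q\<in>I. r 1 (v k q) * r 1 (v q l)) = r 1 (v k l)"
      using mult_left[OF c, of k l 1 1] by simp
    show "(\<Sum>q\<in>I. r 1 (v k q) * s 1 (v q l)) = (if k = l then 1 else 0)"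
      using conv2_corep[OF ucorep_corep[OF ucorep_one], of 0 0 I v k l, OF _ _ c _ _ bilinear s(1)]
        \<open>k \<in> I\<close> \<open>l \<in> I\<close> by (simp add: s(2) counit_one corep_counit[OF c])
  qed
  then show "r 1 (v i j) = counit H (v i j)" using corep_counit[OF c ij] by simp
qed (rule linear_right, rule counit_linear)

lemma one_right: "r a 1 = counit H a"
proof (rule form_eqI[of "\<lambda>a. r a 1" "counit H"])
  fix I :: "nat set" and v i j assume v: "ucorep I v" and ij: "i \<in> I" "j \<in> I"
  have c: "corep I v" by (rule ucorep_corep[OF v])
  obtain s where s: "bilinear_form H s" "conv2 H r s = (\<lambda>a b. counit H a * counit H b)"
    using invertible by (auto simp: is_conv_inverse_def)
  have "r (v i j) 1 = (if i = j then 1 else 0)"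
  proof (rule idempotent_invertible[OF corep_finite[OF c] ij, of "\<lambda>i j. r (v i j) 1" "\<lambda>i j. s (v i j) 1"])
    fix k l assume "k \<in> I" "l \<in> I"
    then show "(\<Sum>q\<in>I. r (v k q) 1 * r (v q l) 1) = r (v k l) 1"
      using mult_right[OF c, of k l 1 1] by simp
    show "(\<Sum>q\<in>I. r (v k q) 1 * s (v q l) 1) = (if k = l then 1 else 0)"
      using conv2_corep[OF c \<open>k \<in> I\<close> \<open>l \<in> I\<close> ucorep_corep[OF ucorep_one], of 0 0, OF _ _ bilinear s(1)]
      by (simp add: s(2) counit_one corep_counit[OF c] \<open>k \<in> I\<close> \<open>l \<in> I\<close>)
  qed
  then show "r (v i j) 1 = counit H (v i j)" using corep_counit[OF c ij] by simp
qed (rule linear_left, rule counit_linear)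

text \<open>This is the convolution inverse of \<open>r\<close>, because multiplicativity in the first argument contracts
  \<open>a\<^sub>1 S(a\<^sub>2)\<close> and \<open>S(a\<^sub>1) a\<^sub>2\<close>.\<close>

definition rb :: "'a \<Rightarrow> 'a \<Rightarrow> complex" where
  "rb a b = r (antipode H a) b"

lemma rb_bilinear: "bilinear_form H rb"
  using bilinear by (auto simp: rb_def bilinear_form_iff antipode_add antipode_scl)

lemma rb_linear_left: "linear_form H (\<lambda>a. rb a b)"
  and rb_linear_right: "linear_form H (rb a)"
  using rb_bilinear by (auto simp: bilinear_form_def)

lemma r_rb:
  assumes v: "corep I v" "i \<in> I" "j \<in> I" and w: "corep J w" "k \<in> J" "l \<in> J"
  shows "(\<Sum>p\<in>I. \<Sum>q\<in>J. r (v i p) (w k q) * rb (v p j) (w q l)) = (if i = j \<and> k = l then 1 else 0)"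
    and "(\<Sum>p\<in>I. \<Sum>q\<in>J. rb (v i p) (w k q) * r (v p j) (w q l)) = (if i = j \<and> k = l then 1 else 0)"
proof -
  have "(\<Sum>p\<in>I. \<Sum>q\<in>J. r (v i p) (w k q) * rb (v p j) (w q l)) = r (\<Sum>p\<in>I. v i p * antipode H (v p j)) (w k l)"
    by (simp add: linear_form_sum[OF linear_left] mult_left[OF w] rb_def)
  then show "(\<Sum>p\<in>I. \<Sum>q\<in>J. r (v i p) (w k q) * rb (v p j) (w q l)) = (if i = j \<and> k = l then 1 else 0)"
    unfolding corep_antipode_right[OF v]
    by (auto simp: one_left linear_form_zero[OF linear_left] corep_counit[OF w(1)] w)
  have "(\<Sum>p\<in>I. \<Sum>q\<in>J. rb (v i p) (w k q) * r (v p j) (w q l)) = r (\<Sum>p\<in>I. antipode H (v i p) * v p j) (w k l)"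
    by (simp add: linear_form_sum[OF linear_left] mult_left[OF w] rb_def)
  then show "(\<Sum>p\<in>I. \<Sum>q\<in>J. rb (v i p) (w k q) * r (v p j) (w q l)) = (if i = j \<and> k = l then 1 else 0)"
    unfolding corep_antipode_left[OF v]
    by (auto simp: one_left linear_form_zero[OF linear_left] corep_counit[OF w(1)] w)
qed

lemma is_conv_inverse_rb: "is_conv_inverse H r rb"
proof -
  have e: "bilinear_form H (\<lambda>a b. counit H a * counit H b)"
    using counit_linear by (auto simp: bilinear_form_iff linear_form_iff algebra_simps)
  have "conv2 H r rb a b = counit H a * counit H b" for a b
    by (rule bilinear_form_eqI[OF conv2_bilinear[OF bilinear rb_bilinear] e])
      (simp add: conv2_corep[OF ucorep_corep _ _ ucorep_corep _ _ bilinear rb_bilinear]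
        r_rb[OF ucorep_corep _ _ ucorep_corep] corep_counit[OF ucorep_corep])
  moreover have "conv2 H rb r a b = counit H a * counit H b" for a b
    by (rule bilinear_form_eqI[OF conv2_bilinear[OF rb_bilinear bilinear] e])
      (simp add: conv2_corep[OF ucorep_corep _ _ ucorep_corep _ _ rb_bilinear bilinear]
        r_rb[OF ucorep_corep _ _ ucorep_corep] corep_counit[OF ucorep_corep])
  ultimately show ?thesis by (simp add: is_conv_inverse_def rb_bilinear fun_eq_iff)
qed

lemma conv_inverse_unique:
  assumes s: "is_conv_inverse H r s"
  shows "s a b = rb a b"
proof (rule bilinear_form_eqI[of s rb])
  show sb: "bilinear_form H s" using s by (simp add: is_conv_inverse_def)
  fix I J :: "nat set" and v w i j k l
  assume v: "ucorep I v" "i \<in> I" "j \<in> I" and w: "ucorep J w" "k \<in> J" "l \<in> J"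
  have cv: "corep I v" and cw: "corep J w" using v w by (auto simp: ucorep_corep)
  let ?M = "\<lambda>B p q. B (v (fst p) (fst q)) (w (snd p) (snd q)) :: complex"
  have "?M rb (i, k) (j, l) = ?M s (i, k) (j, l)"
  proof (rule matrix_inverse_unique[of "I \<times> J" "(i, k)" "(j, l)" "?M rb" "?M r" "?M s"])
    show "finite (I \<times> J)" using corep_finite[OF cv] corep_finite[OF cw] by simp
    fix p q assume p: "p \<in> I \<times> J" and q: "q \<in> I \<times> J"
    show "(\<Sum>m\<in>I \<times> J. ?M rb p m * ?M r m q) = (if p = q then 1 else 0)"
      using r_rb(2)[OF cv _ _ cw, of "fst p" "fst q" "snd p" "snd q"] p q
      by (auto simp: sum.cartesian_product' prod_eq_iff)
    have "(\<Sum>m\<in>I \<times> J. ?M r p m * ?M s m q) = conv2 H r s (v (fst p) (fst q)) (w (snd p) (snd q))"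
      using p q by (subst conv2_corep[OF cv _ _ cw _ _ bilinear sb]) (auto simp: sum.cartesian_product')
    also have "\<dots> = (if p = q then 1 else 0)"
      using s p q corep_counit[OF cv] corep_counit[OF cw] by (auto simp: is_conv_inverse_def prod_eq_iff)
    finally show "(\<Sum>m\<in>I \<times> J. ?M r p m * ?M s m q) = (if p = q then 1 else 0)" .
  qed (use v w in auto)
  then show "s (v i j) (w k l) = rb (v i j) (w k l)" by simp
qed (rule rb_bilinear)

lemma conv_inverse_eq: "conv_inverse H r = rb"
  unfolding conv_inverse_def
  by (rule the_equality[of "is_conv_inverse H r", OF is_conv_inverse_rb]) (intro ext conv_inverse_unique)

lemma rbar21_eq: "rbar21 H r a b = rb b a"
  by (simp add: rbar21_def conv_inverse_eq)

text \<open>Quasi-commutativity says that the matrix of \<open>r\<close> intertwines the two orders of multiplication; here it is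
  inverted.\<close>

lemma rb_quasi_commutative:
  assumes v: "corep I v" "i \<in> I" "j \<in> I" and w: "corep J w" "k \<in> J" "l \<in> J"
  shows "(\<Sum>p\<in>I. \<Sum>q\<in>J. scl H (rb (v i p) (w k q)) (w q l * v p j))
    = (\<Sum>p\<in>I. \<Sum>q\<in>J. scl H (rb (v p j) (w q l)) (v i p * w k q))"
proof -
  let ?M = "\<lambda>B p q. B (v (fst p) (fst q)) (w (snd p) (snd q)) :: complex"
  have fin: "finite (I \<times> J)" using corep_finite[OF v(1)] corep_finite[OF w(1)] by simp
  have "(\<Sum>y\<in>I \<times> J. scl H (?M rb (i, k) y) (w (snd y) (snd (j, l)) * v (fst y) (fst (j, l))))
    = (\<Sum>y\<in>I \<times> J. scl H (?M rb y (j, l)) (v (fst (i, k)) (fst y) * w (snd (i, k)) (snd y)))"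
  proof (rule intertwiner_inverse[OF fin, where R = "?M r" and
        M = "\<lambda>x y. v (fst x) (fst y) * w (snd x) (snd y)" and M' = "\<lambda>x y. w (snd x) (snd y) * v (fst x) (fst y)"])
    fix x y assume x: "x \<in> I \<times> J" and y: "y \<in> I \<times> J"
    then show "(\<Sum>m\<in>I \<times> J. ?M rb x m * ?M r m y) = (if x = y then 1 else 0)"
      "(\<Sum>m\<in>I \<times> J. ?M r x m * ?M rb m y) = (if x = y then 1 else 0)"
      using r_rb[OF v(1) _ _ w(1), of "fst x" "fst y" "snd x" "snd y"]
      by (auto simp: sum.cartesian_product' prod_eq_iff)
    show "(\<Sum>m\<in>I \<times> J. scl H (?M r x m) (v (fst m) (fst y) * w (snd m) (snd y)))
      = (\<Sum>m\<in>I \<times> J. scl H (?M r m y) (w (snd x) (snd m) * v (fst x) (fst m)))"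
      using quasi_commutative[OF v(1) _ _ w(1), of "fst x" "fst y" "snd x" "snd y"] x y
      by (auto simp: sum.cartesian_product')
  qed (use v w in auto)
  then show ?thesis by (simp add: sum.cartesian_product')
qed

lemma flip_inverse:
  assumes "is_conv_inverse H s s'" and "bilinear_form H s"
  shows "is_conv_inverse H (\<lambda>a b. s b a) (\<lambda>a b. s' b a)"
proof -
  have flip: "conv2 H (\<lambda>a b. X b a) (\<lambda>a b. Y b a) = (\<lambda>a b. conv2 H X Y b a)" for X Y
    unfolding conv2_def by (intro ext) (rule sweedler_swap)
  have "bilinear_form H (\<lambda>a b. s' b a)" using assms by (auto simp: is_conv_inverse_def bilinear_form_def)
  then show ?thesis
    using assms flip[of s s'] flip[of s' s] by (simp add: is_conv_inverse_def mult.commute)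
qed

text \<open>The multiplication rules of the flipped inverse form are those of \<open>r\<close> with the roles of the two
  arguments interchanged, since \<open>S\<close> reverses products and coproducts. Quasi-commutativity is
  \<open>rb_quasi_commutative\<close>.\<close>

lemma universal_rbar21: "universal_r_form H (rbar21 H r)"
proof -
  let ?t = "\<lambda>a b. rb b a"
  have t: "rbar21 H r = ?t" by (intro ext rbar21_eq)
  have bl: "bilinear_form H ?t" using rb_bilinear by (auto simp: bilinear_form_def)
  have "is_conv_inverse H rb r"
    using is_conv_inverse_rb bilinear by (auto simp: is_conv_inverse_def)
  then have inv: "\<exists>s. is_conv_inverse H ?t s" using flip_inverse[OF _ rb_bilinear] by blast
  have 1: "?t c (a * b) = sweedler H (\<lambda>c1 c2. ?t c1 b * ?t c2 a) c" for a b c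
    unfolding rb_def antipode_mult by (rule axiom_left)
  have 2: "?t (a * b) c = sweedler H (\<lambda>c1 c2. ?t a c1 * ?t b c2) c" for a b c
  proof (rule form_eqI[of "?t (a * b)"])
    show "linear_form H (\<lambda>c. rb c (a * b))" by (rule rb_linear_left)
    have B: "bilinear_form H (\<lambda>c1 c2. rb c1 a * rb c2 b)"
      using rb_bilinear by (auto simp: bilinear_form_iff algebra_simps)
    then show "linear_form H (sweedler H (\<lambda>c1 c2. rb c1 a * rb c2 b))" by (rule comult_linear)
    fix I :: "nat set" and v i j assume v: "ucorep I v" "i \<in> I" "j \<in> I"
    have "rb (v i j) (a * b) = (\<Sum>k\<in>I. rb (v i k) a * rb (v k j) b)"
      using mult_right[OF corep_antipode_transpose[OF v(1)] v(3,2), of a b]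
      by (simp add: rb_def mult.commute)
    then show "rb (v i j) (a * b) = sweedler H (\<lambda>c1 c2. rb c1 a * rb c2 b) (v i j)"
      using corep_form[OF ucorep_corep[OF v(1)] v(2,3) B] by simp
  qed
  have 3: "sweedler H (\<lambda>a1 a2. sweedler H (\<lambda>b1 b2. scl H (?t a1 b1) (a2 * b2)) b) a =
      sweedler H (\<lambda>a1 a2. sweedler H (\<lambda>b1 b2. scl H (?t a2 b2) (b1 * a1)) b) a" for a b
  proof (rule bilinear_map_eqI[of "\<lambda>a b. sweedler H (\<lambda>a1 a2. sweedler H (\<lambda>b1 b2. scl H (?t a1 b1) (a2 * b2)) b) a"
        "\<lambda>a b. sweedler H (\<lambda>a1 a2. sweedler H (\<lambda>b1 b2. scl H (?t a2 b2) (b1 * a1)) b) a"])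
    have bil: "bilinear_map (\<lambda>a b. sweedler H (\<lambda>a1 a2. sweedler H (\<lambda>b1 b2. G a1 a2 b1 b2) b) a)"
      if G1: "\<And>a1 a2. bilinear_map (G a1 a2)" and G2: "\<And>b1 b2. bilinear_map (\<lambda>a1 a2. G a1 a2 b1 b2)"
      for G :: "'a \<Rightarrow> 'a \<Rightarrow> 'a \<Rightarrow> 'a \<Rightarrow> 'a"
    proof -
      have s: "bilinear_map (\<lambda>a1 a2. sweedler H (\<lambda>b1 b2. K a1 a2 b1 b2) b)"
        if "\<And>b1 b2. bilinear_map (\<lambda>a1 a2. K a1 a2 b1 b2)" for K :: "'a \<Rightarrow> 'a \<Rightarrow> 'a \<Rightarrow> 'a \<Rightarrow> 'a" and b
      proof -
        have "bilinear_map (\<lambda>a1 a2. \<Sum>(b1, b2)\<leftarrow>xs. K a1 a2 b1 b2)" for xs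
          using that by (induction xs) (auto simp: bilinear_map_def algebra_simps)
        then show ?thesis by (simp add: sweedler_def)
      qed
      have "linear_map (\<lambda>a. sweedler H (\<lambda>a1 a2. sweedler H (\<lambda>b1 b2. G a1 a2 b1 b2) b) a)" for b
        by (rule sweedler_linear[OF s[OF G2]])
      moreover have "linear_map (\<lambda>b. sweedler H (\<lambda>a1 a2. sweedler H (\<lambda>b1 b2. G a1 a2 b1 b2) b) a)" for a
        by (subst sweedler_swap) (rule sweedler_linear[OF s[OF G1]])
      ultimately show ?thesis by (auto simp: bilinear_map_def linear_map_iff)
    qed
    show "bilinear_map (\<lambda>a b. sweedler H (\<lambda>a1 a2. sweedler H (\<lambda>b1 b2. scl H (?t a1 b1) (a2 * b2)) b) a)"
      by (rule bil) (use bl in \<open>auto simp: bilinear_map_def bilinear_form_iff scl_mult_left scl_mult_right algebra_simps\<close>)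
    show "bilinear_map (\<lambda>a b. sweedler H (\<lambda>a1 a2. sweedler H (\<lambda>b1 b2. scl H (?t a2 b2) (b1 * a1)) b) a)"
      by (rule bil) (use bl in \<open>auto simp: bilinear_map_def bilinear_form_iff scl_mult_left scl_mult_right algebra_simps\<close>)
    fix I J :: "nat set" and v w i j k l
    assume v: "ucorep I v" "i \<in> I" "j \<in> I" and w: "ucorep J w" "k \<in> J" "l \<in> J"
    have cv: "corep I v" and cw: "corep J w" using v w by (auto simp: ucorep_corep)
    show "sweedler H (\<lambda>a1 a2. sweedler H (\<lambda>b1 b2. scl H (?t a1 b1) (a2 * b2)) (w k l)) (v i j) =
      sweedler H (\<lambda>a1 a2. sweedler H (\<lambda>b1 b2. scl H (?t a2 b2) (b1 * a1)) (w k l)) (v i j)"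
      unfolding quasi_commutative_side(1)[OF cv v(2,3) cw w(2,3) bl bilinear_mult(1)]
        quasi_commutative_side(2)[OF cv v(2,3) cw w(2,3) bl bilinear_mult(2)]
      using rb_quasi_commutative[OF cw w(2,3) cv v(2,3)]
      by (subst (1 2) sum.swap) simp
  qed
  show ?thesis
    unfolding t universal_r_form_def using bl inv 1 2 3 by blast
qed


lemma rb_rbar21: "r_form_algebra.rb H (rbar21 H r) a b = r b a"
proof -
  interpret t: r_form_algebra H "rbar21 H r"
    by unfold_locales (rule universal_rbar21)
  have "is_conv_inverse H rb r"
    using is_conv_inverse_rb bilinear by (auto simp: is_conv_inverse_def)
  from flip_inverse[OF this rb_bilinear]
  have "is_conv_inverse H (rbar21 H r) (\<lambda>a b. r b a)"
    by (simp add: rbar21_eq[abs_def])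
  from t.conv_inverse_unique[OF this] show ?thesis by simp
qed

text \<open>Flipping and inverting twice gives back \<open>r\<close>, and each inversion applies \<open>S\<close> to one of the arguments.\<close>

lemma antipode_invariant: "r (antipode H a) (antipode H b) = r a b"
proof -
  interpret t: r_form_algebra H "rbar21 H r"
    by unfold_locales (rule universal_rbar21)
  have "t.rb b a = r (antipode H a) (antipode H b)"
    by (simp add: t.rb_def rbar21_eq rb_def)
  then show ?thesis by (simp add: rb_rbar21)
qed

lemma r_antipode_right: "r a (antipode H b) = rb a (antipode H (antipode H b))"
  by (simp add: rb_def antipode_invariant)


section \<open>The functionals \<open>f\<^sub>r\<close> and \<open>F\<^sub>r\<close>\<close>

lemma f_bilinear: "bilinear_form H (\<lambda>x y. r x (antipode H y))"
  using bilinear by (auto simp: bilinear_form_iff antipode_add antipode_scl)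

lemma f_linear: "linear_form H (f_form H r)"
  unfolding f_form_def by (rule comult_linear[OF f_bilinear])

lemma f_corep:
  "corep I v \<Longrightarrow> i \<in> I \<Longrightarrow> j \<in> I \<Longrightarrow> f_form H r (v i j) = (\<Sum>k\<in>I. r (v i k) (antipode H (v k j)))"
  unfolding f_form_def by (rule corep_form[OF _ _ _ f_bilinear])

text \<open>In Sweedler notation, \<open>f\<^sub>r(a\<^sub>1) S\<^sup>2(a\<^sub>2) = a\<^sub>1 f\<^sub>r(a\<^sub>2)\<close>: the functional \<open>f\<^sub>r\<close> implements the square of the
  antipode. This is Drinfeld's argument, applied to the quasi-commutativity of \<open>v\<close> and \<open>S(v)\<close>.\<close>

lemma f_antipode_square:
  assumes v: "ucorep I v" and il: "i \<in> I" "l \<in> I"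
  shows "(\<Sum>k\<in>I. scl H (f_form H r (v i k)) (antipode H (antipode H (v k l))))
    = (\<Sum>k\<in>I. scl H (f_form H r (v k l)) (v i k))"
proof -
  have c: "corep I v" by (rule ucorep_corep[OF v])
  have fin: "finite I" by (rule corep_finite[OF c])
  let ?S = "antipode H"
  note cS = corep_antipode_transpose[OF v]
  have *: "scl H (f_form H r (v i k)) 1 = (\<Sum>p\<in>I. \<Sum>s\<in>I. scl H (f_form H r (v p s)) (?S (v s k) * v i p))"
    if k: "k \<in> I" for k
  proof -
    have "(\<Sum>j\<in>I. \<Sum>p\<in>I. \<Sum>s\<in>I. scl H (r (v i p) (?S (v s k))) (v p j * ?S (v j s)))
        = (\<Sum>j\<in>I. \<Sum>p\<in>I. \<Sum>s\<in>I. scl H (r (v p j) (?S (v j s))) (?S (v s k) * v i p))"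
      by (rule sum.cong[OF refl]) (rule quasi_commutative[OF c il(1) _ cS k])
    moreover have "(\<Sum>j\<in>I. \<Sum>p\<in>I. \<Sum>s\<in>I. scl H (r (v i p) (?S (v s k))) (v p j * ?S (v j s)))
        = scl H (f_form H r (v i k)) 1"
    proof -
      have "(\<Sum>j\<in>I. \<Sum>p\<in>I. \<Sum>s\<in>I. scl H (r (v i p) (?S (v s k))) (v p j * ?S (v j s)))
          = (\<Sum>p\<in>I. \<Sum>j\<in>I. \<Sum>s\<in>I. scl H (r (v i p) (?S (v s k))) (v p j * ?S (v j s)))"
        by (rule sum.swap)
      also have "\<dots> = (\<Sum>p\<in>I. \<Sum>s\<in>I. \<Sum>j\<in>I. scl H (r (v i p) (?S (v s k))) (v p j * ?S (v j s)))"
        by (intro sum.cong refl sum.swap)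
      also have "\<dots> = (\<Sum>p\<in>I. \<Sum>s\<in>I. scl H (r (v i p) (?S (v s k))) (if p = s then 1 else 0))"
        by (intro sum.cong refl) (simp add: corep_antipode_right[OF c] flip: scale_sum_right)
      also have "\<dots> = (\<Sum>p\<in>I. scl H (r (v i p) (?S (v p k))) 1)"
        using fin by (intro sum.cong refl) (simp add: if_distrib[of "scl H _"] cong: if_cong)
      finally show ?thesis by (simp add: f_corep[OF c il(1) k] scale_sum_left)
    qed
    moreover have "(\<Sum>j\<in>I. \<Sum>p\<in>I. \<Sum>s\<in>I. scl H (r (v p j) (?S (v j s))) (?S (v s k) * v i p))
        = (\<Sum>p\<in>I. \<Sum>s\<in>I. scl H (f_form H r (v p s)) (?S (v s k) * v i p))"
    proof -
      have "(\<Sum>j\<in>I. \<Sum>p\<in>I. \<Sum>s\<in>I. scl H (r (v p j) (?S (v j s))) (?S (v s k) * v i p))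
          = (\<Sum>p\<in>I. \<Sum>j\<in>I. \<Sum>s\<in>I. scl H (r (v p j) (?S (v j s))) (?S (v s k) * v i p))"
        by (rule sum.swap)
      also have "\<dots> = (\<Sum>p\<in>I. \<Sum>s\<in>I. \<Sum>j\<in>I. scl H (r (v p j) (?S (v j s))) (?S (v s k) * v i p))"
        by (intro sum.cong refl sum.swap)
      also have "\<dots> = (\<Sum>p\<in>I. \<Sum>s\<in>I. scl H (f_form H r (v p s)) (?S (v s k) * v i p))"
        by (intro sum.cong refl) (simp add: f_corep[OF c] scale_sum_left)
      finally show ?thesis .
    qed
    ultimately show ?thesis by simp
  qed
  have S2: "(\<Sum>k\<in>I. ?S (?S (v k l)) * ?S (v s k)) = (if s = l then 1 else 0)" if "s \<in> I" for s
  proof -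
    have "(\<Sum>k\<in>I. ?S (?S (v k l)) * ?S (v s k)) = ?S (\<Sum>k\<in>I. v s k * ?S (v k l))"
      by (simp add: antipode_sum antipode_mult)
    then show ?thesis
      unfolding corep_antipode_right[OF c that il(2)] using antipode_scl[of 0 0] by (simp add: antipode_one)
  qed
  have "(\<Sum>k\<in>I. scl H (f_form H r (v i k)) (?S (?S (v k l)))) = (\<Sum>k\<in>I. ?S (?S (v k l)) * scl H (f_form H r (v i k)) 1)"
    by (simp add: scl_mult_right)
  also have "\<dots> = (\<Sum>k\<in>I. \<Sum>p\<in>I. \<Sum>s\<in>I. scl H (f_form H r (v p s)) (?S (?S (v k l)) * ?S (v s k) * v i p))"
    by (intro sum.cong refl) (simp add: * sum_distrib_left scl_mult_right mult.assoc)
  also have "\<dots> = (\<Sum>p\<in>I. \<Sum>k\<in>I. \<Sum>s\<in>I. scl H (f_form H r (v p s)) (?S (?S (v k l)) * ?S (v s k) * v i p))"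
    by (rule sum.swap)
  also have "\<dots> = (\<Sum>p\<in>I. \<Sum>s\<in>I. \<Sum>k\<in>I. scl H (f_form H r (v p s)) (?S (?S (v k l)) * ?S (v s k) * v i p))"
    by (intro sum.cong refl sum.swap)
  also have "\<dots> = (\<Sum>p\<in>I. \<Sum>s\<in>I. scl H (f_form H r (v p s)) ((if s = l then 1 else 0) * v i p))"
    by (intro sum.cong refl) (simp add: S2 flip: scale_sum_right sum_distrib_right)
  also have "\<dots> = (\<Sum>p\<in>I. scl H (f_form H r (v p l)) (v i p))"
    using fin il by (intro sum.cong refl) (simp add: if_distrib[of "\<lambda>x. x * _"] if_distrib[of "scl H _"] cong: if_cong)
  finally show ?thesis .
qed

lemma f_shift:
  assumes v: "ucorep I v" and il: "i \<in> I" "l \<in> I"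
  shows "(\<Sum>k\<in>I. f_form H r (v i k) * r c (antipode H (v k l))) = (\<Sum>k\<in>I. f_form H r (v k l) * rb c (v i k))"
  using arg_cong[OF f_antipode_square[OF assms], of "rb c"]
  by (simp add: linear_form_sum[OF rb_linear_right] linear_form_scl[OF rb_linear_right] r_antipode_right)

lemma r_product_antipode:
  assumes v: "ucorep I v" and ij: "i \<in> I" "j \<in> I"
  shows "(\<Sum>x\<in>I. r (a * v i x) (antipode H (v x j))) = (\<Sum>y\<in>I. f_form H r (v y j) * rb a (v i y))"
proof -
  note cS = corep_antipode_transpose[OF v]
  have "(\<Sum>x\<in>I. r (a * v i x) (antipode H (v x j)))
      = (\<Sum>x\<in>I. \<Sum>y\<in>I. r a (antipode H (v y j)) * r (v i x) (antipode H (v x y)))"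
    using ij by (intro sum.cong refl mult_left[OF cS])
  also have "\<dots> = (\<Sum>y\<in>I. \<Sum>x\<in>I. r a (antipode H (v y j)) * r (v i x) (antipode H (v x y)))"
    by (rule sum.swap)
  also have "\<dots> = (\<Sum>y\<in>I. f_form H r (v i y) * r a (antipode H (v y j)))"
    using ij by (intro sum.cong refl) (simp add: f_corep[OF ucorep_corep[OF v]] sum_distrib_left mult.commute)
  also have "\<dots> = (\<Sum>y\<in>I. f_form H r (v y j) * rb a (v i y))" by (rule f_shift[OF assms])
  finally show ?thesis .
qed

text \<open>The functional \<open>f\<^sub>r\<close> fails to be multiplicative by the inverse of the double braiding: in Sweedler
  notation, with \<open>r\<^sup>-\<close> for the inverse of \<open>r\<close>,
  \<open>f\<^sub>r(a b) = r\<^sup>-(a\<^sub>1 \<otimes> b\<^sub>1) r\<^sup>-(b\<^sub>2 \<otimes> a\<^sub>2) f\<^sub>r(a\<^sub>3) f\<^sub>r(b\<^sub>3)\<close>. Splitting \<open>S(b) S(a)\<close> off the second argument of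
  \<open>r(a b \<otimes> S(b) S(a))\<close> produces \<open>f\<^sub>r\<close> of one factor; quasi-commutativity then moves the other factor into
  the position where the same can be done with it.\<close>

lemma f_mult:
  assumes w: "ucorep J w" "k \<in> J" "l \<in> J" and v: "ucorep I v" "i \<in> I" "j \<in> I"
  shows "f_form H r (w k l * v i j) = (\<Sum>k'\<in>J. \<Sum>i'\<in>I. rb (w k k') (v i i') *
    (\<Sum>s\<in>J. \<Sum>y\<in>I. rb (v i' y) (w k' s) * (f_form H r (w s l) * f_form H r (v y j))))"
proof -
  have cv: "corep I v" and cw: "corep J w" using v w by (auto simp: ucorep_corep)
  let ?S = "antipode H" and ?f = "f_form H r"
  have m2: "r (w k p * v i x) (a * b) = (\<Sum>k'\<in>J. \<Sum>i'\<in>I. r (w k k' * v i i') b * r (w k' p * v i' x) a)"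
    if "p \<in> J" "x \<in> I" for p x a b
    using mult_right[OF corep_tensor[OF cw cv], of "(k, i)" "(p, x)" a b] w v that
    by (simp add: tensor_corep_def sum.cartesian_product')
  have br: "(\<Sum>k'\<in>J. \<Sum>i'\<in>I. rb (w k' p) (v i' y) * r (w k k' * v i i') b)
      = (\<Sum>k'\<in>J. \<Sum>i'\<in>I. rb (w k k') (v i i') * r (v i' y * w k' p) b)" if "p \<in> J" "y \<in> I" for p y b
    using arg_cong[OF rb_quasi_commutative[OF cw w(2) that(1) cv v(2) that(2)], of "\<lambda>x. r x b"]
    by (simp add: linear_form_sum[OF linear_left] linear_form_scl[OF linear_left])
  have "?f (w k l * v i j) = (\<Sum>p\<in>J. \<Sum>x\<in>I. r (w k p * v i x) (?S (v x j) * ?S (w p l)))"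
    using f_corep[OF corep_tensor[OF cw cv], of "(k, i)" "(l, j)"] w v
    by (simp add: tensor_corep_def sum.cartesian_product' antipode_mult)
  also have "\<dots> = (\<Sum>p\<in>J. \<Sum>x\<in>I. \<Sum>k'\<in>J. \<Sum>i'\<in>I. r (w k k' * v i i') (?S (w p l)) * r (w k' p * v i' x) (?S (v x j)))"
    by (intro sum.cong refl m2)
  also have "\<dots> = (\<Sum>p\<in>J. \<Sum>k'\<in>J. \<Sum>x\<in>I. \<Sum>i'\<in>I. r (w k k' * v i i') (?S (w p l)) * r (w k' p * v i' x) (?S (v x j)))"
    by (intro sum.cong refl sum.swap)
  also have "\<dots> = (\<Sum>p\<in>J. \<Sum>k'\<in>J. \<Sum>i'\<in>I. \<Sum>x\<in>I. r (w k k' * v i i') (?S (w p l)) * r (w k' p * v i' x) (?S (v x j)))"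
    by (intro sum.cong refl sum.swap)
  also have "\<dots> = (\<Sum>p\<in>J. \<Sum>k'\<in>J. \<Sum>i'\<in>I. \<Sum>y\<in>I. ?f (v y j) * (rb (w k' p) (v i' y) * r (w k k' * v i i') (?S (w p l))))"
  proof (rule sum.cong[OF refl], rule sum.cong[OF refl], rule sum.cong[OF refl])
    fix p k' i' assume "p \<in> J" "k' \<in> J" "i' \<in> I"
    have "(\<Sum>x\<in>I. r (w k k' * v i i') (?S (w p l)) * r (w k' p * v i' x) (?S (v x j)))
        = r (w k k' * v i i') (?S (w p l)) * (\<Sum>x\<in>I. r (w k' p * v i' x) (?S (v x j)))"
      by (simp only: sum_distrib_left)
    also have "\<dots> = (\<Sum>y\<in>I. ?f (v y j) * (rb (w k' p) (v i' y) * r (w k k' * v i i') (?S (w p l))))"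
      by (simp add: r_product_antipode[OF v(1) \<open>i' \<in> I\<close> v(3)] sum_distrib_left mult_ac)
    finally show "(\<Sum>x\<in>I. r (w k k' * v i i') (?S (w p l)) * r (w k' p * v i' x) (?S (v x j)))
      = (\<Sum>y\<in>I. ?f (v y j) * (rb (w k' p) (v i' y) * r (w k k' * v i i') (?S (w p l))))" .
  qed
  also have "\<dots> = (\<Sum>p\<in>J. \<Sum>k'\<in>J. \<Sum>y\<in>I. \<Sum>i'\<in>I. ?f (v y j) * (rb (w k' p) (v i' y) * r (w k k' * v i i') (?S (w p l))))"
    by (intro sum.cong refl sum.swap)
  also have "\<dots> = (\<Sum>p\<in>J. \<Sum>y\<in>I. \<Sum>k'\<in>J. \<Sum>i'\<in>I. ?f (v y j) * (rb (w k' p) (v i' y) * r (w k k' * v i i') (?S (w p l))))"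
    by (intro sum.cong refl sum.swap)
  also have "\<dots> = (\<Sum>p\<in>J. \<Sum>y\<in>I. \<Sum>k'\<in>J. \<Sum>i'\<in>I. ?f (v y j) * (rb (w k k') (v i i') * r (v i' y * w k' p) (?S (w p l))))"
    by (rule sum.cong[OF refl], rule sum.cong[OF refl]) (simp only: br flip: sum_distrib_left)
  also have "\<dots> = (\<Sum>y\<in>I. \<Sum>p\<in>J. \<Sum>k'\<in>J. \<Sum>i'\<in>I. ?f (v y j) * (rb (w k k') (v i i') * r (v i' y * w k' p) (?S (w p l))))"
    by (rule sum.swap)
  also have "\<dots> = (\<Sum>y\<in>I. \<Sum>k'\<in>J. \<Sum>p\<in>J. \<Sum>i'\<in>I. ?f (v y j) * (rb (w k k') (v i i') * r (v i' y * w k' p) (?S (w p l))))"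
    by (intro sum.cong refl sum.swap)
  also have "\<dots> = (\<Sum>y\<in>I. \<Sum>k'\<in>J. \<Sum>i'\<in>I. \<Sum>p\<in>J. ?f (v y j) * (rb (w k k') (v i i') * r (v i' y * w k' p) (?S (w p l))))"
    by (intro sum.cong refl sum.swap)
  also have "\<dots> = (\<Sum>y\<in>I. \<Sum>k'\<in>J. \<Sum>i'\<in>I. rb (w k k') (v i i') * (\<Sum>s\<in>J. rb (v i' y) (w k' s) * (?f (w s l) * ?f (v y j))))"
  proof (rule sum.cong[OF refl], rule sum.cong[OF refl], rule sum.cong[OF refl])
    fix y k' i' assume "y \<in> I" "k' \<in> J" "i' \<in> I"
    have "(\<Sum>p\<in>J. ?f (v y j) * (rb (w k k') (v i i') * r (v i' y * w k' p) (?S (w p l))))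
        = ?f (v y j) * (rb (w k k') (v i i') * (\<Sum>p\<in>J. r (v i' y * w k' p) (?S (w p l))))"
      by (simp only: sum_distrib_left)
    also have "\<dots> = rb (w k k') (v i i') * (\<Sum>s\<in>J. rb (v i' y) (w k' s) * (?f (w s l) * ?f (v y j)))"
      by (simp add: r_product_antipode[OF w(1) \<open>k' \<in> J\<close> w(3)] sum_distrib_left mult_ac)
    finally show "(\<Sum>p\<in>J. ?f (v y j) * (rb (w k k') (v i i') * r (v i' y * w k' p) (?S (w p l))))
      = rb (w k k') (v i i') * (\<Sum>s\<in>J. rb (v i' y) (w k' s) * (?f (w s l) * ?f (v y j)))" .
  qed
  also have "\<dots> = (\<Sum>k'\<in>J. \<Sum>y\<in>I. \<Sum>i'\<in>I. rb (w k k') (v i i') * (\<Sum>s\<in>J. rb (v i' y) (w k' s) * (?f (w s l) * ?f (v y j))))"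
    by (rule sum.swap)
  also have "\<dots> = (\<Sum>k'\<in>J. \<Sum>i'\<in>I. \<Sum>y\<in>I. rb (w k k') (v i i') * (\<Sum>s\<in>J. rb (v i' y) (w k' s) * (?f (w s l) * ?f (v y j))))"
    by (intro sum.cong refl sum.swap)
  also have "\<dots> = (\<Sum>k'\<in>J. \<Sum>i'\<in>I. rb (w k k') (v i i') *
    (\<Sum>s\<in>J. \<Sum>y\<in>I. rb (v i' y) (w k' s) * (?f (w s l) * ?f (v y j))))"
    by (rule sum.cong[OF refl], rule sum.cong[OF refl]) (subst sum.swap, simp only: sum_distrib_left)
  finally show ?thesis .
qed

lemma F_linear: "linear_form H (F_form H r)"
proof -
  interpret t: r_form_algebra H "rbar21 H r"
    by unfold_locales (rule universal_rbar21)
  show ?thesis unfolding F_form_def by (intro conv_linear f_linear t.f_linear)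
qed

lemma F_corep:
  assumes v: "corep I v" "i \<in> I" "j \<in> I"
  shows "F_form H r (v i j) = (\<Sum>k\<in>I. f_form H r (v i k) * f_form H (rbar21 H r) (v k j))"
proof -
  interpret t: r_form_algebra H "rbar21 H r"
    by unfold_locales (rule universal_rbar21)
  show ?thesis unfolding F_form_def by (intro conv_corep[OF v] f_linear t.f_linear)
qed

text \<open>The value \<open>f\<^sub>r(a b)\<close> contains the inverse of the double braiding of \<open>a\<close> and \<open>b\<close>, and the corresponding
  value for the flipped inverse form contains the double braiding itself. They cancel, because quasi-commutativity,
  applied twice, lets the double braiding commute with the functional \<open>(a, b) \<mapsto> f\<^sub>r(a b)\<close>.\<close>

lemma F_mult: "F_form H r (a * b) = F_form H r a * F_form H r b"
proof (rule bilinear_form_eqI[of "\<lambda>a b. F_form H r (a * b)" "\<lambda>a b. F_form H r a * F_form H r b"])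
  interpret t: r_form_algebra H "rbar21 H r"
    by unfold_locales (rule universal_rbar21)
  show "bilinear_form H (\<lambda>a b. F_form H r (a * b))" "bilinear_form H (\<lambda>a b. F_form H r a * F_form H r b)"
    using F_linear by (auto simp: bilinear_form_iff linear_form_iff scl_mult_left scl_mult_right algebra_simps)
  fix J I :: "nat set" and w v k l i j
  assume w: "ucorep J w" "k \<in> J" "l \<in> J" and v: "ucorep I v" "i \<in> I" "j \<in> I"
  have cv: "corep I v" and cw: "corep J w" using v w by (auto simp: ucorep_corep)
  let ?f = "f_form H r" and ?b = "f_form H (rbar21 H r)"
  let ?K = "J \<times> I"
  have fin: "finite ?K" using corep_finite[OF cv] corep_finite[OF cw] by simp
  let ?W = "\<lambda>h p q. h (w (fst p) (fst q)) (v (snd p) (snd q)) :: complex"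
  \<comment> \<open>\<open>P\<close> and \<open>P'\<close> are the braidings, \<open>Pb\<close> and \<open>Pb'\<close> their inverses. The matrices \<open>fm\<close>, \<open>bm\<close> are the two
    functionals on products, \<open>fo\<close> is \<open>f\<^sub>r\<close> on the opposite product, and \<open>ff\<close>, \<open>bb\<close> are the products of values.\<close>
  define P where "P = cut ?K (?W r)"
  define P' where "P' = cut ?K (?W (\<lambda>x y. r y x))"
  define Pb where "Pb = cut ?K (?W rb)"
  define Pb' where "Pb' = cut ?K (?W (\<lambda>x y. rb y x))"
  define fm where "fm = cut ?K (?W (\<lambda>x y. ?f (x * y)))"
  define fo where "fo = cut ?K (?W (\<lambda>x y. ?f (y * x)))"
  define bm where "bm = cut ?K (?W (\<lambda>x y. ?b (x * y)))"
  define ff where "ff = cut ?K (?W (\<lambda>x y. ?f x * ?f y))"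
  define bb where "bb = cut ?K (?W (\<lambda>x y. ?b x * ?b y))"
  note defs = P_def P'_def Pb_def Pb'_def fm_def fo_def bm_def ff_def bb_def
  have PP: "mmul ?K P Pb = cut ?K unit_matrix"
    unfolding defs
    by (rule mmul_cut_eqI) (use r_rb(1)[OF cw _ _ cv] in \<open>auto simp: sum.cartesian_product' unit_matrix_def prod_eq_iff\<close>)
  have PP': "mmul ?K P' Pb' = cut ?K unit_matrix"
    unfolding defs
    by (rule mmul_cut_eqI)
      (use r_rb(1)[OF cv _ _ cw] in \<open>auto simp: sum.cartesian_product' unit_matrix_def prod_eq_iff sum.swap[of _ J I]\<close>)
  have c1: "mmul ?K P fm = mmul ?K fo P"
    unfolding defs
  proof (rule mmul_cut_eq_mmulI)
    fix x y assume x: "x \<in> ?K" and y: "y \<in> ?K"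
    show "(\<Sum>z\<in>?K. ?W r x z * ?f (w (fst z) (fst y) * v (snd z) (snd y)))
        = (\<Sum>z\<in>?K. ?f (v (snd x) (snd z) * w (fst x) (fst z)) * ?W r z y)"
      using arg_cong[OF quasi_commutative[OF cw _ _ cv, of "fst x" "fst y" "snd x" "snd y"], of ?f] x y
      by (simp add: linear_form_sum[OF f_linear] linear_form_scl[OF f_linear] sum.cartesian_product'
          mem_Times_iff mult.commute)
  qed
  have c2: "mmul ?K P' fo = mmul ?K fm P'"
    unfolding defs
  proof (rule mmul_cut_eq_mmulI)
    fix x y assume x: "x \<in> ?K" and y: "y \<in> ?K"
    have "(\<Sum>p\<in>I. \<Sum>q\<in>J. r (v (snd x) p) (w (fst x) q) * ?f (v p (snd y) * w q (fst y)))
        = (\<Sum>p\<in>I. \<Sum>q\<in>J. ?f (w (fst x) q * v (snd x) p) * r (v p (snd y)) (w q (fst y)))"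
      using arg_cong[OF quasi_commutative[OF cv _ _ cw, of "snd x" "snd y" "fst x" "fst y"], of ?f] x y
      by (simp add: linear_form_sum[OF f_linear] linear_form_scl[OF f_linear] mem_Times_iff mult.commute)
    then have "(\<Sum>q\<in>J. \<Sum>p\<in>I. r (v (snd x) p) (w (fst x) q) * ?f (v p (snd y) * w q (fst y)))
        = (\<Sum>q\<in>J. \<Sum>p\<in>I. ?f (w (fst x) q * v (snd x) p) * r (v p (snd y)) (w q (fst y)))"
      by (subst (1 2) sum.swap)
    then show "(\<Sum>z\<in>?K. ?W (\<lambda>x y. r y x) x z * ?f (v (snd z) (snd y) * w (fst z) (fst y)))
        = (\<Sum>z\<in>?K. ?f (w (fst x) (fst z) * v (snd x) (snd z)) * ?W (\<lambda>x y. r y x) z y)"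
      by (simp add: sum.cartesian_product')
  qed
  have three: "mmul ?K (cut ?K X) (mmul ?K (cut ?K Y) (cut ?K Z)) = cut ?K M"
    if "\<And>k l i j. k \<in> J \<Longrightarrow> l \<in> J \<Longrightarrow> i \<in> I \<Longrightarrow> j \<in> I \<Longrightarrow> M (k, i) (l, j) = (\<Sum>k'\<in>J. \<Sum>i'\<in>I. X (k, i) (k', i') *
    (\<Sum>s\<in>J. \<Sum>y\<in>I. Y (k', i') (s, y) * Z (s, y) (l, j)))" for X Y Z M :: "nat \<times> nat \<Rightarrow> nat \<times> nat \<Rightarrow> complex"
    using that by (auto simp: mmul_def cut_def fun_eq_iff sum.cartesian_product')
  have lf: "fm = mmul ?K Pb (mmul ?K Pb' ff)"
    unfolding defs by (rule three[symmetric]) (simp add: f_mult[OF w(1) _ _ v(1)])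
  have lb: "bm = mmul ?K P' (mmul ?K P bb)"
    unfolding defs by (rule three[symmetric]) (simp add: t.f_mult[OF w(1) _ _ v(1)] rb_rbar21)
  have "mmul ?K P' (mmul ?K P fm) = mmul ?K P' (mmul ?K (mmul ?K P Pb) (mmul ?K Pb' ff))"
    unfolding lf by (simp only: mmul_assoc)
  also have "\<dots> = mmul ?K P' (mmul ?K Pb' ff)"
  proof -
    have "mmul ?K (cut ?K unit_matrix) (mmul ?K Pb' ff) = mmul ?K Pb' ff"
      using fin unfolding mmul_assoc[symmetric] by (simp add: Pb'_def)
    then show ?thesis unfolding PP by simp
  qed
  also have "\<dots> = ff"
    using fin unfolding PP' mmul_assoc[symmetric] by (simp add: ff_def)
  finally have PPf: "mmul ?K P' (mmul ?K P fm) = ff" .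
  have "mmul ?K fm bm = mmul ?K (mmul ?K fm P') (mmul ?K P bb)"
    unfolding lb by (simp only: mmul_assoc)
  also have "\<dots> = mmul ?K P' (mmul ?K (mmul ?K fo P) bb)"
    unfolding c2[symmetric] by (simp only: mmul_assoc)
  also have "\<dots> = mmul ?K ff bb"
    unfolding c1[symmetric] PPf[symmetric] by (simp only: mmul_assoc)
  finally have "mmul ?K fm bm (k, i) (l, j) = mmul ?K ff bb (k, i) (l, j)" by simp
  then have "(\<Sum>p\<in>J. \<Sum>q\<in>I. ?f (w k p * v i q) * ?b (w p l * v q j))
      = (\<Sum>p\<in>J. \<Sum>q\<in>I. (?f (w k p) * ?f (v i q)) * (?b (w p l) * ?b (v q j)))"
    unfolding defs using w v by (simp add: mmul_cut_app sum.cartesian_product')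
  moreover have "F_form H r (w k l * v i j) = (\<Sum>p\<in>J. \<Sum>q\<in>I. ?f (w k p * v i q) * ?b (w p l * v q j))"
    using F_corep[OF corep_tensor[OF cw cv], of "(k, i)" "(l, j)"] w v
    by (simp add: tensor_corep_def sum.cartesian_product')
  moreover have "F_form H r (w k l) * F_form H r (v i j)
      = (\<Sum>p\<in>J. \<Sum>q\<in>I. (?f (w k p) * ?f (v i q)) * (?b (w p l) * ?b (v q j)))"
    unfolding F_corep[OF cw w(2,3)] F_corep[OF cv v(2,3)] sum_product
    by (intro sum.cong refl) (simp add: mult_ac)
  ultimately show "F_form H r (w k l * v i j) = F_form H r (w k l) * F_form H r (v i j)" by simp
qed

lemma F_one: "F_form H r 1 = 1"
proof -
  interpret t: r_form_algebra H "rbar21 H r"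
    by unfold_locales (rule universal_rbar21)
  note c = ucorep_corep[OF ucorep_one]
  show ?thesis
    using F_corep[OF c, of 0 0] f_corep[OF c, of 0 0] t.f_corep[OF c, of 0 0]
    by (simp add: antipode_one one_left t.one_left counit_one)
qed


section \<open>The balancing property\<close>

text \<open>As \<open>A\<close> implements \<open>S\<^sup>-\<^sup>2\<close> and \<open>K\<close> implements \<open>S\<^sup>2\<close>, the product \<open>A K\<close> commutes with \<open>V\<close>, and Schur's
  lemma applies.\<close>

lemma schur_antipode_square:
  fixes A K Ki :: "nat \<Rightarrow> nat \<Rightarrow> complex"
  assumes irr: "irreducible_corep H n V"
    and KKi: "\<And>i j. i < n \<Longrightarrow> j < n \<Longrightarrow> (\<Sum>k<n. K i k * Ki k j) = (if i = j then 1 else 0)"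
    and KiK: "\<And>i j. i < n \<Longrightarrow> j < n \<Longrightarrow> (\<Sum>k<n. Ki i k * K k j) = (if i = j then 1 else 0)"
    and S2: "\<And>i j. i < n \<Longrightarrow> j < n \<Longrightarrow> antipode H (antipode H (V $$ (i, j)))
      = (\<Sum>k<n. \<Sum>l<n. scl H (K i k * Ki l j) (V $$ (k, l)))"
    and tw: "\<And>i l. i < n \<Longrightarrow> l < n \<Longrightarrow> (\<Sum>k<n. scl H (A i k) (antipode H (antipode H (V $$ (k, l)))))
      = (\<Sum>k<n. scl H (A k l) (V $$ (i, k)))"
  obtains c where "\<And>i j. i < n \<Longrightarrow> j < n \<Longrightarrow> A i j = c * Ki i j"
proof -
  define M where "M i j = (\<Sum>k<n. A i k * K k j)" for i j
  have "(\<Sum>k<n. scl H (M i k) (V $$ (k, j))) = (\<Sum>k<n. scl H (M k j) (V $$ (i, k)))" if ij: "i < n" "j < n" for i j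
  proof -
    have "(\<Sum>l<n. scl H (K l j) (\<Sum>k<n. scl H (A i k) (antipode H (antipode H (V $$ (k, l))))))
        = (\<Sum>l<n. \<Sum>k<n. \<Sum>a<n. \<Sum>b<n. scl H ((A i k * K k a) * (Ki b l * K l j)) (V $$ (a, b)))"
      by (rule sum.cong[OF refl]) (simp add: S2 scale_sum_right mult_ac)
    also have "\<dots> = (\<Sum>a<n. \<Sum>b<n. \<Sum>k<n. \<Sum>l<n. scl H ((A i k * K k a) * (Ki b l * K l j)) (V $$ (a, b)))"
      (is "?l = ?r")
    proof -
      have "?l = (\<Sum>(l, k, a, b)\<in>{..<n} \<times> {..<n} \<times> {..<n} \<times> {..<n}.
          scl H ((A i k * K k a) * (Ki b l * K l j)) (V $$ (a, b)))"
        by (simp add: sum.cartesian_product case_prod_unfold)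
      also have "\<dots> = (\<Sum>(a, b, k, l)\<in>{..<n} \<times> {..<n} \<times> {..<n} \<times> {..<n}.
          scl H ((A i k * K k a) * (Ki b l * K l j)) (V $$ (a, b)))"
        by (rule sum.reindex_bij_witness[of _ "\<lambda>(a, b, k, l). (l, k, a, b)" "\<lambda>(l, k, a, b). (a, b, k, l)"]) auto
      also have "\<dots> = ?r" by (simp add: sum.cartesian_product case_prod_unfold)
      finally show ?thesis .
    qed
    also have "\<dots> = (\<Sum>a<n. \<Sum>b<n. scl H (M i a * (\<Sum>l<n. Ki b l * K l j)) (V $$ (a, b)))"
      unfolding M_def sum_product by (simp only: scale_sum_left)
    also have "\<dots> = (\<Sum>a<n. \<Sum>b<n. scl H (M i a * (if b = j then 1 else 0)) (V $$ (a, b)))"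
      using ij by (intro sum.cong refl) (simp add: KiK)
    also have "\<dots> = (\<Sum>a<n. scl H (M i a) (V $$ (a, j)))"
      using ij by (intro sum.cong refl)
        (simp add: if_distrib[of "\<lambda>x. _ * x"] if_distrib[of "\<lambda>c. scl H c _"] cong: if_cong)
    finally have "(\<Sum>a<n. scl H (M i a) (V $$ (a, j)))
        = (\<Sum>l<n. scl H (K l j) (\<Sum>k<n. scl H (A i k) (antipode H (antipode H (V $$ (k, l))))))" ..
    also have "\<dots> = (\<Sum>l<n. scl H (K l j) (\<Sum>k<n. scl H (A k l) (V $$ (i, k))))"
      using ij by (simp add: tw)
    also have "\<dots> = (\<Sum>l<n. \<Sum>k<n. scl H (A k l * K l j) (V $$ (i, k)))"
      by (simp add: scale_sum_right mult.commute)
    also have "\<dots> = (\<Sum>k<n. scl H (M k j) (V $$ (i, k)))"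
      by (subst sum.swap) (simp add: M_def scale_sum_left)
    finally show ?thesis .
  qed
  from schur[OF irr, of M, OF this] obtain c where c: "\<And>i j. i < n \<Longrightarrow> j < n \<Longrightarrow> M i j = (if i = j then c else 0)"
    by blast
  have "A i j = c * Ki i j" if ij: "i < n" "j < n" for i j
  proof -
    have "A i j = (\<Sum>k<n. A i k * (\<Sum>l<n. K k l * Ki l j))"
      using ij by (simp add: KKi if_distrib[of "\<lambda>x. _ * x"] cong: if_cong)
    also have "\<dots> = (\<Sum>l<n. M i l * Ki l j)"
      by (simp add: M_def sum_distrib_left sum_distrib_right mult.assoc) (rule sum.swap)
    also have "\<dots> = c * Ki i j"
      using ij by (simp add: c if_distrib[of "\<lambda>x. x * _"] cong: if_cong)
    finally show ?thesis .
  qed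
  with that show thesis by blast
qed

text \<open>The functional \<open>a \<mapsto> r(a\<^sub>2 \<otimes> S(a\<^sub>1))\<close> is inverse to \<open>f\<close> of the flipped inverse form: that \<open>f\<close> moves past
  \<open>S\<^sup>2\<close>, after which multiplicativity contracts \<open>S(v) v\<close>.\<close>

lemma f_rbar21_inverse:
  assumes v: "ucorep I v" and il: "i \<in> I" "l \<in> I"
  shows "(\<Sum>k\<in>I. f_form H (rbar21 H r) (v i k) * (\<Sum>m\<in>I. r (v m l) (antipode H (v k m)))) = (if i = l then 1 else 0)"
proof -
  interpret t: r_form_algebra H "rbar21 H r"
    by unfold_locales (rule universal_rbar21)
  have c: "corep I v" by (rule ucorep_corep[OF v])
  let ?S = "antipode H" and ?b = "f_form H (rbar21 H r)"
  have "(\<Sum>k\<in>I. ?b (v i k) * (\<Sum>m\<in>I. r (v m l) (?S (v k m)))) = (\<Sum>m\<in>I. \<Sum>k\<in>I. ?b (v i k) * rb (v m l) (?S (?S (v k m))))"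
    by (simp add: r_antipode_right sum_distrib_left) (rule sum.swap)
  also have "\<dots> = (\<Sum>m\<in>I. \<Sum>k\<in>I. ?b (v k m) * rb (v m l) (v i k))"
  proof (rule sum.cong[OF refl])
    fix m assume "m \<in> I"
    from arg_cong[OF t.f_antipode_square[OF v il(1) this], of "rb (v m l)"]
    show "(\<Sum>k\<in>I. ?b (v i k) * rb (v m l) (?S (?S (v k m)))) = (\<Sum>k\<in>I. ?b (v k m) * rb (v m l) (v i k))"
      by (simp add: linear_form_sum[OF rb_linear_right] linear_form_scl[OF rb_linear_right])
  qed
  also have "\<dots> = (\<Sum>m\<in>I. \<Sum>k\<in>I. \<Sum>p\<in>I. rb (?S (v p m)) (v k p) * rb (v m l) (v i k))"
    by (intro sum.cong refl) (simp add: t.f_corep[OF c] rbar21_eq sum_distrib_right)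
  also have "\<dots> = (\<Sum>m\<in>I. \<Sum>p\<in>I. \<Sum>k\<in>I. rb (?S (v p m)) (v k p) * rb (v m l) (v i k))"
    by (intro sum.cong refl sum.swap)
  also have "\<dots> = (\<Sum>m\<in>I. \<Sum>p\<in>I. rb (?S (v p m) * v m l) (v i p))"
  proof (intro sum.cong refl)
    fix m p assume "m \<in> I" "p \<in> I"
    from t.mult_right[OF c il(1) this(2), of "?S (v p m)" "v m l"]
    show "(\<Sum>k\<in>I. rb (?S (v p m)) (v k p) * rb (v m l) (v i k)) = rb (?S (v p m) * v m l) (v i p)"
      by (simp add: rbar21_eq mult.commute)
  qed
  also have "\<dots> = (\<Sum>p\<in>I. \<Sum>m\<in>I. rb (?S (v p m) * v m l) (v i p))"
    by (rule sum.swap)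
  also have "\<dots> = (\<Sum>p\<in>I. rb (if p = l then 1 else 0) (v i p))"
    using il by (intro sum.cong refl) (simp add: corep_antipode_left[OF c] flip: linear_form_sum[OF rb_linear_left])
  also have "\<dots> = (\<Sum>p\<in>I. if p = l then counit H (v i p) else 0)"
    by (intro sum.cong refl) (simp add: rb_def antipode_one one_left linear_form_zero[OF rb_linear_left, unfolded rb_def])
  also have "\<dots> = (if i = l then 1 else 0)"
    using il corep_finite[OF c] corep_counit[OF c il] by simp
  finally show ?thesis .
qed

text \<open>If \<open>K\<close> implements \<open>S\<^sup>2\<close> on an irreducible corepresentation and \<open>F\<^sub>r\<close> is its inverse square, then the
  left and the right quantum dimension agree. In categorical terms: \<open>K\<close> turns the braiding
  into a ribbon structure, and ribbon categories are spherical. Concretely, closing the inverse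
  braiding on either side gives the same scalar \<open>c\<close>, and the full closure, computed from
  either side, is \<open>c\<close> times either trace.\<close>

lemma balanced_trace:
  fixes K Ki :: "nat \<Rightarrow> nat \<Rightarrow> complex"
  assumes irr: "irreducible_corep H n V" and v: "ucorep {..<n} (\<lambda>i j. V $$ (i, j))"
    and KKi: "\<And>i j. i < n \<Longrightarrow> j < n \<Longrightarrow> (\<Sum>k<n. K i k * Ki k j) = (if i = j then 1 else 0)"
    and KiK: "\<And>i j. i < n \<Longrightarrow> j < n \<Longrightarrow> (\<Sum>k<n. Ki i k * K k j) = (if i = j then 1 else 0)"
    and S2: "\<And>i j. i < n \<Longrightarrow> j < n \<Longrightarrow> antipode H (antipode H (V $$ (i, j)))
      = (\<Sum>k<n. \<Sum>l<n. scl H (K i k * Ki l j) (V $$ (k, l)))"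
    and F: "\<And>i j. i < n \<Longrightarrow> j < n \<Longrightarrow> F_form H r (V $$ (i, j)) = (\<Sum>k<n. Ki i k * Ki k j)"
  shows "(\<Sum>i<n. K i i) = (\<Sum>i<n. Ki i i)"
proof -
  interpret t: r_form_algebra H "rbar21 H r"
    by unfold_locales (rule universal_rbar21)
  let ?v = "\<lambda>i j. V $$ (i, j)" and ?S = "antipode H"
  have cv: "corep {..<n} ?v" by (rule ucorep_corep[OF v])
  have n: "0 < n" using irr by (simp add: irreducible_corep_def)
  obtain c where A: "\<And>i j. i < n \<Longrightarrow> j < n \<Longrightarrow> f_form H r (?v i j) = c * Ki i j"
    using schur_antipode_square[OF irr KKi KiK S2, of "\<lambda>i j. f_form H r (?v i j)"] f_antipode_square[OF v]
    by auto
  obtain c' where B: "\<And>i j. i < n \<Longrightarrow> j < n \<Longrightarrow> f_form H (rbar21 H r) (?v i j) = c' * Ki i j"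
    using schur_antipode_square[OF irr KKi KiK S2, of "\<lambda>i j. f_form H (rbar21 H r) (?v i j)"] t.f_antipode_square[OF v]
    by auto
  have FF: "(c * c') * (\<Sum>k<n. Ki i k * Ki k j) = (\<Sum>k<n. Ki i k * Ki k j)" if ij: "i < n" "j < n" for i j
    using F[OF ij] F_corep[OF cv, of i j] ij by (simp add: A B sum_distrib_left mult_ac)
  \<comment> \<open>By \<open>FF\<close> the factor \<open>c c'\<close> can differ from 1 only if the square of \<open>Ki\<close> vanishes.\<close>
  have cc: "c * c' = 1"
  proof (rule ccontr)
    assume "c * c' \<noteq> 1"
    then have z: "(\<Sum>k<n. Ki i k * Ki k j) = 0" if "i < n" "j < n" for i j
      using FF[OF that] \<open>c * c' \<noteq> 1\<close> by (simp only: mult_cancel_right2) simp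
    have KK: "mmul {..<n} (cut {..<n} Ki) (cut {..<n} Ki) = cut {..<n} (\<lambda>_ _. 0)"
      by (rule mmul_cut_eqI) (simp add: z)
    have KK': "mmul {..<n} (cut {..<n} Ki) (cut {..<n} K) = cut {..<n} unit_matrix"
      by (rule mmul_cut_eqI) (simp add: KiK unit_matrix_def)
    have "mmul {..<n} (mmul {..<n} (mmul {..<n} (cut {..<n} Ki) (cut {..<n} Ki)) (cut {..<n} K)) (cut {..<n} K)
        = cut {..<n} unit_matrix"
      unfolding mmul_assoc KK' by (simp add: KK')
    moreover have "mmul {..<n} (mmul {..<n} (cut {..<n} (\<lambda>_ _. 0)) (cut {..<n} K)) (cut {..<n} K) = (\<lambda>_ _. 0)"
      by (simp add: mmul_def cut_def fun_eq_iff)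
    ultimately have "cut {..<n} unit_matrix 0 0 = (0 :: complex)" unfolding KK by (simp add: fun_eq_iff)
    then show False using n by (simp add: cut_def unit_matrix_def)
  qed
  define g where "g k l = (\<Sum>m<n. r (?v m l) (?S (?v k m)))" for k l
  have g: "g i j = c * K i j" if ij: "i < n" "j < n" for i j
  proof -
    have "c' * (\<Sum>k<n. Ki a k * g k j) = (if a = j then 1 else 0)" if "a < n" for a
      using f_rbar21_inverse[OF v, of a j] that ij by (simp add: B g_def sum_distrib_left mult_ac)
    then have Kig: "(\<Sum>k<n. Ki a k * g k j) = (if a = j then c else 0)" if "a < n" for a
    proof -
      have "(\<Sum>k<n. Ki a k * g k j) = c * (c' * (\<Sum>k<n. Ki a k * g k j))"
        using cc by (simp flip: mult.assoc)
      then show ?thesis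
        using \<open>\<And>a. a < n \<Longrightarrow> c' * (\<Sum>k<n. Ki a k * g k j) = (if a = j then 1 else 0)\<close>[OF that] by simp
    qed
    have "g i j = (\<Sum>k<n. (\<Sum>a<n. K i a * Ki a k) * g k j)"
      using ij by (simp add: KKi if_distrib[of "\<lambda>x. x * _"] cong: if_cong)
    also have "\<dots> = (\<Sum>a<n. K i a * (\<Sum>k<n. Ki a k * g k j))"
      by (simp add: sum_distrib_left sum_distrib_right mult.assoc) (rule sum.swap)
    also have "\<dots> = c * K i j"
      using ij by (simp add: Kig if_distrib[of "\<lambda>x. _ * x"] cong: if_cong)
    finally show ?thesis .
  qed
  have rbS2: "r x (?S (?v i j)) = (\<Sum>a<n. \<Sum>b<n. K i a * Ki b j * rb x (?v a b))" if "i < n" "j < n" for x i j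
    using S2[OF that] by (simp add: r_antipode_right linear_form_sum[OF rb_linear_right] linear_form_scl[OF rb_linear_right])
  \<comment> \<open>The closure of the inverse braiding on the right, and on the left.\<close>
  have right: "(\<Sum>k<n. \<Sum>a<n. K k a * rb (?v i k) (?v a l)) = (if i = l then c else 0)" if il: "i < n" "l < n" for i l
  proof -
    have "c * (\<Sum>j<n. Ki i j * K j l) = (\<Sum>j<n. f_form H r (?v i j) * K j l)"
      using il by (simp add: A sum_distrib_left mult_ac)
    also have "\<dots> = (\<Sum>j<n. \<Sum>k<n. \<Sum>a<n. \<Sum>b<n. K k a * rb (?v i k) (?v a b) * (Ki b j * K j l))"
      using il by (intro sum.cong[OF refl]) (simp add: f_corep[OF cv] rbS2 sum_distrib_left sum_distrib_right mult_ac)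
    also have "\<dots> = (\<Sum>k<n. \<Sum>j<n. \<Sum>a<n. \<Sum>b<n. K k a * rb (?v i k) (?v a b) * (Ki b j * K j l))"
      by (rule sum.swap)
    also have "\<dots> = (\<Sum>k<n. \<Sum>a<n. \<Sum>j<n. \<Sum>b<n. K k a * rb (?v i k) (?v a b) * (Ki b j * K j l))"
      by (intro sum.cong refl sum.swap)
    also have "\<dots> = (\<Sum>k<n. \<Sum>a<n. \<Sum>b<n. \<Sum>j<n. K k a * rb (?v i k) (?v a b) * (Ki b j * K j l))"
      by (intro sum.cong refl sum.swap)
    also have "\<dots> = (\<Sum>k<n. \<Sum>a<n. \<Sum>b<n. K k a * rb (?v i k) (?v a b) * (if b = l then 1 else 0))"
      using il by (intro sum.cong refl) (simp add: KiK flip: sum_distrib_left)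
    also have "\<dots> = (\<Sum>k<n. \<Sum>a<n. K k a * rb (?v i k) (?v a l))"
      using il by (simp add: if_distrib[of "\<lambda>x. _ * x"] cong: if_cong)
    finally have "(\<Sum>k<n. \<Sum>a<n. K k a * rb (?v i k) (?v a l)) = c * (\<Sum>j<n. Ki i j * K j l)" ..
    then show ?thesis unfolding KiK[OF il] by simp
  qed
  have left: "(\<Sum>b<n. \<Sum>k<n. Ki b k * rb (?v k j) (?v a b)) = (if a = j then c else 0)" if aj: "a < n" "j < n" for a j
  proof -
    have "c * (\<Sum>i<n. Ki a i * K i j) = (\<Sum>i<n. Ki a i * g i j)"
      using aj by (simp add: g sum_distrib_left mult_ac)
    also have "\<dots> = (\<Sum>i<n. \<Sum>k<n. \<Sum>e<n. \<Sum>b<n. (Ki a i * K i e) * (Ki b k * rb (?v k j) (?v e b)))"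
      using aj by (intro sum.cong[OF refl]) (simp add: g_def rbS2 sum_distrib_left mult_ac)
    also have "\<dots> = (\<Sum>k<n. \<Sum>i<n. \<Sum>e<n. \<Sum>b<n. (Ki a i * K i e) * (Ki b k * rb (?v k j) (?v e b)))"
      by (rule sum.swap)
    also have "\<dots> = (\<Sum>k<n. \<Sum>e<n. \<Sum>i<n. \<Sum>b<n. (Ki a i * K i e) * (Ki b k * rb (?v k j) (?v e b)))"
      by (intro sum.cong refl sum.swap)
    also have "\<dots> = (\<Sum>k<n. \<Sum>e<n. (\<Sum>i<n. Ki a i * K i e) * (\<Sum>b<n. Ki b k * rb (?v k j) (?v e b)))"
      by (simp only: sum_product)
    also have "\<dots> = (\<Sum>k<n. \<Sum>e<n. (if a = e then 1 else 0) * (\<Sum>b<n. Ki b k * rb (?v k j) (?v e b)))"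
      using aj by (intro sum.cong refl) (simp add: KiK)
    also have "\<dots> = (\<Sum>k<n. \<Sum>b<n. Ki b k * rb (?v k j) (?v a b))"
      using aj by (simp add: if_distrib[of "\<lambda>x. x * _"] cong: if_cong)
    also have "\<dots> = (\<Sum>b<n. \<Sum>k<n. Ki b k * rb (?v k j) (?v a b))"
      by (rule sum.swap)
    finally have "(\<Sum>b<n. \<Sum>k<n. Ki b k * rb (?v k j) (?v a b)) = c * (\<Sum>i<n. Ki a i * K i j)" ..
    then show ?thesis unfolding KiK[OF aj] by simp
  qed
  have "c * (\<Sum>a<n. K a a) = (\<Sum>a<n. \<Sum>j<n. K j a * (if a = j then c else 0))"
    by (simp add: sum_distrib_left mult.commute if_distrib[of "\<lambda>x. _ * x"] cong: if_cong)
  also have "\<dots> = (\<Sum>a<n. \<Sum>j<n. \<Sum>b<n. \<Sum>k<n. K j a * (Ki b k * rb (?v k j) (?v a b)))"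
    by (simp add: left[symmetric] sum_distrib_left)
  also have "\<dots> = (\<Sum>b<n. \<Sum>k<n. \<Sum>j<n. \<Sum>a<n. Ki b k * (K j a * rb (?v k j) (?v a b)))"
    (is "?l = ?r")
  proof -
    have "?l = (\<Sum>(a, j, b, k)\<in>{..<n} \<times> {..<n} \<times> {..<n} \<times> {..<n}. K j a * (Ki b k * rb (?v k j) (?v a b)))"
      by (simp add: sum.cartesian_product case_prod_unfold)
    also have "\<dots> = (\<Sum>(b, k, j, a)\<in>{..<n} \<times> {..<n} \<times> {..<n} \<times> {..<n}. Ki b k * (K j a * rb (?v k j) (?v a b)))"
      by (rule sum.reindex_bij_witness[of _ "\<lambda>(b, k, j, a). (a, j, b, k)" "\<lambda>(a, j, b, k). (b, k, j, a)"]) auto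
    also have "\<dots> = ?r" by (simp add: sum.cartesian_product case_prod_unfold)
    finally show ?thesis .
  qed
  also have "\<dots> = (\<Sum>b<n. \<Sum>k<n. Ki b k * (if k = b then c else 0))"
    by (simp add: right[symmetric] sum_distrib_left)
  also have "\<dots> = c * (\<Sum>b<n. Ki b b)"
    by (simp add: sum_distrib_left mult.commute if_distrib[of "\<lambda>x. _ * x"] cong: if_cong)
  finally show ?thesis using cc by auto
qed

end

section \<open>Algebras given by generators and relations\<close>

text \<open>The evaluation of noncommutative polynomials makes sense in every complex algebra, in particular
  in the complex numbers, where it yields characters.\<close>

locale scalar_algebra = vector_space "scl H" for H :: "('b::ring_1) hopf_star" +
  assumes scl_left: "scl H c x * y = scl H c (x * y)"
    and scl_right: "x * scl H c y = scl H c (x * y)"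
begin

lemma free_eval_superset:
  assumes "finite W" "Poly_Mapping.keys p \<subseteq> W"
  shows "free_eval H g p = (\<Sum>w\<in>W. scl H (Poly_Mapping.lookup p w) (prod_list (map g (letters w))))"
  unfolding free_eval_def using assms by (intro sum.mono_neutral_left) (auto simp: in_keys_iff)

lemma free_eval_add: "free_eval H g (p + p') = free_eval H g p + free_eval H g p'"
proof -
  let ?W = "Poly_Mapping.keys p \<union> Poly_Mapping.keys p'"
  have "finite ?W" "Poly_Mapping.keys (p + p') \<subseteq> ?W" using keys_add[of p p'] by auto
  then show ?thesis
    by (simp add: free_eval_superset[of ?W] lookup_add scale_left_distrib sum.distrib)
qed

lemma free_eval_zero [simp]: "free_eval H g 0 = 0"
  by (simp add: free_eval_def)

lemma free_eval_sum: "free_eval H g (\<Sum>x\<in>A. f x) = (\<Sum>x\<in>A. free_eval H g (f x))"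
  by (induction A rule: infinite_finite_induct) (auto simp: free_eval_add)

lemma free_eval_single:
  "free_eval H g (Poly_Mapping.single w c) = scl H c (prod_list (map g (letters w)))"
  by (cases "c = 0") (auto simp: free_eval_def)

lemma free_eval_diff: "free_eval H g (p - p') = free_eval H g p - free_eval H g p'"
  using free_eval_add[of g "p - p'" p'] by simp

lemma poly_mapping_sum_single:
  "p = (\<Sum>w\<in>Poly_Mapping.keys p. Poly_Mapping.single w (Poly_Mapping.lookup p w))"
  by (rule poly_mapping_eqI) (auto simp: lookup_sum lookup_single when_def in_keys_iff)

lemma free_eval_mult: "free_eval H g (p * p') = free_eval H g p * free_eval H g p'"
proof -
  have s: "free_eval H g (Poly_Mapping.single w c * Poly_Mapping.single w' c')
      = free_eval H g (Poly_Mapping.single w c) * free_eval H g (Poly_Mapping.single w' c')" for w w' c c'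
    by (simp add: mult_single free_eval_single plus_fword_def scl_left scl_right mult.commute)
  have "p * p' = (\<Sum>w\<in>Poly_Mapping.keys p. \<Sum>w'\<in>Poly_Mapping.keys p'.
      Poly_Mapping.single w (Poly_Mapping.lookup p w) * Poly_Mapping.single w' (Poly_Mapping.lookup p' w'))"
    using sum_product[of "\<lambda>w. Poly_Mapping.single w (Poly_Mapping.lookup p w)" "Poly_Mapping.keys p"
        "\<lambda>w. Poly_Mapping.single w (Poly_Mapping.lookup p' w)" "Poly_Mapping.keys p'"]
    unfolding poly_mapping_sum_single[symmetric] .
  then have "free_eval H g (p * p')
    = (\<Sum>w\<in>Poly_Mapping.keys p. free_eval H g (Poly_Mapping.single w (Poly_Mapping.lookup p w))) *
      (\<Sum>w'\<in>Poly_Mapping.keys p'. free_eval H g (Poly_Mapping.single w' (Poly_Mapping.lookup p' w')))"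
    by (simp add: free_eval_sum s sum_product)
  also have "\<dots> = free_eval H g p * free_eval H g p'"
    unfolding free_eval_sum[symmetric] poly_mapping_sum_single[symmetric] ..
  finally show ?thesis .
qed

lemma free_eval_const: "free_eval H g (fconst c) = scl H c 1"
  by (simp add: fconst_def free_eval_single zero_fword_def)

lemma free_eval_gen: "free_eval H g (fgen x) = g x"
  by (simp add: fgen_def free_eval_single)

lemma free_eval_one: "free_eval H g 1 = 1"
  using free_eval_const[of g 1] by (simp add: fconst_def)

lemma free_eval_prod_list: "free_eval H g (prod_list ps) = prod_list (map (free_eval H g) ps)"
  by (induction ps) (auto simp: free_eval_one free_eval_mult)

lemmas free_eval_simps = free_eval_add free_eval_sum free_eval_diff free_eval_mult free_eval_const
  free_eval_gen free_eval_one free_eval_prod_list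

lemma free_eval_ideal:
  assumes rel: "\<And>\<rho>. \<rho> \<in> R \<Longrightarrow> free_eval H g \<rho> = 0" and p: "p \<in> two_sided_ideal X R"
  shows "free_eval H g p = 0"
  using p by (induction rule: two_sided_ideal.induct) (auto simp: free_eval_add free_eval_mult rel)

end

lemma free_on_zero: "0 \<in> free_on X"
  and free_on_one: "1 \<in> free_on X"
  and free_on_const: "fconst c \<in> free_on X"
  by (auto simp: free_on_def fconst_def zero_fword_def)

lemma free_on_gen: "x \<in> X \<Longrightarrow> fgen x \<in> free_on X"
  by (auto simp: free_on_def fgen_def)

lemma free_on_add: "p \<in> free_on X \<Longrightarrow> p' \<in> free_on X \<Longrightarrow> p + p' \<in> free_on X"
  using keys_add[of p p'] by (auto simp: free_on_def)

lemma free_on_diff: "p \<in> free_on X \<Longrightarrow> p' \<in> free_on X \<Longrightarrow> p - p' \<in> free_on X"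
  for p :: "'g free_algebra"
  by (auto simp: free_on_def in_keys_iff lookup_minus) (metis diff_0_right diff_zero in_keys_iff subsetD)+

lemma free_on_mult: "p \<in> free_on X \<Longrightarrow> p' \<in> free_on X \<Longrightarrow> p * p' \<in> free_on X"
  using keys_mult[of p p'] by (fastforce simp: free_on_def plus_fword_def)

lemma free_on_sum: "(\<And>x. x \<in> A \<Longrightarrow> f x \<in> free_on X) \<Longrightarrow> (\<Sum>x\<in>A. f x) \<in> free_on X"
  by (induction A rule: infinite_finite_induct) (auto simp: free_on_zero free_on_add)

lemma free_on_prod_list: "(\<And>p. p \<in> set ps \<Longrightarrow> p \<in> free_on X) \<Longrightarrow> prod_list ps \<in> free_on X"
  by (induction ps) (auto simp: free_on_one free_on_mult)

lemmas free_on_intros = free_on_one free_on_const free_on_gen free_on_add free_on_diff free_on_mult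
  free_on_sum free_on_prod_list

text \<open>The complex numbers as an algebra over themselves, in the form in which noncommutative polynomials can be
  evaluated in them.\<close>

definition complex_scalars :: "complex hopf_star" where
  "complex_scalars = \<lparr>scl = (*), comult = (\<lambda>_. []), counit = (\<lambda>_. 0), antipode = id, star = id\<rparr>"

interpretation cev: scalar_algebra complex_scalars
  by unfold_locales (auto simp: complex_scalars_def algebra_simps)

lemma scl_complex_scalars [simp]: "scl complex_scalars = (*)"
  by (simp add: complex_scalars_def)

section \<open>The compact forms\<close>

lemma qrels_free:
  assumes "\<rho> \<in> qrels G N q"
  shows "\<rho> \<in> free_on (qgens G N)"
proof -
  have gen: "Gen i j \<in> qgens G N" if "1 \<le> i" "i \<le> N" "1 \<le> j" "j \<le> N" for i j
    using that by (cases G) auto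
  have frt: "\<rho> \<in> free_on (qgens G N)" if "\<rho> \<in> FRT_rels G N q"
    using that unfolding FRT_rels_def by (auto intro!: free_on_intros gen)
  have c: "\<rho> \<in> free_on (qgens G N)" if "\<rho> \<in> C_rels G N q"
    using that unfolding C_rels_def Un_iff mem_Collect_eq
    apply (elim disjE exE conjE)
    subgoal for i j
      apply (erule ssubst)
      apply (rule free_on_diff)
       apply (rule free_on_sum)+
       apply (rule free_on_mult free_on_const free_on_gen gen | simp)+
      done
    subgoal for i j
      apply (erule ssubst)
      apply (rule free_on_diff)
       apply (rule free_on_sum)+
       apply (rule free_on_mult free_on_const free_on_gen gen | simp)+
      done
    done
  have det: "qdet N q \<in> free_on (qgens G N)"
  proof -
    have "fgen (Gen i (\<pi> i)) \<in> free_on (qgens G N)" if "\<pi> permutes {1..N}" "1 \<le> i" "i \<le> N" for \<pi> i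
      using permutes_in_image[OF that(1), of i] that(2,3) by (intro free_on_gen gen) auto
    then show ?thesis
      unfolding qdet_def by (auto intro!: free_on_sum free_on_mult free_on_const free_on_prod_list)
  qed
  have dinv: "fgen GenDinv \<in> free_on (qgens GLq N)"
    by (intro free_on_gen) simp
  show ?thesis
    using assms frt c det dinv gen by (cases G) (auto intro!: free_on_intros)
qed

locale compact_quantum_group = hopf_star_algebra H for H :: "('a::ring_1) hopf_star" +
  fixes G :: family and N :: nat and q :: real and u :: "nat \<Rightarrow> nat \<Rightarrow> 'a" and dinv :: 'a
  assumes params: "admissible_params G N q"
    and presented: "presented_by H (case_qgen u dinv) (qgens G N) (qrels G N q)"
    and comult_u: "i \<in> {1..N} \<Longrightarrow> j \<in> {1..N} \<Longrightarrow>
      tensor_eq H (comult H (u i j)) [(u i k, u k j). k \<leftarrow> [1..<Suc N]]"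
    and counit_u: "i \<in> {1..N} \<Longrightarrow> j \<in> {1..N} \<Longrightarrow> counit H (u i j) = (if i = j then 1 else 0)"
    and star_u: "i \<in> {1..N} \<Longrightarrow> j \<in> {1..N} \<Longrightarrow> star H (u i j) = antipode H (u j i)"
begin

sublocale aev: scalar_algebra H
  by unfold_locales (rule scl_mult_left, rule scl_mult_right)

abbreviation gen :: "qgen \<Rightarrow> 'a" where "gen \<equiv> case_qgen u dinv"

lemma N_pos: "0 < N" and q_nz: "q \<noteq> 0"
  using params by (cases G; auto)+

lemma relation:
  assumes "\<rho> \<in> qrels G N q"
  shows "free_eval H gen \<rho> = 0"
proof -
  have "1 * \<rho> * 1 \<in> two_sided_ideal (qgens G N) (qrels G N q)"
    using assms by (intro two_sided_ideal.rel free_on_one)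
  then show ?thesis
    using presented qrels_free[OF assms] by (auto simp: presented_by_def)
qed

lemma words_span: "span {prod_list (map gen ls) | ls. set ls \<subseteq> qgens G N} = UNIV"
proof -
  have "a \<in> span {prod_list (map gen ls) | ls. set ls \<subseteq> qgens G N}" for a
  proof -
    have "a \<in> free_eval H gen ` free_on (qgens G N)" using presented by (simp add: presented_by_def)
    then obtain p where p: "p \<in> free_on (qgens G N)" "a = free_eval H gen p" by blast
    show ?thesis
      unfolding p(2) free_eval_def using p(1)
      by (intro span_sum span_scale span_base) (auto simp: free_on_def)
  qed
  then show ?thesis by auto
qed

text \<open>Values on the generators that respect the relations define a character: two noncommutative polynomials that
  represent the same element differ by an element of the ideal of relations.\<close>

lemma character_exists:
  fixes \<chi> :: "qgen \<Rightarrow> complex"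
  assumes "\<And>\<rho>. \<rho> \<in> qrels G N q \<Longrightarrow> free_eval complex_scalars \<chi> \<rho> = 0"
  obtains \<phi> where "linear_form H \<phi>" "\<phi> 1 = 1" "\<And>a b. \<phi> (a * b) = \<phi> a * \<phi> b"
    "\<And>x. x \<in> qgens G N \<Longrightarrow> \<phi> (gen x) = \<chi> x"
proof -
  let ?X = "qgens G N"
  define rep where "rep a = (SOME p. p \<in> free_on ?X \<and> free_eval H gen p = a)" for a
  have rep: "rep a \<in> free_on ?X \<and> free_eval H gen (rep a) = a" for a
  proof -
    have "a \<in> free_eval H gen ` free_on ?X" using presented by (simp add: presented_by_def)
    then have "\<exists>p. p \<in> free_on ?X \<and> free_eval H gen p = a" by blast
    then show ?thesis unfolding rep_def by (rule someI_ex)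
  qed
  define \<phi> where "\<phi> a = free_eval complex_scalars \<chi> (rep a)" for a
  have eval: "\<phi> (free_eval H gen p) = free_eval complex_scalars \<chi> p" if p: "p \<in> free_on ?X" for p
  proof -
    let ?p = "rep (free_eval H gen p) - p"
    have "?p \<in> free_on ?X" using rep p by (intro free_on_diff) auto
    moreover have "free_eval H gen ?p = 0" using rep by (simp add: aev.free_eval_diff)
    ultimately have "?p \<in> two_sided_ideal ?X (qrels G N q)" using presented by (auto simp: presented_by_def)
    from cev.free_eval_ideal[OF assms this] show ?thesis by (simp add: \<phi>_def cev.free_eval_diff)
  qed
  show thesis
  proof (rule that)
    show "\<phi> 1 = 1" using eval[OF free_on_one] by (simp add: aev.free_eval_one cev.free_eval_one)
    show "\<phi> (a * b) = \<phi> a * \<phi> b" for a b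
      using eval[OF free_on_mult, of "rep a" "rep b"] rep
      by (simp add: aev.free_eval_mult cev.free_eval_mult \<phi>_def)
    show "\<phi> (gen x) = \<chi> x" if "x \<in> ?X" for x
      using eval[OF free_on_gen[OF that]] by (simp add: aev.free_eval_gen cev.free_eval_gen)
    have "\<phi> (a + b) = \<phi> a + \<phi> b" for a b
      using eval[OF free_on_add, of "rep a" "rep b"] rep
      by (simp add: aev.free_eval_add cev.free_eval_add \<phi>_def)
    moreover have "\<phi> (scl H c a) = c * \<phi> a" for c a
      using eval[OF free_on_mult[OF free_on_const], of "rep a" c] rep
      by (simp add: aev.free_eval_simps cev.free_eval_simps \<phi>_def scl_mult_left)
    ultimately show "linear_form H \<phi>" by (simp add: linear_form_iff)
  qed
qed

lemma corep_u: "corep {1..N} u"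
  unfolding corep_def
proof (intro conjI ballI allI impI)
  fix i j assume ij: "i \<in> {1..N}" "j \<in> {1..N}"
  show "counit H (u i j) = (if i = j then 1 else 0)" by (rule counit_u[OF ij])
  fix B assume B: "bilinear_form H B"
  have "sweedler H B (u i j) = (\<Sum>(x, y)\<leftarrow>[(u i k, u k j). k \<leftarrow> [1..<Suc N]]. B x y)"
    using comult_u[OF ij] B by (simp add: tensor_eq_def sweedler_def)
  also have "\<dots> = (\<Sum>k=1..N. B (u i k) (u k j))"
    by (simp add: comp_def interv_sum_list_conv_sum_set_nat atLeastLessThanSuc_atLeastAtMost del: upt_Suc)
  finally show "sweedler H B (u i j) = (\<Sum>k\<in>{1..N}. B (u i k) (u k j))" .
qed simp

lemma ucorep_u: "ucorep {1..N} u"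
  using corep_u star_u by (simp add: ucorep_def)

end

section \<open>The quantum determinant\<close>

fun word_inversions :: "nat list \<Rightarrow> nat" where
  "word_inversions [] = 0"
| "word_inversions (x # xs) = length (filter (\<lambda>y. y < x) xs) + word_inversions xs"

text \<open>The coordinates of the \<open>q\<close>-antisymmetric tensor that spans the top degree of the quantum exterior
  algebra.\<close>

definition qsign :: "real \<Rightarrow> nat list \<Rightarrow> complex" where
  "qsign q J = (if distinct J then complex_of_real ((- q) ^ word_inversions J) else 0)"

lemma word_inversions_swap:
  assumes "a < b"
  shows "word_inversions (P @ b # a # Q) = Suc (word_inversions (P @ a # b # Q))"
  using assms by (induction P) auto

lemma qsign_swap:
  assumes "a < b"
  shows "qsign q (P @ b # a # Q) = - complex_of_real q * qsign q (P @ a # b # Q)"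
proof -
  have "distinct (P @ b # a # Q) \<longleftrightarrow> distinct (P @ a # b # Q)" by auto
  then show ?thesis
    unfolding qsign_def word_inversions_swap[OF assms] by (simp only: power_Suc of_real_mult of_real_minus) simp
qed

lemma qsign_repeat: "qsign q (P @ a # a # Q) = 0"
  by (simp add: qsign_def)

lemma word_inversions_sorted: "sorted_wrt (<) xs \<Longrightarrow> word_inversions xs = 0"
  by (induction xs) (auto simp: filter_empty_conv)

lemma qsign_sorted: "sorted_wrt (<) xs \<Longrightarrow> qsign q xs = 1"
  by (simp add: qsign_def word_inversions_sorted strict_sorted_iff)

lemma not_sorted_adjacent:
  assumes "\<not> sorted_wrt (<) (xs :: nat list)"
  obtains P a b Q where "xs = P @ b # a # Q" "a \<le> b"
proof -
  have "\<exists>P a b Q. xs = P @ b # a # Q \<and> a \<le> b"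
    using assms
  proof (induction xs)
    case (Cons x xs)
    show ?case
    proof (cases "sorted_wrt (<) xs")
      case False
      then obtain P a b Q where "xs = P @ b # a # Q \<and> a \<le> b" using Cons.IH by blast
      then have "x # xs = (x # P) @ b # a # Q \<and> a \<le> b" by simp
      then show ?thesis by blast
    next
      case True
      then obtain y where y: "y \<in> set xs" "y \<le> x" using Cons.prems by (auto simp: not_less)
      then obtain z zs where xs: "xs = z # zs" by (cases xs) auto
      then have "z \<le> x" using True y by auto
      then have "x # xs = [] @ x # z # zs \<and> z \<le> x" using xs by simp
      then show ?thesis by blast
    qed
  qed simp
  with that show thesis by blast
qed

definition standard_word :: "nat \<Rightarrow> nat list" where
  "standard_word N = [1..<Suc N]"

definition words :: "nat \<Rightarrow> nat \<Rightarrow> nat list set" where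
  "words N n = {I. length I = n \<and> set I \<subseteq> {1..N}}"

lemma finite_words: "finite (words N n)"
  using finite_lists_length_eq[of "{1..N}" n] by (simp add: words_def conj_commute)

lemma words_bij: "bij_betw (\<lambda>I. (hd I, tl I)) (words N (Suc n)) ({1..N} \<times> words N n)"
  by (rule bij_betw_byWitness[of _ "\<lambda>(i, I). i # I"])
    (auto simp: words_def length_Suc_conv)

lemma sum_words_Suc: "(\<Sum>I\<in>words N (Suc n). f I) = (\<Sum>i=1..N. \<Sum>I\<in>words N n. f (i # I))"
proof -
  have "(\<Sum>I\<in>words N (Suc n). f I) = (\<Sum>I\<in>words N (Suc n). f (fst (hd I, tl I) # snd (hd I, tl I)))"
    by (intro sum.cong refl) (auto simp: words_def length_Suc_conv)
  also have "\<dots> = (\<Sum>p\<in>{1..N} \<times> words N n. f (fst p # snd p))"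
    by (rule sum.reindex_bij_betw[OF words_bij])
  finally show ?thesis by (simp add: sum.cartesian_product')
qed

lemma sum_words_append:
  "(\<Sum>I\<in>words N (m + n). f I) = (\<Sum>P\<in>words N m. \<Sum>I\<in>words N n. f (P @ I))"
proof (induction m arbitrary: f)
  case 0
  have "words N 0 = {[]}" by (auto simp: words_def)
  then show ?case by simp
next
  case (Suc m)
  then show ?case by (simp add: sum_words_Suc)
qed

lemma sum_words_split:
  "(\<Sum>I\<in>words N (m + Suc (Suc n)). f I)
    = (\<Sum>P\<in>words N m. \<Sum>Q\<in>words N n. \<Sum>a=1..N. \<Sum>b=1..N. f (P @ a # b # Q))"
proof -
  have "(\<Sum>I\<in>words N (m + Suc (Suc n)). f I)
      = (\<Sum>P\<in>words N m. \<Sum>a=1..N. \<Sum>b=1..N. \<Sum>Q\<in>words N n. f (P @ a # b # Q))"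
    by (simp only: sum_words_append sum_words_Suc)
  also have "\<dots> = (\<Sum>P\<in>words N m. \<Sum>a=1..N. \<Sum>Q\<in>words N n. \<Sum>b=1..N. f (P @ a # b # Q))"
    by (intro sum.cong refl sum.swap)
  also have "\<dots> = (\<Sum>P\<in>words N m. \<Sum>Q\<in>words N n. \<Sum>a=1..N. \<Sum>b=1..N. f (P @ a # b # Q))"
    by (intro sum.cong[OF refl] sum.swap)
  finally show ?thesis .
qed

lemma strictly_sorted_word:
  assumes "I \<in> words N N" "sorted_wrt (<) I"
  shows "I = standard_word N"
proof -
  have "card (set I) = N" using assms by (auto simp: words_def strict_sorted_iff distinct_card)
  moreover have "set I \<subseteq> {1..N}" using assms by (simp add: words_def)
  ultimately have I: "set I = {1..N}" by (intro card_subset_eq) simp_all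
  have L: "set [1..<Suc N] = {1..N}" by (simp add: atLeastLessThanSuc_atLeastAtMost del: upt_Suc)
  have "[1..<Suc N] = I"
    by (rule strict_sorted_equal[OF assms(2) sorted_wrt_upt]) (simp only: I L)
  then show ?thesis by (simp only: standard_word_def)
qed

lemma word_inversions_map:
  fixes xs :: "nat list"
  assumes "sorted_wrt (<) xs"
  shows "word_inversions (map \<pi> xs) = card {(i, j). i \<in> set xs \<and> j \<in> set xs \<and> i < j \<and> \<pi> j < \<pi> i}"
  using assms
proof (induction xs)
  case (Cons x xs)
  let ?S = "\<lambda>xs. {(i, j). i \<in> set xs \<and> j \<in> set xs \<and> i < j \<and> \<pi> j < \<pi> i}"
  have lt: "x < y" if "y \<in> set xs" for y using Cons.prems that by simp
  have "?S (x # xs) = Pair x ` {j \<in> set xs. \<pi> j < \<pi> x} \<union> ?S xs" (is "?A = ?B")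
  proof (rule Set.set_eqI, rule iffI)
    fix p assume "p \<in> ?A"
    then obtain i j where p: "p = (i, j)" "i = x \<or> i \<in> set xs" "j = x \<or> j \<in> set xs" "i < j" "\<pi> j < \<pi> i"
      by auto
    then have "j \<in> set xs" using lt[of i] by auto
    then show "p \<in> ?B" using p by blast
  next
    fix p assume "p \<in> ?B"
    then show "p \<in> ?A" using lt by auto
  qed
  moreover have "finite (?S xs)" by (rule finite_subset[of _ "set xs \<times> set xs"]) auto
  moreover have "Pair x ` {j \<in> set xs. \<pi> j < \<pi> x} \<inter> ?S xs = {}" using Cons.prems by auto
  ultimately have "card (?S (x # xs)) = card (Pair x ` {j \<in> set xs. \<pi> j < \<pi> x}) + card (?S xs)"
    by (simp add: card_Un_disjoint)
  also have "card (Pair x ` {j \<in> set xs. \<pi> j < \<pi> x}) = card {j \<in> set xs. \<pi> j < \<pi> x}"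
    by (rule card_image) (simp add: inj_on_def)
  also have "{j \<in> set xs. \<pi> j < \<pi> x} = set (filter (\<lambda>j. \<pi> j < \<pi> x) xs)" by auto
  also have "card \<dots> = length (filter (\<lambda>j. \<pi> j < \<pi> x) xs)"
    using Cons.prems by (intro distinct_card distinct_filter) (auto simp: strict_sorted_iff)
  finally show ?case using Cons by (simp add: filter_map comp_def)
qed simp

lemma permutations_as_words:
  "bij_betw (\<lambda>\<pi>. map \<pi> [1..<Suc N]) {\<pi>. \<pi> permutes {1..N}} {J \<in> words N N. distinct J}"
proof -
  let ?f = "\<lambda>\<pi>. map \<pi> [1..<Suc N]"
  have inj: "inj_on ?f {\<pi>. \<pi> permutes {1..N}}"
  proof (rule inj_onI, rule ext)
    fix \<pi> \<sigma> i assume "\<pi> \<in> {\<pi>. \<pi> permutes {1..N}}" "\<sigma> \<in> {\<pi>. \<pi> permutes {1..N}}"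
      and eq: "map \<pi> [1..<Suc N] = map \<sigma> [1..<Suc N]"
    then show "\<pi> i = \<sigma> i"
      by (cases "i \<in> {1..N}") (auto simp: permutes_not_in map_eq_conv simp del: upt_Suc)
  qed
  have sub: "?f ` {\<pi>. \<pi> permutes {1..N}} \<subseteq> {J \<in> words N N. distinct J}"
    by (auto simp: words_def distinct_map permutes_inj_on permutes_in_image simp del: upt_Suc)
      (metis One_nat_def atLeastAtMost_iff less_Suc_eq_le permutes_in_image)+
  have "{J \<in> words N N. distinct J} = {xs. length xs = N \<and> distinct xs \<and> set xs \<subseteq> {1..N}}"
    by (auto simp: words_def)
  then have "card {J \<in> words N N. distinct J} = fact N"
    using card_lists_distinct_length_eq[of "{1..N}" N] by (simp add: fact_prod)
  moreover have "card (?f ` {\<pi>. \<pi> permutes {1..N}}) = fact N"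
    using card_image[OF inj] card_permutations[of "{1..N}" N] by simp
  ultimately have "?f ` {\<pi>. \<pi> permutes {1..N}} = {J \<in> words N N. distinct J}"
    using sub finite_words by (intro card_subset_eq) auto
  with inj show ?thesis by (simp add: bij_betw_def)
qed

lemma double_delta:
  assumes "finite I" "i \<in> I" "j \<in> I"
  shows "(\<Sum>k\<in>I. \<Sum>l\<in>I. if k = i then if l = j then f k l else 0 else 0) = (f i j :: 'b::comm_monoid_add)"
proof -
  have "(\<Sum>k\<in>I. \<Sum>l\<in>I. if k = i then if l = j then f k l else 0 else 0)
      = (\<Sum>k\<in>I. if k = i then (\<Sum>l\<in>I. if l = j then f k l else 0) else 0)"
    by (intro sum.cong refl) auto
  then show ?thesis using assms by simp
qed

context hopf_star_algebra
begin

lemma ucorep_cong: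
  assumes v: "ucorep I v" and eq: "\<And>i j. i \<in> I \<Longrightarrow> j \<in> I \<Longrightarrow> v i j = w i j"
  shows "ucorep I w"
  using corep_cong[OF ucorep_corep[OF v] eq] ucorep_antipode[OF v] eq by (auto simp: ucorep_def)

end

context compact_quantum_group
begin

definition tpow :: "nat list \<Rightarrow> nat list \<Rightarrow> 'a" where
  "tpow I J = prod_list (map2 u I J)"

lemma tpow_Cons: "tpow (i # I) (j # J) = u i j * tpow I J"
  by (simp add: tpow_def)

lemma tpow_append: "length I = length J \<Longrightarrow> tpow (I @ I') (J @ J') = tpow I J * tpow I' J'"
  by (simp add: tpow_def)

lemma ucorep_tpow: "ucorep (words N n) tpow"
proof (induction n)
  case 0
  have w: "words N 0 = {[]}" by (auto simp: words_def)
  have "bij_betw (\<lambda>_. 0) {[] :: nat list} {0 :: nat}" by (simp add: bij_betw_def)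
  from ucorep_reindex[OF ucorep_one this] show ?case
    unfolding w by (rule ucorep_cong) (simp add: tpow_def)
next
  case (Suc n)
  from ucorep_reindex[OF ucorep_tensor[OF ucorep_u Suc] words_bij]
  show ?case
    by (rule ucorep_cong) (auto simp: tensor_corep_def words_def length_Suc_conv tpow_Cons)
qed

lemma frt_relation:
  assumes "i \<in> {1..N}" "j \<in> {1..N}" "m \<in> {1..N}" "n \<in> {1..N}"
  shows "(\<Sum>k=1..N. \<Sum>l=1..N. scl H (Rmat G N q i j k l) (u k m * u l n))
    = (\<Sum>k=1..N. \<Sum>l=1..N. scl H (Rmat G N q k l m n) (u j l * u i k))"
proof -
  have "FRT_rels G N q \<subseteq> qrels G N q" by (cases G) auto
  then have "(\<Sum>k=1..N. \<Sum>l=1..N. fconst (Rmat G N q i j k l) * U k m * U l n)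
      - (\<Sum>k=1..N. \<Sum>l=1..N. U j l * U i k * fconst (Rmat G N q k l m n)) \<in> qrels G N q"
    using assms unfolding FRT_rels_def by blast
  from relation[OF this] show ?thesis
    by (simp add: aev.free_eval_simps scl_mult_left scl_mult_right)
qed

end

locale type_A = compact_quantum_group +
  assumes A: "G = GLq \<or> G = SLq"
begin

lemma sum_R_A_left:
  fixes f :: "nat \<Rightarrow> nat \<Rightarrow> 'a"
  assumes "i \<in> {1..N}" "j \<in> {1..N}"
  shows "(\<Sum>k=1..N. \<Sum>l=1..N. scl H (Rmat G N q i j k l) (f k l))
    = scl H (qpow q (kron i j)) (f i j) + scl H ((q - inverse q) * theta (int i - int j)) (f j i)"
proof -
  have "(\<Sum>k=1..N. \<Sum>l=1..N. scl H (Rmat G N q i j k l) (f k l))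
    = (\<Sum>k=1..N. \<Sum>l=1..N. (if k = i then if l = j then scl H (qpow q (kron i j)) (f k l) else 0 else 0)
      + (if k = j then if l = i then scl H ((q - inverse q) * theta (int i - int j)) (f k l) else 0 else 0))"
    using A by (intro sum.cong refl) (auto simp: Rmat_def R_A_def kron_def scale_left_distrib)
  then show ?thesis
    using assms by (simp only: sum.distrib double_delta finite_atLeastAtMost)
qed

lemma sum_R_A_right:
  fixes f :: "nat \<Rightarrow> nat \<Rightarrow> 'a"
  assumes "m \<in> {1..N}" "n \<in> {1..N}"
  shows "(\<Sum>k=1..N. \<Sum>l=1..N. scl H (Rmat G N q k l m n) (f k l))
    = scl H (qpow q (kron m n)) (f m n) + scl H ((q - inverse q) * theta (int n - int m)) (f n m)"
proof -
  have "(\<Sum>k=1..N. \<Sum>l=1..N. scl H (Rmat G N q k l m n) (f k l))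
    = (\<Sum>k=1..N. \<Sum>l=1..N. (if k = m then if l = n then scl H (qpow q (kron m n)) (f k l) else 0 else 0)
      + (if k = n then if l = m then scl H ((q - inverse q) * theta (int n - int m)) (f k l) else 0 else 0))"
    using A by (intro sum.cong refl) (auto simp: Rmat_def R_A_def kron_def scale_left_distrib)
  then show ?thesis
    using assms by (simp only: sum.distrib double_delta finite_atLeastAtMost)
qed

lemma frt_A:
  assumes "i \<in> {1..N}" "j \<in> {1..N}" "m \<in> {1..N}" "n \<in> {1..N}"
  shows "scl H (qpow q (kron i j)) (u i m * u j n) + scl H ((q - inverse q) * theta (int i - int j)) (u j m * u i n)
    = scl H (qpow q (kron m n)) (u j n * u i m) + scl H ((q - inverse q) * theta (int n - int m)) (u j m * u i n)"
  using frt_relation[OF assms] sum_R_A_left[OF assms(1,2), of "\<lambda>k l. u k m * u l n"]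
    sum_R_A_right[OF assms(3,4), of "\<lambda>k l. u j l * u i k"] by simp

lemma qpow_kron: "qpow q (kron i j) = (if i = j then q else 1)"
  by (simp add: qpow_def kron_def)

lemma rows_q_commute:
  assumes a: "a \<in> {1..N}" and m: "m \<in> {1..N}" "n \<in> {1..N}" "m < n"
  shows "u a m * u a n = scl H q (u a n * u a m)"
proof -
  have "scl H q (u a m * u a n) = u a n * u a m + scl H (q - inverse q) (u a m * u a n)"
    using frt_A[OF a a m(1,2)] m(3) by (simp add: qpow_kron theta_def)
  then have "scl H (inverse q) (u a m * u a n) = u a n * u a m"
    by (simp add: scale_left_diff_distrib)
  then have "scl H q (scl H (inverse q) (u a m * u a n)) = scl H q (u a n * u a m)" by simp
  then show ?thesis using q_nz by simp
qed

lemma antidiagonal_commute: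
  assumes a: "a \<in> {1..N}" "b \<in> {1..N}" "a < b" and m: "m \<in> {1..N}" "n \<in> {1..N}" "m < n"
  shows "u a n * u b m = u b m * u a n"
  using frt_A[OF a(1,2) m(2,1)] a(3) m(3) by (simp add: qpow_kron theta_def)

lemma diagonal_commute:
  assumes a: "a \<in> {1..N}" "b \<in> {1..N}" "a < b" and m: "m \<in> {1..N}" "n \<in> {1..N}" "m < n"
  shows "u a m * u b n = u b n * u a m + scl H (q - inverse q) (u b m * u a n)"
  using frt_A[OF a(1,2) m(1,2)] a(3) m(3) by (simp add: qpow_kron theta_def)

lemma double_sum_pairs:
  fixes f :: "nat \<Rightarrow> nat \<Rightarrow> 'a"
  shows "(\<Sum>m\<in>I. \<Sum>n\<in>I. f m n)
    = (\<Sum>m\<in>I. \<Sum>n\<in>I. if m < n then f m n + f n m else if m = n then f m n else 0)"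
proof -
  have "(\<Sum>m\<in>I. \<Sum>n\<in>I. f m n) = (\<Sum>m\<in>I. \<Sum>n\<in>I. (if m < n then f m n else 0) +
      ((if n < m then f m n else 0) + (if m = n then f m n else 0)))"
    by (intro sum.cong refl) auto
  also have "\<dots> = (\<Sum>m\<in>I. \<Sum>n\<in>I. if m < n then f m n else 0) +
      ((\<Sum>m\<in>I. \<Sum>n\<in>I. if n < m then f m n else 0) + (\<Sum>m\<in>I. \<Sum>n\<in>I. if m = n then f m n else 0))"
    by (simp only: sum.distrib)
  also have "(\<Sum>m\<in>I. \<Sum>n\<in>I. if n < m then f m n else 0) = (\<Sum>m\<in>I. \<Sum>n\<in>I. if m < n then f n m else 0)"
    by (rule sum.swap)
  also have "(\<Sum>m\<in>I. \<Sum>n\<in>I. if m < n then f m n else 0) +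
      ((\<Sum>m\<in>I. \<Sum>n\<in>I. if m < n then f n m else 0) + (\<Sum>m\<in>I. \<Sum>n\<in>I. if m = n then f m n else 0))
    = (\<Sum>m\<in>I. \<Sum>n\<in>I. (if m < n then f m n else 0) +
      ((if m < n then f n m else 0) + (if m = n then f m n else 0)))"
    by (simp only: sum.distrib)
  also have "\<dots> = (\<Sum>m\<in>I. \<Sum>n\<in>I. if m < n then f m n + f n m else if m = n then f m n else 0)"
    by (intro sum.cong refl) auto
  finally show ?thesis .
qed

text \<open>The quadratic relations of the linear groups imply that \<open>u \<otimes> u\<close> preserves \<open>q\<close>-antisymmetric tensors of
  degree two.\<close>

lemma q_antisymmetric_two:
  fixes W :: "nat \<Rightarrow> nat \<Rightarrow> complex"
  assumes W0: "\<And>m. W m m = 0" and W1: "\<And>m n. m < n \<Longrightarrow> W n m = - complex_of_real q * W m n"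
  defines "Y a b \<equiv> \<Sum>m=1..N. \<Sum>n=1..N. scl H (W m n) (u a m * u b n)"
  assumes ab: "a \<in> {1..N}" "b \<in> {1..N}"
  shows "Y a a = 0" and "a < b \<Longrightarrow> Y b a = scl H (- complex_of_real q) (Y a b)"
proof -
  have Y: "Y a b = (\<Sum>m=1..N. \<Sum>n=1..N. if m < n then scl H (W m n) (u a m * u b n - scl H q (u a n * u b m)) else 0)" for a b
    unfolding Y_def
    by (subst double_sum_pairs, intro sum.cong refl) (simp add: W0 W1 scale_right_diff_distrib mult.commute)
  have "(\<Sum>m=1..N. \<Sum>n=1..N. if m < n then scl H (W m n) (u a m * u a n - scl H q (u a n * u a m)) else 0) = (\<Sum>m=1..N. \<Sum>n=1..N. 0)"
    using ab by (intro sum.cong refl) (simp add: rows_q_commute)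
  then show "Y a a = 0" unfolding Y by simp
  assume lt: "a < b"
  have "u b m * u a n - scl H q (u b n * u a m) = scl H (- complex_of_real q) (u a m * u b n - scl H q (u a n * u b m))"
    if "m \<in> {1..N}" "n \<in> {1..N}" "m < n" for m n
  proof -
    have "scl H (- complex_of_real q) (u a m * u b n - scl H q (u a n * u b m))
        = scl H (- complex_of_real q) (u b n * u a m) - scl H (q * (q - inverse q)) (u b m * u a n) + scl H (q * q) (u b m * u a n)"
      by (simp add: antidiagonal_commute[OF ab lt that] diagonal_commute[OF ab lt that]
          scale_right_diff_distrib scale_right_distrib)
    also have "q * (q - inverse q) = q * q - 1" using q_nz by (simp add: algebra_simps)
    finally show ?thesis by (simp add: scale_left_diff_distrib)
  qed
  then show "Y b a = scl H (- complex_of_real q) (Y a b)"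
    unfolding Y scale_sum_right
    by (intro sum.cong refl) (auto simp: scale_left_commute)
qed

text \<open>The vector \<open>qsign\<close>, acted upon by the tensor power of \<open>u\<close>, stays \<open>q\<close>-antisymmetric, hence is multiplied
  by a scalar from the algebra, the quantum determinant.\<close>

definition det_vector :: "nat list \<Rightarrow> 'a" where
  "det_vector I = (\<Sum>J\<in>words N N. scl H (qsign q J) (tpow I J))"

definition qdeterminant :: 'a where
  "qdeterminant = det_vector (standard_word N)"

lemma det_vector_split:
  assumes I: "P @ a # b # Q \<in> words N N"
  shows "det_vector (P @ a # b # Q) = (\<Sum>P'\<in>words N (length P). \<Sum>Q'\<in>words N (length Q). tpow P P' *
    (\<Sum>m=1..N. \<Sum>n=1..N. scl H (qsign q (P' @ m # n # Q')) (u a m * u b n)) * tpow Q Q')"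
proof -
  have N: "N = length P + Suc (Suc (length Q))" using I by (simp add: words_def)
  have split: "(\<Sum>I\<in>words N N. f I)
      = (\<Sum>P'\<in>words N (length P). \<Sum>Q'\<in>words N (length Q). \<Sum>m=1..N. \<Sum>n=1..N. f (P' @ m # n # Q'))"
    for f :: "nat list \<Rightarrow> 'a"
    using sum_words_split[of f N "length P" "length Q"] by (simp only: N[symmetric])
  have "det_vector (P @ a # b # Q) = (\<Sum>P'\<in>words N (length P). \<Sum>Q'\<in>words N (length Q). \<Sum>m=1..N. \<Sum>n=1..N.
      scl H (qsign q (P' @ m # n # Q')) (tpow (P @ a # b # Q) (P' @ m # n # Q')))"
    unfolding det_vector_def by (rule split)
  also have "\<dots> = (\<Sum>P'\<in>words N (length P). \<Sum>Q'\<in>words N (length Q). \<Sum>m=1..N. \<Sum>n=1..N.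
      scl H (qsign q (P' @ m # n # Q')) (tpow P P' * (u a m * u b n) * tpow Q Q'))"
    by (intro sum.cong refl) (auto simp: words_def tpow_append tpow_Cons mult.assoc)
  also have "\<dots> = (\<Sum>P'\<in>words N (length P). \<Sum>Q'\<in>words N (length Q). tpow P P' *
    (\<Sum>m=1..N. \<Sum>n=1..N. scl H (qsign q (P' @ m # n # Q')) (u a m * u b n)) * tpow Q Q')"
    by (simp add: sum_distrib_left sum_distrib_right scl_mult_left scl_mult_right)
  finally show ?thesis .
qed

lemma det_vector_antisymmetric:
  assumes I: "P @ a # b # Q \<in> words N N"
  shows "a = b \<Longrightarrow> det_vector (P @ a # b # Q) = 0"
    and "a < b \<Longrightarrow> det_vector (P @ b # a # Q) = scl H (- complex_of_real q) (det_vector (P @ a # b # Q))"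
proof -
  have ab: "a \<in> {1..N}" "b \<in> {1..N}" and I': "P @ b # a # Q \<in> words N N" using I by (auto simp: words_def)
  have two1: "(\<Sum>m=1..N. \<Sum>n=1..N. scl H (qsign q (P' @ m # n # Q')) (u a m * u a n)) = 0" for P' Q'
    by (rule q_antisymmetric_two(1)) (use ab in \<open>simp_all add: qsign_repeat qsign_swap\<close>)
  have two2: "(\<Sum>m=1..N. \<Sum>n=1..N. scl H (qsign q (P' @ m # n # Q')) (u b m * u a n))
    = scl H (- complex_of_real q) (\<Sum>m=1..N. \<Sum>n=1..N. scl H (qsign q (P' @ m # n # Q')) (u a m * u b n))"
    if "a < b" for P' Q'
    by (rule q_antisymmetric_two(2)) (use ab that in \<open>simp_all add: qsign_repeat qsign_swap\<close>)
  have "det_vector (P @ a # a # Q) = 0" if "P @ a # a # Q \<in> words N N"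
    using det_vector_split[OF that] by (simp only: two1) simp
  then show "det_vector (P @ a # b # Q) = 0" if "a = b" using I that by simp
  show "det_vector (P @ b # a # Q) = scl H (- complex_of_real q) (det_vector (P @ a # b # Q))" if "a < b"
  proof -
    have e: "x * scl H c y * z = scl H c (x * y * z)" for c x y z
      by (simp only: scl_mult_left scl_mult_right)
    show ?thesis
      unfolding det_vector_split[OF I] det_vector_split[OF I'] two2[OF that] e scale_sum_right[symmetric] ..
  qed
qed

text \<open>Sorting \<open>I\<close> by adjacent transpositions removes one inversion at a time and multiplies both sides by
  \<open>-q\<close>; if two adjacent letters agree, both sides vanish.\<close>

lemma det_vector_eq:
  assumes "I \<in> words N N"
  shows "det_vector I = scl H (qsign q I) qdeterminant"
  using assms
proof (induction "word_inversions I" arbitrary: I rule: less_induct)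
  case less
  show ?case
  proof (cases "sorted_wrt (<) I")
    case True
    then show ?thesis
      using strictly_sorted_word[OF less.prems True] qsign_sorted[OF True, of q] by (simp add: qdeterminant_def)
  next
    case False
    then obtain P a b Q where I: "I = P @ b # a # Q" and ab: "a \<le> b" by (rule not_sorted_adjacent)
    show ?thesis
    proof (cases "a = b")
      case True
      have "det_vector I = 0"
        unfolding I by (rule det_vector_antisymmetric(1)) (use less.prems I True in simp_all)
      moreover have "qsign q I = 0" unfolding I True by (rule qsign_repeat)
      ultimately show ?thesis by simp
    next
      case False
      then have lt: "a < b" using ab by simp
      let ?I = "P @ a # b # Q"
      have w: "?I \<in> words N N" using less.prems I by (auto simp: words_def)
      have "det_vector ?I = scl H (qsign q ?I) qdeterminant"
        using less.hyps[OF _ w] I lt by (simp add: word_inversions_swap)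
      then show ?thesis
        using det_vector_antisymmetric(2)[OF w lt] I lt by (simp add: qsign_swap)
    qed
  qed
qed

text \<open>Permutations correspond to the words without repetitions, the other words have \<open>qsign\<close> zero.\<close>

lemma free_eval_qdet: "free_eval H gen (qdet N q) = qdeterminant"
proof -
  let ?L = "[1..<Suc N]"
  have s: "qsign q (map \<pi> ?L) = complex_of_real ((- q) ^ inversions N \<pi>)" if "\<pi> permutes {1..N}" for \<pi>
  proof -
    have "distinct (map \<pi> ?L)" using that by (simp add: distinct_map permutes_inj_on del: upt_Suc)
    moreover have "word_inversions (map \<pi> ?L) = inversions N \<pi>"
      using word_inversions_map[OF sorted_wrt_upt, of \<pi> 1 "Suc N"]
      by (simp add: inversions_def atLeastLessThanSuc_atLeastAtMost del: upt_Suc)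
    ultimately show ?thesis by (simp add: qsign_def del: upt_Suc)
  qed
  have t: "tpow ?L (map \<pi> ?L) = prod_list (map (\<lambda>i. u i (\<pi> i)) ?L)" for \<pi>
    by (simp add: tpow_def map2_map_map[of u id, simplified] del: upt_Suc)
  have "free_eval H gen (qdet N q) = (\<Sum>\<pi> | \<pi> permutes {1..N}. scl H (qsign q (map \<pi> ?L)) (tpow ?L (map \<pi> ?L)))"
    unfolding qdet_def aev.free_eval_sum
  proof (rule sum.cong[OF refl])
    fix \<pi> assume "\<pi> \<in> {\<pi>. \<pi> permutes {1..N}}"
    then show "free_eval H gen (fconst (complex_of_real ((- q) ^ inversions N \<pi>)) * prod_list (map (\<lambda>i. U i (\<pi> i)) ?L))
      = scl H (qsign q (map \<pi> ?L)) (tpow ?L (map \<pi> ?L))"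
      unfolding t by (simp add: s aev.free_eval_simps comp_def scl_mult_left del: upt_Suc One_nat_def)
  qed
  also have "\<dots> = (\<Sum>J | J \<in> words N N \<and> distinct J. scl H (qsign q J) (tpow ?L J))"
    by (rule sum.reindex_bij_betw[OF permutations_as_words, of "\<lambda>J. scl H (qsign q J) (tpow ?L J)"])
  also have "\<dots> = qdeterminant"
    unfolding qdeterminant_def det_vector_def standard_word_def using finite_words
    by (intro sum.mono_neutral_left) (auto simp: qsign_def)
  finally show ?thesis .
qed

lemma standard_word: "standard_word N \<in> words N N" "qsign q (standard_word N) = 1"
  using qsign_sorted[OF sorted_wrt_upt] by (auto simp: words_def standard_word_def simp del: upt_Suc)

text \<open>The quantum determinant is group-like, and unitary because the tensor power of \<open>u\<close> is.\<close>

lemma ucorep_qdeterminant: "ucorep {0 :: nat} (\<lambda>_ _. qdeterminant)"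
proof (rule ucorepI)
  let ?L = "standard_word N" and ?W = "words N N"
  note t = ucorep_tpow[of N] and c = ucorep_corep[OF ucorep_tpow[of N]]
  have form: "sweedler H B qdeterminant = B qdeterminant qdeterminant" if B: "bilinear_form H B" for B
  proof -
    have B1: "linear_form H (\<lambda>y. B x y)" and B2: "linear_form H (\<lambda>x. B x y)" for x y
      using B by (auto simp: bilinear_form_def)
    note lin = comult_linear[OF B]
    have "sweedler H B qdeterminant = (\<Sum>J\<in>?W. qsign q J * (\<Sum>K\<in>?W. B (tpow ?L K) (tpow K J)))"
      unfolding qdeterminant_def det_vector_def linear_form_sum[OF lin] linear_form_scl[OF lin]
      by (intro sum.cong refl) (simp add: corep_form[OF c standard_word(1) _ B])
    also have "\<dots> = (\<Sum>K\<in>?W. \<Sum>J\<in>?W. qsign q J * B (tpow ?L K) (tpow K J))"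
      unfolding sum_distrib_left by (rule sum.swap)
    also have "\<dots> = (\<Sum>K\<in>?W. B (tpow ?L K) (det_vector K))"
      by (simp add: det_vector_def linear_form_sum[OF B1] linear_form_scl[OF B1])
    also have "\<dots> = (\<Sum>K\<in>?W. qsign q K * B (tpow ?L K) qdeterminant)"
      by (intro sum.cong refl) (simp add: det_vector_eq linear_form_scl[OF B1])
    also have "\<dots> = B qdeterminant qdeterminant"
      by (simp add: qdeterminant_def det_vector_def linear_form_sum[OF B2] linear_form_scl[OF B2])
    finally show ?thesis .
  qed
  have "counit H qdeterminant = (\<Sum>J\<in>?W. qsign q J * (if ?L = J then 1 else 0))"
    unfolding qdeterminant_def det_vector_def linear_form_sum[OF counit_linear] linear_form_scl[OF counit_linear]
    by (intro sum.cong refl) (simp add: corep_counit[OF c standard_word(1)])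
  also have "\<dots> = 1"
    using finite_words standard_word by (simp add: if_distrib[of "\<lambda>x. _ * x"] cong: if_cong)
  finally show "corep {0 :: nat} (\<lambda>_ _. qdeterminant)" using form by (simp add: corep_def)
  \<comment> \<open>As \<open>tpow\<close> is unitary and multiplies \<open>qsign\<close> by \<open>D\<close>, comparing squared lengths gives \<open>n D\<^sup>* D = n\<close>.\<close>
  define n where "n = (\<Sum>J\<in>?W. qsign q J * qsign q J)"
  have "star H (det_vector I) * det_vector I = scl H (qsign q I * qsign q I) (star H qdeterminant * qdeterminant)"
    if "I \<in> ?W" for I
    using that by (simp add: det_vector_eq star_scl scl_mult qsign_def)
  then have "scl H n (star H qdeterminant * qdeterminant) = (\<Sum>I\<in>?W. star H (det_vector I) * det_vector I)"
    by (simp add: n_def scale_sum_left)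
  also have "\<dots> = (\<Sum>I\<in>?W. \<Sum>J\<in>?W. \<Sum>K\<in>?W. scl H (qsign q J * qsign q K) (star H (tpow I J) * tpow I K))"
    unfolding det_vector_def star_sum sum_product
    by (intro sum.cong refl) (simp add: star_scl scl_mult qsign_def)
  also have "\<dots> = (\<Sum>J\<in>?W. \<Sum>I\<in>?W. \<Sum>K\<in>?W. scl H (qsign q J * qsign q K) (star H (tpow I J) * tpow I K))"
    by (rule sum.swap)
  also have "\<dots> = (\<Sum>J\<in>?W. \<Sum>K\<in>?W. \<Sum>I\<in>?W. scl H (qsign q J * qsign q K) (star H (tpow I J) * tpow I K))"
    by (intro sum.cong refl sum.swap)
  also have "\<dots> = (\<Sum>J\<in>?W. \<Sum>K\<in>?W. scl H (qsign q J * qsign q K) (if J = K then 1 else 0))"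
    by (intro sum.cong refl) (simp add: ucorep_star_left[OF t] flip: scale_sum_right)
  also have "\<dots> = (\<Sum>J\<in>?W. scl H (qsign q J * qsign q J) 1)"
    using finite_words by (intro sum.cong refl) (simp add: if_distrib[of "scl H _"] cong: if_cong)
  also have "\<dots> = scl H n 1" by (simp add: n_def scale_sum_left)
  finally have eq: "scl H n (star H qdeterminant * qdeterminant) = scl H n 1" .
  have "n \<noteq> 0"
  proof -
    have nonneg: "qsign q J * qsign q J = complex_of_real ((Re (qsign q J))\<^sup>2)" for J
      by (simp add: qsign_def power2_eq_square)
    have "n = complex_of_real (\<Sum>J\<in>?W. (Re (qsign q J))\<^sup>2)" by (simp add: n_def nonneg)
    moreover have "0 < (\<Sum>J\<in>?W. (Re (qsign q J))\<^sup>2)"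
      by (rule sum_pos2[OF finite_words standard_word(1)]) (simp_all add: standard_word)
    ultimately show ?thesis by (metis of_real_eq_0_iff less_irrefl)
  qed
  then have "star H qdeterminant * qdeterminant = 1"
    using eq scale_cancel_left by metis
  then show "(\<Sum>k\<in>{0}. star H qdeterminant * qdeterminant) = (if i = j then 1 else 0)"
    if "i \<in> {0 :: nat}" "j \<in> {0}" for i j
    using that by simp
qed

lemma star_qdeterminant: "star H qdeterminant * qdeterminant = 1"
  using ucorep_star_left[OF ucorep_qdeterminant, of 0 0] by simp

lemma dinv_eq_star:
  assumes "G = GLq"
  shows "dinv = star H qdeterminant"
proof -
  have "qdet N q * fgen GenDinv - 1 \<in> qrels G N q" using assms by simp
  from relation[OF this] have "qdeterminant * dinv = 1"
    by (simp add: aev.free_eval_simps free_eval_qdet)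
  then have "star H qdeterminant * (qdeterminant * dinv) = star H qdeterminant" by simp
  then show ?thesis by (simp add: star_qdeterminant flip: mult.assoc)
qed

lemma ucorep_dinv:
  assumes "G = GLq"
  shows "ucorep {0 :: nat} (\<lambda>_ _. dinv)"
proof (rule ucorepI)
  show "corep {0 :: nat} (\<lambda>_ _. dinv)"
    using corep_conj[OF ucorep_corep[OF ucorep_qdeterminant]] by (simp add: dinv_eq_star[OF assms])
  have "qdet N q * fgen GenDinv - 1 \<in> qrels G N q" using assms by simp
  from relation[OF this] have "qdeterminant * dinv = 1"
    by (simp add: aev.free_eval_simps free_eval_qdet)
  then show "(\<Sum>k\<in>{0}. star H dinv * dinv) = (if i = j then 1 else 0)" if "i \<in> {0 :: nat}" "j \<in> {0}" for i j
    using that dinv_eq_star[OF assms] by (simp add: star_star)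
qed

end

context compact_quantum_group
begin

lemma generator_coefficient:
  assumes "x \<in> qgens G N"
  obtains I v i j where "ucorep (I :: nat set) v" "i \<in> I" "j \<in> I" "gen x = v i j" "x \<noteq> GenDinv \<longrightarrow> v = u \<and> I = {1..N}"
    "x = GenDinv \<longrightarrow> G = GLq \<and> I = {0} \<and> v = (\<lambda>_ _. dinv)"
proof (cases x)
  case (Gen i j)
  then have "i \<in> {1..N}" "j \<in> {1..N}" using assms by (cases G; auto)+
  then show thesis using that[OF ucorep_u, of i j] Gen by simp
next
  case GenDinv
  then have G: "G = GLq" using assms by (cases G) auto
  interpret type_A H G N q u dinv by unfold_locales (simp add: G)
  show thesis using that[OF ucorep_dinv[OF G], of 0 0] GenDinv G by simp
qed

end

section \<open>Weights and the quantum trace of \<open>R\<close>\<close>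

text \<open>On the generators the modular character with index \<open>t\<close> takes the values \<open>exp(t * modular_exponent i)\<close>
  on the diagonal.\<close>

definition modular_exponent :: "family \<Rightarrow> nat \<Rightarrow> real \<Rightarrow> nat \<Rightarrow> real" where
  "modular_exponent G N q i =
     (if G = GLq \<or> G = SLq then 2 * real i - real N - 1 else - 2 * rho G N i) * ln \<bar>q\<bar>"

lemma qpow_pos: "q > 0 \<Longrightarrow> qpow q x = q powr x"
  by (auto simp: qpow_def powr_real_of_int' elim!: Ints_cases)

lemma qpow_double:
  assumes "q \<noteq> 0" "q > 0 \<or> x \<in> \<int>"
  shows "qpow q (2 * x) = \<bar>q\<bar> powr (2 * x)"
proof (cases "q > 0")
  case True
  then show ?thesis by (simp add: qpow_pos)
next
  case False
  then obtain a where a: "x = of_int a" using assms by (auto elim!: Ints_cases)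
  then have a2: "2 * x = of_int (2 * a)" by simp
  have "qpow q (2 * x) = q powi (2 * a)" unfolding qpow_def a2 by (simp only: Ints_of_int if_True floor_of_int)
  also have "\<dots> = \<bar>q\<bar> powi (2 * a)"
    by (simp add: power_int_mult)
  also have "\<dots> = \<bar>q\<bar> powr (2 * x)"
    using assms(1) unfolding a2 by (subst powr_real_of_int') auto
  finally show ?thesis .
qed

lemma opp_mem: "i \<in> {1..N} \<Longrightarrow> opp N i \<in> {1..N}"
  and opp_opp: "i \<in> {1..N} \<Longrightarrow> opp N (opp N i) = i"
  by (auto simp: opp_def)

lemma opp_swap: "i \<in> {1..N} \<Longrightarrow> j \<in> {1..N} \<Longrightarrow> opp N i = j \<longleftrightarrow> i = opp N j"
  by (auto simp: opp_def)

lemma opp_bij: "bij_betw (opp N) {1..N} {1..N}"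
  by (rule bij_betw_byWitness[of _ "opp N"]) (auto simp: opp_def)

lemma sum_opp: "(\<Sum>k=1..N. f (opp N k)) = (\<Sum>k=1..N. f k)"
  by (rule sum.reindex_bij_betw[OF opp_bij])

lemma rho_opp: "i \<in> {1..N} \<Longrightarrow> rho G N (opp N i) = - rho G N i" if "G \<noteq> Spq \<or> even N"
  using that by (cases G) (auto simp: opp_def of_nat_diff elim!: evenE)

lemma eps_opp:
  assumes "i \<in> {1..N}" "G \<noteq> Spq \<or> even N"
  shows "eps G N i * eps G N (opp N i) = (if G = Spq then - 1 else 1)"
  using assms by (cases G) (auto simp: opp_def elim!: evenE)

lemma modular_exponent_opp:
  assumes "admissible_params G N q" "i \<in> {1..N}"
  shows "modular_exponent G N q (opp N i) = - modular_exponent G N q i"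
  using assms rho_opp[of G N i]
  by (cases G) (auto simp: modular_exponent_def opp_def of_nat_diff algebra_simps)

text \<open>Hence diagonal values of the above form for \<open>u\<close> respect the quadratic relations.\<close>

lemma Rmat_weight:
  assumes p: "admissible_params G N q" and i: "i \<in> {1..N}" "j \<in> {1..N}" "m \<in> {1..N}" "n \<in> {1..N}"
    and R: "Rmat G N q i j m n \<noteq> 0"
  shows "modular_exponent G N q i + modular_exponent G N q j = modular_exponent G N q m + modular_exponent G N q n"
proof (cases "G = GLq \<or> G = SLq")
  case True
  with R have "R_A q i j m n \<noteq> 0" by (simp add: Rmat_def)
  then have "i = m \<and> j = n \<or> i = n \<and> j = m" by (auto simp: R_A_def kron_def split: if_splits)
  then show ?thesis by auto
next
  case False
  with R have "R_BCD G N q i j m n \<noteq> 0" by (simp add: Rmat_def)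
  then have "i = m \<and> j = n \<or> i = n \<and> j = m \<or> j = opp N i \<and> n = opp N m"
    by (auto simp: R_BCD_def kron_def split: if_splits)
  then show ?thesis using modular_exponent_opp[OF p] i by auto
qed

text \<open>The inverse of \<open>R\<close> inherits this symmetry, which there interchanges the two partial traces.\<close>

lemma Rmat_symmetric:
  assumes p: "admissible_params G N q" and i: "i \<in> {1..N}" "j \<in> {1..N}" "m \<in> {1..N}" "n \<in> {1..N}"
  shows "Rmat G N q (opp N m) (opp N n) (opp N i) (opp N j) = Rmat G N q i j m n"
proof -
  have k: "kron (opp N a) (opp N b) = kron a b" if "a \<in> {1..N}" "b \<in> {1..N}" for a b
    using that by (auto simp: kron_def opp_def)
  have k2: "kron (opp N a) b = kron a (opp N b)" if "a \<in> {1..N}" "b \<in> {1..N}" for a b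
    using that by (auto simp: kron_def opp_def)
  have ks: "kron a b = kron b a" for a b by (auto simp: kron_def)
  have th: "theta (int (opp N a) - int (opp N b)) = theta (int b - int a)" if "a \<in> {1..N}" "b \<in> {1..N}" for a b
    using that by (auto simp: theta_def opp_def)
  show ?thesis
  proof (cases "G = GLq \<or> G = SLq")
    case True
    have "R_A q (opp N m) (opp N n) (opp N i) (opp N j) = R_A q i j m n"
      using i by (simp add: R_A_def k th) (auto simp: kron_def theta_def)
    then show ?thesis using True by (simp add: Rmat_def)
  next
    case False
    then have G: "G = Oq \<or> G = Spq" by (cases G) auto
    have ev: "G \<noteq> Spq \<or> even N" using p by (cases G) auto
    have e: "eps G N (opp N m) * eps G N (opp N i) = eps G N i * eps G N m"
    proof -
      have sq: "eps G N a * eps G N a = 1" for a using G by auto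
      have "eps G N (opp N m) * eps G N (opp N i)
          = (eps G N m * eps G N m) * eps G N (opp N m) * (eps G N (opp N i) * (eps G N i * eps G N i))"
        by (simp add: sq)
      also have "\<dots> = (eps G N m * eps G N (opp N m)) * (eps G N i * eps G N (opp N i)) * (eps G N i * eps G N m)"
        by simp
      finally show ?thesis using eps_opp[OF i(1) ev] eps_opp[OF i(3) ev] by simp
    qed
    have r: "rho G N (opp N m) - rho G N (opp N i) = rho G N i - rho G N m"
      using rho_opp[OF ev i(1)] rho_opp[OF ev i(3)] by simp
    have "R_BCD G N q (opp N m) (opp N n) (opp N i) (opp N j) = R_BCD G N q i j m n"
    proof -
      have d: "qpow q (kron (opp N m) (opp N n) - kron (opp N m) (opp N (opp N n))) * kron (opp N m) (opp N i) * kron (opp N n) (opp N j)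
        = qpow q (kron i j - kron i (opp N j)) * kron i m * kron j n"
        using i opp_opp[OF i(4)] k2[of m n] by (simp add: k opp_mem) (auto simp: kron_def)
      have t: "kron (opp N n) (opp N i) * kron (opp N m) (opp N j) = kron j m * kron i n"
        using i by (simp add: k) (auto simp: kron_def)
      have u: "kron (opp N n) (opp N (opp N m)) * kron (opp N j) (opp N (opp N i)) = kron j (opp N i) * kron n (opp N m)"
        using i k[of n "opp N m"] k[of j "opp N i"] opp_mem by simp
      have T: "theta (int (opp N m) - int (opp N i)) = theta (int i - int m)" using th i by blast
      show ?thesis
        unfolding R_BCD_def d T r using t u e by (simp add: mult.assoc mult.left_commute)
    qed
    then show ?thesis using False by (simp add: Rmat_def)
  qed
qed

text \<open>The \<open>i\<close>-th diagonal entry of the quantum trace of \<open>R\<close>: the first summand comes from \<open>k = i\<close>, the sum from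
  \<open>k > i\<close>, and the last term from \<open>k = i'\<close>. The quantum trace is a multiple of the identity because consecutive
  entries are equal.\<close>

definition trace_entry :: "family \<Rightarrow> nat \<Rightarrow> real \<Rightarrow> nat \<Rightarrow> real" where
  "trace_entry G N q i =
     (if (G = Oq \<or> G = Spq) \<and> 2 * i = N + 1 then 1 else q) * exp (modular_exponent G N q i) +
     (q - inverse q) * ((\<Sum>k\<in>{i<..N}. exp (modular_exponent G N q k)) -
       (if (G = Oq \<or> G = Spq) \<and> 2 * i < N + 1 then (if G = Spq then - 1 else 1) else 0))"

lemma exp_ln_powr: "(q::real) \<noteq> 0 \<Longrightarrow> exp (x * ln \<bar>q\<bar>) = \<bar>q\<bar> powr x"
  by (simp add: powr_def mult.commute)

lemma modular_exponent_step:
  assumes q: "q \<noteq> 0" and d: "modular_exponent G N q (Suc i) = modular_exponent G N q i + real c * ln \<bar>q\<bar>"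
  shows "exp (modular_exponent G N q (Suc i)) = \<bar>q\<bar> ^ c * exp (modular_exponent G N q i)"
  using q by (simp add: d exp_add exp_ln_powr powr_realpow mult.commute)

lemma trace_entry_step:
  assumes p: "admissible_params G N q" and i: "1 \<le> i" "i < N"
  shows "trace_entry G N q i = trace_entry G N q (Suc i)"
proof -
  have q: "q \<noteq> 0" using p by (cases G) auto
  let ?K = "\<lambda>i. exp (modular_exponent G N q i)"
  have "{i<..N} = insert (Suc i) {Suc i<..N}" using i by auto
  then have tail: "(\<Sum>k\<in>{i<..N}. ?K k) = ?K (Suc i) + (\<Sum>k\<in>{Suc i<..N}. ?K k)" by simp
  have generic: "q * ?K i - q * ?K (Suc i) + (q - inverse q) * ?K (Suc i) = 0"
    if "modular_exponent G N q (Suc i) = modular_exponent G N q i + real 2 * ln \<bar>q\<bar>"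
    using modular_exponent_step[OF q that] q by (simp add: field_simps power2_eq_square)
  show ?thesis
  proof (cases "G = Oq \<or> G = Spq")
    case False
    then have "modular_exponent G N q (Suc i) = modular_exponent G N q i + real 2 * ln \<bar>q\<bar>"
      by (cases G) (simp_all add: modular_exponent_def algebra_simps)
    from generic[OF this] show ?thesis using False by (simp add: trace_entry_def tail algebra_simps)
  next
    case True
    then have nA: "\<not> (G = GLq \<or> G = SLq)" by auto
    \<comment> \<open>The exponents increase by \<open>2 ln \<bar>q\<bar>\<close> at each step, except in the middle of the index range, where
      \<open>\<rho>\<close> repeats or skips values and the summand \<open>k = i'\<close> ceases to contribute.\<close>
    have "2 * Suc i \<le> N \<or> 2 * i > N + 1 \<or> 2 * i = N \<or> 2 * i + 1 = N \<or> 2 * i = N + 1" by arith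
    then consider "2 * Suc i \<le> N \<or> 2 * i > N + 1" | "2 * i = N" | "2 * i + 1 = N" | "2 * i = N + 1" by blast
    then show ?thesis
    proof cases
      case 1
      then have "rho G N i - rho G N (Suc i) = 1" using True by auto
      then have step: "rho G N i = rho G N (Suc i) + 1" by linarith
      have "modular_exponent G N q (Suc i) = modular_exponent G N q i + real 2 * ln \<bar>q\<bar>"
        using nA unfolding modular_exponent_def step by (simp add: algebra_simps)
      from generic[OF this] show ?thesis using True 1 by (auto simp: trace_entry_def tail algebra_simps)
    next
      case 2
      show ?thesis
      proof (cases "G = Oq")
        case True
        have "?K i = 1" "?K (Suc i) = 1" using True 2 by (auto simp: modular_exponent_def)
        then show ?thesis unfolding trace_entry_def tail using True 2 by (simp add: algebra_simps)
      next
        case False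
        then have G: "G = Spq" using \<open>G = Oq \<or> G = Spq\<close> by simp
        have "?K i = inverse (q ^ 2)" "?K (Suc i) = q ^ 2"
          using G 2 q by (auto simp: modular_exponent_def exp_ln_powr powr_minus exp_minus)
        then show ?thesis unfolding trace_entry_def tail using G 2 q by (simp add: field_simps power2_eq_square)
      qed
    next
      case 3
      then have G: "G = Oq" and q0: "q > 0" using True p by auto
      have "?K i = inverse q" "?K (Suc i) = 1"
        using G 3 q0 by (auto simp: modular_exponent_def exp_minus)
      then show ?thesis unfolding trace_entry_def tail using G 3 q0 by (auto simp: field_simps)
    next
      case 4
      then have "odd N" by presburger
      then have G: "G = Oq" and q0: "q > 0" using True p by auto
      have "rho G N i = 0" "rho G N (Suc i) = - 1 / 2" using G 4 by (auto simp: field_simps)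
      then have "?K i = 1" "?K (Suc i) = q" using G q0 by (simp_all add: modular_exponent_def)
      then show ?thesis unfolding trace_entry_def tail using G 4 q0 by (auto simp: field_simps)
    qed
  qed
qed

lemma trace_entry_const:
  assumes p: "admissible_params G N q" and i: "i \<in> {1..N}"
  shows "trace_entry G N q i = trace_entry G N q N"
proof -
  have "i \<le> N" "1 \<le> i" using i by auto
  then show ?thesis
  proof (induction i rule: inc_induct)
    case base
    show ?case by (rule refl)
  next
    case (step n)
    from trace_entry_step[OF p step.prems step.hyps(2)] step.IH show ?case by simp
  qed
qed

lemma Rmat_quantum_trace:
  assumes p: "admissible_params G N q" and i: "i \<in> {1..N}" "j \<in> {1..N}"
  shows "(\<Sum>k=1..N. complex_of_real (exp (modular_exponent G N q k)) * Rmat G N q k i j k)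
    = (if i = j then complex_of_real (trace_entry G N q N) else 0)"
proof -
  let ?K = "\<lambda>i. exp (modular_exponent G N q i)"
  have q: "q \<noteq> 0" using p by (cases G) auto
  have tail: "(\<Sum>k=1..N. ?K k * theta (int k - int i)) = (\<Sum>k\<in>{i<..N}. ?K k)" for i
  proof -
    have "(\<Sum>k=1..N. ?K k * theta (int k - int i)) = (\<Sum>k=1..N. if k \<in> {i<..N} then ?K k else 0)"
      by (intro sum.cong refl) (auto simp: theta_def)
    also have "\<dots> = (\<Sum>k\<in>{1..N} \<inter> {i<..N}. ?K k)" by (simp add: sum.inter_restrict)
    also have "{1..N} \<inter> {i<..N} = {i<..N}" by auto
    finally show ?thesis .
  qed
  have real: "(\<Sum>k=1..N. ?K k * (if G = GLq \<or> G = SLq then R_A q k i j k else R_BCD G N q k i j k))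
      = (if i = j then trace_entry G N q i else 0)"
  proof (cases "G = GLq \<or> G = SLq")
    case True
    have "(\<Sum>k=1..N. ?K k * R_A q k i j k) = (\<Sum>k=1..N. (if k = i then (if i = j then q * ?K k else 0) else 0)
        + (if i = j then (q - inverse q) * (?K k * theta (int k - int i)) else 0))"
      by (intro sum.cong refl) (auto simp: R_A_def kron_def qpow_def theta_def)
    also have "\<dots> = (if i = j then q * ?K i + (q - inverse q) * (\<Sum>k\<in>{i<..N}. ?K k) else 0)"
      using i by (simp add: sum.distrib tail del: One_nat_def flip: sum_distrib_left)
    finally show ?thesis using True by (auto simp: trace_entry_def)
  next
    case False
    then have G: "G = Oq \<or> G = Spq" by (cases G) auto
    have ev: "G \<noteq> Spq \<or> even N" using p by (cases G) auto
    let ?e = "if G = Spq then - 1 else 1 :: real"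
    have corner: "?K (opp N i) * (eps G N (opp N i) * eps G N i * qpow q (rho G N (opp N i) - rho G N i)) = ?e"
    proof -
      have "rho G N (opp N i) - rho G N i = 2 * (- rho G N i)" using rho_opp[OF ev i(1)] by simp
      moreover have "q > 0 \<or> - rho G N i \<in> \<int>" using rho_Ints[OF p G, of i] by auto
      ultimately have "qpow q (rho G N (opp N i) - rho G N i) = \<bar>q\<bar> powr (- 2 * rho G N i)"
        using qpow_double[OF q, of "- rho G N i"] by (simp only:) simp
      moreover have "?K (opp N i) = \<bar>q\<bar> powr (2 * rho G N i)"
        using False rho_opp[OF ev i(1)] q by (simp add: modular_exponent_def exp_ln_powr)
      ultimately have "?K (opp N i) * qpow q (rho G N (opp N i) - rho G N i) = 1"
        using q by (simp flip: powr_add)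
      then show ?thesis using eps_opp[OF i(1) ev] by (simp add: mult_ac)
    qed
    have oi: "opp N i \<in> {1..N}" using i(1) by (rule opp_mem)
    have th: "theta (int (opp N i) - int i) = (if 2 * i < N + 1 then 1 else 0)"
      using i by (auto simp: theta_def opp_def)
    have mid: "i = opp N i \<longleftrightarrow> 2 * i = N + 1" using i by (auto simp: opp_def)
    have "(\<Sum>k=1..N. ?K k * R_BCD G N q k i j k) = (\<Sum>k=1..N.
        (if k = i then (if i = j then (if 2 * i = N + 1 then 1 else q) * ?K k else 0) else 0)
        + ((if i = j then (q - inverse q) * (?K k * theta (int k - int i)) else 0)
        + (if k = opp N i then (if i = j then - (q - inverse q) * (theta (int k - int i) *
            (?K k * (eps G N k * eps G N i * qpow q (rho G N k - rho G N i)))) else 0) else 0)))"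
    proof (intro sum.cong refl)
      fix k assume k: "k \<in> {1..N}"
      have 1: "kron i (opp N k) * kron k (opp N j) = (if k = opp N i \<and> i = j then 1 else 0)"
        using k i by (auto simp: kron_def opp_def)
      have 2: "qpow q (kron k i - kron k (opp N i)) * kron k j * kron i k = (if k = i \<and> i = j then (if 2 * i = N + 1 then 1 else q) else 0)"
        using mid by (auto simp: kron_def qpow_def)
      have split: "\<kappa> * (if a then M else 0) + c * (\<kappa> * t) * 1 - c * t * w * (if b then 1 else 0)
          = (if a then M * \<kappa> else 0) + (c * (\<kappa> * t) + (if b then - c * (t * w) else 0))"
        for a b and \<kappa> M c t w :: real
        by simp
      have expand: "?K k * R_BCD G N q k i j k = ?K k * (qpow q (kron k i - kron k (opp N i)) * kron k j * kron i k)
        + (q - inverse q) * (?K k * theta (int k - int j)) * kron i j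
        - (q - inverse q) * theta (int k - int j) * (?K k * (eps G N k * eps G N j * qpow q (rho G N k - rho G N j))) *
            (kron i (opp N k) * kron k (opp N j))"
        by (simp add: R_BCD_def kron_def[of k k] algebra_simps)
      show "?K k * R_BCD G N q k i j k =
        (if k = i then (if i = j then (if 2 * i = N + 1 then 1 else q) * ?K k else 0) else 0)
        + ((if i = j then (q - inverse q) * (?K k * theta (int k - int i)) else 0)
        + (if k = opp N i then (if i = j then - (q - inverse q) * (theta (int k - int i) *
            (?K k * (eps G N k * eps G N i * qpow q (rho G N k - rho G N i)))) else 0) else 0))"
      proof (cases "i = j")
        case True
        show ?thesis
          unfolding expand 1 2 unfolding True kron_def by (simp only: refl simp_thms if_True) (rule split)
      next
        case False
        then show ?thesis unfolding expand 1 2 by (simp add: kron_def)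
      qed
    qed
    also have "\<dots> = (if i = j then (if 2 * i = N + 1 then 1 else q) * ?K i + ((q - inverse q) * (\<Sum>k\<in>{i<..N}. ?K k)
        + - (q - inverse q) * (theta (int (opp N i) - int i) * ?e)) else 0)"
    proof (cases "i = j")
      case True
      show ?thesis
        unfolding True[symmetric]
        by (simp only: refl if_True sum.distrib sum_distrib_left[symmetric] tail sum.delta finite_atLeastAtMost i(1) oi corner)
    next
      case False
      then show ?thesis by simp
    qed
    finally show ?thesis using G False unfolding th trace_entry_def by (auto simp: algebra_simps)
  qed
  have "(\<Sum>k=1..N. complex_of_real (?K k) * Rmat G N q k i j k)
      = complex_of_real (\<Sum>k=1..N. ?K k * (if G = GLq \<or> G = SLq then R_A q k i j k else R_BCD G N q k i j k))"
    by (simp add: Rmat_def)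
  also have "\<dots> = (if i = j then complex_of_real (trace_entry G N q N) else 0)"
    unfolding real trace_entry_const[OF p i(1)] by simp
  finally show ?thesis .
qed

section \<open>Algebra maps on a compact form\<close>

definition algebra_map :: "('a::ring_1) hopf_star \<Rightarrow> ('b::ring_1) hopf_star \<Rightarrow> ('a \<Rightarrow> 'b) \<Rightarrow> bool" where
  "algebra_map A B f \<longleftrightarrow> (\<forall>x y. f (x + y) = f x + f y) \<and> (\<forall>c x. f (scl A c x) = scl B c (f x)) \<and>
     f 1 = 1 \<and> (\<forall>x y. f (x * y) = f x * f y)"

abbreviation character :: "('a::ring_1) hopf_star \<Rightarrow> ('a \<Rightarrow> complex) \<Rightarrow> bool" where
  "character A \<equiv> algebra_map A complex_scalars"

lemma algebra_mapD:
  assumes "algebra_map A B f"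
  shows "f (x + y) = f x + f y" "f (scl A c x) = scl B c (f x)" "f 1 = 1" "f (x * y) = f x * f y"
    "f 0 = 0" "f (\<Sum>i\<in>I. g i) = (\<Sum>i\<in>I. f (g i))" "f (prod_list xs) = prod_list (map f xs)"
proof -
  show add: "f (x + y) = f x + f y" for x y using assms by (simp add: algebra_map_def)
  show "f (scl A c x) = scl B c (f x)" using assms by (simp add: algebra_map_def)
  show one: "f 1 = 1" using assms by (simp add: algebra_map_def)
  show mult: "f (x * y) = f x * f y" for x y using assms by (simp add: algebra_map_def)
  show zero: "f 0 = 0" using add[of 0 0] by simp
  show "f (\<Sum>i\<in>I. g i) = (\<Sum>i\<in>I. f (g i))"
    by (induction I rule: infinite_finite_induct) (auto simp: zero add)
  show "f (prod_list xs) = prod_list (map f xs)"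
    by (induction xs) (auto simp: one mult)
qed

lemma algebra_map_compose:
  "algebra_map B C g \<Longrightarrow> algebra_map A B f \<Longrightarrow> algebra_map A C (\<lambda>x. g (f x))"
  by (simp add: algebra_map_def)

context hopf_star_algebra
begin

lemma character_linear: "character H f \<Longrightarrow> linear_form H f"
  by (simp add: algebra_map_def linear_form_iff)

text \<open>In Sweedler notation these are \<open>f(a\<^sub>1) a\<^sub>2\<close> and \<open>a\<^sub>1 f(a\<^sub>2)\<close>.\<close>

definition left_translate :: "('a \<Rightarrow> complex) \<Rightarrow> 'a \<Rightarrow> 'a" where
  "left_translate f = sweedler H (\<lambda>x y. scl H (f x) y)"

definition right_translate :: "('a \<Rightarrow> complex) \<Rightarrow> 'a \<Rightarrow> 'a" where
  "right_translate f = sweedler H (\<lambda>x y. scl H (f y) x)"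

lemma bilinear_translate:
  assumes "linear_form H f"
  shows "bilinear_map (\<lambda>x y. scl H (f x) y)" "bilinear_map (\<lambda>x y. scl H (f y) x)"
  using assms by (auto simp: bilinear_map_def linear_form_iff scale_left_distrib scale_right_distrib mult.commute)

lemma translate_linear:
  assumes "linear_form H f"
  shows "linear_map (left_translate f)" "linear_map (right_translate f)"
  unfolding left_translate_def right_translate_def
  by (intro sweedler_linear bilinear_translate assms)+

lemma translate_corep:
  assumes "corep I v" "i \<in> I" "j \<in> I" "linear_form H f"
  shows "left_translate f (v i j) = (\<Sum>k\<in>I. scl H (f (v i k)) (v k j))"
    and "right_translate f (v i j) = (\<Sum>k\<in>I. scl H (f (v k j)) (v i k))"
  unfolding left_translate_def right_translate_def
  using corep_map[OF assms(1-3)] bilinear_translate[OF assms(4)] by auto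

end

context cqg_algebra
begin

lemma multiplicative_eqI:
  assumes f: "linear_map f"
    and eq: "\<And>(I :: nat set) v i j (J :: nat set) w k l. ucorep I v \<Longrightarrow> i \<in> I \<Longrightarrow> j \<in> I \<Longrightarrow>
      ucorep J w \<Longrightarrow> k \<in> J \<Longrightarrow> l \<in> J \<Longrightarrow> f (v i j * w k l) = f (v i j) * f (w k l)"
  shows "f (a * b) = f a * f b"
proof (rule bilinear_map_eqI[of "\<lambda>a b. f (a * b)" "\<lambda>a b. f a * f b"])
  show "bilinear_map (\<lambda>a b. f (a * b))" "bilinear_map (\<lambda>a b. f a * f b)"
    using f by (auto simp: bilinear_map_def linear_map_iff scl_mult_left scl_mult_right distrib_left distrib_right)
qed (rule eq)

lemma sum_product_pairs:
  fixes f :: "'i \<Rightarrow> 'b::semiring_0"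
  shows "(\<Sum>p\<in>I \<times> J. f (fst p) * g (snd p)) = (\<Sum>x\<in>I. f x) * (\<Sum>y\<in>J. g y)"
  by (simp add: sum_product sum.cartesian_product case_prod_beta)

text \<open>Multiplicativity can be checked on coefficients, where it expresses that \<open>f\<close> is multiplicative on tensor
  products of corepresentations.\<close>

lemma translate_algebra_map:
  assumes "character H f"
  shows "algebra_map H H (left_translate f)" "algebra_map H H (right_translate f)"
proof -
  have lin: "linear_form H f" using assms by (rule character_linear)
  have mult: "left_translate f (v i j * w k l) = left_translate f (v i j) * left_translate f (w k l)"
    "right_translate f (v i j * w k l) = right_translate f (v i j) * right_translate f (w k l)"
    if "ucorep I v" "i \<in> I" "j \<in> I" "ucorep J w" "k \<in> J" "l \<in> J" for I J :: "nat set" and v w i j k l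
  proof -
    note c = ucorep_corep[OF that(1)] ucorep_corep[OF that(4)]
    have p: "(i, k) \<in> I \<times> J" "(j, l) \<in> I \<times> J" using that by auto
    have e: "v i j * w k l = tensor_corep v w (i, k) (j, l)" by (simp add: tensor_corep_def)
    show "left_translate f (v i j * w k l) = left_translate f (v i j) * left_translate f (w k l)"
      unfolding e translate_corep(1)[OF corep_tensor[OF c] p lin]
        translate_corep(1)[OF c(1) that(2,3) lin] translate_corep(1)[OF c(2) that(5,6) lin]
      by (simp add: tensor_corep_def algebra_mapD(4)[OF assms] scl_mult flip: sum_product_pairs)
    show "right_translate f (v i j * w k l) = right_translate f (v i j) * right_translate f (w k l)"
      unfolding e translate_corep(2)[OF corep_tensor[OF c] p lin]
        translate_corep(2)[OF c(1) that(2,3) lin] translate_corep(2)[OF c(2) that(5,6) lin]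
      by (simp add: tensor_corep_def algebra_mapD(4)[OF assms] scl_mult flip: sum_product_pairs)
  qed
  have one: "left_translate f 1 = 1" "right_translate f 1 = 1"
    using translate_corep[OF ucorep_corep[OF ucorep_one], of 0 0 f] lin algebra_mapD(3)[OF assms] by simp_all
  have "left_translate f (a * b) = left_translate f a * left_translate f b" for a b
    by (rule multiplicative_eqI[OF translate_linear(1)[OF lin]]) (rule mult(1))
  then show "algebra_map H H (left_translate f)"
    using translate_linear(1)[OF lin] one by (simp add: algebra_map_def linear_map_iff)
  have "right_translate f (a * b) = right_translate f a * right_translate f b" for a b
    by (rule multiplicative_eqI[OF translate_linear(2)[OF lin]]) (rule mult(2))
  then show "algebra_map H H (right_translate f)"
    using translate_linear(2)[OF lin] one by (simp add: algebra_map_def linear_map_iff)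
qed

text \<open>Since \<open>f * g = f \<circ> right_translate g\<close>, convolution products of characters are characters.\<close>

lemma conv_character:
  assumes f: "character H f" and g: "character H g"
  shows "character H (conv H f g)"
proof -
  have "conv H f g a = f (right_translate g a)" for a
    using character_linear[OF f]
    by (simp add: conv_def right_translate_def linear_form_sweedler linear_form_scl mult.commute)
  moreover have "character H (\<lambda>a. f (right_translate g a))"
    by (rule algebra_map_compose[OF f translate_algebra_map(2)[OF g]])
  ultimately show ?thesis by (simp add: algebra_map_def)
qed

lemma antipode_square_algebra_map: "algebra_map H H (\<lambda>a. antipode H (antipode H a))"
  by (simp add: algebra_map_def antipode_add antipode_scl antipode_one antipode_mult)

end

context compact_quantum_group
begin

text \<open>Products of coefficients are coefficients of tensor products, renumbered to have natural numbers as
  indices.\<close>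

lemma word_coefficient:
  assumes "set ls \<subseteq> qgens G N"
  shows "\<exists>(I :: nat set) v i j. ucorep I v \<and> i \<in> I \<and> j \<in> I \<and> prod_list (map gen ls) = v i j"
  using assms
proof (induction ls)
  case Nil
  show ?case using ucorep_one by (intro exI[of _ "{0}"] exI[of _ "\<lambda>_ _. 1"]) auto
next
  case (Cons x ls)
  from Cons.IH Cons.prems obtain J :: "nat set" and w k l
    where w: "ucorep J w" "k \<in> J" "l \<in> J" "prod_list (map gen ls) = w k l" by auto
  from Cons.prems have "x \<in> qgens G N" by simp
  then obtain I :: "nat set" and v i j where v: "ucorep I v" "i \<in> I" "j \<in> I" "gen x = v i j"
    by (rule generator_coefficient)
  have "finite (I \<times> J)" using v(1) w(1) by (auto dest: ucorep_corep corep_finite)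
  from ex_bij_betw_nat_finite[OF this] obtain h where h: "bij_betw h {0..<card (I \<times> J)} (I \<times> J)" ..
  have im: "(i, k) \<in> h ` {0..<card (I \<times> J)}" "(j, l) \<in> h ` {0..<card (I \<times> J)}"
    using v w unfolding bij_betw_imp_surj_on[OF h] by auto
  from im(1) obtain a where a: "(i, k) = h a" "a \<in> {0..<card (I \<times> J)}" by (rule imageE)
  from im(2) obtain b where b: "(j, l) = h b" "b \<in> {0..<card (I \<times> J)}" by (rule imageE)
  show ?case
  proof (intro exI conjI)
    show "ucorep {0..<card (I \<times> J)} (\<lambda>a b. tensor_corep v w (h a) (h b))"
      by (rule ucorep_reindex[OF ucorep_tensor[OF v(1) w(1)] h])
    show "prod_list (map gen (x # ls)) = tensor_corep v w (h a) (h b)"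
      using v(4) w(4) by (simp add: tensor_corep_def flip: a(1) b(1))
  qed (fact a(2), fact b(2))
qed

sublocale cqg_algebra H
proof unfold_locales
  have "{prod_list (map gen ls) | ls. set ls \<subseteq> qgens G N}
      \<subseteq> {v i j | (I :: nat set) v i j. ucorep I v \<and> i \<in> I \<and> j \<in> I}"
    using word_coefficient by fast
  from span_mono[OF this]
  show "span {v i j | (I :: nat set) v i j. ucorep I v \<and> i \<in> I \<and> j \<in> I} = UNIV"
    using words_span by auto
qed

lemma irreducible_span: "span irreducible_coefficients = UNIV"
proof -
  have "{v i j | (I :: nat set) v i j. ucorep I v \<and> i \<in> I \<and> j \<in> I} \<subseteq> span irreducible_coefficients"
    using coefficients_in_span by auto
  from span_minimal[OF this subspace_span] show ?thesis using coefficients_span by auto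
qed

text \<open>An algebra map is determined by its values on the matrix \<open>u\<close>, because it maps the inverse of the
  quantum determinant to the inverse of the image of the determinant.\<close>

lemma algebra_map_eqI:
  fixes f g :: "'a \<Rightarrow> 'b::ring_1"
  assumes f: "algebra_map H B f" and g: "algebra_map H B g"
    and eq: "\<And>i j. i \<in> {1..N} \<Longrightarrow> j \<in> {1..N} \<Longrightarrow> f (u i j) = g (u i j)"
    and add: "\<And>c x y. scl B c (x + y) = scl B c x + scl B c y"
  shows "f a = g a"
proof -
  have gen_eq: "f (gen x) = g (gen x)" if x: "x \<in> qgens G N" for x
  proof (cases x)
    case (Gen i j)
    then have "i \<in> {1..N}" "j \<in> {1..N}" using x by (cases G; auto)+
    then show ?thesis using eq Gen by simp
  next
    case GenDinv
    then have G: "G = GLq" using x by (cases G) auto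
    interpret type_A H G N q u dinv by unfold_locales (simp add: G)
    have D: "f qdeterminant = g qdeterminant"
    proof -
      have "f (tpow (standard_word N) J) = g (tpow (standard_word N) J)" if "J \<in> words N N" for J
      proof -
        have "set (zip (standard_word N) J) \<subseteq> {1..N} \<times> {1..N}"
          using that standard_word(1) by (auto simp: words_def dest: set_zip_leftD set_zip_rightD)
        then have "map f (map2 u (standard_word N) J) = map g (map2 u (standard_word N) J)"
          using eq by auto
        then show ?thesis unfolding tpow_def algebra_mapD(7)[OF f] algebra_mapD(7)[OF g] by (rule arg_cong)
      qed
      then show ?thesis
        unfolding qdeterminant_def det_vector_def algebra_mapD(6)[OF f] algebra_mapD(6)[OF g]
          algebra_mapD(2)[OF f] algebra_mapD(2)[OF g] by simp
    qed
    have "dinv * qdeterminant = 1" using star_qdeterminant dinv_eq_star[OF G] by simp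
    from arg_cong[OF this, of f] have l: "f dinv * g qdeterminant = 1"
      by (simp only: algebra_mapD(3,4)[OF f] D)
    have "qdet N q * fgen GenDinv - 1 \<in> qrels G N q" using G by simp
    from relation[OF this] have "qdeterminant * dinv = 1"
      by (simp add: aev.free_eval_simps free_eval_qdet)
    from arg_cong[OF this, of g] have r: "g qdeterminant * g dinv = 1"
      by (simp only: algebra_mapD(3,4)[OF g])
    have "f dinv = f dinv * (g qdeterminant * g dinv)" by (simp add: r)
    also have "\<dots> = g dinv" by (simp add: l flip: mult.assoc)
    finally show ?thesis using GenDinv by simp
  qed
  have "a \<in> span {prod_list (map gen ls) | ls. set ls \<subseteq> qgens G N}" by (simp add: words_span)
  then show ?thesis
  proof (induction rule: span_induct_alt)
    case base
    show ?case by (simp add: algebra_mapD(5)[OF f] algebra_mapD(5)[OF g])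
  next
    case (step c x y)
    then obtain ls where ls: "x = prod_list (map gen ls)" "set ls \<subseteq> qgens G N" by auto
    have "map f (map gen ls) = map g (map gen ls)" using ls(2) gen_eq by auto
    then have "f x = g x" unfolding ls(1) algebra_mapD(7)[OF f] algebra_mapD(7)[OF g] by (rule arg_cong)
    then show ?case
      by (simp add: algebra_mapD(1,2)[OF f] algebra_mapD(1,2)[OF g] step)
  qed
qed


section \<open>The modular characters on the generators\<close>

abbreviation \<mu> :: "nat \<Rightarrow> real" where "\<mu> \<equiv> modular_exponent G N q"

definition diagonal_value :: "real \<Rightarrow> qgen \<Rightarrow> complex" where
  "diagonal_value t x = (case x of Gen i j \<Rightarrow> if i = j then complex_of_real (exp (t * \<mu> i)) else 0 | GenDinv \<Rightarrow> 1)"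

lemma diagonal_value_simps [simp]:
  "diagonal_value t (Gen i j) = (if i = j then complex_of_real (exp (t * \<mu> i)) else 0)"
  "diagonal_value t GenDinv = 1"
  by (simp_all add: diagonal_value_def)

text \<open>The matrix \<open>R\<close> preserves weights, the quantum determinant has weight zero, and \<open>C\<close> pairs opposite
  weights.\<close>

lemma diagonal_value_relation:
  assumes "\<rho> \<in> qrels G N q"
  shows "free_eval complex_scalars (diagonal_value t) \<rho> = 0"
proof -
  interpret cev: scalar_algebra complex_scalars
    by unfold_locales (auto simp: complex_scalars_def algebra_simps)
  let ?w = "\<lambda>i. complex_of_real (exp (t * \<mu> i))"
  have frt: "free_eval complex_scalars (diagonal_value t) \<rho> = 0" if "\<rho> \<in> FRT_rels G N q"
  proof -
    from that obtain i j m n where ij: "i \<in> {1..N}" "j \<in> {1..N}" "m \<in> {1..N}" "n \<in> {1..N}"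
      and \<rho>: "\<rho> = (\<Sum>k=1..N. \<Sum>l=1..N. fconst (Rmat G N q i j k l) * U k m * U l n)
      - (\<Sum>k=1..N. \<Sum>l=1..N. U j l * U i k * fconst (Rmat G N q k l m n))"
      unfolding FRT_rels_def by blast
    have 1: "(\<Sum>k=1..N. \<Sum>l=1..N. Rmat G N q i j k l * diagonal_value t (Gen k m) * diagonal_value t (Gen l n))
        = (\<Sum>k=1..N. \<Sum>l=1..N. if k = m then if l = n then Rmat G N q i j k l * (?w k * ?w l) else 0 else 0)"
      by (intro sum.cong refl) simp
    have 2: "(\<Sum>k=1..N. \<Sum>l=1..N. diagonal_value t (Gen j l) * diagonal_value t (Gen i k) * Rmat G N q k l m n)
        = (\<Sum>k=1..N. \<Sum>l=1..N. if k = i then if l = j then Rmat G N q k l m n * (?w k * ?w l) else 0 else 0)"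
      by (intro sum.cong refl) simp
    have "Rmat G N q i j m n * (?w m * ?w n) = Rmat G N q i j m n * (?w i * ?w j)"
    proof (cases "Rmat G N q i j m n = 0")
      case False
      from Rmat_weight[OF params ij this] have "t * \<mu> i + t * \<mu> j = t * \<mu> m + t * \<mu> n"
        by (simp flip: distrib_left)
      then show ?thesis by (simp only: of_real_mult[symmetric] exp_add[symmetric])
    qed simp
    then show ?thesis
      unfolding \<rho> cev.free_eval_simps scl_complex_scalars mult_1_right
      unfolding 1 2 double_delta[OF finite_atLeastAtMost ij(3,4)] double_delta[OF finite_atLeastAtMost ij(1,2)]
      by simp
  qed
  have crel: "free_eval complex_scalars (diagonal_value t) \<rho> = 0"
    if "\<rho> \<in> C_rels G N q" and G: "G = Oq \<or> G = Spq"
  proof -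
    have opp1: "?w i * ?w (opp N i) = 1" if "i \<in> {1..N}" for i
      using modular_exponent_opp[OF params that] by (simp flip: of_real_mult exp_add)
    from that(1) consider (1) i j where "i \<in> {1..N}" "j \<in> {1..N}"
        "\<rho> = (\<Sum>k=1..N. \<Sum>l=1..N. \<Sum>p=1..N.
         U i k * fconst (Cmat G N q k l) * U p l * fconst (Cinv G N q p j)) - fconst (complex_of_real (kron i j))"
      | (2) i j where "i \<in> {1..N}" "j \<in> {1..N}"
        "\<rho> = (\<Sum>k=1..N. \<Sum>l=1..N. \<Sum>p=1..N.
         fconst (Cmat G N q i k) * U l k * fconst (Cinv G N q l p) * U p j) - fconst (complex_of_real (kron i j))"
      unfolding C_rels_def by blast
    then show ?thesis
    proof cases
      case 1
      have "(\<Sum>k=1..N. \<Sum>l=1..N. \<Sum>p=1..N. diagonal_value t (Gen i k) * Cmat G N q k l *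
          diagonal_value t (Gen p l) * Cinv G N q p j)
        = (\<Sum>k=1..N. if k = i then (\<Sum>l=1..N. ?w i * Cmat G N q i l * ?w l * Cinv G N q l j) else 0)"
        by (intro sum.cong[OF refl]) (simp add: if_distrib[of "\<lambda>x. _ * x"] if_distrib[of "\<lambda>x. x * _"] cong: if_cong)
      also have "\<dots> = (\<Sum>l=1..N. ?w i * Cmat G N q i l * ?w l * Cinv G N q l j)"
        using 1(1) by simp
      also have "\<dots> = (\<Sum>l=1..N. Cmat G N q i l * Cinv G N q l j)"
      proof (rule sum.cong[OF refl])
        fix l assume l: "l \<in> {1..N}"
        show "?w i * Cmat G N q i l * ?w l * Cinv G N q l j = Cmat G N q i l * Cinv G N q l j"
        proof (cases "i = opp N l")
          case True
          have "?w i * Cmat G N q i l * ?w l * Cinv G N q l j = (?w l * ?w i) * (Cmat G N q i l * Cinv G N q l j)"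
            by (simp only: mult_ac)
          also have "?w l * ?w i = 1" using opp1[OF l] by (simp only: True)
          finally show ?thesis by (simp only: mult_1_left)
        qed (simp add: Cmat_def kron_def)
      qed
      also have "\<dots> = complex_of_real (kron i j)" using Cmat_Cinv(1)[OF params G 1(1,2)] by (simp add: kron_def)
      finally show ?thesis
        unfolding 1(3) cev.free_eval_simps scl_complex_scalars mult_1_right by simp
    next
      case 2
      have "(\<Sum>k=1..N. \<Sum>l=1..N. \<Sum>p=1..N. Cmat G N q i k * diagonal_value t (Gen l k) *
          Cinv G N q l p * diagonal_value t (Gen p j))
        = (\<Sum>k=1..N. Cmat G N q i k * ?w k * Cinv G N q k j * ?w j)"
        using 2(2) by (intro sum.cong[OF refl]) (simp add: if_distrib[of "\<lambda>x. _ * x"] if_distrib[of "\<lambda>x. x * _"] cong: if_cong)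
      also have "\<dots> = (\<Sum>l=1..N. Cmat G N q i l * Cinv G N q l j)"
      proof (rule sum.cong[OF refl])
        fix l assume l: "l \<in> {1..N}"
        show "Cmat G N q i l * ?w l * Cinv G N q l j * ?w j = Cmat G N q i l * Cinv G N q l j"
        proof (cases "l = opp N j")
          case True
          have "Cmat G N q i l * ?w l * Cinv G N q l j * ?w j = (?w j * ?w l) * (Cmat G N q i l * Cinv G N q l j)"
            by (simp only: mult_ac)
          also have "?w j * ?w l = 1" using opp1[OF 2(2)] by (simp only: True)
          finally show ?thesis by (simp only: mult_1_left)
        qed (simp add: Cinv_def kron_def)
      qed
      also have "\<dots> = complex_of_real (kron i j)" using Cmat_Cinv(1)[OF params G 2(1,2)] by (simp add: kron_def)
      finally show ?thesis
        unfolding 2(3) cev.free_eval_simps scl_complex_scalars mult_1_right by simp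
    qed
  qed
  have det: "free_eval complex_scalars (diagonal_value t) (qdet N q) = 1"
  proof -
    let ?P = "{\<pi>. \<pi> permutes {1..N}}"
    have prod: "prod_list (map (\<lambda>i. diagonal_value t (Gen i (\<pi> i))) [1..<Suc N]) = (if \<pi> = id then 1 else 0)"
      if "\<pi> \<in> ?P" for \<pi>
    proof (cases "\<pi> = id")
      case False
      have "\<exists>i\<in>{1..N}. \<pi> i \<noteq> i"
      proof (rule ccontr)
        assume "\<not> (\<exists>i\<in>{1..N}. \<pi> i \<noteq> i)"
        then have "\<pi> i = i" for i using that permutes_not_in[of \<pi> "{1..N}" i] by (cases "i \<in> {1..N}") auto
        then show False using False by auto
      qed
      then obtain i where i: "i \<in> {1..N}" "\<pi> i \<noteq> i" by blast
      then have "i \<in> set [1..<Suc N]" by (simp add: less_Suc_eq_le del: upt_Suc)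
      then have "0 \<in> set (map (\<lambda>i. diagonal_value t (Gen i (\<pi> i))) [1..<Suc N])" using i(2) by (force simp del: upt_Suc)
      then show ?thesis using False by (simp only: prod_list_zero_iff if_False)
    next
      case True
      have s: "(\<Sum>i=1..N. \<mu> i) = 0"
      proof -
        have "(\<Sum>i=1..N. \<mu> i) = (\<Sum>i=1..N. \<mu> (opp N i))" by (rule sum_opp[symmetric])
        also have "\<dots> = (\<Sum>i=1..N. - \<mu> i)" by (intro sum.cong refl modular_exponent_opp[OF params])
        finally show ?thesis by (simp add: sum_negf)
      qed
      have "prod_list (map (\<lambda>i. diagonal_value t (Gen i (\<pi> i))) [1..<Suc N]) = (\<Prod>i\<in>set [1..<Suc N]. ?w i)"
        unfolding True by (subst prod.distinct_set_conv_list) (simp_all del: upt_Suc)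
      also have "\<dots> = (\<Prod>i=1..N. ?w i)"
        by (intro prod.cong) auto
      also have "\<dots> = complex_of_real (exp (t * (\<Sum>i=1..N. \<mu> i)))"
        by (simp add: exp_sum sum_distrib_left)
      finally show ?thesis using True s by (simp del: upt_Suc)
    qed
    have inv: "inversions N id = 0"
    proof -
      have "{(i, j). i \<in> {1..N} \<and> j \<in> {1..N} \<and> i < j \<and> id j < id i} = {}" by auto
      then show ?thesis unfolding inversions_def by (simp only: card.empty)
    qed
    have "free_eval complex_scalars (diagonal_value t) (qdet N q)
      = (\<Sum>\<pi>\<in>?P. complex_of_real ((- q) ^ inversions N \<pi>) *
          prod_list (map (\<lambda>i. diagonal_value t (Gen i (\<pi> i))) [1..<Suc N]))"
      unfolding qdet_def cev.free_eval_simps scl_complex_scalars mult_1_right map_map comp_def by (rule refl)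
    also have "\<dots> = (\<Sum>\<pi>\<in>?P. if \<pi> = id then 1 else 0)"
    proof (rule sum.cong[OF refl])
      fix \<pi> assume "\<pi> \<in> ?P"
      from prod[OF this] show "complex_of_real ((- q) ^ inversions N \<pi>) *
          prod_list (map (\<lambda>i. diagonal_value t (Gen i (\<pi> i))) [1..<Suc N]) = (if \<pi> = id then 1 else 0)"
        using inv by (simp only: split: if_split) simp
    qed
    also have "\<dots> = 1" by (simp add: finite_permutations permutes_id)
    finally show ?thesis .
  qed
  show ?thesis
    using assms frt crel det diagonal_value_simps(2)[of t] by (cases G) (auto simp: cev.free_eval_simps)
qed

text \<open>For real \<open>t\<close> these are the modular characters with index \<open>t\<close>.\<close>

definition \<phi> :: "real \<Rightarrow> 'a \<Rightarrow> complex" where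
  "\<phi> t = (SOME f. character H f \<and> (\<forall>i\<in>{1..N}. \<forall>j\<in>{1..N}. f (u i j) = diagonal_value t (Gen i j)))"

lemma \<phi>: "character H (\<phi> t)"
  and \<phi>_u: "i \<in> {1..N} \<Longrightarrow> j \<in> {1..N} \<Longrightarrow>
    \<phi> t (u i j) = (if i = j then complex_of_real (exp (t * \<mu> i)) else 0)"
proof -
  from character_exists[OF diagonal_value_relation] obtain f where f: "linear_form H f" "f 1 = 1"
    "\<And>a b. f (a * b) = f a * f b" "\<And>x. x \<in> qgens G N \<Longrightarrow> f (gen x) = diagonal_value t x" by blast
  have "Gen i j \<in> qgens G N" if "i \<in> {1..N}" "j \<in> {1..N}" for i j using that by (cases G) auto
  from f(4)[OF this] have "f (u i j) = diagonal_value t (Gen i j)" if "i \<in> {1..N}" "j \<in> {1..N}" for i j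
    using that by simp
  moreover have "character H f" using f by (simp add: algebra_map_def linear_form_iff)
  ultimately have "\<exists>f. character H f \<and> (\<forall>i\<in>{1..N}. \<forall>j\<in>{1..N}. f (u i j) = diagonal_value t (Gen i j))" by blast
  from someI_ex[OF this] have "character H (\<phi> t) \<and> (\<forall>i\<in>{1..N}. \<forall>j\<in>{1..N}. \<phi> t (u i j) = diagonal_value t (Gen i j))"
    unfolding \<phi>_def .
  then show "character H (\<phi> t)" and "i \<in> {1..N} \<Longrightarrow> j \<in> {1..N} \<Longrightarrow>
    \<phi> t (u i j) = (if i = j then complex_of_real (exp (t * \<mu> i)) else 0)" by auto
qed

lemma character_eqI:
  assumes "character H f" "character H g"
    and "\<And>i j. i \<in> {1..N} \<Longrightarrow> j \<in> {1..N} \<Longrightarrow> f (u i j) = g (u i j)"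
  shows "f = g"
  using algebra_map_eqI[OF assms] by (auto simp: distrib_left)

lemma \<phi>_linear: "linear_form H (\<phi> t)"
  by (rule character_linear[OF \<phi>])

lemma \<phi>_add: "conv H (\<phi> s) (\<phi> t) = \<phi> (s + t)"
proof (rule character_eqI[OF conv_character[OF \<phi> \<phi>] \<phi>])
  fix i j assume ij: "i \<in> {1..N}" "j \<in> {1..N}"
  have "conv H (\<phi> s) (\<phi> t) (u i j) = (\<Sum>k=1..N. \<phi> s (u i k) * \<phi> t (u k j))"
    by (rule conv_corep[OF corep_u ij \<phi>_linear \<phi>_linear])
  also have "\<dots> = (\<Sum>k=1..N. if k = i then \<phi> s (u i i) * \<phi> t (u i j) else 0)"
    using ij by (intro sum.cong refl) (auto simp: \<phi>_u)
  finally show "conv H (\<phi> s) (\<phi> t) (u i j) = \<phi> (s + t) (u i j)"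
    using ij by (simp add: \<phi>_u distrib_right exp_add)
qed

lemma \<phi>_zero: "\<phi> 0 = counit H"
proof (rule character_eqI[OF \<phi>])
  show "character H (counit H)"
    using counit_linear by (simp add: algebra_map_def linear_form_iff counit_one counit_mult)
qed (simp add: \<phi>_u counit_u)

lemma \<phi>_mult:
  assumes "corep I v" "i \<in> I" "j \<in> I"
  shows "(\<Sum>k\<in>I. \<phi> s (v i k) * \<phi> t (v k j)) = \<phi> (s + t) (v i j)"
  using conv_corep[OF assms \<phi>_linear \<phi>_linear, of s t] by (simp add: \<phi>_add)

lemma \<phi>_inverse:
  assumes "corep I v" "i \<in> I" "j \<in> I"
  shows "(\<Sum>k\<in>I. \<phi> t (v i k) * \<phi> (- t) (v k j)) = (if i = j then 1 else 0)"
  using \<phi>_mult[OF assms, of t "- t"] corep_counit[OF assms] by (simp add: \<phi>_zero)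

text \<open>The character \<open>a \<mapsto> cnj (\<phi> (S(a)\<^sup>*))\<close> agrees with \<open>\<phi>\<close> on the generators.\<close>

lemma \<phi>_hermitian:
  assumes v: "ucorep I v" "i \<in> I" "j \<in> I"
  shows "\<phi> t (v i j) = cnj (\<phi> t (v j i))"
proof -
  let ?f = "\<lambda>a. cnj (\<phi> t (star H (antipode H a)))"
  note m = algebra_mapD[OF \<phi>]
  have "?f = \<phi> t"
  proof (rule character_eqI[OF _ \<phi>])
    show "character H ?f"
      by (simp add: algebra_map_def m antipode_add antipode_scl antipode_mult antipode_one star_add star_scl
          star_mult star_one)
    show "?f (u i j) = \<phi> t (u i j)" if "i \<in> {1..N}" "j \<in> {1..N}" for i j
      using that by (simp add: star_u[symmetric] star_star \<phi>_u)
  qed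
  from fun_cong[OF this, of "v i j"] show ?thesis
    using v by (simp add: ucorep_antipode star_star)
qed

end

section \<open>The square of the antipode\<close>

lemma qpow_square:
  assumes "q \<noteq> 0" "q > 0 \<or> x \<in> \<int>"
  shows "qpow q x * qpow q x = \<bar>q\<bar> powr (2 * x)"
proof (cases "q > 0")
  case True
  then show ?thesis by (simp add: qpow_pos flip: powr_add)
next
  case False
  then obtain a where a: "x = of_int a" using assms by (auto elim!: Ints_cases)
  have "qpow q x * qpow q x = \<bar>q\<bar> powi a * \<bar>q\<bar> powi a"
    unfolding qpow_def a by (simp flip: power_int_mult_distrib)
  also have "\<bar>q\<bar> powi a = \<bar>q\<bar> powr x"
    using assms(1) unfolding a by (subst powr_real_of_int') auto
  finally show ?thesis by (simp flip: powr_add)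
qed

context compact_quantum_group
begin

text \<open>The relation \<open>u C u\<^sup>t C\<^sup>-\<^sup>1 = I\<close> exhibits \<open>C u\<^sup>t C\<^sup>-\<^sup>1\<close> as the inverse of \<open>u\<close>, and \<open>C\<close> is antidiagonal.\<close>

lemma antipode_u_BCD:
  assumes G: "G = Oq \<or> G = Spq" and ij: "i \<in> {1..N}" "j \<in> {1..N}"
  shows "antipode H (u i j) = scl H (Cmat G N q i (opp N i) * Cinv G N q (opp N j) j) (u (opp N j) (opp N i))"
proof -
  have rel: "(\<Sum>k=1..N. u i k * (\<Sum>l=1..N. \<Sum>p=1..N. scl H (Cmat G N q k l * Cinv G N q p j) (u p l)))
      = (if i = j then 1 else 0)" if "i \<in> {1..N}" "j \<in> {1..N}" for i j
  proof -
    have "(\<Sum>k=1..N. \<Sum>l=1..N. \<Sum>p=1..N.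
         U i k * fconst (Cmat G N q k l) * U p l * fconst (Cinv G N q p j))
      - fconst (complex_of_real (kron i j)) \<in> qrels G N q"
      using G that by (cases G) (auto simp: C_rels_def)
    from relation[OF this]
    have "(\<Sum>k=1..N. \<Sum>l=1..N. \<Sum>p=1..N. u i k * scl H (Cmat G N q k l) 1 * u p l * scl H (Cinv G N q p j) 1)
        = scl H (complex_of_real (kron i j)) 1"
      unfolding aev.free_eval_simps by simp
    moreover have "u i k * scl H (Cmat G N q k l) 1 * u p l * scl H (Cinv G N q p j) 1
        = u i k * scl H (Cmat G N q k l * Cinv G N q p j) (u p l)" for k l p
      by (simp add: scl_mult_left scl_mult_right mult.commute)
    ultimately show ?thesis
      by (simp add: sum_distrib_left kron_def split: if_splits)
  qed
  have "antipode H (u i j) = (\<Sum>l=1..N. \<Sum>p=1..N. scl H (Cmat G N q i l * Cinv G N q p j) (u p l))"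
    by (rule corep_antipode_eqI_right[OF corep_u ij]) (rule rel)
  also have "\<dots> = (\<Sum>l=1..N. \<Sum>p=1..N. if l = opp N i then
      if p = opp N j then scl H (Cmat G N q i l * Cinv G N q p j) (u p l) else 0 else 0)"
  proof (intro sum.cong refl)
    fix l p assume l: "l \<in> {1..N}" and p: "p \<in> {1..N}"
    have "Cmat G N q i l = 0" if "l \<noteq> opp N i"
      using that opp_swap[OF l ij(1)] opp_swap[OF ij(1) l] by (auto simp: Cmat_def kron_def)
    moreover have "Cinv G N q p j = 0" if "p \<noteq> opp N j"
      using that by (simp add: Cinv_def kron_def)
    ultimately show "scl H (Cmat G N q i l * Cinv G N q p j) (u p l) = (if l = opp N i then
      if p = opp N j then scl H (Cmat G N q i l * Cinv G N q p j) (u p l) else 0 else 0)" by simp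
  qed
  also have "\<dots> = scl H (Cmat G N q i (opp N i) * Cinv G N q (opp N j) j) (u (opp N j) (opp N i))"
    by (rule double_delta[OF finite_atLeastAtMost opp_mem[OF ij(1)] opp_mem[OF ij(2)]])
  finally show ?thesis .
qed

lemma antipode_square_u_BCD:
  assumes G: "G = Oq \<or> G = Spq" and ij: "i \<in> {1..N}" "j \<in> {1..N}"
  shows "antipode H (antipode H (u i j)) = scl H (complex_of_real (exp (\<mu> i - \<mu> j))) (u i j)"
proof -
  have ev: "G \<noteq> Spq \<or> even N" using params by (cases G) auto
  have nA: "\<not> (G = GLq \<or> G = SLq)" using G by auto
  let ?s = "if G = Spq then - 1 else 1 :: real"
  have C: "Cmat G N q i (opp N i) * Cinv G N q (opp N (opp N i)) (opp N i)
      = complex_of_real (exp (\<mu> i)) * ?s" if i: "i \<in> {1..N}" for i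
  proof -
    have "q > 0 \<or> - rho G N i \<in> \<int>" using rho_Ints[OF params G, of i] by auto
    moreover have "exp (\<mu> i) = \<bar>q\<bar> powr (2 * - rho G N i)"
      using nA exp_ln_powr[OF q_nz, of "2 * - rho G N i"] by (simp add: modular_exponent_def)
    ultimately have e: "qpow q (- rho G N i) * qpow q (- rho G N i) = exp (\<mu> i)"
      using qpow_square[OF q_nz] by simp
    have k: "kron i (opp N (opp N i)) = 1" "kron i i = 1" by (simp_all add: kron_def opp_opp[OF i])
    have "Cmat G N q i (opp N i) * Cinv G N q (opp N (opp N i)) (opp N i)
      = complex_of_real ((eps G N i * eps G N (opp N i)) * (qpow q (- rho G N i) * qpow q (- rho G N i)))"
      unfolding Cmat_def Cinv_def rho_opp[OF ev i] opp_opp[OF i] k of_real_mult[symmetric] mult_1_right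
      by (rule arg_cong[of _ _ complex_of_real]) (simp only: mult_ac)
    then show ?thesis unfolding e eps_opp[OF i ev] by simp
  qed
  have C': "Cinv G N q (opp N j) j * Cmat G N q (opp N j) (opp N (opp N j))
      = complex_of_real (exp (- \<mu> j)) * ?s" if j: "j \<in> {1..N}" for j
    using C[OF opp_mem[OF j]] modular_exponent_opp[OF params j] opp_opp[OF j] by (simp add: mult.commute)
  have "antipode H (antipode H (u i j))
      = scl H ((Cmat G N q i (opp N i) * Cinv G N q (opp N (opp N i)) (opp N i)) *
          (Cinv G N q (opp N j) j * Cmat G N q (opp N j) (opp N (opp N j)))) (u i j)"
    unfolding antipode_u_BCD[OF G ij] antipode_scl antipode_u_BCD[OF G opp_mem[OF ij(2)] opp_mem[OF ij(1)]]
      opp_opp[OF ij(1)] opp_opp[OF ij(2)] scale_scale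
    by (simp only: mult_ac)
  also have "\<dots> = scl H (complex_of_real (exp (\<mu> i - \<mu> j))) (u i j)"
    unfolding C[OF ij(1)] C'[OF ij(2)] by (simp add: exp_diff exp_minus field_simps)
  finally show ?thesis .
qed

end

locale quantum_group_r_form = compact_quantum_group H G N q u dinv + r_form_algebra H r
  for H :: "('a::ring_1) hopf_star" and G N q u dinv r +
  fixes z :: complex
  assumes z_nz: "z \<noteq> 0"
    and r_u: "i \<in> {1..N} \<Longrightarrow> j \<in> {1..N} \<Longrightarrow> n \<in> {1..N} \<Longrightarrow> m \<in> {1..N} \<Longrightarrow>
      r (u i j) (u n m) = z * Rmat G N q i n j m"
begin

text \<open>For the linear groups \<open>S\<^sup>2\<close> is computed from \<open>f\<^sub>r\<close>: the multiplication rule of the r-form, evaluated on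
  \<open>S(u) u = 1\<close>, is a linear system for \<open>f\<^sub>r(u)\<close>.\<close>

lemma f_u_equation:
  assumes il: "i \<in> {1..N}" "l \<in> {1..N}"
  shows "(\<Sum>m=1..N. \<Sum>n=1..N. r (u i m) (u n l) * f_form H r (u m n)) = (if i = l then 1 else 0)"
proof -
  have "(\<Sum>m=1..N. \<Sum>n=1..N. r (u i m) (u n l) * f_form H r (u m n))
      = (\<Sum>m=1..N. \<Sum>n=1..N. \<Sum>k=1..N. r (u i m) (u n l) * r (u m k) (antipode H (u k n)))"
    by (intro sum.cong refl) (simp add: f_corep[OF corep_u] sum_distrib_left)
  also have "\<dots> = (\<Sum>k=1..N. \<Sum>n=1..N. \<Sum>m=1..N. r (u i m) (u n l) * r (u m k) (antipode H (u k n)))"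
    by (subst sum.swap, subst (2) sum.swap, subst sum.swap) (rule refl)
  also have "\<dots> = (\<Sum>k=1..N. \<Sum>n=1..N. r (u i k) (antipode H (u k n) * u n l))"
    by (intro sum.cong refl) (simp add: mult_right[OF corep_u il(1)])
  also have "\<dots> = (\<Sum>k=1..N. r (u i k) (if k = l then 1 else 0))"
    by (intro sum.cong refl) (simp only: linear_form_sum[OF linear_right, symmetric] corep_antipode_left[OF corep_u _ il(2)])
  also have "\<dots> = (\<Sum>k=1..N. if k = l then r (u i l) 1 else 0)"
    by (intro sum.cong refl) (simp add: linear_form_zero[OF linear_right])
  also have "\<dots> = (if i = l then 1 else 0)"
    using il by (simp add: one_right counit_u)
  finally show ?thesis .
qed

text \<open>The linear system is triangular: off the diagonal the solution vanishes, and consecutive equations show that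
  the diagonal entries are divided by \<open>q\<^sup>2\<close> at each step.\<close>

lemma f_u_type_A:
  assumes A: "G = GLq \<or> G = SLq"
  obtains c where "c \<noteq> 0" "\<And>i j. i \<in> {1..N} \<Longrightarrow> j \<in> {1..N} \<Longrightarrow>
    f_form H r (u i j) = (if i = j then c * complex_of_real (exp (- \<mu> i)) else 0)"
proof -
  let ?f = "\<lambda>i j. f_form H r (u i j)" and ?q = "complex_of_real q"
  have eq: "z * (complex_of_real (qpow q (kron i l)) * ?f i l
      + (if i = l then (?q - inverse ?q) * (\<Sum>n\<in>{1..<i}. ?f n n) else 0)) = (if i = l then 1 else 0)"
    if il: "i \<in> {1..N}" "l \<in> {1..N}" for i l
  proof -
    have "(\<Sum>m=1..N. \<Sum>n=1..N. r (u i m) (u n l) * ?f m n)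
        = (\<Sum>m=1..N. \<Sum>n=1..N. (if m = i then if n = l then z * complex_of_real (qpow q (kron i n)) * ?f m n else 0 else 0)
          + (if m = n then if i = l \<and> n \<in> {1..<i} then z * (?q - inverse ?q) * ?f n n else 0 else 0))"
    proof (intro sum.cong refl)
      fix m n assume m: "m \<in> {1..N}" "n \<in> {1..N}"
      show "r (u i m) (u n l) * ?f m n = (if m = i then if n = l then z * complex_of_real (qpow q (kron i n)) * ?f m n else 0 else 0)
          + (if m = n then if i = l \<and> n \<in> {1..<i} then z * (?q - inverse ?q) * ?f n n else 0 else 0)"
        using A m by (auto simp: r_u[OF il(1) m il(2)] Rmat_def R_A_def kron_def theta_def algebra_simps)
    qed
    also have "\<dots> = z * complex_of_real (qpow q (kron i l)) * ?f i l
        + (\<Sum>n=1..N. if i = l \<and> n \<in> {1..<i} then z * (?q - inverse ?q) * ?f n n else 0)"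
    proof -
      have "(\<Sum>m=1..N. \<Sum>n=1..N. if m = n then g n else 0) = (\<Sum>n=1..N. g n)" for g :: "nat \<Rightarrow> complex"
        by (rule sum.cong[OF refl]) simp
      then show ?thesis unfolding sum.distrib double_delta[OF finite_atLeastAtMost il] by simp
    qed
    also have "(\<Sum>n=1..N. if i = l \<and> n \<in> {1..<i} then z * (?q - inverse ?q) * ?f n n else 0)
        = (if i = l then z * (?q - inverse ?q) * (\<Sum>n\<in>{1..<i}. ?f n n) else 0)"
    proof (cases "i = l")
      case True
      have "{1..N} \<inter> {1..<i} = {1..<i}" using il by auto
      then show ?thesis using True sum.inter_restrict[of "{1..N}" "\<lambda>n. z * (?q - inverse ?q) * ?f n n" "{1..<i}"]
        by (simp add: sum_distrib_left del: One_nat_def)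
    qed simp
    finally show ?thesis using f_u_equation[OF il] by (auto simp: algebra_simps)
  qed
  have off: "?f i l = 0" if "i \<in> {1..N}" "l \<in> {1..N}" "i \<noteq> l" for i l
    using eq[OF that(1,2)] that(3) z_nz by (simp add: kron_def qpow_def)
  have qq: "?q \<noteq> 0" using q_nz by simp
  have diag: "?q * ?f i i + (?q - inverse ?q) * (\<Sum>n\<in>{1..<i}. ?f n n) = 1 / z" if "i \<in> {1..N}" for i
    using eq[OF that that] z_nz by (simp add: kron_def qpow_def field_simps)
  have subtract: "x * b = y * a" if "x * b + (x - y) * (a + s) = w" "x * a + (x - y) * s = w" for x y a b s w :: complex
  proof -
    have "x * b + (x - y) * (a + s) = x * b - y * a + (x * a + (x - y) * s)" by (simp add: algebra_simps)
    then show ?thesis unfolding that by simp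
  qed
  have step: "?f (Suc i) (Suc i) = ?f i i / ?q\<^sup>2" if i: "1 \<le> i" "i < N" for i
  proof -
    have "{1..<Suc i} = insert i {1..<i}" using i by auto
    then have "?q * ?f (Suc i) (Suc i) + (?q - inverse ?q) * (?f i i + (\<Sum>n\<in>{1..<i}. ?f n n)) = 1 / z"
      using diag[of "Suc i"] i by simp
    moreover have "?q * ?f i i + (?q - inverse ?q) * (\<Sum>n\<in>{1..<i}. ?f n n) = 1 / z" using diag[of i] i by simp
    ultimately have "?q * ?f (Suc i) (Suc i) = inverse ?q * ?f i i" by (rule subtract)
    then show ?thesis using qq by (simp add: field_simps power2_eq_square)
  qed
  have const: "?f i i * complex_of_real (exp (\<mu> i)) = ?f 1 1 * complex_of_real (exp (\<mu> 1))" if "1 \<le> i" "i \<le> N" for i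
    using that
  proof (induction i rule: dec_induct)
    case base
    show ?case by (rule refl)
  next
    case (step i)
    have "\<mu> (Suc i) = \<mu> i + real 2 * ln \<bar>q\<bar>" using A by (auto simp: modular_exponent_def algebra_simps)
    from modular_exponent_step[OF q_nz this]
    have "complex_of_real (exp (\<mu> (Suc i))) = ?q\<^sup>2 * complex_of_real (exp (\<mu> i))" by simp
    then show ?case using step \<open>\<And>i. 1 \<le> i \<Longrightarrow> i < N \<Longrightarrow> ?f (Suc i) (Suc i) = ?f i i / ?q\<^sup>2\<close>[of i] qq by simp
  qed
  have *: "?f i i = (?f 1 1 * complex_of_real (exp (\<mu> 1))) * complex_of_real (exp (- \<mu> i))" if "i \<in> {1..N}" for i
  proof -
    have "complex_of_real (exp (\<mu> i)) * complex_of_real (exp (- \<mu> i)) = 1"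
      by (simp flip: of_real_mult exp_add)
    then have "?f i i = (?f i i * complex_of_real (exp (\<mu> i))) * complex_of_real (exp (- \<mu> i))"
      by (simp only: mult.assoc mult_1_right)
    then show ?thesis using that by (simp only: const atLeastAtMost_iff)
  qed
  have "?f 1 1 \<noteq> 0" using diag[of 1] N_pos z_nz by auto
  then have nz: "?f 1 1 * complex_of_real (exp (\<mu> 1)) \<noteq> 0" by simp
  show thesis
  proof (rule that[OF nz])
    fix i j assume ij: "i \<in> {1..N}" "j \<in> {1..N}"
    show "?f i j = (if i = j then ?f 1 1 * complex_of_real (exp (\<mu> 1)) * complex_of_real (exp (- \<mu> i)) else 0)"
    proof (cases "i = j")
      case True
      show ?thesis unfolding True by (simp only: refl if_True) (rule *[OF ij(2)])
    next
      case False
      show ?thesis by (simp only: False if_False off[OF ij False])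
    qed
  qed
qed

text \<open>For the linear groups, \<open>f\<^sub>r(u)\<close> is diagonal and implements \<open>S\<^sup>2\<close>.\<close>

lemma antipode_square_u:
  assumes ij: "i \<in> {1..N}" "j \<in> {1..N}"
  shows "antipode H (antipode H (u i j)) = scl H (complex_of_real (exp (\<mu> i - \<mu> j))) (u i j)"
proof (cases "G = GLq \<or> G = SLq")
  case False
  then have "G = Oq \<or> G = Spq" by (cases G) auto
  then show ?thesis by (rule antipode_square_u_BCD[OF _ ij])
next
  case True
  then obtain c where c: "c \<noteq> 0" "\<And>i j. i \<in> {1..N} \<Longrightarrow> j \<in> {1..N} \<Longrightarrow>
    f_form H r (u i j) = (if i = j then c * complex_of_real (exp (- \<mu> i)) else 0)" by (rule f_u_type_A) blast
  let ?e = "\<lambda>i. c * complex_of_real (exp (- \<mu> i))"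
  have "(\<Sum>k=1..N. scl H (f_form H r (u i k)) (antipode H (antipode H (u k j))))
      = (\<Sum>k=1..N. if k = i then scl H (?e i) (antipode H (antipode H (u i j))) else 0)"
    using ij by (intro sum.cong refl) (auto simp: c(2))
  moreover have "(\<Sum>k=1..N. scl H (f_form H r (u k j)) (u i k))
      = (\<Sum>k=1..N. if k = j then scl H (?e j) (u i j) else 0)"
    using ij by (intro sum.cong refl) (auto simp: c(2))
  ultimately have "scl H (?e i) (antipode H (antipode H (u i j))) = scl H (?e j) (u i j)"
    using f_antipode_square[OF ucorep_u ij] ij by simp
  from arg_cong[OF this, of "scl H (inverse (?e i))"]
  have "scl H (inverse (?e i) * ?e i) (antipode H (antipode H (u i j))) = scl H (inverse (?e i) * ?e j) (u i j)"
    by (simp only: scale_scale)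
  moreover have "inverse (?e i) * ?e i = 1" by (rule left_inverse) (simp add: c(1))
  ultimately have "antipode H (antipode H (u i j)) = scl H (inverse (?e i) * ?e j) (u i j)"
    by (simp only: scale_one)
  also have "inverse (?e i) * ?e j = complex_of_real (exp (\<mu> i - \<mu> j))"
    using c(1) by (simp add: exp_diff exp_minus field_simps)
  finally show ?thesis .
qed

text \<open>Both sides of \<open>S\<^sup>2(a) = \<phi>\<^sub>1(a\<^sub>1) a\<^sub>2 \<phi>\<^sub>-\<^sub>1(a\<^sub>3)\<close> are algebra maps, so it suffices to compare them on \<open>u\<close>.\<close>

lemma antipode_square_\<phi>:
  assumes w: "corep I w" "i \<in> I" "j \<in> I"
  shows "antipode H (antipode H (w i j)) = (\<Sum>k\<in>I. \<Sum>l\<in>I. scl H (\<phi> 1 (w i k) * \<phi> (- 1) (w l j)) (w k l))"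
proof -
  let ?\<tau> = "\<lambda>a. left_translate (\<phi> 1) (right_translate (\<phi> (- 1)) a)"
  have \<tau>: "?\<tau> (w i j) = (\<Sum>k\<in>I. \<Sum>l\<in>I. scl H (\<phi> 1 (w i k) * \<phi> (- 1) (w l j)) (w k l))"
  proof -
    have "?\<tau> (w i j) = (\<Sum>l\<in>I. scl H (\<phi> (- 1) (w l j)) (\<Sum>k\<in>I. scl H (\<phi> 1 (w i k)) (w k l)))"
      using w by (simp add: translate_corep[OF _ _ _ \<phi>_linear] linear_map_sum[OF translate_linear(1)[OF \<phi>_linear]]
          linear_map_scl[OF translate_linear(1)[OF \<phi>_linear]])
    also have "\<dots> = (\<Sum>l\<in>I. \<Sum>k\<in>I. scl H (\<phi> 1 (w i k) * \<phi> (- 1) (w l j)) (w k l))"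
      by (simp add: scale_sum_right mult.commute)
    also have "\<dots> = (\<Sum>k\<in>I. \<Sum>l\<in>I. scl H (\<phi> 1 (w i k) * \<phi> (- 1) (w l j)) (w k l))"
      by (rule sum.swap)
    finally show ?thesis .
  qed
  have "antipode H (antipode H a) = ?\<tau> a" for a
  proof (rule algebra_map_eqI[OF antipode_square_algebra_map
        algebra_map_compose[OF translate_algebra_map(1)[OF \<phi>] translate_algebra_map(2)[OF \<phi>]]])
    fix i j assume ij: "i \<in> {1..N}" "j \<in> {1..N}"
    have "left_translate (\<phi> 1) (u i j) = (\<Sum>k=1..N. if k = i then scl H (complex_of_real (exp (\<mu> i))) (u i j) else 0)"
      unfolding translate_corep(1)[OF corep_u ij \<phi>_linear] using ij by (intro sum.cong refl) (auto simp: \<phi>_u)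
    then have l: "left_translate (\<phi> 1) (u i j) = scl H (complex_of_real (exp (\<mu> i))) (u i j)" using ij by simp
    have "right_translate (\<phi> (- 1)) (u i j) = (\<Sum>k=1..N. if k = j then scl H (complex_of_real (exp (- \<mu> j))) (u i j) else 0)"
      unfolding translate_corep(2)[OF corep_u ij \<phi>_linear] using ij by (intro sum.cong refl) (auto simp: \<phi>_u)
    then have r: "right_translate (\<phi> (- 1)) (u i j) = scl H (complex_of_real (exp (- \<mu> j))) (u i j)" using ij by simp
    show "antipode H (antipode H (u i j)) = ?\<tau> (u i j)"
      unfolding r linear_map_scl[OF translate_linear(1)[OF \<phi>_linear]] l antipode_square_u[OF ij]
      by (simp add: exp_diff exp_minus field_simps)
  qed (simp add: scale_right_distrib)
  then show ?thesis using \<tau> by simp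
qed


section \<open>The functional \<open>F\<^sub>r\<close> on the generators\<close>

abbreviation \<kappa> :: complex where "\<kappa> \<equiv> complex_of_real (trace_entry G N q N)"

text \<open>With \<open>S\<^sup>2(u)\<close> known, this is the quantum trace of \<open>R\<close>.\<close>

lemma f_rbar21_u:
  assumes ij: "i \<in> {1..N}" "j \<in> {1..N}"
  shows "f_form H (rbar21 H r) (u i j) = (if i = j then z * \<kappa> * complex_of_real (exp (- \<mu> i)) else 0)"
proof -
  interpret t: r_form_algebra H "rbar21 H r"
    by unfold_locales (rule universal_rbar21)
  have "f_form H (rbar21 H r) (u i j) = (\<Sum>k=1..N. r (antipode H (antipode H (u k j))) (u i k))"
    by (simp add: t.f_corep[OF corep_u ij] rbar21_eq rb_def)
  also have "\<dots> = (\<Sum>k=1..N. z * complex_of_real (exp (- \<mu> j)) * (complex_of_real (exp (\<mu> k)) * Rmat G N q k i j k))"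
    using ij by (intro sum.cong refl)
      (simp add: antipode_square_u linear_form_scl[OF linear_left] r_u exp_diff exp_minus field_simps)
  also have "\<dots> = z * complex_of_real (exp (- \<mu> j)) * (if i = j then \<kappa> else 0)"
    by (simp only: sum_distrib_left[symmetric] Rmat_quantum_trace[OF params ij])
  finally show ?thesis by simp
qed

text \<open>The inverse of the functional in the previous lemma, on \<open>u\<close>, is a partial trace of \<open>R\<^sup>-\<^sup>1\<close>. In particular
  \<open>z \<kappa>\<close> does not vanish.\<close>

lemma rb_trace:
  assumes il: "i \<in> {1..N}" "l \<in> {1..N}"
  shows "z * \<kappa> * (\<Sum>m=1..N. complex_of_real (exp (- \<mu> m)) * rb (u m l) (u i m)) = (if i = l then 1 else 0)"
proof -
  have "(if i = l then 1 else 0) = (\<Sum>k=1..N. f_form H (rbar21 H r) (u i k) * (\<Sum>m=1..N. r (u m l) (antipode H (u k m))))"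
    by (rule f_rbar21_inverse[OF ucorep_u il, symmetric])
  also have "\<dots> = (\<Sum>k=1..N. if k = i then z * \<kappa> * complex_of_real (exp (- \<mu> i)) * (\<Sum>m=1..N. r (u m l) (antipode H (u i m))) else 0)"
    using il by (intro sum.cong[OF refl]) (simp add: f_rbar21_u)
  also have "\<dots> = z * \<kappa> * (complex_of_real (exp (- \<mu> i)) * (\<Sum>m=1..N. r (u m l) (antipode H (u i m))))"
    using il by (simp add: mult.assoc)
  also have "complex_of_real (exp (- \<mu> i)) * (\<Sum>m=1..N. r (u m l) (antipode H (u i m)))
      = (\<Sum>m=1..N. complex_of_real (exp (- \<mu> m)) * rb (u m l) (u i m))"
    unfolding sum_distrib_left
    using il by (intro sum.cong refl)
      (simp add: r_antipode_right antipode_square_u linear_form_scl[OF rb_linear_right] exp_diff exp_minus field_simps)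
  finally show ?thesis by simp
qed

text \<open>The inverse of \<open>R\<close> inherits the symmetry of \<open>R\<close>.\<close>

lemma rb_symmetric:
  assumes "i \<in> {1..N}" "j \<in> {1..N}" "m \<in> {1..N}" "n \<in> {1..N}"
  shows "rb (u i j) (u n m) = rb (u (opp N j) (opp N i)) (u (opp N m) (opp N n))"
proof -
  let ?J = "{1..N} \<times> {1..N}"
  let ?R = "\<lambda>p s. r (u (fst p) (fst s)) (u (snd p) (snd s))"
  let ?X = "\<lambda>p s. rb (u (fst p) (fst s)) (u (snd p) (snd s))"
  define o2 where "o2 = (\<lambda>p. (opp N (fst p), opp N (snd p)))"
  have o2: "bij_betw o2 ?J ?J"
    unfolding o2_def by (rule bij_betw_byWitness[of _ o2]) (auto simp: o2_def opp_def)
  have o2_eq: "o2 p = o2 s \<longleftrightarrow> p = s" if "p \<in> ?J" "s \<in> ?J" for p s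
    using bij_betw_imp_inj_on[OF o2] that by (auto dest: inj_onD)
  have R: "?R (o2 s) (o2 p) = ?R p s" if "p \<in> ?J" "s \<in> ?J" for p s
  proof -
    obtain a b c d where e: "p = (a, b)" "s = (c, d)" by (cases p; cases s)
    have m: "a \<in> {1..N}" "b \<in> {1..N}" "c \<in> {1..N}" "d \<in> {1..N}" using that unfolding e by auto
    show ?thesis
      unfolding e o2_def fst_conv snd_conv r_u[OF m(1,3,2,4)] r_u[OF m(3,1,4,2)[THEN opp_mem]]
        Rmat_symmetric[OF params m] ..
  qed
  have mem: "o2 p \<in> ?J" if "p \<in> ?J" for p using that o2 by (rule bij_betw_apply[rotated])
  have RX: "(\<Sum>k\<in>?J. ?R p k * ?X k s) = (if p = s then 1 else 0)" if "p \<in> ?J" "s \<in> ?J" for p s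
    using r_rb(1)[OF corep_u _ _ corep_u, of "fst p" "fst s" "snd p" "snd s"] that
    by (auto simp: sum.cartesian_product case_prod_beta prod_eq_iff)
  have XR: "(\<Sum>k\<in>?J. ?X p k * ?R k s) = (if p = s then 1 else 0)" if "p \<in> ?J" "s \<in> ?J" for p s
    using r_rb(2)[OF corep_u _ _ corep_u, of "fst p" "fst s" "snd p" "snd s"] that
    by (auto simp: sum.cartesian_product case_prod_beta prod_eq_iff)
  have "?X p s = ?X (o2 s) (o2 p)" if ps: "p \<in> ?J" "s \<in> ?J" for p s
  proof (rule matrix_inverse_unique[OF _ ps, of ?X ?R "\<lambda>p s. ?X (o2 s) (o2 p)"])
    show "finite ?J" by simp
    show "(\<Sum>k\<in>?J. ?X p k * ?R k s) = (if p = s then 1 else 0)" if "p \<in> ?J" "s \<in> ?J" for p s by (rule XR[OF that])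
    fix p s assume p: "p \<in> ?J" and s: "s \<in> ?J"
    have "(\<Sum>k\<in>?J. ?R p k * ?X (o2 s) (o2 k)) = (\<Sum>k\<in>?J. ?X (o2 s) (o2 k) * ?R (o2 k) (o2 p))"
    proof (rule sum.cong[OF refl])
      fix k assume k: "k \<in> ?J"
      show "?R p k * ?X (o2 s) (o2 k) = ?X (o2 s) (o2 k) * ?R (o2 k) (o2 p)"
        unfolding R[OF p k] by (rule mult.commute)
    qed
    also have "\<dots> = (\<Sum>k\<in>?J. ?X (o2 s) k * ?R k (o2 p))"
      by (rule sum.reindex_bij_betw[OF o2])
    also have "\<dots> = (if p = s then 1 else 0)"
      unfolding XR[OF mem[OF s] mem[OF p]] o2_eq[OF s p] by auto
    finally show "(\<Sum>k\<in>?J. ?R p k * ?X (o2 s) (o2 k)) = (if p = s then 1 else 0)" .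
  qed
  from this[of "(i, n)" "(j, m)"] assms show ?thesis by (simp add: o2_def)
qed

text \<open>The symmetry of \<open>R\<^sup>-\<^sup>1\<close> carries the partial trace that defines \<open>f\<^sub>r(u)\<close> to the one in \<open>rb_trace\<close>.\<close>

lemma f_u:
  assumes ij: "i \<in> {1..N}" "j \<in> {1..N}"
  shows "z * \<kappa> * f_form H r (u i j) = (if i = j then complex_of_real (exp (- \<mu> i)) else 0)"
proof -
  have "f_form H r (u i j) = (\<Sum>k=1..N. complex_of_real (exp (- \<mu> j)) * (complex_of_real (exp (\<mu> k)) * rb (u i k) (u k j)))"
    unfolding f_corep[OF corep_u ij]
    using ij by (intro sum.cong refl)
      (simp add: r_antipode_right antipode_square_u linear_form_scl[OF rb_linear_right] exp_diff exp_minus field_simps)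
  also have "\<dots> = complex_of_real (exp (- \<mu> j)) * (\<Sum>k=1..N. complex_of_real (exp (- \<mu> (opp N k))) *
      rb (u (opp N k) (opp N i)) (u (opp N j) (opp N k)))"
    unfolding sum_distrib_left
  proof (rule sum.cong[OF refl])
    fix k assume k: "k \<in> {1..N}"
    show "complex_of_real (exp (- \<mu> j)) * (complex_of_real (exp (\<mu> k)) * rb (u i k) (u k j))
      = complex_of_real (exp (- \<mu> j)) * (complex_of_real (exp (- \<mu> (opp N k))) *
          rb (u (opp N k) (opp N i)) (u (opp N j) (opp N k)))"
      unfolding modular_exponent_opp[OF params k] minus_minus
      by (simp only: rb_symmetric[OF ij(1) k ij(2) k])
  qed
  also have "(\<Sum>k=1..N. complex_of_real (exp (- \<mu> (opp N k))) * rb (u (opp N k) (opp N i)) (u (opp N j) (opp N k)))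
      = (\<Sum>m=1..N. complex_of_real (exp (- \<mu> m)) * rb (u m (opp N i)) (u (opp N j) m))"
    by (rule sum_opp)
  finally have "z * \<kappa> * f_form H r (u i j) = complex_of_real (exp (- \<mu> j)) *
      (z * \<kappa> * (\<Sum>m=1..N. complex_of_real (exp (- \<mu> m)) * rb (u m (opp N i)) (u (opp N j) m)))"
    by (simp only: mult_ac)
  also have "\<dots> = (if i = j then complex_of_real (exp (- \<mu> i)) else 0)"
    unfolding rb_trace[OF opp_mem[OF ij(2)] opp_mem[OF ij(1)]]
    using opp_swap[OF ij(2) opp_mem[OF ij(1)]] opp_opp[OF ij(1)] by auto
  finally show ?thesis .
qed

lemma F_eq_\<phi>: "F_form H r = \<phi> (- 2)"
proof (rule character_eqI[OF _ \<phi>])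
  show "character H (F_form H r)"
    using F_linear F_one F_mult by (simp add: algebra_map_def linear_form_iff)
  fix i j assume ij: "i \<in> {1..N}" "j \<in> {1..N}"
  have "F_form H r (u i j) = (\<Sum>k=1..N. if k = j then (z * \<kappa> * f_form H r (u i j)) * complex_of_real (exp (- \<mu> j)) else 0)"
    unfolding F_corep[OF corep_u ij] using ij by (intro sum.cong refl) (simp add: f_rbar21_u)
  moreover have "complex_of_real (exp (- \<mu> j)) * complex_of_real (exp (- \<mu> j)) = complex_of_real (exp (- 2 * \<mu> j))"
    by (simp flip: of_real_mult exp_add)
  ultimately show "F_form H r (u i j) = \<phi> (- 2) (u i j)"
    using ij by (simp add: f_u \<phi>_u)
qed

text \<open>On an irreducible unitary \<open>V\<close> the modular matrix is \<open>\<phi>\<^sub>1(V)\<close>: it implements \<open>S\<^sup>2\<close>, is positive definite as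
  the square of the Hermitian matrix \<open>\<phi>\<^sub>1\<^sub>/\<^sub>2(V)\<close>, and has the right trace by \<open>balanced_trace\<close>.\<close>

theorem F_eq_modular_character: "modular_character H (- 2) = F_form H r"
proof (rule modular_character_eqI[OF irreducible_span F_linear])
  fix n V assume V: "unitary_corep H n V" and irr: "irreducible_corep H n V"
  note uc = unitary_corep_ucorep[OF V] and c = ucorep_corep[OF unitary_corep_ucorep[OF V]]
  define M where "M t = mat n n (\<lambda>(i, j). \<phi> t (V $$ (i, j)))" for t
  have M[simp]: "M t \<in> carrier_mat n n" "i < n \<Longrightarrow> j < n \<Longrightarrow> M t $$ (i, j) = \<phi> t (V $$ (i, j))" for t i j
    by (simp_all add: M_def)
  have M_mult: "M s * M t = M (s + t)" for s t
  proof (rule eq_matI)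
    fix i j assume "i < dim_row (M (s + t))" "j < dim_col (M (s + t))"
    then have ij: "i < n" "j < n" by (simp_all add: M_def)
    then have "(M s * M t) $$ (i, j) = (\<Sum>k<n. \<phi> s (V $$ (i, k)) * \<phi> t (V $$ (k, j)))"
      by (simp add: M_def scalar_prod_def atLeast0LessThan)
    then show "(M s * M t) $$ (i, j) = M (s + t) $$ (i, j)"
      using ij \<phi>_mult[OF c, of i j s t] by simp
  qed (simp_all add: M_def)
  have M_zero: "M 0 = 1\<^sub>m n"
    by (rule eq_matI) (auto simp: M_def \<phi>_zero corep_counit[OF c])
  have adj: "mat_adjoint (M t) = M t" for t
    by (rule eq_matI) (use \<phi>_hermitian[OF uc, symmetric] in \<open>auto simp: M_def mat_adjoint_def mat_of_rows_def\<close>)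
  have pos: "positive_definite n (M 1)"
    using positive_definite_square[OF M(1) adj M(1), of "- (1 / 2)" "1 / 2"] by (simp add: M_mult M_zero)
  have S2: "antipode H (antipode H (V $$ (i, j))) = (\<Sum>k<n. \<Sum>l<n. scl H (\<phi> 1 (V $$ (i, k)) * \<phi> (- 1) (V $$ (l, j))) (V $$ (k, l)))"
    if "i < n" "j < n" for i j
    using antipode_square_\<phi>[OF c, of i j] that by simp
  have F: "F_form H r (V $$ (i, j)) = (\<Sum>k<n. \<phi> (- 1) (V $$ (i, k)) * \<phi> (- 1) (V $$ (k, j)))"
    if "i < n" "j < n" for i j
    using \<phi>_mult[OF c, of i j "- 1" "- 1"] that by (simp add: F_eq_\<phi>)
  have trace: "(\<Sum>i<n. \<phi> 1 (V $$ (i, i))) = (\<Sum>i<n. \<phi> (- 1) (V $$ (i, i)))"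
  proof (rule balanced_trace[OF irr uc _ _ S2 F])
    show "(\<Sum>k<n. \<phi> 1 (V $$ (i, k)) * \<phi> (- 1) (V $$ (k, j))) = (if i = j then 1 else 0)"
      if "i < n" "j < n" for i j
      using \<phi>_inverse[OF c, of i j 1] that by simp
    show "(\<Sum>k<n. \<phi> (- 1) (V $$ (i, k)) * \<phi> 1 (V $$ (k, j))) = (if i = j then 1 else 0)"
      if "i < n" "j < n" for i j
      using \<phi>_inverse[OF c, of i j "- 1"] that by simp
  qed
  show "\<exists>F G. positive_definite n F \<and> G \<in> carrier_mat n n \<and> F * G = 1\<^sub>m n \<and> mat_trace F = mat_trace G \<and>
      (\<forall>i<n. \<forall>j<n. antipode H (antipode H (V $$ (i, j)))
        = (\<Sum>k<n. \<Sum>l<n. scl H (F $$ (i, k) * G $$ (l, j)) (V $$ (k, l)))) \<and>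
      (\<forall>i<n. \<forall>j<n. F_form H r (V $$ (i, j)) = (G * G) $$ (i, j))"
  proof (intro exI conjI allI impI)
    show "positive_definite n (M 1)" by (rule pos)
    show "M (- 1) \<in> carrier_mat n n" by simp
    show "M 1 * M (- 1) = 1\<^sub>m n" by (simp add: M_mult M_zero)
    show "mat_trace (M 1) = mat_trace (M (- 1))"
      using trace by (simp add: mat_trace_def M_def)
    fix i j assume ij: "i < n" "j < n"
    show "antipode H (antipode H (V $$ (i, j))) = (\<Sum>k<n. \<Sum>l<n. scl H (M 1 $$ (i, k) * M (- 1) $$ (l, j)) (V $$ (k, l)))"
      using S2[OF ij] ij by simp
    show "F_form H r (V $$ (i, j)) = (M (- 1) * M (- 1)) $$ (i, j)"
      using ij by (simp add: M_mult F_eq_\<phi>)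
  qed
qed

end

theorem proposition4p5:
  fixes G :: family and N :: nat and q :: real
    and H :: "('a::ring_1) hopf_star" and u :: "nat \<Rightarrow> nat \<Rightarrow> 'a"
    and r :: "'a \<Rightarrow> 'a \<Rightarrow> complex" and z :: complex
  assumes "admissible_params G N q"
    and "compact_form G N q H u"
    and "admissible_z G N q z"
    and "universal_r_form H r"
    and "\<And>i j n m. i \<in> {1..N} \<Longrightarrow> j \<in> {1..N} \<Longrightarrow> n \<in> {1..N} \<Longrightarrow> m \<in> {1..N} \<Longrightarrow>
           r (u i j) (u n m) = z * Rmat G N q i n j m"
  shows "F_form H r = modular_character H (-2)"
proof -
  from assms(2) obtain dinv where H: "hopf_star_algebra H"
    and pres: "presented_by H (case_qgen u dinv) (qgens G N) (qrels G N q)"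
    and cu: "\<And>i j. i \<in> {1..N} \<Longrightarrow> j \<in> {1..N} \<Longrightarrow>
        tensor_eq H (comult H (u i j)) [(u i k, u k j). k \<leftarrow> [1..<Suc N]] \<and>
        counit H (u i j) = (if i = j then 1 else 0) \<and> star H (u i j) = antipode H (u j i)"
    unfolding compact_form_def by blast
  interpret hopf_star_algebra H by (rule H)
  interpret compact_quantum_group H G N q u dinv
    by unfold_locales (use assms(1) pres cu in auto)
  interpret r_form_algebra H r
    by unfold_locales (rule assms(4))
  have "z \<noteq> 0"
    using assms(1,3) by (cases G) (auto simp: power_0_left)
  then interpret quantum_group_r_form H G N q u dinv r z
    by unfold_locales (use assms(5) in auto)
  show ?thesis by (rule F_eq_modular_character[symmetric])
qed

end
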